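(* Let $d=1$, $\omega\in\{+1,-1\}$, $p>1$, $s_c:=\frac12-\frac2{p-1}$, $s_{\rm sob}:=\max(0,\frac12-\frac1p)$, and let $s<s_{\rm sob}$. Suppose either that $p$ is an odd positive integer, or that $p>\lfloor s\rfloor+1$. Then the Cauchy problem $$\square u=\omega|u|^{p-1}u,\qquad u(0,x)=u_0(x),\qquad\partial_tu(0,x)=u_1(x)\qquad(\text{gNLW})$$ on $\mathbb{R}$ is ill-posed in $H^s(\mathbb{R})$. More specifically: (a) If $s_c<s<s_{\rm sob}$, then for any $\varepsilon>0$ there exist a real-valued solution $u$ of (gNLW) and $t\in\mathbb{R}^+$ such that $u(0)\in\mathcal{S}$ and $$\|u(0)\|_{H^s}<\varepsilon,\qquad u_t(0)=0,\qquad0<t<\varepsilon,\qquad\|u(t)\|_{H^s}>\varepsilon^{-1}.$$ In particular, for any $t>0$ the solution map $\mathcal{S}\ni(u(0),u_t(0))\mapsto(u(t),u_t(t))$ for the Cauchy problem (gNLW) fails to be continuous at $0$ in the $H^s\times H^{s-1}$ topology. (b) If $s<s_c$, the same is true, except that the conclusion $\|u(t)\|_{H^s}>\varepsilon^{-1}$ is weakened to $$\|u(t)\|_{H^s}\ge c(t)\quad\text{for some constant }c(t)>0\text{ independent of }\varepsilon.$$ (c) If $s=s_c$, the same as in (b) holds with $c(t)$ independent of $t$. Thus for $s\le s_c$, for any $t>0$, the solution operator fails to be continuous in $H^s$ at $0$.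
   Context: $\square:=-\partial_t^2+\partial_x^2$, $H^s=H^s(\mathbb{R})$ is the usual inhomogeneous $L^2$-based Sobolev space, and $\mathcal{S}$ is the Schwartz class on $\mathbb{R}$ (for the solution map, both components of the datum are Schwartz). (gNLW) is called locally well-posed in $H^s$ if for every $(u_0,u_1)\in H^s\times H^{s-1}$ there exist a time $T>0$ depending only on the norm of the datum and a distributional solution $u$ of (gNLW) in $C^0([-T,T];H^s_x)\cap C^1([-T,T];H^{s-1}_x)$, such that the solution map $(u_0,u_1)\mapsto u$ is uniformly continuous from $H^s\times H^{s-1}$ to this space; and moreover there is an additional space $X\subset L^p_{t,x,\mathrm{loc}}$ (so that $|u|^{p-1}u$ is a well-defined spacetime distribution) such that $u$ is the unique solution lying also in $X$. Ill-posed means not locally well-posed. "Solution" means a distributional solution on a time interval containing $0$ and the time $t$ under consideration. *)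

theory Defs
  imports "HOL-Analysis.Analysis"
begin

section \<open>Schwartz functions and tempered distributions on the real line\<close>

definition nth_deriv :: "nat \<Rightarrow> (real \<Rightarrow> complex) \<Rightarrow> real \<Rightarrow> complex" where
  "nth_deriv n f = ((\<lambda>g x. vector_derivative g (at x)) ^^ n) f"

definition schwartz :: "(real \<Rightarrow> complex) set" where
  "schwartz = {\<phi>. (\<forall>n x. nth_deriv n \<phi> differentiable (at x)) \<and>
                  (\<forall>k n. bounded (range (\<lambda>x. x ^ k *\<^sub>R nth_deriv n \<phi> x)))}"

definition schwartz_seminorm :: "nat \<Rightarrow> nat \<Rightarrow> (real \<Rightarrow> complex) \<Rightarrow> real" where
  "schwartz_seminorm k n \<phi> = (SUP x. \<bar>x\<bar> ^ k * cmod (nth_deriv n \<phi> x))"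

text \<open>A distribution is a functional on all functions that vanishes outside the Schwartz class.
  This convention makes equality of functionals coincide with equality of distributions.\<close>

type_synonym dist = "(real \<Rightarrow> complex) \<Rightarrow> complex"

definition tempered :: "dist \<Rightarrow> bool" where
  "tempered u \<longleftrightarrow>
     (\<forall>\<phi>\<in>schwartz. \<forall>\<psi>\<in>schwartz. u (\<lambda>x. \<phi> x + \<psi> x) = u \<phi> + u \<psi>) \<and>
     (\<forall>\<phi>\<in>schwartz. \<forall>c. u (\<lambda>x. c * \<phi> x) = c * u \<phi>) \<and>
     (\<exists>C N. \<forall>\<phi>\<in>schwartz. cmod (u \<phi>) \<le> C * (\<Sum>k\<le>N. \<Sum>n\<le>N. schwartz_seminorm k n \<phi>)) \<and>
     (\<forall>\<phi>. \<phi> \<notin> schwartz \<longrightarrow> u \<phi> = 0)"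

definition zero_dist :: dist where
  "zero_dist = (\<lambda>_. 0)"

definition minus_dist :: "dist \<Rightarrow> dist \<Rightarrow> dist" where
  "minus_dist u v = (\<lambda>\<phi>. u \<phi> - v \<phi>)"

definition scale_dist :: "real \<Rightarrow> dist \<Rightarrow> dist" where
  "scale_dist c u = (\<lambda>\<phi>. complex_of_real c * u \<phi>)"

definition dist_of :: "(real \<Rightarrow> complex) \<Rightarrow> dist" where
  "dist_of f = (\<lambda>\<phi>. if \<phi> \<in> schwartz then (LINT x|lborel. f x * \<phi> x) else 0)"

definition real_valued :: "dist \<Rightarrow> bool" where
  "real_valued u \<longleftrightarrow> (\<forall>\<phi>\<in>schwartz. (\<forall>x. \<phi> x \<in> \<real>) \<longrightarrow> u \<phi> \<in> \<real>)"


section \<open>Sobolev spaces\<close>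

text \<open>The Fourier transform is normalised to be unitary on $L^2$.\<close>

definition fourier :: "(real \<Rightarrow> complex) \<Rightarrow> real \<Rightarrow> complex" where
  "fourier \<phi> \<xi> = complex_of_real (1 / sqrt (2 * pi)) * (LINT x|lborel. cis (- (x * \<xi>)) * \<phi> x)"

text \<open>The tempered distribution \<open>u\<close> lies in $H^s$ with Fourier transform the function \<open>g\<close>,
  where the Fourier transform of \<open>u\<close> is the functional \<open>\<phi> \<mapsto> u (fourier \<phi>)\<close>.\<close>

definition sobolev_ft :: "real \<Rightarrow> dist \<Rightarrow> (real \<Rightarrow> complex) \<Rightarrow> bool" where
  "sobolev_ft s u g \<longleftrightarrow>
     g \<in> borel_measurable lborel \<and>
     integrable lborel (\<lambda>\<xi>. (1 + \<xi>\<^sup>2) powr s * (cmod (g \<xi>))\<^sup>2) \<and>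
     (\<forall>\<phi>\<in>schwartz. u (fourier \<phi>) = (LINT \<xi>|lborel. g \<xi> * \<phi> \<xi>))"

definition sobolev :: "real \<Rightarrow> dist set" where
  "sobolev s = {u. tempered u \<and> (\<exists>g. sobolev_ft s u g)}"

text \<open>The function \<open>g\<close> is determined almost everywhere by \<open>u\<close>, so the choice below is immaterial.
  The value of the norm is meaningful for elements of \<open>sobolev s\<close> only.\<close>

definition sobolev_norm :: "real \<Rightarrow> dist \<Rightarrow> real" where
  "sobolev_norm s u =
     sqrt (LINT \<xi>|lborel. (1 + \<xi>\<^sup>2) powr s * (cmod ((SOME g. sobolev_ft s u g) \<xi>))\<^sup>2)"

definition data_norm :: "real \<Rightarrow> dist \<Rightarrow> dist \<Rightarrow> real" where
  "data_norm s u v = sobolev_norm s u + sobolev_norm (s - 1) v"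

definition continuous_sobolev :: "real \<Rightarrow> real set \<Rightarrow> (real \<Rightarrow> dist) \<Rightarrow> bool" where
  "continuous_sobolev s I u \<longleftrightarrow>
     (\<forall>t\<in>I. u t \<in> sobolev s) \<and>
     (\<forall>t\<in>I. ((\<lambda>\<tau>. sobolev_norm s (minus_dist (u \<tau>) (u t))) \<longlongrightarrow> 0) (at t within I))"

definition has_sobolev_derivative ::
    "real \<Rightarrow> real set \<Rightarrow> (real \<Rightarrow> dist) \<Rightarrow> (real \<Rightarrow> dist) \<Rightarrow> bool" where
  "has_sobolev_derivative s I u v \<longleftrightarrow>
     (\<forall>t\<in>I. ((\<lambda>\<tau>. sobolev_norm s
          (minus_dist (scale_dist (1 / (\<tau> - t)) (minus_dist (u \<tau>) (u t))) (v t)))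
        \<longlongrightarrow> 0) (at t within I))"


section \<open>Distributions on spacetime\<close>

text \<open>Points of spacetime are pairs \<open>(t, x)\<close>.\<close>

definition dt :: "(real \<times> real \<Rightarrow> complex) \<Rightarrow> real \<times> real \<Rightarrow> complex" where
  "dt \<psi> z = vector_derivative (\<lambda>\<tau>. \<psi> (\<tau>, snd z)) (at (fst z))"

definition dx :: "(real \<times> real \<Rightarrow> complex) \<Rightarrow> real \<times> real \<Rightarrow> complex" where
  "dx \<psi> z = vector_derivative (\<lambda>y. \<psi> (fst z, y)) (at (snd z))"

definition box :: "(real \<times> real \<Rightarrow> complex) \<Rightarrow> real \<times> real \<Rightarrow> complex" where
  "box \<psi> z = - dt (dt \<psi>) z + dx (dx \<psi>) z"

inductive_set partials :: "(real \<times> real \<Rightarrow> complex) \<Rightarrow> (real \<times> real \<Rightarrow> complex) set"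
  for \<psi> :: "real \<times> real \<Rightarrow> complex" where
  self: "\<psi> \<in> partials \<psi>"
| dt: "g \<in> partials \<psi> \<Longrightarrow> dt g \<in> partials \<psi>"
| dx: "g \<in> partials \<psi> \<Longrightarrow> dx g \<in> partials \<psi>"

definition smooth :: "(real \<times> real \<Rightarrow> complex) \<Rightarrow> bool" where
  "smooth \<psi> \<longleftrightarrow> (\<forall>g\<in>partials \<psi>. continuous_on UNIV g \<and>
     (\<forall>t x. (\<lambda>\<tau>. g (\<tau>, x)) differentiable (at t) \<and> (\<lambda>y. g (t, y)) differentiable (at x)))"

definition test_functions :: "(real \<times> real) set \<Rightarrow> (real \<times> real \<Rightarrow> complex) set" where
  "test_functions \<Omega> = {\<psi>. smooth \<psi> \<and> (\<exists>K. compact K \<and> K \<subseteq> \<Omega> \<and> (\<forall>z. z \<notin> K \<longrightarrow> \<psi> z = 0))}"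

text \<open>Local integrability refers to compact subsets of \<open>I \<times> UNIV\<close>, so it reaches up to the
  endpoints that belong to \<open>I\<close>. Values outside \<open>I \<times> UNIV\<close> are irrelevant.\<close>

definition Lp_loc :: "real \<Rightarrow> real set \<Rightarrow> (real \<times> real \<Rightarrow> complex) set" where
  "Lp_loc p I = {f. f \<in> borel_measurable lborel \<and>
     (\<forall>K. compact K \<and> K \<subseteq> I \<times> UNIV \<longrightarrow> set_integrable lborel K (\<lambda>z. cmod (f z) powr p))}"

text \<open>The curve \<open>u\<close> of distributions on the line and the function \<open>f\<close> are the same distribution on
  \<open>interior I \<times> UNIV\<close>.\<close>

definition represents :: "real set \<Rightarrow> (real \<times> real \<Rightarrow> complex) \<Rightarrow> (real \<Rightarrow> dist) \<Rightarrow> bool" where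
  "represents I f u \<longleftrightarrow> (\<forall>\<psi>\<in>test_functions (interior I \<times> UNIV).
     (LINT z|lborel. f z * \<psi> z) = (LINT t:I|lborel. u t (\<lambda>x. \<psi> (t, x))))"

definition weak_gNLW :: "real \<Rightarrow> real \<Rightarrow> real set \<Rightarrow> (real \<times> real \<Rightarrow> complex) \<Rightarrow> bool" where
  "weak_gNLW \<omega> p I f \<longleftrightarrow> (\<forall>\<psi>\<in>test_functions (interior I \<times> UNIV).
     (LINT z|lborel. f z * box \<psi> z) =
     complex_of_real \<omega> * (LINT z|lborel. complex_of_real (cmod (f z) powr (p - 1)) * f z * \<psi> z))"


section \<open>Solutions and well-posedness\<close>

text \<open>Here \<open>v\<close> is the time derivative of \<open>u\<close>; the Cauchy data are \<open>u 0\<close> and \<open>v 0\<close>.\<close>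

definition gNLW_solution ::
    "real \<Rightarrow> real \<Rightarrow> real \<Rightarrow> real set \<Rightarrow> (real \<Rightarrow> dist) \<Rightarrow> (real \<Rightarrow> dist) \<Rightarrow> bool" where
  "gNLW_solution \<omega> p s I u v \<longleftrightarrow>
     is_interval I \<and> 0 \<in> I \<and>
     continuous_sobolev s I u \<and>
     continuous_sobolev (s - 1) I v \<and>
     has_sobolev_derivative (s - 1) I u v \<and>
     (\<exists>f\<in>Lp_loc p I. represents I f u \<and> weak_gNLW \<omega> p I f)"

definition linear_space :: "(real \<times> real \<Rightarrow> complex) set \<Rightarrow> bool" where
  "linear_space X \<longleftrightarrow>
     (\<lambda>_. 0) \<in> X \<and>
     (\<forall>f\<in>X. \<forall>g\<in>X. (\<lambda>z. f z + g z) \<in> X) \<and>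
     (\<forall>f\<in>X. \<forall>c. (\<lambda>z. c * f z) \<in> X)"

definition lies_in :: "real set \<Rightarrow> (real \<times> real \<Rightarrow> complex) set \<Rightarrow> (real \<Rightarrow> dist) \<Rightarrow> bool" where
  "lies_in I X u \<longleftrightarrow> (\<exists>f\<in>X. represents I f u)"

text \<open>The existence time \<open>T\<close> is uniform on balls of data, and uniform continuity of the solution map
  \<open>(u0, u1) \<mapsto> (u u0 u1, v u0 u1)\<close> is required on each such ball, for the norm of
  $C^0([-T,T];H^s) \cap C^1([-T,T];H^{s-1})$.\<close>

definition locally_well_posed :: "real \<Rightarrow> real \<Rightarrow> real \<Rightarrow> bool" where
  "locally_well_posed \<omega> p s \<longleftrightarrow>
     (\<forall>R>0. \<exists>T>0. \<exists>X u v.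
        linear_space X \<and> X \<subseteq> Lp_loc p {-T..T} \<and>
        (\<forall>u0\<in>sobolev s. \<forall>u1\<in>sobolev (s - 1). data_norm s u0 u1 \<le> R \<longrightarrow>
           gNLW_solution \<omega> p s {-T..T} (u u0 u1) (v u0 u1) \<and>
           u u0 u1 0 = u0 \<and> v u0 u1 0 = u1 \<and>
           lies_in {-T..T} X (u u0 u1) \<and>
           (\<forall>w w'. gNLW_solution \<omega> p s {-T..T} w w' \<and> w 0 = u0 \<and> w' 0 = u1 \<and>
                   lies_in {-T..T} X w \<longrightarrow> (\<forall>t\<in>{-T..T}. w t = u u0 u1 t))) \<and>
        (\<forall>\<eta>>0. \<exists>\<delta>>0. \<forall>u0\<in>sobolev s. \<forall>u1\<in>sobolev (s - 1).
           \<forall>w0\<in>sobolev s. \<forall>w1\<in>sobolev (s - 1).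
             data_norm s u0 u1 \<le> R \<and> data_norm s w0 w1 \<le> R \<and>
             data_norm s (minus_dist u0 w0) (minus_dist u1 w1) < \<delta> \<longrightarrow>
             (\<forall>t\<in>{-T..T}.
                data_norm s (minus_dist (u u0 u1 t) (u w0 w1 t))
                            (minus_dist (v u0 u1 t) (v w0 w1 t)) < \<eta>)))"

definition ill_posed :: "real \<Rightarrow> real \<Rightarrow> real \<Rightarrow> bool" where
  "ill_posed \<omega> p s \<longleftrightarrow> \<not> locally_well_posed \<omega> p s"

text \<open>Continuity at zero of the map from Schwartz data to \<open>(u t, v t)\<close>. Its domain consists of the
  data having a solution on an interval that contains \<open>0\<close> and \<open>t\<close>; it maps zero to zero.\<close>

definition solution_map_continuous_at_zero :: "real \<Rightarrow> real \<Rightarrow> real \<Rightarrow> real \<Rightarrow> bool" where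
  "solution_map_continuous_at_zero \<omega> p s t \<longleftrightarrow>
     (\<forall>\<eta>>0. \<exists>\<delta>>0. \<forall>I u v.
        gNLW_solution \<omega> p s I u v \<and> t \<in> I \<and>
        u 0 \<in> dist_of ` schwartz \<and> v 0 \<in> dist_of ` schwartz \<and>
        data_norm s (u 0) (v 0) < \<delta> \<longrightarrow>
        data_norm s (u t) (v t) < \<eta>)"

text \<open>The same for the map from \<open>u 0\<close> to \<open>u t\<close> with vanishing initial velocity, in $H^s$ alone.\<close>

definition solution_operator_continuous_at_zero :: "real \<Rightarrow> real \<Rightarrow> real \<Rightarrow> real \<Rightarrow> bool" where
  "solution_operator_continuous_at_zero \<omega> p s t \<longleftrightarrow>
     (\<forall>\<eta>>0. \<exists>\<delta>>0. \<forall>I u v.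
        gNLW_solution \<omega> p s I u v \<and> t \<in> I \<and>
        u 0 \<in> dist_of ` schwartz \<and> v 0 = zero_dist \<and>
        sobolev_norm s (u 0) < \<delta> \<longrightarrow>
        sobolev_norm s (u t) < \<eta>)"

definition s_crit :: "real \<Rightarrow> real" where
  "s_crit p = 1 / 2 - 2 / (p - 1)"

definition s_sob :: "real \<Rightarrow> real" where
  "s_sob p = max 0 (1 / 2 - 1 / p)"

end

theory Submission
  imports Defs "HOL-Probability.Characteristic_Functions" "HOL-Probability.Sinc_Integral"
begin

text \<open>Below \<open>s_sob p\<close> there are nonnegative profiles on $[1,2]$ whose $H^s$ norm is small compared with their
  $L^p$ norm: rescaled bumps for $s \ge 0$, and for $s < 0$ products of a bump with factors $1 + \cos(N_j x)$, $N_1 \ll N_2 \ll \ldots$,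
  which leave the $H^s$ norm asymptotically unchanged but increase the $L^p$ norm.

  Norm inflation: the datum is a train of $L$ far separated copies of a profile, at rest. Since it is
  small in $L^{p-1}$ on every window of length $2T$, a contraction argument shows that the solution is the free wave plus a
  correction close to the first Picard iterate. That iterate has a definite sign, so its pairing with a wide bump
  grows like $L$, whereas the $H^{-s}$ norm of the wide bump grows like $\sqrt L$ only.

  Ill-posedness: testing the equation near $t = 0$ shows that the initial value of any solution is
  bounded on the unit ball of $L^{p'}$ on $[1,2]$, but a superposition of profiles is a datum in $H^s$ for which this fails.\<close>

section \<open>Smooth functions of one variable\<close>

text \<open>The time of inflation is prescribed, so smallness cannot come from a short time. It
  comes from the profiles. Below \<open>s_sob p\<close> the H^s norm does not control the L^p norm,
  but it does control the integral of a nonnegative function on a fixed interval. A profile with L^p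
  norm one and tiny H^s norm therefore has tiny L^1 norm, and by interpolation tiny L^(p-1) norm.
  The latter is what the difference estimate for the nonlinearity needs, while the fixed L^p norm of
  each bump produces the growth. The contraction is run in the sup norm and for the correction
  alone, since such profiles have unbounded sup norms; two integrations along characteristics turn
  integrals over windows into pointwise bounds. The order of choices matters: the amplitude depends
  on T and p, the number of bumps on the final norm wanted, and the profile comes last, so that its
  smallness absorbs the number of bumps. Ill-posedness has to exclude solutions about which nothing
  is known beyond the definition. The obstruction is that a solution is locally L^p in spacetime,
  and this passes to the initial value in dual form.\<close>

abbreviation cplx :: "(real \<Rightarrow> real) \<Rightarrow> real \<Rightarrow> complex" where
  "cplx f \<equiv> (\<lambda>x. complex_of_real (f x))"

abbreviation deriv1 :: "(real \<Rightarrow> complex) \<Rightarrow> real \<Rightarrow> complex" where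
  "deriv1 f \<equiv> (\<lambda>x. vector_derivative f (at x))"

definition smooth1 :: "(real \<Rightarrow> complex) \<Rightarrow> bool" where
  "smooth1 f \<longleftrightarrow> (\<forall>n x. nth_deriv n f differentiable (at x))"

lemma nth_deriv_0 [simp]: "nth_deriv 0 f = f"
  by (simp add: nth_deriv_def)

lemma nth_deriv_Suc: "nth_deriv (Suc n) f = deriv1 (nth_deriv n f)"
  by (simp add: nth_deriv_def)

lemma nth_deriv_Suc': "nth_deriv (Suc n) f = nth_deriv n (deriv1 f)"
  by (simp add: nth_deriv_def funpow_Suc_right del: funpow.simps)

lemma deriv1_eqI: "(\<And>x. (f has_vector_derivative f' x) (at x)) \<Longrightarrow> deriv1 f = f'"
  by (auto intro: vector_derivative_at)

lemma smooth1_has_deriv: "smooth1 f \<Longrightarrow> (f has_vector_derivative deriv1 f x) (at x)"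
  unfolding smooth1_def by (metis nth_deriv_0 vector_derivative_works)

lemma smooth1_deriv1: "smooth1 f \<Longrightarrow> smooth1 (deriv1 f)"
  unfolding smooth1_def by (metis nth_deriv_Suc')

lemma smooth1_nth_deriv: "smooth1 f \<Longrightarrow> smooth1 (nth_deriv n f)"
  by (induction n) (auto simp: nth_deriv_Suc smooth1_deriv1)

lemma smooth1_continuous: "smooth1 f \<Longrightarrow> continuous_on A f"
  by (meson continuous_at_imp_continuous_on has_vector_derivative_continuous smooth1_has_deriv)

lemma smooth1_measurable [measurable_dest]: "smooth1 f \<Longrightarrow> f \<in> borel_measurable borel"
  by (intro borel_measurable_continuous_onI smooth1_continuous)

text \<open>Spares all formulas for n-th derivatives: it is enough to exhibit a family that contains
  \<open>f\<close> and is closed under differentiation.\<close>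

lemma smooth1_coinduct:
  assumes "f \<in> S" and S: "\<And>g. g \<in> S \<Longrightarrow> \<exists>g'\<in>S. \<forall>x. (g has_vector_derivative g' x) (at x)"
  shows "smooth1 f"
proof -
  have *: "deriv1 g \<in> S \<and> (\<forall>x. g differentiable (at x))" if "g \<in> S" for g
    using S[OF that] deriv1_eqI[of g] by (metis differentiableI_vector)
  have "nth_deriv n f \<in> S" for n
    by (induction n) (use * assms(1) in \<open>auto simp: nth_deriv_Suc\<close>)
  with * show ?thesis by (auto simp: smooth1_def)
qed

text \<open>The span with complex coefficients. Families such as products, or the functions
  \<open>exp (- 1 / x) / x ^ k\<close>, are not closed under differentiation, but their spans
  are.\<close>

inductive_set fspan :: "('a \<Rightarrow> complex) set \<Rightarrow> ('a \<Rightarrow> complex) set" for B where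
  base: "b \<in> B \<Longrightarrow> b \<in> fspan B"
| zero: "(\<lambda>_. 0) \<in> fspan B"
| add: "f \<in> fspan B \<Longrightarrow> g \<in> fspan B \<Longrightarrow> (\<lambda>x. f x + g x) \<in> fspan B"
| scale: "f \<in> fspan B \<Longrightarrow> (\<lambda>x. c * f x) \<in> fspan B"

text \<open>Extends a relation compatible with linear combinations from the generators to the span.
  It is applied with \<open>R f g\<close> saying that \<open>g\<close> is a derivative of
  \<open>f\<close>.\<close>

lemma fspan_relation:
  assumes "f \<in> fspan B" and "\<And>b. b \<in> B \<Longrightarrow> \<exists>g\<in>fspan B. R b g" and "R (\<lambda>_. 0) (\<lambda>_. 0)"
    and add: "\<And>f g f' g'. R f f' \<Longrightarrow> R g g' \<Longrightarrow> R (\<lambda>x. f x + g x) (\<lambda>x. f' x + g' x)"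
    and scale: "\<And>c f f'. R f f' \<Longrightarrow> R (\<lambda>x. c * f x) (\<lambda>x. c * f' x)"
  shows "\<exists>g\<in>fspan B. R f g"
  using assms(1)
proof induction
  case (base b) then show ?case by (rule assms(2))
next
  case zero then show ?case using assms(3) fspan.zero by blast
next
  case (add f g)
  then obtain f' g' where "f' \<in> fspan B" "R f f'" "g' \<in> fspan B" "R g g'" by blast
  then show ?case using assms(4)[of f f' g g'] by (intro bexI[of _ "\<lambda>x. f' x + g' x"] fspan.add)
next
  case (scale f c)
  then obtain f' where "f' \<in> fspan B" "R f f'" by blast
  then show ?case using assms(5)[of f f' c] by (intro bexI[of _ "\<lambda>x. c * f' x"] fspan.scale)
qed

lemma smooth1_fspan:
  assumes "f \<in> fspan B"
    and B: "\<And>b. b \<in> B \<Longrightarrow> \<exists>g\<in>fspan B. \<forall>x. (b has_vector_derivative g x) (at x)"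
  shows "smooth1 f"
proof (rule smooth1_coinduct[OF assms(1)])
  fix g assume "g \<in> fspan B"
  then show "\<exists>g'\<in>fspan B. \<forall>x. (g has_vector_derivative g' x) (at x)"
    by (rule fspan_relation) (use B in \<open>auto intro: has_vector_derivative_add has_vector_derivative_mult_right\<close>)
qed

lemma smooth1_const [simp, intro]: "smooth1 (\<lambda>_. c)"
proof (rule smooth1_coinduct)
  show "(\<lambda>_. c) \<in> range (\<lambda>c (_::real). c)" by blast
  fix g :: "real \<Rightarrow> complex"
  assume "g \<in> range (\<lambda>c _. c)"
  then show "\<exists>g'\<in>range (\<lambda>c _. c). \<forall>x. (g has_vector_derivative g' x) (at x)"
    by (intro bexI[of _ "\<lambda>_. 0"]) auto
qed

lemma smooth1_antideriv:
  assumes "\<And>x. (F has_vector_derivative f x) (at x)" "smooth1 f"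
  shows "smooth1 F"
proof (rule smooth1_coinduct)
  show "F \<in> {F. (\<exists>f. smooth1 f \<and> (\<forall>x. (F has_vector_derivative f x) (at x)))}"
    using assms by blast
qed (use smooth1_has_deriv smooth1_deriv1 in blast)

lemma smooth1_of_real [simp, intro]: "smooth1 complex_of_real"
  by (rule smooth1_antideriv[of _ "\<lambda>_. 1"])
    (auto intro!: has_vector_derivative_of_real derivative_eq_intros)

lemma smooth1_add [intro]:
  assumes "smooth1 f" "smooth1 g" shows "smooth1 (\<lambda>x. f x + g x)"
proof (rule smooth1_coinduct)
  show "(\<lambda>x. f x + g x) \<in> {\<lambda>x. f x + g x |f g. smooth1 f \<and> smooth1 g}" using assms by blast
  fix h :: "real \<Rightarrow> complex"
  assume "h \<in> {\<lambda>x. f x + g x |f g. smooth1 f \<and> smooth1 g}"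
  then obtain f g where h: "h = (\<lambda>x. f x + g x)" "smooth1 f" "smooth1 g" by blast
  have "(\<lambda>x. deriv1 f x + deriv1 g x) \<in> {\<lambda>x. f x + g x |f g. smooth1 f \<and> smooth1 g}"
    using h smooth1_deriv1 by (intro CollectI exI[of _ "deriv1 f"] exI[of _ "deriv1 g"]) simp
  moreover have "(h has_vector_derivative deriv1 f x + deriv1 g x) (at x)" for x
    unfolding h(1) using h(2,3) by (intro has_vector_derivative_add smooth1_has_deriv)
  ultimately show "\<exists>g'\<in>{\<lambda>x. f x + g x |f g. smooth1 f \<and> smooth1 g}. \<forall>x. (h has_vector_derivative g' x) (at x)"
    by (intro bexI[of _ "\<lambda>x. deriv1 f x + deriv1 g x"]) auto
qed

lemma smooth1_mult [intro]:
  assumes "smooth1 f" "smooth1 g" shows "smooth1 (\<lambda>x. f x * g x)"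
proof (rule smooth1_fspan[OF fspan.base])
  show "(\<lambda>x. f x * g x) \<in> {\<lambda>x. f x * g x |f g. smooth1 f \<and> smooth1 g}" using assms by blast
  fix h :: "real \<Rightarrow> complex"
  assume "h \<in> {\<lambda>x. f x * g x |f g. smooth1 f \<and> smooth1 g}"
  then obtain f g where h: "h = (\<lambda>x. f x * g x)" "smooth1 f" "smooth1 g" by blast
  let ?B = "{\<lambda>x. f x * g x |f g. smooth1 f \<and> smooth1 g}"
  have mem: "(\<lambda>x. f x * g x) \<in> ?B" if "smooth1 f" "smooth1 g" for f g
    using that by (intro CollectI exI[of _ f] exI[of _ g]) simp
  have "(\<lambda>x. f x * deriv1 g x) \<in> ?B" "(\<lambda>x. deriv1 f x * g x) \<in> ?B"
    by (rule mem; intro h smooth1_deriv1)+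
  then have "(\<lambda>x. f x * deriv1 g x + deriv1 f x * g x) \<in> fspan ?B"
    by (intro fspan.add fspan.base)
  moreover have "(h has_vector_derivative f x * deriv1 g x + deriv1 f x * g x) (at x)" for x
    unfolding h(1) using h(2,3) by (intro has_vector_derivative_mult smooth1_has_deriv)
  ultimately show "\<exists>g'\<in>fspan ?B. \<forall>x. (h has_vector_derivative g' x) (at x)"
    by (intro bexI[of _ "\<lambda>x. f x * deriv1 g x + deriv1 f x * g x"]) auto
qed

lemma smooth1_cmult [intro]: "smooth1 f \<Longrightarrow> smooth1 (\<lambda>x. c * f x)"
  by (rule smooth1_mult) auto

lemma smooth1_diff [intro]:
  assumes "smooth1 f" "smooth1 g" shows "smooth1 (\<lambda>x. f x - g x)"
  using smooth1_add[OF assms(1) smooth1_cmult[OF assms(2), of "-1"]] by simp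

lemma smooth1_sum [intro]: "(\<And>i. i \<in> A \<Longrightarrow> smooth1 (f i)) \<Longrightarrow> smooth1 (\<lambda>x. \<Sum>i\<in>A. f i x)"
  by (induction A rule: infinite_finite_induct) auto

lemma has_vector_derivative_affine:
  assumes "\<And>x. (f has_vector_derivative f' x) (at x)"
  shows "((\<lambda>x. f (a * x + b)) has_vector_derivative complex_of_real a * f' (a * x + b)) (at x)"
proof -
  have "((\<lambda>x. a * x + b) has_vector_derivative a) (at x)"
    by (auto intro!: derivative_eq_intros simp: has_real_derivative_iff_has_vector_derivative[symmetric])
  from vector_diff_chain_at[OF this assms] show ?thesis
    by (simp add: o_def scaleR_conv_of_real)
qed

lemma smooth1_affine:
  assumes "smooth1 f" shows "smooth1 (\<lambda>x. f (a * x + b))"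
proof (rule smooth1_coinduct)
  let ?S = "{\<lambda>x. c * f (a * x + b) |c f. smooth1 f}"
  have "(\<lambda>x. 1 * f (a * x + b)) \<in> ?S" using assms by blast
  then show "(\<lambda>x. f (a * x + b)) \<in> ?S" by simp
  fix h assume "h \<in> ?S"
  then obtain c f where h: "h = (\<lambda>x. c * f (a * x + b))" "smooth1 f" by blast
  have "(\<lambda>x. (c * a) * deriv1 f (a * x + b)) \<in> ?S"
    using h smooth1_deriv1 by (intro CollectI exI[of _ "c * a"] exI[of _ "deriv1 f"]) simp
  moreover have "(h has_vector_derivative (c * a) * deriv1 f (a * x + b)) (at x)" for x
    unfolding h mult.assoc
    by (intro has_vector_derivative_mult_right has_vector_derivative_affine smooth1_has_deriv h)
  ultimately show "\<exists>g'\<in>?S. \<forall>x. (h has_vector_derivative g' x) (at x)"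
    by (intro bexI[of _ "\<lambda>x. (c * a) * deriv1 f (a * x + b)"]) auto
qed

lemma smooth1_shift: "smooth1 f \<Longrightarrow> smooth1 (\<lambda>x. f (x + b))"
  using smooth1_affine[of f 1 b] by simp

lemma has_vector_derivative_cis: "((\<lambda>x. cis (k * x)) has_vector_derivative \<i> * of_real k * cis (k * x)) (at x)"
  unfolding has_vector_derivative_complex_iff
  by (auto intro!: derivative_eq_intros)

lemma smooth1_cis: "smooth1 (\<lambda>x. cis (k * x))"
proof (rule smooth1_coinduct)
  let ?S = "{\<lambda>x. c * cis (k * x) |c. True}"
  have "(\<lambda>x. 1 * cis (k * x)) \<in> ?S" by blast
  then show "(\<lambda>x. cis (k * x)) \<in> ?S" by simp
  fix h assume "h \<in> ?S"
  then obtain c where h: "h = (\<lambda>x. c * cis (k * x))" by blast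
  have "(\<lambda>x. (c * (\<i> * of_real k)) * cis (k * x)) \<in> ?S" by blast
  moreover have "(h has_vector_derivative (c * (\<i> * of_real k)) * cis (k * x)) (at x)" for x
    unfolding h mult.assoc[of c] by (intro has_vector_derivative_mult_right has_vector_derivative_cis)
  ultimately show "\<exists>g'\<in>?S. \<forall>x. (h has_vector_derivative g' x) (at x)"
    by (intro bexI[of _ "\<lambda>x. (c * (\<i> * of_real k)) * cis (k * x)"]) auto
qed

subsection \<open>A bump function\<close>

definition ramp :: "real \<Rightarrow> real" where
  "ramp x = (if x > 0 then exp (- 1 / x) else 0)"

lemma ramp_simps: "x \<le> 0 \<Longrightarrow> ramp x = 0" "x > 0 \<Longrightarrow> ramp x > 0" "0 \<le> ramp x" "ramp x \<le> 1"
  by (auto simp: ramp_def)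

lemma exp_inverse_over_power_tendsto_0:
  "((\<lambda>x. exp (- 1 / x) / x ^ n) \<longlongrightarrow> (0::real)) (at_right 0)"
proof -
  have "((\<lambda>y::real. y ^ n / exp y) \<longlongrightarrow> 0) at_top"
    by (rule tendsto_power_div_exp_0)
  from filterlim_compose[OF this filterlim_inverse_at_top_right]
  show ?thesis
  proof (rule Lim_transform_eventually)
    show "\<forall>\<^sub>F x::real in at_right 0. inverse x ^ n / exp (inverse x) = exp (- 1 / x) / x ^ n"
      using eventually_at_right_less
    proof eventually_elim
      case (elim x)
      have "- 1 / x = - inverse x" by (simp add: divide_inverse)
      then show ?case by (simp only: exp_minus power_inverse divide_inverse mult.commute)
    qed
  qed
qed

text \<open>Up to linear combinations the functions \<open>e k\<close>, equal to
  \<open>exp (- 1 / x) / x ^ k\<close> for positive \<open>x\<close> and to zero elsewhere, are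
  closed under differentiation: the derivative of \<open>e k\<close> combines
  \<open>e (Suc k)\<close> and \<open>e (Suc (Suc k))\<close>.\<close>

lemma smooth1_ramp: "smooth1 (cplx ramp)"
proof -
  define e where "e k x = (if x > 0 then exp (- 1 / x) / x ^ k else 0)" for k :: nat and x :: real
  define B where "B = range (\<lambda>k x. complex_of_real (e k x))"
  have De: "(e k has_real_derivative (- real k * e (Suc k) x + e (Suc (Suc k)) x)) (at x)" for k x
  proof -
    consider "x > 0" | "x < 0" | "x = 0" by linarith
    then show ?thesis
    proof cases
      case 1
      have "((\<lambda>x. exp (- 1 / x) / x ^ k) has_real_derivative
        (exp (- 1 / x) * (1 / x ^ 2) * x ^ k - exp (- 1 / x) * (real k * x ^ (k - 1))) / (x ^ k * x ^ k)) (at x)"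
        using 1 by (auto intro!: derivative_eq_intros simp: power2_eq_square)
      also have "(exp (- 1 / x) * (1 / x ^ 2) * x ^ k - exp (- 1 / x) * (real k * x ^ (k - 1))) / (x ^ k * x ^ k)
         = - real k * e (Suc k) x + e (Suc (Suc k)) x"
      proof (cases k)
        case 0 then show ?thesis using 1 by (simp add: e_def power2_eq_square)
      next
        case (Suc m)
        have "(E * (1 / x ^ 2) * x ^ k - E * (real k * x ^ (k - 1))) / (x ^ k * x ^ k)
          = - real k * (E / x ^ Suc k) + E / x ^ Suc (Suc k)" for E :: real
          using 1 Suc by (simp add: divide_simps) (simp add: algebra_simps power2_eq_square)
        then show ?thesis using 1 by (simp add: e_def)
      qed
      finally have *: "((\<lambda>x. exp (- 1 / x) / x ^ k) has_real_derivative (- real k * e (Suc k) x + e (Suc (Suc k)) x)) (at x)" .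
      show ?thesis
        by (rule has_field_derivative_transform_within_open[OF *, of "{0<..}"]) (use 1 in \<open>auto simp: e_def\<close>)
    next
      case 2
      have *: "((\<lambda>x::real. 0) has_real_derivative 0) (at x)" by simp
      have "(e k has_real_derivative 0) (at x)"
        by (rule has_field_derivative_transform_within_open[OF *, of "{..<0}"]) (use 2 in \<open>auto simp: e_def\<close>)
      then show ?thesis using 2 by (simp add: e_def)
    next
      case 3
      \<comment> \<open>At the origin the derivative is found from one-sided quotients: zero on the
        left, and \<open>e (Suc k) h\<close> on the right, which tends to zero.\<close>
      have l: "((\<lambda>h. (e k (0 + h) - e k 0) / h) \<longlongrightarrow> 0) (at_left 0)"
        by (rule tendsto_eventually) (auto simp: e_def eventually_at_left_field intro!: exI[of _ "-1"])
      have r: "((\<lambda>h. (e k (0 + h) - e k 0) / h) \<longlongrightarrow> 0) (at_right 0)"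
      proof (rule Lim_transform_eventually[OF exp_inverse_over_power_tendsto_0[of "Suc k"]])
        show "\<forall>\<^sub>F h in at_right 0. exp (- 1 / h) / h ^ Suc k = (e k (0 + h) - e k 0) / h"
          using eventually_at_right_less by eventually_elim (simp add: e_def)
      qed
      have "((\<lambda>h. (e k (0 + h) - e k 0) / h) \<longlongrightarrow> 0) (at 0)"
        using l r by (simp add: filterlim_split_at)
      then have "(e k has_real_derivative 0) (at 0)" by (simp add: DERIV_def)
      then show ?thesis using 3 by (simp add: e_def)
    qed
  qed
  show ?thesis
  proof (rule smooth1_fspan)
    have "(cplx (e 0)) \<in> B" by (auto simp: B_def)
    then show "(cplx ramp) \<in> fspan B"
      by (intro fspan.base) (simp add: e_def ramp_def cong: if_cong)
    fix b assume "b \<in> B"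
    then obtain k where b: "b = (cplx (e k))" by (auto simp: B_def)
    have "(\<lambda>x. (- of_nat k) * complex_of_real (e (Suc k) x) + complex_of_real (e (Suc (Suc k)) x)) \<in> fspan B"
      by (intro fspan.add fspan.scale fspan.base) (auto simp: B_def)
    moreover have "(b has_vector_derivative (- of_nat k) * complex_of_real (e (Suc k) x) + complex_of_real (e (Suc (Suc k)) x)) (at x)" for x
      unfolding b using has_vector_derivative_of_real[OF De[of k x]] by simp
    ultimately show "\<exists>g\<in>fspan B. \<forall>x. (b has_vector_derivative g x) (at x)"
      by (intro bexI[of _ "\<lambda>x. (- of_nat k) * complex_of_real (e (Suc k) x) + complex_of_real (e (Suc (Suc k)) x)"]) auto
  qed
qed

definition bump :: "real \<Rightarrow> real" where
  "bump x = ramp x * ramp (1 - x)"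

lemma bump_simps: "x \<le> 0 \<Longrightarrow> bump x = 0" "x \<ge> 1 \<Longrightarrow> bump x = 0" "0 < x \<Longrightarrow> x < 1 \<Longrightarrow> bump x > 0"
   "0 \<le> bump x" "bump x \<le> 1" "x \<notin> {0..1} \<Longrightarrow> bump x = 0"
  by (simp_all add: bump_def ramp_simps mult_le_one) (auto simp: ramp_simps)

lemma smooth1_bump: "smooth1 (cplx bump)"
proof -
  have eq: "(cplx bump) = (\<lambda>x. complex_of_real (ramp x) * complex_of_real (ramp (-1 * x + 1)))"
    by (simp add: bump_def fun_eq_iff)
  show ?thesis
    unfolding eq by (rule smooth1_mult[OF smooth1_ramp smooth1_affine[OF smooth1_ramp, of "-1" 1]])
qed

section \<open>Integration tools\<close>

lemmas integrable_add = Bochner_Integration.integrable_add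
  and integrable_diff = Bochner_Integration.integrable_diff
  and integrable_sum = Bochner_Integration.integrable_sum
  and integrable_bound = Bochner_Integration.integrable_bound
  and integral_cong = Bochner_Integration.integral_cong
  and integral_add = Bochner_Integration.integral_add
  and integral_diff = Bochner_Integration.integral_diff
  and integral_sum = Bochner_Integration.integral_sum
  and integral_norm_bound_integral = Bochner_Integration.integral_norm_bound_integral

text \<open>In a first countable space limits along \<open>at t within I\<close> are detected by
  sequences, so the sequential dominated convergence theorem suffices.\<close>

lemma dominated_convergence_within:
  fixes s :: "'c::first_countable_topology \<Rightarrow> 'a \<Rightarrow> 'b::{banach, second_countable_topology}"
  assumes "f \<in> borel_measurable M" "\<And>\<tau>. \<tau> \<in> I \<Longrightarrow> s \<tau> \<in> borel_measurable M" "integrable M w"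
    and lim: "AE x in M. ((\<lambda>\<tau>. s \<tau> x) \<longlongrightarrow> f x) (at t within I)"
    and bound: "\<And>\<tau>. \<tau> \<in> I - {t} \<Longrightarrow> AE x in M. norm (s \<tau> x) \<le> w x"
  shows "((\<lambda>\<tau>. integral\<^sup>L M (s \<tau>)) \<longlongrightarrow> integral\<^sup>L M f) (at t within I)"
  unfolding tendsto_at_iff_sequentially
proof (intro allI impI)
  fix X :: "nat \<Rightarrow> 'c" assume X: "\<forall>i. X i \<in> I - {t}" "X \<longlonglongrightarrow> t"
  show "((\<lambda>\<tau>. integral\<^sup>L M (s \<tau>)) \<circ> X) \<longlonglongrightarrow> integral\<^sup>L M f"
    unfolding o_def
  proof (rule integral_dominated_convergence[where w = w])
    show "AE x in M. (\<lambda>i. s (X i) x) \<longlonglongrightarrow> f x"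
      using lim X unfolding tendsto_at_iff_sequentially by (auto simp: o_def)
  qed (use assms X in auto)
qed

text \<open>Brings derivatives into a form to which dominated convergence applies.\<close>

lemma has_vector_derivative_iff_quotient:
  "(f has_vector_derivative D) (at x within S) \<longleftrightarrow>
    ((\<lambda>y. (f y - f x) /\<^sub>R (y - x)) \<longlongrightarrow> D) (at x within S)"
proof -
  have "norm ((f y - f x - (y - x) *\<^sub>R D)) / norm (y - x) = norm ((f y - f x) /\<^sub>R (y - x) - D)"
    if "y \<noteq> x" for y
  proof -
    have "(f y - f x) /\<^sub>R (y - x) - D = (f y - f x - (y - x) *\<^sub>R D) /\<^sub>R (y - x)"
      using that by (simp add: scaleR_right_diff_distrib)
    then show ?thesis by (simp add: divide_inverse abs_inverse mult.commute)
  qed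
  then have "((\<lambda>y. norm ((f y - f x - (y - x) *\<^sub>R D)) / norm (y - x)) \<longlongrightarrow> 0) (at x within S)
    \<longleftrightarrow> ((\<lambda>y. norm ((f y - f x) /\<^sub>R (y - x) - D)) \<longlongrightarrow> 0) (at x within S)"
    by (intro filterlim_cong refl) (auto simp: eventually_at_filter)
  then show ?thesis
    unfolding has_vector_derivative_def has_derivative_iff_norm
    by (simp add: bounded_linear_scaleR_left LIM_zero_iff tendsto_norm_zero_iff)
qed

lemma has_vector_derivative_lipschitz:
  fixes f :: "real \<Rightarrow> 'b::real_normed_vector"
  assumes "convex S" "\<And>t. t \<in> S \<Longrightarrow> (f has_vector_derivative f' t) (at t within S)" "\<And>t. t \<in> S \<Longrightarrow> norm (f' t) \<le> B"
    "a \<in> S" "b \<in> S"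
  shows "norm (f a - f b) \<le> B * \<bar>a - b\<bar>"
proof -
  have "onorm (\<lambda>h. h *\<^sub>R f' t) \<le> B" if "t \<in> S" for t
  proof (rule onorm_le)
    fix h :: real
    show "norm (h *\<^sub>R f' t) \<le> B * norm h"
      using mult_left_mono[OF assms(3)[OF that], of "\<bar>h\<bar>"] by (simp add: mult.commute)
  qed
  then show ?thesis
    using differentiable_bound[of S f "\<lambda>t h. h *\<^sub>R f' t" B a b] assms
    by (simp add: has_vector_derivative_def)
qed

text \<open>The mean value inequality bounds every difference quotient by the majorant
  \<open>w\<close> of the derivative, so the limit may be taken under the integral.\<close>

lemma has_vector_derivative_lborel_integral:
  fixes f :: "real \<Rightarrow> 'a \<Rightarrow> 'b::{banach, second_countable_topology}"
  assumes f: "\<And>t. integrable M (f t)" and f': "f' t \<in> borel_measurable M" and w: "integrable M w"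
    and d: "\<And>t x. ((\<lambda>t. f t x) has_vector_derivative f' t x) (at t)"
    and b: "\<And>t x. norm (f' t x) \<le> w x"
  shows "((\<lambda>t. \<integral>x. f t x \<partial>M) has_vector_derivative (\<integral>x. f' t x \<partial>M)) (at t)"
  unfolding has_vector_derivative_iff_quotient
proof -
  have [measurable]: "f t \<in> borel_measurable M" for t using f by auto
  have "((\<lambda>y. \<integral>x. (f y x - f t x) /\<^sub>R (y - t) \<partial>M) \<longlongrightarrow> (\<integral>x. f' t x \<partial>M)) (at t)"
  proof (rule dominated_convergence_within[OF f' _ w])
    show "AE x in M. ((\<lambda>\<tau>. (f \<tau> x - f t x) /\<^sub>R (\<tau> - t)) \<longlongrightarrow> f' t x) (at t)"
      using d[of _ t] unfolding has_vector_derivative_iff_quotient by simp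
    show "AE x in M. norm ((f \<tau> x - f t x) /\<^sub>R (\<tau> - t)) \<le> w x" if "\<tau> \<in> UNIV - {t}" for \<tau>
    proof (rule AE_I2)
      fix x
      have "norm (f \<tau> x - f t x) \<le> w x * \<bar>\<tau> - t\<bar>"
        by (rule has_vector_derivative_lipschitz[of UNIV "\<lambda>t. f t x" "\<lambda>t. f' t x"]) (use d b in auto)
      then show "norm ((f \<tau> x - f t x) /\<^sub>R (\<tau> - t)) \<le> w x"
        using that by (simp add: pos_divide_le_eq divide_inverse_commute[symmetric])
    qed
  qed measurable
  then show "((\<lambda>y. ((\<integral>x. f y x \<partial>M) - (\<integral>x. f t x \<partial>M)) /\<^sub>R (y - t)) \<longlongrightarrow> (\<integral>x. f' t x \<partial>M)) (at t)"
    using f by simp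
qed

lemma integrable_compact_support:
  fixes f :: "'a::euclidean_space \<Rightarrow> 'b::{banach, second_countable_topology}"
  assumes "continuous_on UNIV f" "compact K" "\<And>x. x \<notin> K \<Longrightarrow> f x = 0"
  shows "integrable lborel f"
proof -
  have "integrable lborel (\<lambda>x. indicator K x *\<^sub>R f x)"
    using assms by (intro borel_integrable_compact) (auto intro: continuous_on_subset)
  also have "(\<lambda>x. indicator K x *\<^sub>R f x) = f"
    using assms(3) by (auto simp: indicator_def fun_eq_iff)
  finally show ?thesis .
qed

text \<open>The fundamental theorem on \<open>{- real n..real n}\<close>, where both boundary terms
  tend to zero. It serves as integration by parts on the whole line.\<close>

lemma integral_derivative_eq_0:
  fixes F :: "real \<Rightarrow> 'b::euclidean_space"
  assumes d: "\<And>x. (F has_vector_derivative f x) (at x)" and c: "continuous_on UNIV f"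
    and i: "integrable lborel f" and l: "(F \<longlongrightarrow> 0) at_top" "(F \<longlongrightarrow> 0) at_bot"
  shows "(LINT x|lborel. f x) = 0"
proof (rule LIMSEQ_unique)
  have eq: "(LINT x|lborel. indicator {- real n..real n} x *\<^sub>R f x) = F (real n) - F (- real n)" for n
    by (rule integral_FTC_atLeastAtMost)
      (auto intro: has_vector_derivative_at_within d continuous_on_subset[OF c])
  show "(\<lambda>n. LINT x|lborel. indicator {- real n..real n} x *\<^sub>R f x) \<longlonglongrightarrow> (LINT x|lborel. f x)"
  proof (rule integral_dominated_convergence[where w = "\<lambda>x. norm (f x)"])
    show "AE x in lborel. (\<lambda>n. indicator {- real n..real n} x *\<^sub>R f x) \<longlonglongrightarrow> f x"
    proof (rule AE_I2)
      fix x
      have "\<forall>\<^sub>F n in sequentially. \<bar>x\<bar> \<le> real n"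
        using eventually_ge_at_top[of "nat \<lceil>\<bar>x\<bar>\<rceil>"] by eventually_elim linarith
      then have "\<forall>\<^sub>F n in sequentially. indicator {- real n..real n} x *\<^sub>R f x = f x"
        by eventually_elim (auto simp: indicator_def)
      then show "(\<lambda>n. indicator {- real n..real n} x *\<^sub>R f x) \<longlonglongrightarrow> f x" by (rule tendsto_eventually)
    qed
    show "AE x in lborel. norm (indicator {- real n..real n} x *\<^sub>R f x) \<le> norm (f x)" for n
      by (auto simp: indicator_def)
  qed (use i in \<open>auto intro: borel_measurable_integrable\<close>)
  have "(\<lambda>n. F (real n) - F (- real n)) \<longlonglongrightarrow> 0 - 0"
    by (intro tendsto_diff filterlim_compose[OF l(1)] filterlim_compose[OF l(2)] filterlim_real_sequentially
        filterlim_compose[OF filterlim_uminus_at_bot_at_top filterlim_real_sequentially])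
  then show "(\<lambda>n. LINT x|lborel. indicator {- real n..real n} x *\<^sub>R f x) \<longlonglongrightarrow> 0" by (simp add: eq)
qed

lemma integrable_prod_kernel:
  fixes f g :: "real \<Rightarrow> complex" and K :: "real \<Rightarrow> real \<Rightarrow> complex"
  assumes f: "integrable lborel f" and g: "integrable lborel g"
    and K [measurable]: "(\<lambda>z. K (fst z) (snd z)) \<in> borel_measurable (lborel \<Otimes>\<^sub>M lborel)"
    and b: "\<And>x y. cmod (K x y) \<le> B"
  shows "integrable (lborel \<Otimes>\<^sub>M lborel) (\<lambda>(x, y). f x * g y * K x y)"
proof (rule lborel_pair.Fubini_integrable)
  note [measurable] = borel_measurable_integrable[OF f] borel_measurable_integrable[OF g]
  show "(\<lambda>(x, y). f x * g y * K x y) \<in> borel_measurable (lborel \<Otimes>\<^sub>M lborel)"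
    unfolding split_beta' by measurable
  have Kx [measurable]: "K x \<in> borel_measurable lborel" for x
    using measurable_compose[OF measurable_Pair1' K, of x] by simp
  have B: "B \<ge> 0" using b[of 0 0] norm_ge_zero order_trans by blast
  have i: "integrable lborel (\<lambda>y. f x * g y * K x y)" for x
  proof (rule integrable_bound)
    show "integrable lborel (\<lambda>y. cmod (f x) * B * cmod (g y))" using g by auto
    show "AE y in lborel. norm (f x * g y * K x y) \<le> norm (cmod (f x) * B * cmod (g y))"
      using b B by (auto simp: norm_mult intro!: AE_I2 mult_left_mono) (metis mult.commute mult.left_commute mult_left_mono norm_ge_zero mult_nonneg_nonneg)
  qed measurable
  then show "AE x in lborel. integrable lborel (\<lambda>y. case (x, y) of (x, y) \<Rightarrow> f x * g y * K x y)" by simp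
  show "integrable lborel (\<lambda>x. LINT y|lborel. norm (case (x, y) of (x, y) \<Rightarrow> f x * g y * K x y))"
  proof (rule integrable_bound)
    show "integrable lborel (\<lambda>x. (B * (LINT y|lborel. cmod (g y))) * cmod (f x))" using f by auto
    show "AE x in lborel. norm (LINT y|lborel. norm (case (x, y) of (x, y) \<Rightarrow> f x * g y * K x y))
      \<le> norm ((B * (LINT y|lborel. cmod (g y))) * cmod (f x))"
    proof (rule AE_I2)
      fix x
      have "(LINT y|lborel. norm (f x * g y * K x y)) \<le> (LINT y|lborel. (cmod (f x) * B) * cmod (g y))"
      proof (rule integral_mono)
        show "integrable lborel (\<lambda>y. norm (f x * g y * K x y))" using i by auto
        show "norm (f x * g y * K x y) \<le> cmod (f x) * B * cmod (g y)" for y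
          using mult_left_mono[OF b[of x y], of "cmod (f x) * cmod (g y)"]
          by (simp add: norm_mult mult_ac)
      qed (use g in auto)
      also have "... = (B * (LINT y|lborel. cmod (g y))) * cmod (f x)" by simp
      finally show "norm (LINT y|lborel. norm (case (x, y) of (x, y) \<Rightarrow> f x * g y * K x y))
         \<le> norm ((B * (LINT y|lborel. cmod (g y))) * cmod (f x))"
        using B by simp
    qed
  qed measurable
qed

text \<open>Meant for oscillating kernels such as \<open>cis (- (x * y))\<close>: being bounded,
  they leave the double integrand dominated by a product of two integrable functions.\<close>

lemma Fubini_kernel:
  fixes f g :: "real \<Rightarrow> complex" and K :: "real \<Rightarrow> real \<Rightarrow> complex"
  assumes f: "integrable lborel f" and g: "integrable lborel g"
    and K [measurable]: "(\<lambda>z. K (fst z) (snd z)) \<in> borel_measurable (lborel \<Otimes>\<^sub>M lborel)"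
    and b: "\<And>x y. cmod (K x y) \<le> B"
  shows "(LINT x|lborel. f x * (LINT y|lborel. g y * K x y)) = (LINT y|lborel. g y * (LINT x|lborel. f x * K x y))"
proof -
  have "(LINT y|lborel. LINT x|lborel. f x * g y * K x y) = (LINT x|lborel. LINT y|lborel. f x * g y * K x y)"
    by (rule lborel_pair.Fubini_integral) (rule integrable_prod_kernel[OF assms])
  then show ?thesis
    unfolding integral_mult_right_zero[symmetric] by (simp only: mult.assoc mult.left_commute mult.commute)
qed

lemma integrable_powr_tail:
  assumes "e < -1" shows "integrable lborel (\<lambda>x::real. indicator {1..} x * x powr e)"
proof -
  have "(\<lambda>x::real. x powr e) absolutely_integrable_on {1..}"
    using has_integral_powr_to_inf[OF assms, of 1]
    by (intro nonnegative_absolutely_integrable_1) (auto simp: integrable_on_def)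
  then have "integrable lebesgue (\<lambda>x::real. indicator {1..} x * x powr e)"
    by (simp add: set_integrable_def)
  then show ?thesis by (subst (asm) integrable_completion) measurable
qed

lemma integrable_weight:
  assumes "r < - 1/2" shows "integrable lborel (\<lambda>x::real. (1 + x^2) powr r)"
proof (rule integrable_bound)
  let ?h = "\<lambda>x::real. indicator {1..} x * x powr (2 * r)"
  have h: "integrable lborel ?h" by (rule integrable_powr_tail) (use assms in simp)
  show "integrable lborel (\<lambda>x. indicator {-1..1} x + (?h x + ?h (0 + -1 * x)))"
    using h lborel_integrable_real_affine[OF h, of "-1" 0] by (intro integrable_add) auto
  show "AE x in lborel. norm ((1 + x^2) powr r) \<le> norm (indicator {-1..1} x + (?h x + ?h (0 + -1 * x)))"
  proof (rule AE_I2)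
    fix x :: real
    have 1: "(1 + x^2) powr r \<le> 1" using powr_mono2'[of r 1 "1 + x^2"] assms by simp
    have 2: "(1 + x^2) powr r \<le> \<bar>x\<bar> powr (2 * r)" if "\<bar>x\<bar> \<ge> 1"
    proof -
      have "(1 + x^2) powr r \<le> (x^2) powr r" using that assms by (intro powr_mono2') auto
      also have "(x^2) powr r = (\<bar>x\<bar> powr 2) powr r" using that by (subst powr_numeral) auto
      finally show ?thesis by (simp only: powr_powr)
    qed
    show "norm ((1 + x^2) powr r) \<le> norm (indicator {-1..1} x + (?h x + ?h (0 + -1 * x)))"
      using 1 2 by (auto simp: indicator_def abs_if split: if_splits)
  qed
qed auto

section \<open>The Schwartz class\<close>

lemma schwartz_iff:
  "\<phi> \<in> schwartz \<longleftrightarrow> smooth1 \<phi> \<and> (\<forall>k n. \<exists>C. \<forall>x. \<bar>x\<bar> ^ k * cmod (nth_deriv n \<phi> x) \<le> C)"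
  by (auto simp: schwartz_def smooth1_def bounded_iff power_abs)

lemma schwartz_smooth1: "\<phi> \<in> schwartz \<Longrightarrow> smooth1 \<phi>"
  by (simp add: schwartz_iff)

lemma schwartzE:
  assumes "\<phi> \<in> schwartz" obtains C where "C \<ge> 0" "\<And>x. \<bar>x\<bar> ^ k * cmod (nth_deriv n \<phi> x) \<le> C"
proof -
  obtain C where C: "\<And>x. \<bar>x\<bar> ^ k * cmod (nth_deriv n \<phi> x) \<le> C"
    using assms unfolding schwartz_iff by blast
  show ?thesis by (rule that[of "\<bar>C\<bar>"]) (use C in \<open>auto intro: order_trans[OF _ abs_ge_self]\<close>)
qed

lemma schwartz_measurable [measurable_dest]: "\<phi> \<in> schwartz \<Longrightarrow> \<phi> \<in> borel_measurable borel"
  by (intro smooth1_measurable schwartz_smooth1)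

section \<open>Schwartz functions under sums, multiples, dilations and multiplication by x\<close>

lemma nth_deriv_add:
  assumes "smooth1 f" "smooth1 g"
  shows "nth_deriv n (\<lambda>x. f x + g x) = (\<lambda>x. nth_deriv n f x + nth_deriv n g x)"
proof (induction n)
  case (Suc n)
  show ?case unfolding nth_deriv_Suc Suc
    by (intro deriv1_eqI has_vector_derivative_add smooth1_has_deriv smooth1_nth_deriv assms)
qed simp

lemma nth_deriv_cmult:
  assumes "smooth1 f"
  shows "nth_deriv n (\<lambda>x. c * f x) = (\<lambda>x. c * nth_deriv n f x)"
proof (induction n)
  case (Suc n)
  show ?case unfolding nth_deriv_Suc Suc
    by (intro deriv1_eqI has_vector_derivative_mult_right smooth1_has_deriv smooth1_nth_deriv assms)
qed simp

lemma nth_deriv_scale: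
  assumes "smooth1 f"
  shows "nth_deriv n (\<lambda>x. f (a * x)) = (\<lambda>x. of_real (a ^ n) * nth_deriv n f (a * x))"
proof (induction n)
  case (Suc n)
  have "((\<lambda>x. of_real (a ^ n) * nth_deriv n f (a * x)) has_vector_derivative
     of_real (a ^ n) * (of_real a * deriv1 (nth_deriv n f) (a * x))) (at x)" for x
    using has_vector_derivative_affine[of "nth_deriv n f" "deriv1 (nth_deriv n f)" a 0 x]
    by (intro has_vector_derivative_mult_right) (simp add: smooth1_has_deriv smooth1_nth_deriv assms)
  from deriv1_eqI[OF this] show ?case unfolding nth_deriv_Suc Suc by (simp add: mult_ac)
qed simp

lemma nth_deriv_mult_x:
  assumes "smooth1 f"
  shows "nth_deriv n (\<lambda>x. of_real x * f x) = (\<lambda>x. of_real x * nth_deriv n f x + of_nat n * nth_deriv (n - 1) f x)"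
proof (induction n)
  case (Suc n)
  have 1: "((\<lambda>x. of_real x * nth_deriv n f x) has_vector_derivative of_real x * nth_deriv (Suc n) f x + 1 * nth_deriv n f x) (at x)" for x
    unfolding nth_deriv_Suc
    using has_vector_derivative_mult[OF has_vector_derivative_of_real[OF DERIV_ident]
        smooth1_has_deriv[OF smooth1_nth_deriv[OF assms]]]
    by simp
  have 2: "((\<lambda>x. of_nat n * nth_deriv (n - 1) f x) has_vector_derivative of_nat n * nth_deriv n f x) (at x)" for x
  proof (cases n)
    case (Suc m)
    show ?thesis unfolding Suc diff_Suc_1 nth_deriv_Suc
      by (intro has_vector_derivative_mult_right smooth1_has_deriv smooth1_nth_deriv assms)
  qed simp
  from deriv1_eqI[OF has_vector_derivative_add[OF 1 2]] show ?case
    unfolding Suc nth_deriv_Suc[of n "\<lambda>x. of_real x * f x"] by (simp add: algebra_simps)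
qed simp

lemma schwartz_add:
  assumes "f \<in> schwartz" "g \<in> schwartz" shows "(\<lambda>x. f x + g x) \<in> schwartz"
  unfolding schwartz_iff
proof (intro conjI allI)
  show "smooth1 (\<lambda>x. f x + g x)" using assms by (intro smooth1_add schwartz_smooth1)
  fix k n
  obtain C where C: "\<And>x. \<bar>x\<bar> ^ k * cmod (nth_deriv n f x) \<le> C" using schwartzE[OF assms(1)] by metis
  obtain D where D: "\<And>x. \<bar>x\<bar> ^ k * cmod (nth_deriv n g x) \<le> D" using schwartzE[OF assms(2)] by metis
  have "\<bar>x\<bar> ^ k * cmod (nth_deriv n f x + nth_deriv n g x) \<le> C + D" for x
    using mult_left_mono[OF norm_triangle_ineq[of "nth_deriv n f x" "nth_deriv n g x"], of "\<bar>x\<bar> ^ k"] C[of x] D[of x]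
    by (simp add: distrib_left)
  then show "\<exists>C. \<forall>x. \<bar>x\<bar> ^ k * cmod (nth_deriv n (\<lambda>x. f x + g x) x) \<le> C"
    by (auto simp: nth_deriv_add schwartz_smooth1 assms)
qed

lemma schwartz_cmult:
  assumes "f \<in> schwartz" shows "(\<lambda>x. c * f x) \<in> schwartz"
  unfolding schwartz_iff
proof (intro conjI allI)
  show "smooth1 (\<lambda>x. c * f x)" using assms by (intro smooth1_cmult schwartz_smooth1)
  fix k n
  obtain C where C: "\<And>x. \<bar>x\<bar> ^ k * cmod (nth_deriv n f x) \<le> C" using schwartzE[OF assms(1)] by metis
  have "\<bar>x\<bar> ^ k * cmod (c * nth_deriv n f x) \<le> cmod c * C" for x
    using mult_left_mono[OF C[of x], of "cmod c"] by (simp add: norm_mult mult_ac)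
  then show "\<exists>C. \<forall>x. \<bar>x\<bar> ^ k * cmod (nth_deriv n (\<lambda>x. c * f x) x) \<le> C"
    by (auto simp: nth_deriv_cmult schwartz_smooth1 assms)
qed

lemma schwartz_deriv1: "f \<in> schwartz \<Longrightarrow> deriv1 f \<in> schwartz"
  unfolding schwartz_iff by (auto simp: smooth1_deriv1 nth_deriv_Suc'[symmetric])

lemma schwartz_mult_x:
  assumes "f \<in> schwartz" shows "(\<lambda>x. of_real x * f x) \<in> schwartz"
  unfolding schwartz_iff
proof (intro conjI allI)
  show "smooth1 (\<lambda>x. of_real x * f x)" using assms by (intro smooth1_mult schwartz_smooth1 smooth1_of_real)
  fix k n
  obtain C where C: "\<And>x. \<bar>x\<bar> ^ Suc k * cmod (nth_deriv n f x) \<le> C" using schwartzE[OF assms(1)] by metis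
  obtain D where D: "\<And>x. \<bar>x\<bar> ^ k * cmod (nth_deriv (n - 1) f x) \<le> D" using schwartzE[OF assms(1)] by metis
  have "\<bar>x\<bar> ^ k * cmod (of_real x * nth_deriv n f x + of_nat n * nth_deriv (n - 1) f x) \<le> C + real n * D" for x
  proof -
    have "cmod (of_real x * nth_deriv n f x + of_nat n * nth_deriv (n - 1) f x)
      \<le> \<bar>x\<bar> * cmod (nth_deriv n f x) + real n * cmod (nth_deriv (n - 1) f x)"
      by (rule order_trans[OF norm_triangle_ineq]) (simp add: norm_mult)
    from mult_left_mono[OF this, of "\<bar>x\<bar> ^ k"] C[of x] mult_left_mono[OF D[of x], of "real n"] show ?thesis
      by (simp add: algebra_simps)
  qed
  then show "\<exists>C. \<forall>x. \<bar>x\<bar> ^ k * cmod (nth_deriv n (\<lambda>x. of_real x * f x) x) \<le> C"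
    by (auto simp: nth_deriv_mult_x schwartz_smooth1 assms)
qed

lemma schwartz_scale:
  assumes "f \<in> schwartz" "a \<noteq> 0" shows "(\<lambda>x. f (a * x)) \<in> schwartz"
  unfolding schwartz_iff
proof (intro conjI allI)
  show "smooth1 (\<lambda>x. f (a * x))" using smooth1_affine[OF schwartz_smooth1[OF assms(1)], of a 0] by simp
  fix k n
  obtain C where C: "\<And>x. \<bar>x\<bar> ^ k * cmod (nth_deriv n f x) \<le> C" using schwartzE[OF assms(1)] by metis
  have "\<bar>x\<bar> ^ k * cmod (of_real (a ^ n) * nth_deriv n f (a * x)) \<le> \<bar>a\<bar> ^ n / \<bar>a\<bar> ^ k * C" for x
  proof -
    have "\<bar>x\<bar> ^ k * cmod (of_real (a ^ n) * nth_deriv n f (a * x))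
      = \<bar>a\<bar> ^ n / \<bar>a\<bar> ^ k * (\<bar>a * x\<bar> ^ k * cmod (nth_deriv n f (a * x)))"
      using assms(2) by (simp add: norm_mult norm_power abs_mult power_mult_distrib)
    also have "... \<le> \<bar>a\<bar> ^ n / \<bar>a\<bar> ^ k * C" by (intro mult_left_mono C) auto
    finally show ?thesis .
  qed
  then show "\<exists>C. \<forall>x. \<bar>x\<bar> ^ k * cmod (nth_deriv n (\<lambda>x. f (a * x)) x) \<le> C"
    by (auto simp: nth_deriv_scale schwartz_smooth1 assms)
qed

lemma deriv1_eq_0_outside:
  assumes "\<And>x. x \<notin> {a..b::real} \<Longrightarrow> f x = (0::complex)" "x \<notin> {a..b}"
  shows "deriv1 f x = 0"
proof -
  have "((\<lambda>_. 0) has_vector_derivative (0::complex)) (at x)" by simp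
  then have "(f has_vector_derivative 0) (at x)"
    by (rule has_vector_derivative_transform_within_open[of _ _ _ "- {a..b}"]) (use assms in \<open>auto intro!: open_Compl\<close>)
  then show ?thesis by (rule vector_derivative_at)
qed

lemma schwartz_compact_support:
  assumes f: "smooth1 f" "\<And>x. x \<notin> {a..b} \<Longrightarrow> f x = 0"
  shows "f \<in> schwartz"
  unfolding schwartz_iff
proof (intro conjI allI)
  show "smooth1 f" by fact
  fix k n
  have 0: "nth_deriv n f x = 0" if "x \<notin> {a..b}" for x
    using that
  proof (induction n arbitrary: x)
    case (Suc n) then show ?case unfolding nth_deriv_Suc by (intro deriv1_eq_0_outside[of a b]) auto
  qed (use f in auto)
  have "bounded ((\<lambda>x. \<bar>x\<bar> ^ k * cmod (nth_deriv n f x)) ` {a..b})"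
    by (intro compact_imp_bounded compact_continuous_image continuous_intros smooth1_continuous smooth1_nth_deriv f) auto
  then obtain C where "\<forall>y\<in>(\<lambda>x. \<bar>x\<bar> ^ k * cmod (nth_deriv n f x)) ` {a..b}. norm y \<le> C"
    unfolding bounded_iff by blast
  then have C: "\<bar>x\<bar> ^ k * cmod (nth_deriv n f x) \<le> C" if "x \<in> {a..b}" for x
    using that by (simp add: ball_simps del: atLeastAtMost_iff)
  have "\<bar>x\<bar> ^ k * cmod (nth_deriv n f x) \<le> \<bar>C\<bar>" for x
    using C[of x] 0[of x] by (cases "x \<in> {a..b}") auto
  then show "\<exists>C. \<forall>x. \<bar>x\<bar> ^ k * cmod (nth_deriv n f x) \<le> C" by blast
qed

text \<open>Passes from the integer powers in the Schwartz seminorms to real powers of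
  \<open>1 + x^2\<close>, by interposing an integer \<open>k \<ge> r\<close>.\<close>

lemma schwartz_weight_bound:
  assumes "\<phi> \<in> schwartz" obtains C where "C \<ge> 0" "\<And>x. (1 + x^2) powr r * cmod (\<phi> x) \<le> C"
proof -
  obtain k :: nat where k: "r \<le> real k" using real_arch_simple by blast
  obtain C where C: "C \<ge> 0" "\<And>x. \<bar>x\<bar> ^ 0 * cmod (nth_deriv 0 \<phi> x) \<le> C" using schwartzE[OF assms] by metis
  obtain D where D: "D \<ge> 0" "\<And>x. \<bar>x\<bar> ^ (2 * k) * cmod (nth_deriv 0 \<phi> x) \<le> D" using schwartzE[OF assms] by metis
  have "(1 + x^2) powr r * cmod (\<phi> x) \<le> 2 ^ k * (C + D)" for x
  proof -
    have "(1 + x^2) powr r \<le> (1 + x^2) powr k" using k by (intro powr_mono) auto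
    also have "... = (1 + x^2) ^ k" by (simp add: powr_realpow add_pos_nonneg)
    also have "... \<le> 2 ^ k * (1 + (x^2) ^ k)"
    proof (cases "x\<^sup>2 \<le> 1")
      case True
      then have "(1 + x^2) ^ k \<le> 2 ^ k" by (intro power_mono) auto
      also have "... \<le> 2 ^ k * (1 + (x^2) ^ k)" by simp
      finally show ?thesis .
    next
      case False
      then have "(1 + x^2) ^ k \<le> (2 * x^2) ^ k" by (intro power_mono) auto
      also have "... \<le> 2 ^ k * (1 + (x^2) ^ k)" unfolding power_mult_distrib by simp
      finally show ?thesis .
    qed
    finally have "(1 + x^2) powr r \<le> 2 ^ k * (1 + (x^2) ^ k)" .
    have px: "\<bar>x\<bar> ^ (2 * k) = (x^2) ^ k" by (metis power2_abs power_mult)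
    from mult_right_mono[OF \<open>(1 + x^2) powr r \<le> 2 ^ k * (1 + (x^2) ^ k)\<close> norm_ge_zero[of "\<phi> x"]]
    have "(1 + x^2) powr r * cmod (\<phi> x) \<le> 2 ^ k * (cmod (\<phi> x) + \<bar>x\<bar> ^ (2 * k) * cmod (\<phi> x))"
      unfolding px by (simp add: algebra_simps)
    also have "... \<le> 2 ^ k * (C + D)" using C(2)[of x] D(2)[of x] by (intro mult_left_mono) auto
    finally show ?thesis .
  qed
  then show ?thesis using C D by (intro that[of "2 ^ k * (C + D)"]) auto
qed

text \<open>One power of \<open>1 + x^2\<close> is given away: with exponent \<open>r + 1\<close>
  the product is still bounded, and \<open>(1 + x^2) powr -1\<close> is integrable.\<close>

lemma schwartz_integrable_weight:
  assumes "\<phi> \<in> schwartz" shows "integrable lborel (\<lambda>x. (1 + x^2) powr r * cmod (\<phi> x))"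
proof -
  note [measurable] = schwartz_measurable[OF assms]
  obtain C where C: "C \<ge> 0" "\<And>x. (1 + x^2) powr (r + 1) * cmod (\<phi> x) \<le> C"
    using schwartz_weight_bound[OF assms] by metis
  show ?thesis
  proof (rule integrable_bound)
    show "integrable lborel (\<lambda>x::real. C * (1 + x^2) powr -1)" by (intro integrable_mult_right integrable_weight) simp
    show "AE x in lborel. norm ((1 + x^2) powr r * cmod (\<phi> x)) \<le> norm (C * (1 + x^2) powr - 1)"
    proof (rule AE_I2)
      fix x :: real
      have "(1 + x^2) powr r = (1 + x^2) powr -1 * (1 + x^2) powr (r + 1)"
        by (simp only: powr_add[symmetric]) simp
      then show "norm ((1 + x^2) powr r * cmod (\<phi> x)) \<le> norm (C * (1 + x^2) powr - 1)"
        using mult_left_mono[OF C(2)[of x], of "(1 + x^2) powr -1"] C(1) by (simp add: mult_ac abs_mult)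
    qed
  qed measurable
qed

lemma schwartz_integrable: "\<phi> \<in> schwartz \<Longrightarrow> integrable lborel \<phi>"
  using schwartz_integrable_weight[of \<phi> 0]
  by (subst integrable_norm_iff[symmetric]) (auto simp: schwartz_measurable add_pos_nonneg powr_def add_nonneg_eq_0_iff)

lemma schwartz_bounded: "\<phi> \<in> schwartz \<Longrightarrow> \<exists>C\<ge>0. \<forall>x. cmod (\<phi> x) \<le> C"
  using schwartzE[of \<phi> 0 0] by (metis mult_1 nth_deriv_0 power_0)

lemma schwartz_integrable_weight_square:
  assumes "\<phi> \<in> schwartz" shows "integrable lborel (\<lambda>x. (1 + x^2) powr r * (cmod (\<phi> x))^2)"
proof -
  note [measurable] = schwartz_measurable[OF assms]
  obtain C where C: "C \<ge> 0" "\<And>x. cmod (\<phi> x) \<le> C" using schwartz_bounded[OF assms] by metis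
  show ?thesis
  proof (rule integrable_bound)
    show "integrable lborel (\<lambda>x. C * ((1 + x^2) powr r * cmod (\<phi> x)))"
      using schwartz_integrable_weight[OF assms] by auto
    show "AE x in lborel. norm ((1 + x^2) powr r * (cmod (\<phi> x))^2) \<le> norm (C * ((1 + x^2) powr r * cmod (\<phi> x)))"
    proof (rule AE_I2)
      fix x
      show "norm ((1 + x^2) powr r * (cmod (\<phi> x))^2) \<le> norm (C * ((1 + x^2) powr r * cmod (\<phi> x)))"
        using mult_right_mono[OF C(2)[of x], of "(1 + x^2) powr r * cmod (\<phi> x)"] C(1)
        by (simp add: power2_eq_square abs_mult mult_ac)
    qed
  qed measurable
qed

lemma schwartz_tendsto_0:
  assumes "\<phi> \<in> schwartz" shows "(\<phi> \<longlongrightarrow> 0) at_infinity"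
proof -
  obtain C where C: "C \<ge> 0" "\<And>x. \<bar>x\<bar> ^ 1 * cmod (nth_deriv 0 \<phi> x) \<le> C" using schwartzE[OF assms] by metis
  have "((\<lambda>x::real. C * inverse (norm x)) \<longlongrightarrow> C * 0) at_infinity"
    by (rule tendsto_mult[OF tendsto_const tendsto_inverse_0_at_top[OF filterlim_norm_at_top]])
  then have "((\<lambda>x::real. C * inverse (norm x)) \<longlongrightarrow> 0) at_infinity" by simp
  then show ?thesis
  proof (rule Lim_null_comparison[rotated])
    show "\<forall>\<^sub>F x in at_infinity. norm (\<phi> x) \<le> C * inverse (norm x)"
      unfolding eventually_at_infinity
      by (intro exI[of _ 1] allI impI) (use C(2) in \<open>auto simp: field_simps\<close>)
  qed
qed

section \<open>The Fourier transform on the Schwartz class\<close>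

lemma measurable_lborel_prod_continuous:
  fixes f :: "real \<times> real \<Rightarrow> 'b::{banach, second_countable_topology}"
  assumes "continuous_on UNIV f" shows "f \<in> borel_measurable (lborel \<Otimes>\<^sub>M lborel)"
  unfolding lborel_prod using borel_measurable_continuous_onI[OF assms] by simp

lemma continuous_on_cis_compose [continuous_intros]:
  "continuous_on A f \<Longrightarrow> continuous_on A (\<lambda>x. cis (f x))"
  unfolding cis_conv_exp by (intro continuous_intros)

lemma measurable_cis [measurable]: "cis \<in> borel_measurable borel"
  by (intro borel_measurable_continuous_onI continuous_intros)

lemma measurable_fourier [measurable]:
  assumes [measurable]: "f \<in> borel_measurable borel" shows "fourier f \<in> borel_measurable borel"
proof -
  have "(\<lambda>\<xi>. LINT x|lborel. cis (- (x * \<xi>)) * f x) \<in> borel_measurable lborel"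
    by (rule lborel.borel_measurable_lebesgue_integral) measurable
  then show ?thesis unfolding fourier_def[abs_def] by simp
qed

lemma norm_fourier_le: "cmod (fourier f \<xi>) \<le> (LINT x|lborel. cmod (f x))"
proof -
  have "sqrt 1 \<le> sqrt (2 * pi)" using pi_ge_two by (intro real_sqrt_le_mono) linarith
  then have "1 / sqrt (2 * pi) \<le> 1" by simp
  moreover have "cmod (LINT x|lborel. cis (- (x * \<xi>)) * f x) \<le> (LINT x|lborel. cmod (f x))"
    using integral_norm_bound[of lborel "\<lambda>x. cis (- (x * \<xi>)) * f x"] by (simp add: norm_mult)
  ultimately have "(1 / sqrt (2 * pi)) * cmod (LINT x|lborel. cis (- (x * \<xi>)) * f x) \<le> 1 * (LINT x|lborel. cmod (f x))"
    by (intro mult_mono) auto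
  then show ?thesis by (simp add: fourier_def norm_mult norm_divide)
qed

lemma integrable_cis_mult:
  assumes "integrable lborel f" shows "integrable lborel (\<lambda>x. cis (k * x) * f x)"
proof (rule integrable_bound[OF assms])
  have [measurable]: "f \<in> borel_measurable borel" using borel_measurable_integrable[OF assms] by simp
  show "(\<lambda>x. cis (k * x) * f x) \<in> borel_measurable lborel" by measurable
qed (simp add: norm_mult)

lemma integrable_fourier_kernel:
  "integrable lborel f \<Longrightarrow> integrable lborel (\<lambda>x. cis (- (x * \<xi>)) * f x)"
  using integrable_cis_mult[of f "- \<xi>"] by (simp add: mult.commute)

lemma fourier_add:
  "integrable lborel f \<Longrightarrow> integrable lborel g \<Longrightarrow> fourier (\<lambda>x. f x + g x) \<xi> = fourier f \<xi> + fourier g \<xi>"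
  by (simp add: fourier_def integrable_fourier_kernel distrib_left)

lemma fourier_cmult: "fourier (\<lambda>x. c * f x) \<xi> = c * fourier f \<xi>"
  by (simp add: fourier_def mult.left_commute[of _ c])

lemma fourier_shift: "fourier (\<lambda>x. f (x + a)) \<xi> = cis (a * \<xi>) * fourier f \<xi>"
proof -
  have "(LINT x|lborel. cis (- (x * \<xi>)) * f x) = (LINT x|lborel. cis (- ((a + 1 * x) * \<xi>)) * f (a + 1 * x))"
    by (subst lborel_integral_real_affine[where c = 1 and t = a]) auto
  also have "... = (LINT x|lborel. cis (- (a * \<xi>)) * (cis (- (x * \<xi>)) * f (x + a)))"
  proof -
    have "cis (- ((a + 1 * x) * \<xi>)) = cis (- (a * \<xi>)) * cis (- (x * \<xi>))" for x
      by (simp add: cis_mult distrib_right)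
    then show ?thesis by (simp only: mult.assoc mult_1 add.commute[of a])
  qed
  also have "... = cis (- (a * \<xi>)) * (LINT x|lborel. cis (- (x * \<xi>)) * f (x + a))" by simp
  finally have "cis (a * \<xi>) * (LINT x|lborel. cis (- (x * \<xi>)) * f x)
     = (cis (a * \<xi>) * cis (- (a * \<xi>))) * (LINT x|lborel. cis (- (x * \<xi>)) * f (x + a))"
    by (simp only: mult.assoc)
  then show ?thesis by (simp add: fourier_def cis_mult)
qed

lemma fourier_modulate: "fourier (\<lambda>x. cis (k * x) * f x) \<xi> = fourier f (\<xi> - k)"
proof -
  have "cis (- (x * \<xi>)) * (cis (k * x) * f x) = cis (- (x * (\<xi> - k))) * f x" for x
    unfolding mult.assoc[symmetric] cis_mult by (simp add: algebra_simps)
  then show ?thesis by (simp only: fourier_def)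
qed

lemma fourier_scale:
  assumes "a > 0" shows "fourier (\<lambda>x. f (x / a)) \<xi> = of_real a * fourier f (a * \<xi>)"
proof -
  have "(LINT x|lborel. cis (- (x * \<xi>)) * f (x / a)) = \<bar>a\<bar> *\<^sub>R (LINT x|lborel. cis (- ((0 + a * x) * \<xi>)) * f ((0 + a * x) / a))"
    using assms by (intro lborel_integral_real_affine) auto
  also have "... = of_real a * (LINT x|lborel. cis (- (x * (a * \<xi>))) * f x)"
    using assms by (simp add: scaleR_conv_of_real mult_ac)
  finally show ?thesis by (simp add: fourier_def)
qed

lemma fourier_has_deriv:
  assumes "\<phi> \<in> schwartz"
  shows "(fourier \<phi> has_vector_derivative fourier (\<lambda>x. - \<i> * (of_real x * \<phi> x)) \<xi>) (at \<xi>)"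
proof -
  have x: "(\<lambda>x. of_real x * \<phi> x) \<in> schwartz" by (rule schwartz_mult_x) fact
  note [measurable] = schwartz_measurable[OF assms]
  have "((\<lambda>\<xi>. LINT x|lborel. cis (- x * \<xi>) * \<phi> x) has_vector_derivative
     (LINT x|lborel. (\<i> * of_real (- x) * cis (- x * \<xi>)) * \<phi> x)) (at \<xi>)"
  proof (rule has_vector_derivative_lborel_integral)
    show "integrable lborel (\<lambda>x. cis (- x * t) * \<phi> x)" for t
      using integrable_fourier_kernel[OF schwartz_integrable[OF assms]] by simp
    show "(\<lambda>x. \<i> * of_real (- x) * cis (- x * \<xi>) * \<phi> x) \<in> borel_measurable lborel" by measurable
    show "integrable lborel (\<lambda>x. cmod (of_real x * \<phi> x))" using schwartz_integrable[OF x] by auto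
    show "((\<lambda>t. cis (- x * t) * \<phi> x) has_vector_derivative \<i> * of_real (- x) * cis (- x * t) * \<phi> x) (at t)" for t x
      by (intro has_vector_derivative_mult_left has_vector_derivative_cis)
    show "cmod (\<i> * of_real (- x) * cis (- x * t) * \<phi> x) \<le> cmod (of_real x * \<phi> x)" for t x
      by (simp add: norm_mult)
  qed
  then have "((\<lambda>\<xi>. of_real (1 / sqrt (2 * pi)) * (LINT x|lborel. cis (- x * \<xi>) * \<phi> x)) has_vector_derivative
     of_real (1 / sqrt (2 * pi)) * (LINT x|lborel. (\<i> * of_real (- x) * cis (- x * \<xi>)) * \<phi> x)) (at \<xi>)"
    by (rule has_vector_derivative_mult_right)
  moreover have "(\<i> * of_real (- x) * cis (- x * \<xi>)) * \<phi> x = cis (- (x * \<xi>)) * (- \<i> * (of_real x * \<phi> x))" for x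
    by simp
  ultimately show ?thesis unfolding fourier_def[abs_def] by (simp only: mult_minus_left)
qed

text \<open>The derivative of \<open>cis (- \<xi> * x) * \<phi> x\<close> has integral zero.\<close>

lemma fourier_deriv1:
  assumes d: "\<And>x. (\<phi> has_vector_derivative \<phi>' x) (at x)" and i: "integrable lborel \<phi>" "integrable lborel \<phi>'"
    and c: "continuous_on UNIV \<phi>'" and l: "(\<phi> \<longlongrightarrow> 0) at_top" "(\<phi> \<longlongrightarrow> 0) at_bot"
  shows "fourier \<phi>' \<xi> = \<i> * of_real \<xi> * fourier \<phi> \<xi>"
proof -
  have c\<phi>: "continuous_on UNIV \<phi>"
    by (intro continuous_at_imp_continuous_on ballI has_vector_derivative_continuous[OF d])
  have l': "((\<lambda>x. cis (- \<xi> * x) * \<phi> x) \<longlongrightarrow> 0) F" if "(\<phi> \<longlongrightarrow> 0) F" for F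
  proof (rule tendsto_norm_zero_cancel)
    show "((\<lambda>x. norm (cis (- \<xi> * x) * \<phi> x)) \<longlongrightarrow> 0) F"
      using tendsto_norm_zero[OF that] by (simp add: norm_mult)
  qed
  have i': "integrable lborel (\<lambda>x. cis (- \<xi> * x) * \<phi>' x)"
    "integrable lborel (\<lambda>x. (\<i> * of_real (- \<xi>)) * (cis (- \<xi> * x) * \<phi> x))"
    by (rule integrable_cis_mult[OF i(2)]) (rule integrable_mult_right[OF integrable_cis_mult[OF i(1)]])
  have "(LINT x|lborel. cis (- \<xi> * x) * \<phi>' x + (\<i> * of_real (- \<xi>) * cis (- \<xi> * x)) * \<phi> x) = 0"
  proof (rule integral_derivative_eq_0)
    show "((\<lambda>x. cis (- \<xi> * x) * \<phi> x) has_vector_derivative cis (- \<xi> * x) * \<phi>' x + \<i> * of_real (- \<xi>) * cis (- \<xi> * x) * \<phi> x) (at x)" for x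
      by (intro has_vector_derivative_mult has_vector_derivative_cis d)
    show "continuous_on UNIV (\<lambda>x. cis (- \<xi> * x) * \<phi>' x + \<i> * of_real (- \<xi>) * cis (- \<xi> * x) * \<phi> x)"
      by (intro continuous_intros c c\<phi>)
    show "integrable lborel (\<lambda>x. cis (- \<xi> * x) * \<phi>' x + \<i> * of_real (- \<xi>) * cis (- \<xi> * x) * \<phi> x)"
      using i' by (intro integrable_add) (simp_all add: mult.assoc)
  qed (intro l' l)+
  then have "(LINT x|lborel. cis (- \<xi> * x) * \<phi>' x) + (LINT x|lborel. (\<i> * of_real (- \<xi>)) * (cis (- \<xi> * x) * \<phi> x)) = 0"
    using i' by (subst integral_add[symmetric]) (simp_all add: mult.assoc)
  then have "(LINT x|lborel. cis (- \<xi> * x) * \<phi>' x) = \<i> * of_real \<xi> * (LINT x|lborel. cis (- \<xi> * x) * \<phi> x)"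
    by (simp add: add_eq_0_iff)
  then show ?thesis by (simp add: fourier_def mult.commute mult.left_commute)
qed

lemma schwartz_fourier_deriv1:
  assumes "\<phi> \<in> schwartz" shows "fourier (deriv1 \<phi>) \<xi> = \<i> * of_real \<xi> * fourier \<phi> \<xi>"
proof (rule fourier_deriv1)
  show "(\<phi> \<longlongrightarrow> 0) at_top" "(\<phi> \<longlongrightarrow> 0) at_bot"
    using schwartz_tendsto_0[OF assms] by (auto intro: tendsto_mono at_top_le_at_infinity at_bot_le_at_infinity)
qed (use assms in \<open>auto intro: smooth1_has_deriv smooth1_continuous smooth1_deriv1 schwartz_smooth1 schwartz_integrable schwartz_deriv1\<close>)

lemma fourier_bound_power:
  assumes "\<phi> \<in> schwartz" shows "\<exists>C. \<forall>\<xi>. \<bar>\<xi>\<bar> ^ k * cmod (fourier \<phi> \<xi>) \<le> C"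
  using assms
proof (induction k arbitrary: \<phi>)
  case 0 then show ?case by (auto intro: norm_fourier_le)
next
  case (Suc k)
  obtain C where C: "\<And>\<xi>. \<bar>\<xi>\<bar> ^ k * cmod (fourier (deriv1 \<phi>) \<xi>) \<le> C"
    using Suc.IH[OF schwartz_deriv1[OF Suc.prems]] by blast
  have "\<bar>\<xi>\<bar> ^ Suc k * cmod (fourier \<phi> \<xi>) \<le> C" for \<xi>
    using C[of \<xi>] by (simp add: schwartz_fourier_deriv1 Suc.prems norm_mult mult_ac)
  then show ?case by blast
qed

text \<open>Each derivative of \<open>fourier \<phi>\<close> is again the transform of a Schwartz
  function, namely of \<open>- \<i> * x\<close> times the previous one; the decay of a transform
  comes in turn from derivatives of the original.\<close>

lemma fourier_schwartz:
  assumes "\<phi> \<in> schwartz" shows "fourier \<phi> \<in> schwartz"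
proof -
  have *: "\<exists>\<psi>\<in>schwartz. nth_deriv n (fourier \<phi>) = fourier \<psi>" for n
  proof (induction n)
    case (Suc n)
    then obtain \<psi> where \<psi>: "\<psi> \<in> schwartz" "nth_deriv n (fourier \<phi>) = fourier \<psi>" by blast
    have "(\<lambda>x. - \<i> * (of_real x * \<psi> x)) \<in> schwartz" by (intro schwartz_cmult schwartz_mult_x \<psi>)
    moreover have "nth_deriv (Suc n) (fourier \<phi>) = fourier (\<lambda>x. - \<i> * (of_real x * \<psi> x))"
      unfolding nth_deriv_Suc \<psi> by (intro deriv1_eqI fourier_has_deriv \<psi>)
    ultimately show ?case by blast
  qed (use assms in auto)
  show ?thesis
    unfolding schwartz_iff smooth1_def
  proof (intro conjI allI)
    fix n x k
    obtain \<psi> where \<psi>: "\<psi> \<in> schwartz" "nth_deriv n (fourier \<phi>) = fourier \<psi>" using * by blast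
    show "nth_deriv n (fourier \<phi>) differentiable at x"
      unfolding \<psi> using fourier_has_deriv[OF \<psi>(1)] by (rule differentiableI_vector)
    show "\<exists>C. \<forall>x. \<bar>x\<bar> ^ k * cmod (nth_deriv n (fourier \<phi>) x) \<le> C"
      unfolding \<psi> by (rule fourier_bound_power) fact
  qed
qed

text \<open>Ensures that the transform defined by duality in \<open>sobolev_ft\<close> is, for an
  integrable function \<open>f\<close>, the function \<open>fourier f\<close>.\<close>

lemma fourier_multiplication_formula:
  assumes "integrable lborel f" "integrable lborel g"
  shows "(LINT x|lborel. f x * fourier g x) = (LINT \<xi>|lborel. fourier f \<xi> * g \<xi>)"
proof -
  have "(LINT x|lborel. f x * (LINT y|lborel. g y * cis (- (x * y)))) = (LINT y|lborel. g y * (LINT x|lborel. f x * cis (- (x * y))))"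
    by (intro Fubini_kernel[where B = 1] assms measurable_lborel_prod_continuous continuous_intros) auto
  moreover have "f x * fourier g x = of_real (1 / sqrt (2 * pi)) * (f x * (LINT y|lborel. g y * cis (- (x * y))))" for x
    unfolding fourier_def by (simp only: mult_ac)
  moreover have "fourier f y * g y = of_real (1 / sqrt (2 * pi)) * (g y * (LINT x|lborel. f x * cis (- (x * y))))" for y
    unfolding fourier_def by (simp only: mult_ac)
  ultimately show ?thesis by (simp only: integral_mult_right_zero)
qed

definition inv_fourier :: "(real \<Rightarrow> complex) \<Rightarrow> real \<Rightarrow> complex" where
  "inv_fourier \<phi> \<xi> = fourier \<phi> (- \<xi>)"

lemma inv_fourier_schwartz: "\<phi> \<in> schwartz \<Longrightarrow> inv_fourier \<phi> \<in> schwartz"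
  using schwartz_scale[OF fourier_schwartz, of \<phi> "-1"] by (simp add: inv_fourier_def[abs_def])

lemma integrable_std_normal: "integrable lborel (\<lambda>x. complex_of_real (std_normal_density x))"
  by (intro integrable_of_real integrable_normal_density) simp

lemma integral_cis_std_normal:
  "(LINT x|lborel. cis (t * x) * of_real (std_normal_density x)) = of_real (exp (- (t^2) / 2))"
proof -
  have "char std_normal_distribution t = (LINT x|lborel. std_normal_density x *\<^sub>R cis (t * x))"
    unfolding char_def by (subst integral_density) (auto simp: cis_conv_exp mult.commute)
  then show ?thesis using fun_cong[OF char_std_normal_distribution, of t]
    by (simp add: scaleR_conv_of_real mult.commute)
qed

text \<open>Gaussian regularisation: the right-hand side tends to \<open>\<phi> x\<close> as \<open>\<delta>\<close> tends to \<open>0\<close>.\<close>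

lemma fourier_inversion_regularised:
  assumes \<phi>: "\<phi> \<in> schwartz" and \<delta>: "\<delta> > 0"
  shows "of_real (1 / sqrt (2 * pi)) * (LINT \<xi>|lborel. cis (x * \<xi>) * of_real (exp (- (\<delta> * \<xi>)\<^sup>2 / 2)) * fourier \<phi> \<xi>)
    = (LINT z|lborel. \<phi> (x + \<delta> * z) * of_real (std_normal_density z))"
proof -
  let ?c = "complex_of_real (1 / sqrt (2 * pi))" and ?n = "\<lambda>z. complex_of_real (std_normal_density z)"
  have c: "?c * of_real (sqrt (2 * pi)) = 1" by (simp flip: of_real_mult)
  have alg: "?c * (a * (of_real (sqrt (2 * pi)) * X)) = a * X" for a X
    using c by (metis mult.assoc mult.left_commute mult_1)
  \<comment> \<open>Up to a constant the regulariser is the density of the standard normal law,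
    whose characteristic function is Gaussian again. The inner integral below is this characteristic
    function at \<open>(x - y) / \<delta>\<close>.\<close>
  have gauss: "complex_of_real (exp (- (\<eta>)\<^sup>2 / 2)) = of_real (sqrt (2 * pi)) * ?n \<eta>" for \<eta>
  proof -
    have "exp (- \<eta>\<^sup>2 / 2) = sqrt (2 * pi) * std_normal_density \<eta>" by (simp add: std_normal_density_def)
    then show ?thesis by (metis of_real_mult)
  qed
  have "(LINT \<xi>|lborel. cis (x * \<xi>) * of_real (exp (- (\<delta> * \<xi>)\<^sup>2 / 2)) * fourier \<phi> \<xi>)
     = \<bar>1 / \<delta>\<bar> *\<^sub>R (LINT \<eta>|lborel. cis (x * (0 + 1 / \<delta> * \<eta>)) * of_real (exp (- (\<delta> * (0 + 1 / \<delta> * \<eta>))\<^sup>2 / 2)) * fourier \<phi> (0 + 1 / \<delta> * \<eta>))"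
    using \<delta> by (intro lborel_integral_real_affine) auto
  also have "... = of_real (1 / \<delta>) * (LINT \<eta>|lborel. of_real (sqrt (2 * pi)) * (cis (x * \<eta> / \<delta>) * ?n \<eta> * fourier \<phi> (\<eta> / \<delta>)))"
    using \<delta> gauss by (simp add: scaleR_conv_of_real mult_ac)
  finally have 1: "?c * (LINT \<xi>|lborel. cis (x * \<xi>) * of_real (exp (- (\<delta> * \<xi>)\<^sup>2 / 2)) * fourier \<phi> \<xi>)
     = of_real (1 / \<delta>) * (LINT \<eta>|lborel. cis (x * \<eta> / \<delta>) * ?n \<eta> * fourier \<phi> (\<eta> / \<delta>))"
    by (simp only: integral_mult_right_zero alg)
  have "(LINT \<eta>|lborel. cis (x * \<eta> / \<delta>) * ?n \<eta> * fourier \<phi> (\<eta> / \<delta>))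
     = ?c * (LINT \<eta>|lborel. ?n \<eta> * (LINT y|lborel. \<phi> y * cis (- (y * (\<eta> / \<delta>)) + x * \<eta> / \<delta>)))"
  proof -
    have "cis (x * \<eta> / \<delta>) * ?n \<eta> * fourier \<phi> (\<eta> / \<delta>)
       = ?c * (?n \<eta> * (LINT y|lborel. cis (x * \<eta> / \<delta>) * (cis (- (y * (\<eta> / \<delta>))) * \<phi> y)))" for \<eta>
      unfolding fourier_def integral_mult_right_zero by (simp only: mult_ac)
    moreover have "cis (x * \<eta> / \<delta>) * (cis (- (y * (\<eta> / \<delta>))) * \<phi> y) = \<phi> y * cis (- (y * (\<eta> / \<delta>)) + x * \<eta> / \<delta>)" for \<eta> y
      by (simp only: cis_mult[symmetric] mult_ac)
    ultimately show ?thesis by (simp only: integral_mult_right_zero)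
  qed
  also have "(LINT \<eta>|lborel. ?n \<eta> * (LINT y|lborel. \<phi> y * cis (- (y * (\<eta> / \<delta>)) + x * \<eta> / \<delta>)))
     = (LINT y|lborel. \<phi> y * (LINT \<eta>|lborel. ?n \<eta> * cis (- (y * (\<eta> / \<delta>)) + x * \<eta> / \<delta>)))"
    using \<delta> by (intro Fubini_kernel[where B = 1] schwartz_integrable \<phi> integrable_std_normal
        measurable_lborel_prod_continuous continuous_intros) auto
  also have "... = (LINT y|lborel. \<phi> y * of_real (exp (- (((x - y) / \<delta>)^2) / 2)))"
  proof -
    have "(LINT \<eta>|lborel. ?n \<eta> * cis (- (y * (\<eta> / \<delta>)) + x * \<eta> / \<delta>)) = of_real (exp (- (((x - y) / \<delta>)^2) / 2))" for y
    proof -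
      have "- (y * (\<eta> / \<delta>)) + x * \<eta> / \<delta> = (x - y) / \<delta> * \<eta>" for \<eta> using \<delta> by (simp add: field_simps)
      then show ?thesis using integral_cis_std_normal[of "(x - y) / \<delta>"] by (simp add: mult.commute)
    qed
    then show ?thesis by simp
  qed
  also have "... = \<bar>\<delta>\<bar> *\<^sub>R (LINT z|lborel. \<phi> (x + \<delta> * z) * of_real (exp (- (((x - (x + \<delta> * z)) / \<delta>)^2) / 2)))"
    using \<delta> by (intro lborel_integral_real_affine) auto
  also have "... = of_real \<delta> * (LINT z|lborel. of_real (sqrt (2 * pi)) * (\<phi> (x + \<delta> * z) * ?n z))"
  proof -
    have "complex_of_real (exp (- (((x - (x + \<delta> * z)) / \<delta>)^2) / 2)) = of_real (sqrt (2 * pi)) * ?n z" for z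
    proof -
      have "((x - (x + \<delta> * z)) / \<delta>)^2 = z^2" using \<delta> by simp
      then show ?thesis using gauss[of z] by simp
    qed
    then show ?thesis using \<delta> by (simp add: scaleR_conv_of_real mult_ac)
  qed
  finally have 2: "(LINT \<eta>|lborel. cis (x * \<eta> / \<delta>) * ?n \<eta> * fourier \<phi> (\<eta> / \<delta>))
     = of_real \<delta> * (LINT z|lborel. \<phi> (x + \<delta> * z) * ?n z)" by (simp only: integral_mult_right_zero alg)
  show ?thesis unfolding 1 2 using \<delta> by simp
qed

text \<open>Passage to the limit in the regularised formula: on the left the integrable
  \<open>fourier \<phi>\<close> dominates; on the right \<open>\<phi>\<close> is bounded and
  continuous and the normal density has integral one.\<close>

lemma fourier_inversion:
  assumes \<phi>: "\<phi> \<in> schwartz"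
  shows "fourier (inv_fourier \<phi>) x = \<phi> x"
proof -
  let ?c = "complex_of_real (1 / sqrt (2 * pi))" and ?n = "\<lambda>z. complex_of_real (std_normal_density z)"
  note [measurable] = schwartz_measurable[OF \<phi>] schwartz_measurable[OF fourier_schwartz[OF \<phi>]]
  obtain C where C: "\<And>x. cmod (\<phi> x) \<le> C" using schwartz_bounded[OF \<phi>] by blast
  define d where "d n = 1 / real (Suc n)" for n
  have d: "d n > 0" "d \<longlonglongrightarrow> 0" for n
    unfolding d_def using LIMSEQ_inverse_real_of_nat by (simp_all add: inverse_eq_divide)
  have lim1: "(\<lambda>n. LINT \<xi>|lborel. cis (x * \<xi>) * of_real (exp (- (d n * \<xi>)\<^sup>2 / 2)) * fourier \<phi> \<xi>)
     \<longlonglongrightarrow> (LINT \<xi>|lborel. cis (x * \<xi>) * of_real (exp (- (0 * \<xi>)\<^sup>2 / 2)) * fourier \<phi> \<xi>)"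
  proof (rule integral_dominated_convergence[where w = "\<lambda>\<xi>. cmod (fourier \<phi> \<xi>)"])
    show "AE \<xi> in lborel. (\<lambda>n. cis (x * \<xi>) * of_real (exp (- (d n * \<xi>)\<^sup>2 / 2)) * fourier \<phi> \<xi>)
      \<longlonglongrightarrow> cis (x * \<xi>) * of_real (exp (- (0 * \<xi>)\<^sup>2 / 2)) * fourier \<phi> \<xi>"
      by (intro AE_I2 tendsto_intros d) auto
    show "integrable lborel (\<lambda>\<xi>. cmod (fourier \<phi> \<xi>))"
      using schwartz_integrable[OF fourier_schwartz[OF \<phi>]] by auto
    show "AE \<xi> in lborel. norm (cis (x * \<xi>) * of_real (exp (- (d n * \<xi>)\<^sup>2 / 2)) * fourier \<phi> \<xi>) \<le> cmod (fourier \<phi> \<xi>)" for n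
      by (intro AE_I2) (auto simp: norm_mult intro!: mult_left_le_one_le)
  qed measurable
  have lim2: "(\<lambda>n. LINT z|lborel. \<phi> (x + d n * z) * ?n z) \<longlonglongrightarrow> (LINT z|lborel. \<phi> (x + 0 * z) * ?n z)"
  proof (rule integral_dominated_convergence[where w = "\<lambda>z. C * cmod (?n z)"])
    have "isCont \<phi> y" for y
      using smooth1_continuous[OF schwartz_smooth1[OF \<phi>], of UNIV] by (simp add: continuous_on_eq_continuous_at)
    then show "AE z in lborel. (\<lambda>n. \<phi> (x + d n * z) * ?n z) \<longlonglongrightarrow> \<phi> (x + 0 * z) * ?n z"
      by (intro AE_I2 tendsto_intros isCont_tendsto_compose[of _ \<phi>] d)
    show "integrable lborel (\<lambda>z. C * cmod (?n z))" using integrable_std_normal by auto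
    show "AE z in lborel. norm (\<phi> (x + d n * z) * ?n z) \<le> C * cmod (?n z)" for n
      by (intro AE_I2) (auto simp: norm_mult intro!: mult_right_mono C)
  qed measurable
  have "?c * (LINT \<xi>|lborel. cis (x * \<xi>) * fourier \<phi> \<xi>) = \<phi> x"
  proof (rule LIMSEQ_unique)
    show "(\<lambda>n. ?c * (LINT \<xi>|lborel. cis (x * \<xi>) * of_real (exp (- (d n * \<xi>)\<^sup>2 / 2)) * fourier \<phi> \<xi>))
       \<longlonglongrightarrow> ?c * (LINT \<xi>|lborel. cis (x * \<xi>) * fourier \<phi> \<xi>)"
      using tendsto_mult[OF tendsto_const lim1, of ?c] by simp
    have "(LINT z|lborel. \<phi> (x + 0 * z) * ?n z) = \<phi> x"
      using integral_cis_std_normal[of 0] by (simp del: of_real_exp)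
    with lim2 show "(\<lambda>n. ?c * (LINT \<xi>|lborel. cis (x * \<xi>) * of_real (exp (- (d n * \<xi>)\<^sup>2 / 2)) * fourier \<phi> \<xi>)) \<longlonglongrightarrow> \<phi> x"
      by (simp only: fourier_inversion_regularised[OF \<phi> d(1)])
  qed
  moreover have "(LINT \<xi>|lborel. cis (- (\<xi> * x)) * fourier \<phi> (- \<xi>)) = (LINT \<xi>|lborel. cis (x * \<xi>) * fourier \<phi> \<xi>)"
    by (subst lborel_integral_real_affine[where c = "-1" and t = 0]) (simp_all add: mult.commute)
  ultimately show ?thesis unfolding fourier_def[of "inv_fourier \<phi>"] inv_fourier_def by simp
qed

section \<open>Sobolev norms\<close>

abbreviation wt :: "real \<Rightarrow> real \<Rightarrow> real" where
  "wt s \<xi> \<equiv> (1 + \<xi>^2) powr s"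

lemma wt_pos [simp]: "0 < wt s \<xi>" "wt s \<xi> \<noteq> 0"
proof -
  have "1 + \<xi>^2 > 0" by (simp add: add_pos_nonneg)
  then show "0 < wt s \<xi>" "wt s \<xi> \<noteq> 0" by simp_all
qed

lemma wt_minus: "wt s \<xi> * wt (- s) \<xi> = 1"
proof -
  have "1 + \<xi>^2 > 0" by (simp add: add_pos_nonneg)
  then show ?thesis by (simp only: powr_add[symmetric]) simp
qed

text \<open>Splitting off the weights \<open>wt (s / 2)\<close> and \<open>wt (- (s / 2))\<close>,
  whose product is one, reduces this to the ordinary Cauchy-Schwarz inequality. It is the duality of
  H^s and H^(-s).\<close>

lemma weighted_Cauchy_Schwarz:
  fixes g h :: "real \<Rightarrow> complex"
  assumes [measurable]: "g \<in> borel_measurable borel" "h \<in> borel_measurable borel"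
    and g: "integrable lborel (\<lambda>\<xi>. wt s \<xi> * (cmod (g \<xi>))^2)"
    and h: "integrable lborel (\<lambda>\<xi>. wt (- s) \<xi> * (cmod (h \<xi>))^2)"
  shows "integrable lborel (\<lambda>\<xi>. g \<xi> * h \<xi>)"
    and "(LINT \<xi>|lborel. cmod (g \<xi> * h \<xi>)) \<le>
      sqrt (LINT \<xi>|lborel. wt s \<xi> * (cmod (g \<xi>))^2) * sqrt (LINT \<xi>|lborel. wt (- s) \<xi> * (cmod (h \<xi>))^2)"
proof -
  let ?G = "\<lambda>\<xi>. wt (s / 2) \<xi> * cmod (g \<xi>)" and ?H = "\<lambda>\<xi>. wt (- (s / 2)) \<xi> * cmod (h \<xi>)"
  have w2: "(wt (r / 2) \<xi>)^2 = wt r \<xi>" for r \<xi>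
    by (simp only: power2_eq_square powr_add[symmetric]) simp
  have w2': "(wt (- (s / 2)) \<xi>)^2 = wt (- s) \<xi>" for \<xi>
    using w2[where r = "- s" and \<xi> = \<xi>] by simp
  have GH: "?G \<xi> * ?H \<xi> = cmod (g \<xi> * h \<xi>)" for \<xi>
  proof -
    have "?G \<xi> * ?H \<xi> = (wt (s / 2) \<xi> * wt (- (s / 2)) \<xi>) * (cmod (g \<xi>) * cmod (h \<xi>))"
      by (simp only: mult_ac)
    then show ?thesis unfolding wt_minus by (simp add: norm_mult)
  qed
  show *: "integrable lborel (\<lambda>\<xi>. g \<xi> * h \<xi>)"
  proof (rule integrable_bound)
    show "integrable lborel (\<lambda>\<xi>. wt s \<xi> * (cmod (g \<xi>))^2 + wt (- s) \<xi> * (cmod (h \<xi>))^2)"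
      using g h by auto
    show "AE \<xi> in lborel. norm (g \<xi> * h \<xi>) \<le> norm (wt s \<xi> * (cmod (g \<xi>))^2 + wt (- s) \<xi> * (cmod (h \<xi>))^2)"
    proof (rule AE_I2)
      fix \<xi>
      have "0 \<le> (?G \<xi> - ?H \<xi>)^2 + ((?G \<xi>)^2 + (?H \<xi>)^2)" by simp
      then have "?G \<xi> * ?H \<xi> \<le> (?G \<xi>)^2 + (?H \<xi>)^2" by (simp add: power2_diff)
      then show "norm (g \<xi> * h \<xi>) \<le> norm (wt s \<xi> * (cmod (g \<xi>))^2 + wt (- s) \<xi> * (cmod (h \<xi>))^2)"
        unfolding GH power_mult_distrib w2 w2' by simp
    qed
  qed measurable
  have "(\<integral>\<^sup>+\<xi>. ennreal (?G \<xi>) * ennreal (?H \<xi>) \<partial>lborel)^2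
     \<le> (\<integral>\<^sup>+\<xi>. ennreal (?G \<xi>) ^ 2 \<partial>lborel) * (\<integral>\<^sup>+\<xi>. ennreal (?H \<xi>) ^ 2 \<partial>lborel)"
    by (rule Cauchy_Schwarz_nn_integral) measurable
  also have "(\<integral>\<^sup>+\<xi>. ennreal (?G \<xi>) * ennreal (?H \<xi>) \<partial>lborel) = ennreal (LINT \<xi>|lborel. cmod (g \<xi> * h \<xi>))"
    using * by (subst nn_integral_eq_integral[symmetric]) (auto simp: GH simp flip: ennreal_mult)
  also have "(\<integral>\<^sup>+\<xi>. ennreal (?G \<xi>) ^ 2 \<partial>lborel) = ennreal (LINT \<xi>|lborel. wt s \<xi> * (cmod (g \<xi>))^2)"
    using g by (subst nn_integral_eq_integral[symmetric]) (auto simp: ennreal_power power_mult_distrib w2)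
  also have "(\<integral>\<^sup>+\<xi>. ennreal (?H \<xi>) ^ 2 \<partial>lborel) = ennreal (LINT \<xi>|lborel. wt (- s) \<xi> * (cmod (h \<xi>))^2)"
  proof -
    have "(?H \<xi>)^2 = wt (- s) \<xi> * (cmod (h \<xi>))^2" for \<xi>
      by (simp add: power_mult_distrib w2')
    then show ?thesis using h by (subst nn_integral_eq_integral[symmetric]) (auto simp: ennreal_power)
  qed
  finally have "(LINT \<xi>|lborel. cmod (g \<xi> * h \<xi>))^2
     \<le> (LINT \<xi>|lborel. wt s \<xi> * (cmod (g \<xi>))^2) * (LINT \<xi>|lborel. wt (- s) \<xi> * (cmod (h \<xi>))^2)"
    by (simp add: ennreal_power integral_nonneg_AE flip: ennreal_mult)
  then show "(LINT \<xi>|lborel. cmod (g \<xi> * h \<xi>)) \<le>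
      sqrt (LINT \<xi>|lborel. wt s \<xi> * (cmod (g \<xi>))^2) * sqrt (LINT \<xi>|lborel. wt (- s) \<xi> * (cmod (h \<xi>))^2)"
    by (simp add: real_le_rsqrt flip: real_sqrt_mult)
qed

lemma sobolev_ftD:
  assumes "sobolev_ft s u g"
  shows "g \<in> borel_measurable borel" "integrable lborel (\<lambda>\<xi>. wt s \<xi> * (cmod (g \<xi>))^2)"
    "\<And>\<phi>. \<phi> \<in> schwartz \<Longrightarrow> u (fourier \<phi>) = (LINT \<xi>|lborel. g \<xi> * \<phi> \<xi>)"
  using assms by (auto simp: sobolev_ft_def)

lemma sobolev_ft_integrable:
  assumes "sobolev_ft s u g" "\<phi> \<in> schwartz"
  shows "integrable lborel (\<lambda>\<xi>. g \<xi> * \<phi> \<xi>)"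
  by (rule weighted_Cauchy_Schwarz[OF sobolev_ftD(1)[OF assms(1)] _ sobolev_ftD(2)[OF assms(1)]])
    (use assms schwartz_measurable schwartz_integrable_weight_square in auto)

text \<open>Dynkin's argument: open half-lines are stable under intersection and generate the Borel
  sets, and the sets over which \<open>h\<close> has integral zero are closed under complements and
  countable disjoint unions.\<close>

lemma AE_eq_0_if_interval_integrals_0:
  fixes h :: "real \<Rightarrow> complex"
  assumes h: "integrable lborel h"
    and 0: "\<And>a. (LINT x|lborel. indicator {a<..} x *\<^sub>R h x) = 0" "(LINT x|lborel. h x) = 0"
  shows "AE x in lborel. h x = 0"
proof (rule sigma_finite_measure.density_zero[OF lborel.sigma_finite_measure_axioms h])
  note hm [measurable] = borel_measurable_integrable[OF h]
  fix A :: "real set" assume "A \<in> sets lborel"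
  then have A: "A \<in> sigma_sets UNIV (range greaterThan)"
    by (simp add: borel_Ioi sets_measure_of)
  have "Int_stable (range (greaterThan :: real \<Rightarrow> _))"
  proof (rule Int_stableI)
    fix A B :: "real set" assume "A \<in> range greaterThan" "B \<in> range greaterThan"
    then obtain a b where "A = {a<..}" "B = {b<..}" by blast
    then have "A \<inter> B = {max a b<..}" by auto
    then show "A \<inter> B \<in> range greaterThan" by blast
  qed
  moreover have "range greaterThan \<subseteq> Pow (UNIV :: real set)" by simp
  moreover note A
  ultimately have "A \<in> sets borel \<and> (LINT x|lborel. indicator A x *\<^sub>R h x) = 0"
  proof (induction rule: sigma_sets_induct_disjoint)
    case (union A)
    then have A [measurable]: "\<And>i. A i \<in> sets borel" by simp
    have "(LINT x:(\<Union>i. A i)|lborel. h x) = (\<Sum>i. LINT x:A i|lborel. h x)"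
    proof (rule lebesgue_integral_countable_add)
      show "set_integrable lborel (\<Union>i. A i) h"
        unfolding set_integrable_def using h by (intro integrable_mult_indicator) auto
    qed (use union(1) in \<open>auto simp: disjoint_family_on_def\<close>)
    also have "... = 0" using union by (simp add: set_lebesgue_integral_def)
    finally have "(LINT x:(\<Union>i. A i)|lborel. h x) = 0" by (metis sums_unique2 sums_zero)
    then show ?case by (simp add: set_lebesgue_integral_def)
  next
    case (compl A)
    then have [measurable]: "A \<in> sets borel" by simp
    have "(LINT x|lborel. indicator (UNIV - A) x *\<^sub>R h x) = (LINT x|lborel. h x - indicator A x *\<^sub>R h x)"
      by (intro integral_cong) (auto simp: indicator_def)
    also have "... = 0"
      using compl 0 h by (subst integral_diff) (auto intro!: integrable_mult_indicator)
    finally show ?case by simp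
  qed (use 0 in auto)
  then show "set_lebesgue_integral lborel A h = 0"
    by (simp add: set_lebesgue_integral_def)
qed

text \<open>Hence \<open>ramp (n * (x - a)) * ramp (n * (b - x))\<close>, a Schwartz function of
  \<open>x\<close> bounded by one, converges to the indicator of the open interval from
  \<open>a\<close> to \<open>b\<close>.\<close>

lemma ramp_tendsto_indicator: "(\<lambda>n. ramp (real n * x)) \<longlonglongrightarrow> (if x > 0 then 1 else 0)"
proof (cases "x > 0")
  case True
  have "(\<lambda>n. exp (- (inverse (real n) * (1 / x)))) \<longlonglongrightarrow> exp (- (0 * (1 / x)))"
    by (intro tendsto_intros lim_inverse_n)
  moreover have "\<forall>\<^sub>F n in sequentially. exp (- (inverse (real n) * (1 / x))) = ramp (real n * x)"
    using eventually_gt_at_top[of 0] by eventually_elim (use True in \<open>simp add: ramp_def field_simps\<close>)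
  ultimately show ?thesis using True by (auto intro: Lim_transform_eventually)
next
  case False
  then have "ramp (real n * x) = 0" for n by (intro ramp_simps) (simp add: mult_nonneg_nonpos)
  then show ?thesis using False by simp
qed

lemma schwartz_ramp_interval:
  "(\<lambda>x. complex_of_real (ramp (c * (x - a)) * ramp (c * (b - x)))) \<in> schwartz" if "c \<ge> 0"
proof (rule schwartz_compact_support[of _ a b])
  have "smooth1 (\<lambda>x. complex_of_real (ramp (c * x + - c * a)) * complex_of_real (ramp (- c * x + c * b)))"
    by (intro smooth1_mult smooth1_affine[OF smooth1_ramp])
  moreover have "(\<lambda>x. complex_of_real (ramp (c * x + - c * a)) * complex_of_real (ramp (- c * x + c * b)))
     = (\<lambda>x. complex_of_real (ramp (c * (x - a)) * ramp (c * (b - x))))"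
    by (simp add: algebra_simps)
  ultimately show "smooth1 (\<lambda>x. complex_of_real (ramp (c * (x - a)) * ramp (c * (b - x))))" by simp
  fix x assume "x \<notin> {a..b}"
  then consider "x < a" | "x > b" by force
  then show "complex_of_real (ramp (c * (x - a)) * ramp (c * (b - x))) = 0"
    using that by cases (simp_all add: ramp_simps mult_nonneg_nonpos)
qed

text \<open>Justifies the choice by \<open>SOME\<close> in \<open>sobolev_norm\<close>. The
  difference of two candidates annihilates Schwartz functions, hence by approximation the indicators
  of bounded open intervals.\<close>

lemma sobolev_ft_unique:
  assumes g: "sobolev_ft s u g" and g': "sobolev_ft s u g'"
  shows "AE \<xi> in lborel. g \<xi> = g' \<xi>"
proof -
  note [measurable] = sobolev_ftD(1)[OF g] sobolev_ftD(1)[OF g']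
  define h where "h \<xi> = g \<xi> - g' \<xi>" for \<xi>
  have [measurable]: "h \<in> borel_measurable borel" by (simp add: h_def[abs_def])
  have h\<phi>: "integrable lborel (\<lambda>\<xi>. h \<xi> * \<phi> \<xi>)" "(LINT \<xi>|lborel. h \<xi> * \<phi> \<xi>) = 0" if "\<phi> \<in> schwartz" for \<phi>
  proof -
    note i = sobolev_ft_integrable[OF g that] sobolev_ft_integrable[OF g' that]
    from i show "integrable lborel (\<lambda>\<xi>. h \<xi> * \<phi> \<xi>)" by (simp add: h_def left_diff_distrib)
    from i show "(LINT \<xi>|lborel. h \<xi> * \<phi> \<xi>) = 0"
      by (simp add: h_def left_diff_distrib sobolev_ftD(3)[OF g that, symmetric] sobolev_ftD(3)[OF g' that, symmetric])
  qed
  \<comment> \<open>A priori \<open>h\<close> is integrable only against Schwartz functions. One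
    that is at least \<open>exp (- 1) * exp (- 1)\<close> on \<open>{a..b}\<close> yields local
    integrability.\<close>
  have loc: "integrable lborel (\<lambda>x. indicator {a..b} x *\<^sub>R h x)" for a b :: real
  proof -
    let ?\<phi> = "\<lambda>x. complex_of_real (ramp (1 * (x - (a - 1))) * ramp (1 * ((b + 1) - x)))"
    let ?c = "exp (- 1) * exp (- 1) :: real"
    have "integrable lborel (\<lambda>x. (1 / ?c) * cmod (h x * ?\<phi> x))"
      by (intro integrable_mult_right integrable_norm h\<phi> schwartz_ramp_interval) simp
    then show ?thesis
    proof (rule integrable_bound)
      have "indicator {a..b} x * cmod (h x) \<le> (1 / ?c) * cmod (h x * ?\<phi> x)" for x
      proof (cases "x \<in> {a..b}")
        case True
        have r: "exp (- 1) \<le> ramp y" if "y \<ge> 1" for y using that by (auto simp: ramp_def)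
        have "?c \<le> ramp (1 * (x - (a - 1))) * ramp (1 * ((b + 1) - x))"
          using True by (intro mult_mono r ramp_simps) auto
        then have "?c * cmod (h x) \<le> cmod (h x * ?\<phi> x)"
          using mult_left_mono[of ?c "ramp (1 * (x - (a - 1))) * ramp (1 * ((b + 1) - x))" "cmod (h x)"]
          by (simp add: norm_mult abs_mult ramp_simps mult_ac)
        then show ?thesis using True by (simp add: field_simps)
      qed auto
      then show "AE x in lborel. norm (indicator {a..b} x *\<^sub>R h x) \<le> norm ((1 / ?c) * cmod (h x * ?\<phi> x))"
        by (intro AE_I2) (auto simp: indicator_def split: if_splits)
    qed measurable
  qed
  have int0: "(LINT x|lborel. indicator {a<..<b} x *\<^sub>R h x) = 0" for a b :: real
  proof (rule LIMSEQ_unique)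
    let ?\<phi> = "\<lambda>n x. complex_of_real (ramp (real n * (x - a)) * ramp (real n * (b - x)))"
    show "(\<lambda>n. LINT x|lborel. h x * ?\<phi> n x) \<longlonglongrightarrow> (LINT x|lborel. indicator {a<..<b} x *\<^sub>R h x)"
    proof (rule integral_dominated_convergence[where w = "\<lambda>x. norm (indicator {a..b} x *\<^sub>R h x)"])
      have "ramp \<in> borel_measurable borel" unfolding ramp_def[abs_def] by measurable
      note [measurable] = this
      show "(\<lambda>x. h x * ?\<phi> n x) \<in> borel_measurable lborel" for n by measurable
      show "AE x in lborel. (\<lambda>n. h x * ?\<phi> n x) \<longlonglongrightarrow> indicator {a<..<b} x *\<^sub>R h x"
      proof (rule AE_I2)
        fix x
        have "(\<lambda>n. h x * ?\<phi> n x) \<longlonglongrightarrow> h x * of_real ((if x - a > 0 then 1 else 0) * (if b - x > 0 then 1 else 0))"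
          by (intro tendsto_mult tendsto_const tendsto_of_real ramp_tendsto_indicator)
        then show "(\<lambda>n. h x * ?\<phi> n x) \<longlonglongrightarrow> indicator {a<..<b} x *\<^sub>R h x"
          by (auto simp: indicator_def split: if_splits)
      qed
      show "AE x in lborel. norm (h x * ?\<phi> n x) \<le> norm (indicator {a..b} x *\<^sub>R h x)" for n
      proof (rule AE_I2)
        fix x
        have "ramp (real n * (x - a)) * ramp (real n * (b - x)) \<le> 1 * 1" by (intro mult_mono ramp_simps) auto
        moreover have "ramp (real n * (x - a)) * ramp (real n * (b - x)) = 0" if "x \<notin> {a..b}"
          using that by (auto simp: not_le mult_nonneg_nonpos intro!: ramp_simps)
        ultimately show "norm (h x * ?\<phi> n x) \<le> norm (indicator {a..b} x *\<^sub>R h x)"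
          by (cases "x \<in> {a..b}") (auto simp: norm_mult abs_mult ramp_simps intro!: mult_right_le_one_le)
      qed
    qed (use loc integrable_norm[OF loc] in simp_all)
    show "(\<lambda>n. LINT x|lborel. h x * ?\<phi> n x) \<longlonglongrightarrow> 0"
      using h\<phi>(2)[OF schwartz_ramp_interval] by simp
  qed
  \<comment> \<open>The half-line criterion asks for an integrable function, so \<open>h\<close> is
    cut off to bounded intervals exhausting the line.\<close>
  have "AE x in lborel. indicator {- real n<..<real n} x *\<^sub>R h x = 0" for n
  proof (rule AE_eq_0_if_interval_integrals_0)
    have "integrable lborel (\<lambda>x. indicator {- real n<..<real n} x *\<^sub>R (indicator {- real n..real n} x *\<^sub>R h x))"
      by (intro integrable_mult_indicator loc) auto
    moreover have "(\<lambda>x. indicator {- real n<..<real n} x *\<^sub>R (indicator {- real n..real n} x *\<^sub>R h x)) = (\<lambda>x. indicator {- real n<..<real n} x *\<^sub>R h x)"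
      by (auto simp: indicator_def)
    ultimately show "integrable lborel (\<lambda>x. indicator {- real n<..<real n} x *\<^sub>R h x)" by simp
    show "(LINT x|lborel. indicator {a<..} x *\<^sub>R indicator {- real n<..<real n} x *\<^sub>R h x) = 0" for a
    proof -
      have "(LINT x|lborel. indicator {a<..} x *\<^sub>R indicator {- real n<..<real n} x *\<^sub>R h x)
         = (LINT x|lborel. indicator {max a (- real n)<..<real n} x *\<^sub>R h x)"
        by (intro integral_cong) (auto simp: indicator_def)
      then show ?thesis by (simp add: int0)
    qed
  qed (rule int0)
  then have "AE x in lborel. \<forall>n. indicator {- real n<..<real n} x *\<^sub>R h x = 0"
    by (simp only: AE_all_countable) simp
  then show ?thesis
  proof eventually_elim
    case (elim x)
    obtain n where "\<bar>x\<bar> < real n" using reals_Archimedean2 by blast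
    then have "x \<in> {- real n<..<real n}" by auto
    with elim[rule_format, of n] show ?case by (simp add: h_def)
  qed
qed

section \<open>The Sobolev norm, its duality pairing and linear operations\<close>

lemma sobolev_norm_eq:
  assumes "sobolev_ft s u g"
  shows "sobolev_norm s u = sqrt (LINT \<xi>|lborel. wt s \<xi> * (cmod (g \<xi>))^2)"
proof -
  let ?g = "SOME g. sobolev_ft s u g"
  have g': "sobolev_ft s u ?g" using someI[of "sobolev_ft s u", OF assms] .
  note [measurable] = sobolev_ftD(1)[OF assms] sobolev_ftD(1)[OF g']
  have "(LINT \<xi>|lborel. wt s \<xi> * (cmod (?g \<xi>))^2) = (LINT \<xi>|lborel. wt s \<xi> * (cmod (g \<xi>))^2)"
    using sobolev_ft_unique[OF g' assms] by (intro integral_cong_AE) auto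
  then show ?thesis by (simp add: sobolev_norm_def)
qed

lemma sobolev_norm_nonneg: "0 \<le> sobolev_norm s u"
  by (simp add: sobolev_norm_def integral_nonneg_AE)

text \<open>Duality with H^(-s), for a test function given as a transform; by
  \<open>fourier_inversion\<close> every Schwartz function is of this form.\<close>

lemma sobolev_pairing_bound:
  assumes g: "sobolev_ft s u g" and \<phi>: "\<phi> \<in> schwartz"
  shows "cmod (u (fourier \<phi>)) \<le> sobolev_norm s u * sqrt (LINT \<xi>|lborel. wt (- s) \<xi> * (cmod (\<phi> \<xi>))^2)"
proof -
  note [measurable] = sobolev_ftD(1)[OF g] schwartz_measurable[OF \<phi>]
  have "cmod (u (fourier \<phi>)) \<le> (LINT \<xi>|lborel. cmod (g \<xi> * \<phi> \<xi>))"
    unfolding sobolev_ftD(3)[OF assms] by (rule integral_norm_bound)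
  also have "... \<le> sqrt (LINT \<xi>|lborel. wt s \<xi> * (cmod (g \<xi>))^2) * sqrt (LINT \<xi>|lborel. wt (- s) \<xi> * (cmod (\<phi> \<xi>))^2)"
    by (rule weighted_Cauchy_Schwarz(2)) (use sobolev_ftD[OF g] schwartz_integrable_weight_square[OF \<phi>] in auto)
  finally show ?thesis by (simp add: sobolev_norm_eq[OF g])
qed

lemma integrable_weight_square_add:
  fixes g h :: "real \<Rightarrow> complex"
  assumes [measurable]: "g \<in> borel_measurable borel" "h \<in> borel_measurable borel"
    and i: "integrable lborel (\<lambda>\<xi>. wt s \<xi> * (cmod (g \<xi>))^2)" "integrable lborel (\<lambda>\<xi>. wt s \<xi> * (cmod (h \<xi>))^2)"
  shows "integrable lborel (\<lambda>\<xi>. wt s \<xi> * (cmod (g \<xi> + h \<xi>))^2)"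
proof (rule integrable_bound)
  show "integrable lborel (\<lambda>\<xi>. 2 * (wt s \<xi> * (cmod (g \<xi>))^2 + wt s \<xi> * (cmod (h \<xi>))^2))" using i by auto
  have "(cmod (a + b))^2 \<le> 2 * ((cmod a)^2 + (cmod b)^2)" for a b
  proof -
    have "(cmod (a + b))^2 \<le> (cmod a + cmod b)^2" by (intro power_mono norm_triangle_ineq) auto
    also have "... \<le> 2 * ((cmod a)^2 + (cmod b)^2)" using sum_squares_bound[of "cmod a" "cmod b"] by (simp add: power2_sum)
    finally show ?thesis .
  qed
  then have "wt s \<xi> * (cmod (g \<xi> + h \<xi>))^2 \<le> wt s \<xi> * (2 * ((cmod (g \<xi>))^2 + (cmod (h \<xi>))^2))" for \<xi>
    by (intro mult_left_mono) auto
  then show "AE \<xi> in lborel. norm (wt s \<xi> * (cmod (g \<xi> + h \<xi>))^2) \<le> norm (2 * (wt s \<xi> * (cmod (g \<xi>))^2 + wt s \<xi> * (cmod (h \<xi>))^2))"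
    by (intro AE_I2) (simp add: algebra_simps)
qed measurable

lemma sobolev_ft_minus:
  assumes u: "sobolev_ft s u g" and v: "sobolev_ft s v h"
  shows "sobolev_ft s (minus_dist u v) (\<lambda>\<xi>. g \<xi> - h \<xi>)"
proof -
  note [measurable] = sobolev_ftD(1)[OF u] sobolev_ftD(1)[OF v]
  show ?thesis
    unfolding sobolev_ft_def
    using integrable_weight_square_add[of g "\<lambda>\<xi>. - h \<xi>" s] sobolev_ftD[OF u] sobolev_ftD[OF v]
      sobolev_ft_integrable[OF u] sobolev_ft_integrable[OF v]
    by (auto simp: minus_dist_def left_diff_distrib)
qed

lemma sobolev_ft_scale:
  assumes u: "sobolev_ft s u g"
  shows "sobolev_ft s (scale_dist c u) (\<lambda>\<xi>. of_real c * g \<xi>)"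
proof -
  note [measurable] = sobolev_ftD(1)[OF u]
  have "integrable lborel (\<lambda>\<xi>. c\<^sup>2 * (wt s \<xi> * (cmod (g \<xi>))^2))" using sobolev_ftD[OF u] by auto
  then have "integrable lborel (\<lambda>\<xi>. wt s \<xi> * (cmod (of_real c * g \<xi>))^2)"
    by (simp add: norm_mult power_mult_distrib mult_ac)
  then show ?thesis
    unfolding sobolev_ft_def using sobolev_ftD[OF u] by (auto simp: scale_dist_def mult.assoc)
qed

lemma tempered_dist_of:
  assumes f: "integrable lborel f" shows "tempered (dist_of f)"
proof -
  note [measurable] = borel_measurable_integrable[OF f]
  have i: "integrable lborel (\<lambda>x. f x * \<phi> x)" if \<phi>: "\<phi> \<in> schwartz" for \<phi>
  proof -
    note [measurable] = schwartz_measurable[OF \<phi>]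
    obtain C where C: "\<And>x. cmod (\<phi> x) \<le> C" using schwartz_bounded[OF \<phi>] by blast
    show ?thesis
    proof (rule integrable_bound)
      show "integrable lborel (\<lambda>x. C * cmod (f x))" using f by auto
      show "AE x in lborel. norm (f x * \<phi> x) \<le> norm (C * cmod (f x))"
        using C order_trans[OF norm_ge_zero C[of 0]] by (intro AE_I2) (simp add: norm_mult mult.commute[of "cmod (f _)"] mult_right_mono)
    qed measurable
  qed
  have b: "cmod (LINT x|lborel. f x * \<phi> x) \<le> (LINT x|lborel. cmod (f x)) * schwartz_seminorm 0 0 \<phi>" if "\<phi> \<in> schwartz" for \<phi>
  proof -
    have B: "cmod (\<phi> x) \<le> schwartz_seminorm 0 0 \<phi>" for x
      unfolding schwartz_seminorm_def
      by (rule order_trans[OF _ cSUP_upper[of x]]) (use schwartz_bounded[OF that] in \<open>auto simp: bdd_above_def\<close>)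
    have "cmod (LINT x|lborel. f x * \<phi> x) \<le> (LINT x|lborel. cmod (f x * \<phi> x))" by (rule integral_norm_bound)
    also have "... \<le> (LINT x|lborel. cmod (f x) * schwartz_seminorm 0 0 \<phi>)"
    proof (rule integral_mono)
      show "integrable lborel (\<lambda>x. cmod (f x * \<phi> x))" using i[OF that] by (rule integrable_norm)
    qed (use f in \<open>auto simp: norm_mult intro!: mult_left_mono B\<close>)
    finally show ?thesis by simp
  qed
  show ?thesis
    unfolding tempered_def
  proof (intro conjI ballI allI impI)
    fix \<phi> \<psi> assume "\<phi> \<in> schwartz" "\<psi> \<in> schwartz"
    then show "dist_of f (\<lambda>x. \<phi> x + \<psi> x) = dist_of f \<phi> + dist_of f \<psi>"
      using i by (simp add: dist_of_def schwartz_add distrib_left)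
  next
    fix \<phi> c assume "\<phi> \<in> schwartz"
    then show "dist_of f (\<lambda>x. c * \<phi> x) = c * dist_of f \<phi>"
      by (simp add: dist_of_def schwartz_cmult mult.left_commute[of _ c])
  next
    show "\<exists>C N. \<forall>\<phi>\<in>schwartz. cmod (dist_of f \<phi>) \<le> C * (\<Sum>k\<le>N. \<Sum>n\<le>N. schwartz_seminorm k n \<phi>)"
      using b by (intro exI[of _ "LINT x|lborel. cmod (f x)"] exI[of _ 0]) (auto simp: dist_of_def)
  qed (simp add: dist_of_def)
qed

lemma sobolev_ft_dist_of:
  assumes f: "integrable lborel f" and i: "integrable lborel (\<lambda>\<xi>. wt s \<xi> * (cmod (fourier f \<xi>))^2)"
  shows "sobolev_ft s (dist_of f) (fourier f)"
  unfolding sobolev_ft_def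
  using i fourier_multiplication_formula[OF f schwartz_integrable] borel_measurable_integrable[OF f]
  by (auto simp: dist_of_def fourier_schwartz)

lemma sobolevI: "tempered u \<Longrightarrow> sobolev_ft s u g \<Longrightarrow> u \<in> sobolev s"
  by (auto simp: sobolev_def)

lemma sobolev_ft_zero: "sobolev_ft s zero_dist (\<lambda>_. 0)"
  by (simp add: sobolev_ft_def zero_dist_def)

lemma sobolev_norm_zero [simp]: "sobolev_norm s zero_dist = 0"
  by (simp add: sobolev_norm_eq[OF sobolev_ft_zero])

lemma zero_dist_eq: "zero_dist = dist_of (\<lambda>_. 0)"
  by (auto simp: zero_dist_def dist_of_def)

section \<open>Smooth functions on spacetime\<close>

text \<open>The counterpart of \<open>smooth1_coinduct\<close> in two variables, with closure under
  both partial derivatives.\<close>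

lemma smooth_coinduct:
  assumes "\<psi> \<in> S" and c: "\<And>g. g \<in> S \<Longrightarrow> continuous_on UNIV g"
    and t: "\<And>g. g \<in> S \<Longrightarrow> \<exists>g'\<in>S. \<forall>t x. ((\<lambda>\<tau>. g (\<tau>, x)) has_vector_derivative g' (t, x)) (at t)"
    and x: "\<And>g. g \<in> S \<Longrightarrow> \<exists>g'\<in>S. \<forall>t x. ((\<lambda>y. g (t, y)) has_vector_derivative g' (t, x)) (at x)"
  shows "smooth \<psi>"
proof -
  have 1: "dt g \<in> S \<and> (\<forall>t x. (\<lambda>\<tau>. g (\<tau>, x)) differentiable (at t))" if g: "g \<in> S" for g
  proof -
    obtain g' where g': "g' \<in> S" "\<And>t x. ((\<lambda>\<tau>. g (\<tau>, x)) has_vector_derivative g' (t, x)) (at t)" using t[OF g] by blast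
    have "dt g z = g' z" for z
      using vector_derivative_at[OF g'(2)] by (simp add: dt_def)
    then have "dt g = g'" by blast
    with g' show ?thesis by (auto intro: differentiableI_vector)
  qed
  have 2: "dx g \<in> S \<and> (\<forall>t x. (\<lambda>y. g (t, y)) differentiable (at x))" if g: "g \<in> S" for g
  proof -
    obtain g' where g': "g' \<in> S" "\<And>t x. ((\<lambda>y. g (t, y)) has_vector_derivative g' (t, x)) (at x)" using x[OF g] by blast
    have "dx g z = g' z" for z
      using vector_derivative_at[OF g'(2)] by (simp add: dx_def)
    then have "dx g = g'" by blast
    with g' show ?thesis by (auto intro: differentiableI_vector)
  qed
  have "g \<in> S" if "g \<in> partials \<psi>" for g using that by induction (use assms(1) 1 2 in auto)
  with c 1 2 show ?thesis unfolding smooth_def by blast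
qed

lemma smooth_continuous: "smooth \<psi> \<Longrightarrow> continuous_on UNIV \<psi>"
  by (auto simp: smooth_def partials.self)

lemma smooth_dt: assumes "smooth \<psi>" shows "smooth (dt \<psi>)"
proof -
  have "g \<in> partials \<psi>" if "g \<in> partials (dt \<psi>)" for g
    using that by induction (auto intro: partials.intros)
  then show ?thesis using assms by (auto simp: smooth_def)
qed

lemma smooth_dx: assumes "smooth \<psi>" shows "smooth (dx \<psi>)"
proof -
  have "g \<in> partials \<psi>" if "g \<in> partials (dx \<psi>)" for g
    using that by induction (auto intro: partials.intros)
  then show ?thesis using assms by (auto simp: smooth_def)
qed

lemma smooth_has_dt: "smooth \<psi> \<Longrightarrow> ((\<lambda>\<tau>. \<psi> (\<tau>, x)) has_vector_derivative dt \<psi> (t, x)) (at t)"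
  unfolding dt_def by (auto simp: smooth_def vector_derivative_works[symmetric] partials.self)

lemma smooth_has_dx: "smooth \<psi> \<Longrightarrow> ((\<lambda>y. \<psi> (t, y)) has_vector_derivative dx \<psi> (t, x)) (at x)"
  unfolding dx_def by (auto simp: smooth_def vector_derivative_works[symmetric] partials.self)

text \<open>A chain rule from partial derivatives. The space variable is first frozen at
  \<open>z = y + c * t\<close>; what remains is an increment in space alone, which the mean value
  inequality and the continuity of \<open>b\<close> compare with its linear part.\<close>

lemma has_vector_derivative_along_line:
  fixes \<psi> :: "real \<times> real \<Rightarrow> complex"
  assumes a: "\<And>t x. ((\<lambda>\<tau>. \<psi> (\<tau>, x)) has_vector_derivative a (t, x)) (at t)"
    and b: "\<And>t x. ((\<lambda>y. \<psi> (t, y)) has_vector_derivative b (t, x)) (at x)"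
    and cb: "continuous_on UNIV b"
  shows "((\<lambda>\<tau>. \<psi> (\<tau>, y + c * \<tau>)) has_vector_derivative a (t, y + c * t) + c *\<^sub>R b (t, y + c * t)) (at t)"
proof -
  define z where "z = y + c * t"
  define d where "d = b (t, z)"
  have "((\<lambda>\<tau>. \<psi> (\<tau>, y + c * \<tau>) - \<psi> (\<tau>, z)) has_vector_derivative c *\<^sub>R d) (at t)"
    unfolding has_vector_derivative_iff_quotient
  proof (rule tendstoI)
    fix e :: real assume e: "e > 0"
    \<comment> \<open>Gives \<open>e' * \<bar>c\<bar> \<le> e / 2\<close>; the summand 1 covers
      \<open>c = 0\<close>.\<close>
    define e' where "e' = e / (2 * (\<bar>c\<bar> + 1))"
    have e': "e' > 0" using e by (simp add: e'_def)
    have "isCont b (t, z)" using cb by (simp add: continuous_on_eq_continuous_at)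
    then obtain r where r: "r > 0" "\<And>w. dist w (t, z) < r \<Longrightarrow> dist (b w) d < e'"
      unfolding continuous_at_eps_delta d_def using e' by blast
    show "\<forall>\<^sub>F \<tau> in at t. dist (((\<psi> (\<tau>, y + c * \<tau>) - \<psi> (\<tau>, z)) - (\<psi> (t, y + c * t) - \<psi> (t, z))) /\<^sub>R (\<tau> - t)) (c *\<^sub>R d) < e"
      unfolding eventually_at
    proof (intro exI[of _ "r / (1 + \<bar>c\<bar>)"] conjI ballI impI)
      fix \<tau> assume "\<tau> \<noteq> t \<and> dist \<tau> t < r / (1 + \<bar>c\<bar>)"
      then have \<tau>: "\<tau> \<noteq> t" "\<bar>\<tau> - t\<bar> * (1 + \<bar>c\<bar>) < r" by (auto simp: dist_real_def field_simps)
      let ?S = "closed_segment z (y + c * \<tau>)"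
      have S: "\<bar>x - z\<bar> \<le> \<bar>c\<bar> * \<bar>\<tau> - t\<bar>" if "x \<in> ?S" for x
        using segment_bound(1)[OF that] by (simp add: z_def abs_mult flip: right_diff_distrib)
      have "norm ((\<psi> (\<tau>, y + c * \<tau>) - (y + c * \<tau>) *\<^sub>R d) - (\<psi> (\<tau>, z) - z *\<^sub>R d)) \<le> e' * \<bar>(y + c * \<tau>) - z\<bar>"
      proof (rule has_vector_derivative_lipschitz[of ?S _ "\<lambda>x. b (\<tau>, x) - d"])
        show "((\<lambda>x. \<psi> (\<tau>, x) - x *\<^sub>R d) has_vector_derivative b (\<tau>, x) - d) (at x within ?S)" for x
        proof -
          have "((\<lambda>x. x *\<^sub>R d) has_vector_derivative d) (at x within ?S)"
            unfolding has_vector_derivative_def by (intro bounded_linear_imp_has_derivative bounded_linear_scaleR_left)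
          from has_vector_derivative_diff[OF has_vector_derivative_at_within[OF b] this] show ?thesis .
        qed
        show "norm (b (\<tau>, x) - d) \<le> e'" if "x \<in> ?S" for x
        proof -
          have "dist (\<tau>, x) (t, z) \<le> \<bar>\<tau> - t\<bar> + \<bar>x - z\<bar>"
            unfolding dist_prod_def fst_conv snd_conv dist_real_def by (rule sqrt_sum_squares_le_sum_abs[THEN order_trans]) simp
          also have "... \<le> \<bar>\<tau> - t\<bar> * (1 + \<bar>c\<bar>)" using S[OF that] by (simp add: algebra_simps)
          finally have "dist (b (\<tau>, x)) d < e'" using \<tau> r by (intro r) simp
          then show ?thesis by (simp add: dist_norm)
        qed
      qed auto
      also have "(y + c * \<tau>) - z = c * (\<tau> - t)" by (simp add: z_def algebra_simps)
      also have "(\<psi> (\<tau>, y + c * \<tau>) - (y + c * \<tau>) *\<^sub>R d) - (\<psi> (\<tau>, z) - z *\<^sub>R d)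
         = (\<psi> (\<tau>, y + c * \<tau>) - \<psi> (\<tau>, z)) - (\<tau> - t) *\<^sub>R (c *\<^sub>R d)"
        by (simp add: z_def algebra_simps)
      finally have 1: "norm ((\<psi> (\<tau>, y + c * \<tau>) - \<psi> (\<tau>, z)) - (\<tau> - t) *\<^sub>R (c *\<^sub>R d)) \<le> e' * (\<bar>c\<bar> * \<bar>\<tau> - t\<bar>)"
        by (simp only: abs_mult)
      have "dist (((\<psi> (\<tau>, y + c * \<tau>) - \<psi> (\<tau>, z)) - (\<psi> (t, y + c * t) - \<psi> (t, z))) /\<^sub>R (\<tau> - t)) (c *\<^sub>R d)
          = norm ((\<psi> (\<tau>, y + c * \<tau>) - \<psi> (\<tau>, z)) - (\<tau> - t) *\<^sub>R (c *\<^sub>R d)) / \<bar>\<tau> - t\<bar>"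
      proof -
        have "((\<psi> (\<tau>, y + c * \<tau>) - \<psi> (\<tau>, z)) /\<^sub>R (\<tau> - t)) - c *\<^sub>R d
          = ((\<psi> (\<tau>, y + c * \<tau>) - \<psi> (\<tau>, z)) - (\<tau> - t) *\<^sub>R (c *\<^sub>R d)) /\<^sub>R (\<tau> - t)"
          using \<tau> by (simp only: scaleR_right_diff_distrib[of "inverse (\<tau> - t)"]) simp
        then show ?thesis
          unfolding dist_norm z_def[symmetric] by (simp add: divide_inverse mult.commute)
      qed
      also have "... \<le> e' * \<bar>c\<bar>" using 1 \<tau> by (simp add: pos_divide_le_eq mult_ac)
      also have "... < e"
      proof -
        have "e' * \<bar>c\<bar> \<le> e / 2" using e by (simp add: e'_def field_simps)
        then show ?thesis using e by simp
      qed
      finally show "dist (((\<psi> (\<tau>, y + c * \<tau>) - \<psi> (\<tau>, z)) - (\<psi> (t, y + c * t) - \<psi> (t, z))) /\<^sub>R (\<tau> - t)) (c *\<^sub>R d) < e" .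
    qed (use r in \<open>auto intro!: divide_pos_pos add_pos_nonneg\<close>)
  qed
  from has_vector_derivative_add[OF this a[of z t]] show ?thesis
    by (simp add: d_def z_def add.commute)
qed

text \<open>The increment of \<open>\<psi>\<close> in space is the integral of
  \<open>dx \<psi>\<close>. Differentiating this identity in time, under the integral, and then in
  space gives the symmetry of mixed derivatives.\<close>

lemma dt_dx_commute:
  assumes "smooth \<psi>" shows "dt (dx \<psi>) = dx (dt \<psi>)"
proof
  fix p :: "real \<times> real"
  obtain t x where p: "p = (t, x)" by (cases p)
  define a where "a = x - 1"
  note sm = smooth_dt[OF assms] smooth_dx[OF assms] smooth_dt[OF smooth_dx[OF assms]]
  have slice: "continuous_on A (\<lambda>y. g (t, y))" if "smooth g" for g t A
    by (rule continuous_on_compose2[OF smooth_continuous[OF that]]) (auto intro!: continuous_intros)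
  have I: "integral {a..y} (\<lambda>y. dx \<psi> (t, y)) = \<psi> (t, y) - \<psi> (t, a)" if "a \<le> y" for t y
    using that by (intro integral_unique fundamental_theorem_of_calculus)
      (auto intro: has_vector_derivative_at_within smooth_has_dx assms)
  have J: "integral {a..y} (\<lambda>y. dt (dx \<psi>) (t, y)) = dt \<psi> (t, y) - dt \<psi> (t, a)" if "a \<le> y" for y
  proof -
    have "((\<lambda>t. integral (cbox a y) (\<lambda>y. dx \<psi> (t, y))) has_vector_derivative integral (cbox a y) (\<lambda>y. dt (dx \<psi>) (t, y))) (at t within UNIV)"
    proof (rule leibniz_rule_vector_derivative)
      show "((\<lambda>t. dx \<psi> (t, x)) has_vector_derivative dt (dx \<psi>) (t, x)) (at t within UNIV)" for t x
        by (intro smooth_has_dt sm)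
      show "(\<lambda>y. dx \<psi> (t, y)) integrable_on cbox a y" for t
        by (intro integrable_continuous slice sm)
      show "continuous_on (UNIV \<times> cbox a y) (\<lambda>(t, y). dt (dx \<psi>) (t, y))"
        using smooth_continuous[OF sm(3)] by (auto intro: continuous_on_subset)
    qed auto
    moreover have "((\<lambda>t. \<psi> (t, y) - \<psi> (t, a)) has_vector_derivative dt \<psi> (t, y) - dt \<psi> (t, a)) (at t)"
      by (intro has_vector_derivative_diff smooth_has_dt assms)
    ultimately show ?thesis using I[OF that] by (simp add: vector_derivative_unique_at)
  qed
  have "((\<lambda>y. integral {a..y} (\<lambda>y. dt (dx \<psi>) (t, y))) has_vector_derivative dt (dx \<psi>) (t, x)) (at x within {a..x + 1})"
    by (rule integral_has_vector_derivative) (auto intro: slice sm simp: a_def)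
  then have "((\<lambda>y. integral {a..y} (\<lambda>y. dt (dx \<psi>) (t, y))) has_vector_derivative dt (dx \<psi>) (t, x)) (at x)"
    by (subst (asm) at_within_interior) (auto simp: a_def)
  then have "((\<lambda>y. dt \<psi> (t, y) - dt \<psi> (t, a)) has_vector_derivative dt (dx \<psi>) (t, x)) (at x)"
  proof (rule has_vector_derivative_transform_within_open[of _ _ _ "{a<..}"])
    show "x \<in> {a<..}" by (simp add: a_def)
  qed (auto simp: J)
  from has_vector_derivative_add[OF this has_vector_derivative_const[of "dt \<psi> (t, a)"]]
  have "((\<lambda>y. dt \<psi> (t, y)) has_vector_derivative dt (dx \<psi>) (t, x)) (at x)" by simp
  with smooth_has_dx[OF sm(1), of t x] show "dt (dx \<psi>) p = dx (dt \<psi>) p"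
    unfolding p by (rule vector_derivative_unique_at[symmetric])
qed

lemma dt_eq_0_outside:
  assumes "closed K" "\<And>z. z \<notin> K \<Longrightarrow> \<psi> z = 0" "z \<notin> K" "smooth \<psi>"
  shows "dt \<psi> z = 0"
proof -
  have o: "open ((\<lambda>\<tau>. (\<tau>, snd z)) -` (- K))"
    using assms(1) by (intro open_vimage continuous_intros) (auto simp: open_Compl)
  have d: "((\<lambda>_. 0) has_vector_derivative (0::complex)) (at (fst z))" by simp
  have "((\<lambda>\<tau>. \<psi> (\<tau>, snd z)) has_vector_derivative 0) (at (fst z))"
    by (rule has_vector_derivative_transform_within_open[OF d o]) (use assms(2,3) in auto)
  then show ?thesis unfolding dt_def by (rule vector_derivative_at)
qed

lemma dx_eq_0_outside:
  assumes "closed K" "\<And>z. z \<notin> K \<Longrightarrow> \<psi> z = 0" "z \<notin> K" "smooth \<psi>"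
  shows "dx \<psi> z = 0"
proof -
  have o: "open ((\<lambda>y. (fst z, y)) -` (- K))"
    using assms(1) by (intro open_vimage continuous_intros) (auto simp: open_Compl)
  have d: "((\<lambda>_. 0) has_vector_derivative (0::complex)) (at (snd z))" by simp
  have "((\<lambda>y. \<psi> (fst z, y)) has_vector_derivative 0) (at (snd z))"
    by (rule has_vector_derivative_transform_within_open[OF d o]) (use assms(2,3) in auto)
  then show ?thesis unfolding dx_def by (rule vector_derivative_at)
qed

lemma smooth_slice:
  assumes "smooth \<psi>" shows "smooth1 (\<lambda>x. \<psi> (t, x))"
proof (rule smooth1_coinduct)
  show "(\<lambda>x. \<psi> (t, x)) \<in> (\<lambda>g x. g (t, x)) ` {g. smooth g}" using assms by blast
  fix h assume "h \<in> (\<lambda>g x. g (t, x)) ` {g. smooth g}"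
  then obtain g where g: "smooth g" "h = (\<lambda>x. g (t, x))" by blast
  have "(\<lambda>x. dx g (t, x)) \<in> (\<lambda>g x. g (t, x)) ` {g. smooth g}" using smooth_dx[OF g(1)] by blast
  then show "\<exists>g'\<in>(\<lambda>g x. g (t, x)) ` {g. smooth g}. \<forall>x. (h has_vector_derivative g' x) (at x)"
    using smooth_has_dx[OF g(1)] unfolding g(2) by (intro bexI[of _ "\<lambda>x. dx g (t, x)"]) auto
qed

lemma test_function_slice:
  assumes "\<psi> \<in> test_functions \<Omega>" shows "(\<lambda>x. \<psi> (t, x)) \<in> schwartz"
proof -
  obtain K where K: "smooth \<psi>" "compact K" "\<And>z. z \<notin> K \<Longrightarrow> \<psi> z = 0"
    using assms by (auto simp: test_functions_def)
  obtain B where B: "\<And>z. z \<in> K \<Longrightarrow> norm z \<le> B" using compact_imp_bounded[OF K(2)] by (auto simp: bounded_iff)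
  show ?thesis
  proof (rule schwartz_compact_support)
    fix x assume "x \<notin> {- B..B}"
    then have "(t, x) \<notin> K" using B[of "(t, x)"] norm_snd_le[of x t] by auto
    then show "\<psi> (t, x) = 0" by (rule K)
  qed (rule smooth_slice[OF K(1)])
qed

section \<open>Transport along characteristics\<close>

lemma lborel_prod_Fubini:
  fixes f :: "'a::euclidean_space \<times> 'b::euclidean_space \<Rightarrow> 'c::{banach, second_countable_topology}"
  assumes "integrable lborel f"
  shows "(LINT z|lborel. f z) = (LINT x|lborel. LINT y|lborel. f (x, y))"
    and "(LINT z|lborel. f z) = (LINT y|lborel. LINT x|lborel. f (x, y))"
proof -
  have f: "integrable (lborel \<Otimes>\<^sub>M lborel) f" using assms by (simp add: lborel_prod)
  show 1: "(LINT z|lborel. f z) = (LINT x|lborel. LINT y|lborel. f (x, y))"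
    using lborel_pair.integral_fst'[OF f] by (simp add: lborel_prod)
  show "(LINT z|lborel. f z) = (LINT y|lborel. LINT x|lborel. f (x, y))"
    unfolding 1 using f by (intro lborel_pair.Fubini_integral[symmetric]) simp
qed

lemma integrable_bounded_support:
  fixes f :: "'a::euclidean_space \<Rightarrow> 'b::{banach, second_countable_topology}"
  assumes "f \<in> borel_measurable borel" "compact K" "\<And>z. z \<in> K \<Longrightarrow> norm (f z) \<le> B" "\<And>z. z \<notin> K \<Longrightarrow> f z = 0"
  shows "integrable lborel f"
proof (rule integrable_bound)
  show "integrable lborel (\<lambda>z. \<bar>B\<bar> * indicator K z)"
    using borel_integrable_compact[OF assms(2), of "\<lambda>_. \<bar>B\<bar>"] by (simp add: mult.commute)
  show "AE z in lborel. norm (f z) \<le> norm (\<bar>B\<bar> * indicator K z)"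
    using assms(3,4) by (intro AE_I2) (fastforce simp: indicator_def)
qed (use assms(1) in simp)

text \<open>The solution of w_t - c w_x = G with w = 0 at time 0, as an integral along
  characteristics; it is zero at negative times.\<close>

definition transport :: "real \<Rightarrow> (real \<times> real \<Rightarrow> 'b::{banach, second_countable_topology}) \<Rightarrow> real \<times> real \<Rightarrow> 'b" where
  "transport c G z = (LINT s|lborel. indicator {0..fst z} s *\<^sub>R G (s, snd z + c * (fst z - s)))"

lemma transport_integrable:
  fixes G :: "real \<times> real \<Rightarrow> 'b::{banach, second_countable_topology}"
  assumes "continuous_on UNIV G"
  shows "integrable lborel (\<lambda>s. indicator {0..t} s *\<^sub>R G (s, x + c * (t - s)))"
  by (rule borel_integrable_compact[OF compact_Icc], rule continuous_on_compose2[OF assms]) (auto intro!: continuous_intros)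

lemma transport_initial: "transport c G (0, x) = 0"
proof -
  have "AE s in lborel. indicator {0..0} s *\<^sub>R G (s, x + c * (0 - s)) = 0"
    using AE_lborel_singleton[of 0] by eventually_elim auto
  then show ?thesis unfolding transport_def by (intro integral_eq_zero_AE) simp
qed

text \<open>The integrand depends discontinuously on \<open>z\<close> only at
  \<open>s = fst z\<close>, a null set, so dominated convergence applies; the local majorant comes
  from compactness.\<close>

lemma continuous_transport:
  fixes G :: "real \<times> real \<Rightarrow> 'b::{banach, second_countable_topology}"
  assumes G: "continuous_on UNIV G" shows "continuous_on UNIV (transport c G)"
proof -
  have "isCont (transport c G) z" for z
  proof -
    let ?U = "ball z 1"
    let ?K = "(\<lambda>(w, s). (s, snd w + c * (fst w - s))) ` (cball z 1 \<times> {0..fst z + 1})"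
    have "compact (G ` ?K)"
      by (intro compact_continuous_image compact_Times compact_cball compact_Icc continuous_on_subset[OF G])
        (auto intro!: continuous_intros simp: split_beta')
    then obtain B where "\<forall>v\<in>G ` ?K. norm v \<le> B" using compact_imp_bounded bounded_iff by blast
    then have B: "norm (G (s, snd w + c * (fst w - s))) \<le> B" if "w \<in> cball z 1" "s \<in> {0..fst z + 1}" for w s
      using that by (force intro!: bexI[of _ "(w, s)"] image_eqI)
    have [measurable]: "G \<in> borel_measurable borel" using G by (rule borel_measurable_continuous_onI)
    have fw: "fst w \<le> fst z + 1" if "w \<in> cball z 1" for w
      using that dist_fst_le[of z w] by (auto simp: dist_real_def)
    have "(transport c G \<longlongrightarrow> transport c G z) (at z within ?U)"
      unfolding transport_def[abs_def]
    proof (rule dominated_convergence_within[where w = "\<lambda>s. \<bar>B\<bar> * indicator {0..fst z + 1} s"])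
      show "integrable lborel (\<lambda>s. \<bar>B\<bar> * indicator {0..fst z + 1} s)"
        by (intro integrable_mult_right integrable_real_indicator) (auto simp: emeasure_lborel_Icc_eq)
      show "AE s in lborel. ((\<lambda>w. indicator {0..fst w} s *\<^sub>R G (s, snd w + c * (fst w - s))) \<longlongrightarrow>
          indicator {0..fst z} s *\<^sub>R G (s, snd z + c * (fst z - s))) (at z within ?U)"
        using AE_lborel_singleton[of "fst z"]
      proof eventually_elim
        case (elim s)
        have "((\<lambda>w. indicator {0..fst w} s) \<longlongrightarrow> (indicator {0..fst z} s :: real)) (at z within ?U)"
        proof (rule tendsto_eventually)
          have f: "(fst \<longlongrightarrow> fst z) (at z within ?U)" by (intro tendsto_intros)
          consider "s < fst z" | "s > fst z" using elim by linarith
          then show "\<forall>\<^sub>F w in at z within ?U. indicator {0..fst w} s = (indicator {0..fst z} s :: real)"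
          proof cases
            case 1 from order_tendstoD(1)[OF f this] show ?thesis by eventually_elim (use 1 in \<open>auto simp: indicator_def\<close>)
          next
            case 2 from order_tendstoD(2)[OF f this] show ?thesis by eventually_elim (use 2 in \<open>auto simp: indicator_def\<close>)
          qed
        qed
        moreover have "((\<lambda>w. G (s, snd w + c * (fst w - s))) \<longlongrightarrow> G (s, snd z + c * (fst z - s))) (at z within ?U)"
          using G by (intro isCont_tendsto_compose[of _ G] tendsto_intros) (auto simp: continuous_on_eq_continuous_at)
        ultimately show ?case by (intro tendsto_scaleR)
      qed
      show "AE s in lborel. norm (indicator {0..fst w} s *\<^sub>R G (s, snd w + c * (fst w - s))) \<le> \<bar>B\<bar> * indicator {0..fst z + 1} s"
        if w: "w \<in> ?U - {z}" for w
      proof (rule AE_I2)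
        fix s
        have w': "w \<in> cball z 1" using w by auto
        show "norm (indicator {0..fst w} s *\<^sub>R G (s, snd w + c * (fst w - s))) \<le> \<bar>B\<bar> * indicator {0..fst z + 1} s"
          using B[OF w', of s] fw[OF w'] by (auto simp: indicator_def)
      qed
    qed measurable
    then show ?thesis by (simp add: isCont_def at_within_open[of z ?U])
  qed
  then show ?thesis by (simp add: continuous_at_imp_continuous_on)
qed

text \<open>Finite speed of propagation: a characteristic of slope at most one, followed back in
  time from a point outside the light cone, stays outside.\<close>

lemma transport_support:
  assumes "\<And>s y. 0 \<le> s \<Longrightarrow> s \<le> t \<Longrightarrow> \<bar>y\<bar> > R + s \<Longrightarrow> G (s, y) = 0" "\<bar>c\<bar> \<le> 1" "\<bar>x\<bar> > R + t"
  shows "transport c G (t, x) = 0"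
proof -
  have "indicator {0..t} s *\<^sub>R G (s, x + c * (t - s)) = 0" for s
  proof (cases "s \<in> {0..t}")
    case True
    then have "\<bar>c * (t - s)\<bar> \<le> 1 * (t - s)" unfolding abs_mult using assms(2) by (intro mult_mono) auto
    moreover have "\<bar>x\<bar> \<le> \<bar>x + c * (t - s)\<bar> + \<bar>c * (t - s)\<bar>"
      using abs_triangle_ineq4[of "x + c * (t - s)" "c * (t - s)"] by simp
    ultimately have "R + t < \<bar>x + c * (t - s)\<bar> + (t - s)" using assms(3) by (simp only: mult_1)
    then have "\<bar>x + c * (t - s)\<bar> > R + s" by simp
    then show ?thesis using True assms(1) by simp
  qed simp
  then have "AE s in lborel. indicator {0..t} s *\<^sub>R G (s, x + c * (t - s)) = 0" by (intro AE_I2)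
  then show ?thesis unfolding transport_def fst_conv snd_conv by (rule integral_eq_zero_AE)
qed

context
  fixes \<psi> :: "real \<times> real \<Rightarrow> complex" and K :: "(real \<times> real) set" and c :: real and \<eta> :: "real \<times> real \<Rightarrow> complex"
  assumes \<psi>: "smooth \<psi>" and K: "compact K" "K \<subseteq> {0<..} \<times> UNIV" and 0: "\<And>z. z \<notin> K \<Longrightarrow> \<psi> z = 0"
  defines "\<eta> \<equiv> \<lambda>z. dt \<psi> z - of_real c * dx \<psi> z"
begin

lemma eta_continuous: "continuous_on A \<eta>"
  unfolding \<eta>_def by (intro continuous_intros continuous_on_subset[OF smooth_continuous] smooth_dt smooth_dx \<psi>) auto

lemma eta_support: "z \<notin> K \<Longrightarrow> \<eta> z = 0"
  unfolding \<eta>_def using dt_eq_0_outside[OF compact_imp_closed[OF K(1)] 0 _ \<psi>] dx_eq_0_outside[OF compact_imp_closed[OF K(1)] 0 _ \<psi>] by simp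

lemma support_box: obtains b M where "0 \<le> b" "0 \<le> M" "K \<subseteq> {0<..b} \<times> {- M..M}"
proof -
  obtain B where B: "\<And>z. z \<in> K \<Longrightarrow> norm z \<le> B" using compact_imp_bounded[OF K(1)] by (auto simp: bounded_iff)
  have "K \<subseteq> {0<..\<bar>B\<bar>} \<times> {- \<bar>B\<bar>..\<bar>B\<bar>}"
  proof
    fix z assume z: "z \<in> K"
    have "\<bar>fst z\<bar> \<le> B" "\<bar>snd z\<bar> \<le> B" using B[OF z] norm_fst_le[of "fst z" "snd z"] norm_snd_le[of "snd z" "fst z"] by auto
    then show "z \<in> {0<..\<bar>B\<bar>} \<times> {- \<bar>B\<bar>..\<bar>B\<bar>}" using z K(2) by (cases z) (auto simp: mem_Times_iff)
  qed
  then show ?thesis by (intro that) auto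
qed

text \<open>\<open>\<eta>\<close> is the derivative of \<open>\<psi>\<close> along the
  characteristic through \<open>(s, z - c * s)\<close>, and \<open>\<psi>\<close> vanishes at late
  times.\<close>

lemma eta_line_integral:
  "(LINT t|lborel. indicator {s..} t *\<^sub>R \<eta> (t, z - c * t)) = - \<psi> (s, z - c * s)"
proof -
  obtain b M where b: "0 \<le> b" "0 \<le> M" "K \<subseteq> {0<..b} \<times> {- M..M}" by (rule support_box)
  define e where "e = max s b + 1"
  have e: "s \<le> e" "b < e" by (auto simp: e_def)
  have 1: "\<eta> (t, x) = 0" "\<psi> (t, x) = 0" if "t > b" for t x
  proof -
    have "(t, x) \<notin> K" using that b(3) by auto
    then show "\<eta> (t, x) = 0" "\<psi> (t, x) = 0" by (rule eta_support, rule 0)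
  qed
  have "(LINT t|lborel. indicator {s..} t *\<^sub>R \<eta> (t, z - c * t)) = (LINT t|lborel. indicator {s..e} t *\<^sub>R \<eta> (t, z - c * t))"
  proof (rule integral_cong[OF refl])
    fix t
    have "\<eta> (t, z - c * t) = 0" if "t > e" using 1(1) that e(2) by simp
    then show "indicator {s..} t *\<^sub>R \<eta> (t, z - c * t) = indicator {s..e} t *\<^sub>R \<eta> (t, z - c * t)"
      by (cases "t > e") (auto simp: indicator_def)
  qed
  also have "... = \<psi> (e, z - c * e) - \<psi> (s, z - c * s)"
  proof -
    have d: "((\<lambda>t. \<psi> (t, z - c * t)) has_vector_derivative \<eta> (t, z - c * t)) (at t within {s..e})" for t
      using has_vector_derivative_along_line[where \<psi> = \<psi> and a = "dt \<psi>" and b = "dx \<psi>" and y = z and c = "- c" and t = t,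
        OF smooth_has_dt[OF \<psi>] smooth_has_dx[OF \<psi>] smooth_continuous[OF smooth_dx[OF \<psi>]]]
      by (simp add: \<eta>_def scaleR_conv_of_real has_vector_derivative_at_within)
    have cont: "continuous_on {s..e} (\<lambda>t. \<eta> (t, z - c * t))"
      by (rule continuous_on_compose2[OF eta_continuous[of UNIV]]) (auto intro!: continuous_intros)
    show ?thesis
      by (rule integral_FTC_atLeastAtMost[where F = "\<lambda>t. \<psi> (t, z - c * t)" and f = "\<lambda>t. \<eta> (t, z - c * t)", OF e(1) d cont])
  qed
  also have "\<psi> (e, z - c * e) = 0" using 1 e by blast
  finally show ?thesis by simp
qed

text \<open>In coordinates moving with the wave the time integral runs along a characteristic.
  Starting at time 0 it equals minus the value of \<open>\<psi>\<close> there, which is zero because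
  the support lies in positive times. All derivatives fall on the test function.\<close>

lemma free_wave_weak:
  assumes g: "continuous_on UNIV g"
  shows "(LINT z|lborel. g (snd z + c * fst z) * \<eta> z) = 0"
proof -
  obtain b M where b: "0 \<le> b" "0 \<le> M" "K \<subseteq> {0<..b} \<times> {- M..M}" by (rule support_box)
  have g': "continuous_on A (\<lambda>x. g (f x))" if "continuous_on A f" for f :: "real \<times> real \<Rightarrow> real" and A
    by (rule continuous_on_compose2[OF g that]) auto
  have e': "continuous_on A (\<lambda>x. \<eta> (f x))" if "continuous_on A f" for f :: "real \<times> real \<Rightarrow> real \<times> real" and A
    by (rule continuous_on_compose2[OF eta_continuous that]) auto
  have i1: "integrable lborel (\<lambda>z. g (snd z + c * fst z) * \<eta> z)"
    by (rule integrable_compact_support[of _ K]) (use eta_support K in \<open>auto intro!: continuous_intros g' eta_continuous\<close>)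
  have i2: "integrable lborel (\<lambda>z. g (snd z) * \<eta> (fst z, snd z - c * fst z))"
  proof (rule integrable_compact_support[of _ "(\<lambda>z. (fst z, snd z + c * fst z)) ` K"])
    show "compact ((\<lambda>z. (fst z, snd z + c * fst z)) ` K)"
      by (intro compact_continuous_image K continuous_intros)
    show "g (snd z) * \<eta> (fst z, snd z - c * fst z) = 0" if "z \<notin> (\<lambda>z. (fst z, snd z + c * fst z)) ` K" for z
    proof -
      have "(fst z, snd z - c * fst z) \<notin> K" using that by (auto simp: image_iff)
      then show ?thesis by (simp add: eta_support)
    qed
  qed (auto intro!: continuous_intros g' e')
  have "(LINT z|lborel. g (snd z + c * fst z) * \<eta> z) = (LINT t|lborel. LINT x|lborel. g (x + c * t) * \<eta> (t, x))"
    using lborel_prod_Fubini(1)[OF i1] by simp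
  also have "... = (LINT t|lborel. LINT y|lborel. g y * \<eta> (t, y - c * t))"
  proof (rule integral_cong[OF refl])
    fix t
    show "(LINT x|lborel. g (x + c * t) * \<eta> (t, x)) = (LINT y|lborel. g y * \<eta> (t, y - c * t))"
      by (subst lborel_integral_real_affine[where c = 1 and t = "- c * t"]) (auto simp: algebra_simps)
  qed
  also have "... = (LINT y|lborel. LINT t|lborel. g y * \<eta> (t, y - c * t))"
    using lborel_prod_Fubini[OF i2] by simp
  also have "... = 0"
  proof -
    have eq: "(LINT t|lborel. g y * \<eta> (t, y - c * t)) = 0" for y
    proof -
      have "(LINT t|lborel. \<eta> (t, y - c * t)) = (LINT t|lborel. indicator {0..} t *\<^sub>R \<eta> (t, y - c * t))"
      proof (rule integral_cong[OF refl])
        fix t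
        have "\<eta> (t, y - c * t) = 0" if "t < 0" using that b(3) by (intro eta_support) auto
        then show "\<eta> (t, y - c * t) = indicator {0..} t *\<^sub>R \<eta> (t, y - c * t)" by (auto simp: indicator_def)
      qed
      also have "... = 0"
      proof -
        have "(0, y - c * 0) \<notin> K" using b(3) by auto
        from 0[OF this] show ?thesis unfolding eta_line_integral by simp
      qed
      finally show ?thesis by simp
    qed
    show ?thesis unfolding eq by simp
  qed
  finally show ?thesis .
qed

text \<open>Formal adjoint of \<open>transport\<close>: once the integrals are exchanged, the
  integral of \<open>\<eta>\<close> over the characteristic issuing from \<open>(s, y)\<close> is
  \<open>- \<psi> (s, y)\<close>.\<close>

lemma transport_weak:
  assumes G: "continuous_on UNIV G"
  shows "(LINT z|lborel. transport c G z * \<eta> z) = - (LINT z|lborel. G z * \<psi> z)"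
proof -
  obtain b M where b: "0 \<le> b" "0 \<le> M" "K \<subseteq> {0<..b} \<times> {- M..M}" by (rule support_box)
  \<comment> \<open>The joint integrand including its time cut-off. It is bounded and vanishes off
    the compact set \<open>K \<times> {0..b}\<close>, which licenses all exchanges of
    integrals.\<close>
  define H where "H w s = (if 0 \<le> s \<and> s \<le> fst w then G (s, snd w + c * (fst w - s)) * \<eta> w else 0)" for w s
  have [measurable]: "G \<in> borel_measurable (borel \<Otimes>\<^sub>M borel)" "\<eta> \<in> borel_measurable (borel \<Otimes>\<^sub>M borel)"
    unfolding borel_prod using G eta_continuous by (auto intro!: borel_measurable_continuous_onI)
  have "compact ((\<lambda>(w, s). G (s, snd w + c * (fst w - s)) * \<eta> w) ` (K \<times> {0..b}))"
    by (intro compact_continuous_image compact_Times K compact_Icc)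
      (auto intro!: continuous_intros continuous_on_compose2[OF G] continuous_on_compose2[OF eta_continuous[of UNIV]] simp: split_beta')
  then obtain B where "\<forall>v\<in>(\<lambda>(w, s). G (s, snd w + c * (fst w - s)) * \<eta> w) ` (K \<times> {0..b}). cmod v \<le> B"
    using compact_imp_bounded bounded_iff by blast
  then have B: "cmod (G (s, snd w + c * (fst w - s)) * \<eta> w) \<le> B" if "w \<in> K" "s \<in> {0..b}" for w s
    using that by force
  have H0: "H w s = 0" if "\<not> (w \<in> K \<and> s \<in> {0..b})" for w s
  proof (cases "w \<in> K")
    case True
    then have "fst w \<le> b" using b(3) by (cases w) auto
    then show ?thesis using True that by (auto simp: H_def)
  qed (simp add: H_def eta_support)
  have HB: "cmod (H w s) \<le> \<bar>B\<bar>" for w s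
    using B[of w s] H0[of w s] by (cases "w \<in> K \<and> s \<in> {0..b}") (auto simp: H_def)
  have Hm [measurable]: "(\<lambda>(w, s). H w s) \<in> borel_measurable borel"
    unfolding H_def[abs_def] split_beta' borel_prod[symmetric] by measurable
  have H1: "integrable lborel (\<lambda>(w, s). H w s)"
  proof (rule integrable_bounded_support[of _ "K \<times> {0..b}" "\<bar>B\<bar>"])
    show "(case z of (w, s) \<Rightarrow> H w s) = 0" if "z \<notin> K \<times> {0..b}" for z
      using H0[of "fst z" "snd z"] that by (simp add: split_beta mem_Times_iff)
    show "norm (case z of (w, s) \<Rightarrow> H w s) \<le> \<bar>B\<bar>" for z
      using HB by (simp add: split_beta)
  qed (use K in \<open>auto intro!: compact_Times\<close>)
  have H2: "integrable lborel (\<lambda>w. H w s)" for s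
  proof (rule integrable_bounded_support[of _ K "\<bar>B\<bar>"])
    show "(\<lambda>w. H w s) \<in> borel_measurable borel" unfolding H_def[abs_def] borel_prod[symmetric] by measurable
  qed (use K HB H0 in auto)
  have H3: "integrable lborel (\<lambda>z. H (fst z, snd z - c * (fst z - s)) s)" for s
  proof (rule integrable_bounded_support[of _ "(\<lambda>z. (fst z, snd z + c * (fst z - s))) ` K" "\<bar>B\<bar>"])
    show "(\<lambda>z. H (fst z, snd z - c * (fst z - s)) s) \<in> borel_measurable borel" unfolding H_def[abs_def] borel_prod[symmetric] by measurable
    show "compact ((\<lambda>z. (fst z, snd z + c * (fst z - s))) ` K)"
      by (intro compact_continuous_image K continuous_intros)
    show "H (fst z, snd z - c * (fst z - s)) s = 0" if "z \<notin> (\<lambda>z. (fst z, snd z + c * (fst z - s))) ` K" for z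
    proof -
      have "(fst z, snd z - c * (fst z - s)) \<notin> K"
        using that by (auto simp: image_iff)
      then show ?thesis by (intro H0) auto
    qed
  qed (use HB in auto)
  have inner: "(LINT w|lborel. H w s) = - (LINT y|lborel. G (s, y) * \<psi> (s, y))" for s
  proof -
    have "(LINT w|lborel. H w s) = (LINT t|lborel. LINT x|lborel. H (t, x) s)"
      by (rule lborel_prod_Fubini(1)[OF H2])
    also have "... = (LINT t|lborel. LINT y|lborel. H (t, y - c * (t - s)) s)"
    proof (rule integral_cong[OF refl])
      fix t
      show "(LINT x|lborel. H (t, x) s) = (LINT y|lborel. H (t, y - c * (t - s)) s)"
        by (subst lborel_integral_real_affine[where c = 1 and t = "- c * (t - s)"]) (auto simp: algebra_simps)
    qed
    also have "... = (LINT y|lborel. LINT t|lborel. H (t, y - c * (t - s)) s)"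
      using lborel_prod_Fubini[OF H3] by simp
    also have "... = (LINT y|lborel. - (G (s, y) * \<psi> (s, y)))"
    proof (rule integral_cong[OF refl])
      fix y
      show "(LINT t|lborel. H (t, y - c * (t - s)) s) = - (G (s, y) * \<psi> (s, y))"
      proof (cases "0 \<le> s")
        case True
        have "(LINT t|lborel. H (t, y - c * (t - s)) s) = (LINT t|lborel. G (s, y) * (indicator {s..} t *\<^sub>R \<eta> (t, (y + c * s) - c * t)))"
          using True by (intro integral_cong) (auto simp: H_def indicator_def algebra_simps)
        also have "... = G (s, y) * - \<psi> (s, y)"
          unfolding integral_mult_right_zero eta_line_integral by simp
        finally show ?thesis by simp
      next
        case False
        then have "(s, y) \<notin> K" using b(3) by auto
        from 0[OF this] False show ?thesis by (simp add: H_def)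
      qed
    qed
    finally show ?thesis by simp
  qed
  have "(LINT z|lborel. transport c G z * \<eta> z) = (LINT w|lborel. LINT s|lborel. H w s)"
  proof (rule integral_cong[OF refl])
    fix w
    have "transport c G w * \<eta> w = (LINT s|lborel. (indicator {0..fst w} s *\<^sub>R G (s, snd w + c * (fst w - s))) * \<eta> w)"
      unfolding transport_def by (rule integral_mult_left_zero[symmetric])
    also have "... = (LINT s|lborel. H w s)"
      by (intro integral_cong) (auto simp: H_def indicator_def)
    finally show "transport c G w * \<eta> w = (LINT s|lborel. H w s)" .
  qed
  also have "... = (LINT s|lborel. LINT w|lborel. H w s)"
    using lborel_prod_Fubini[OF H1] by simp
  also have "... = - (LINT s|lborel. LINT y|lborel. G (s, y) * \<psi> (s, y))"
    by (simp add: inner)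
  also have "(LINT s|lborel. LINT y|lborel. G (s, y) * \<psi> (s, y)) = (LINT z|lborel. G z * \<psi> z)"
  proof (rule lborel_prod_Fubini(1)[symmetric])
    show "integrable lborel (\<lambda>z. G z * \<psi> z)"
      by (rule integrable_compact_support[of _ K]) (use K 0 G smooth_continuous[OF \<psi>] in \<open>auto intro!: continuous_intros\<close>)
  qed
  finally show ?thesis .
qed

end

section \<open>Duhamel's formula on the Fourier side\<close>

text \<open>The Fourier counterpart of \<open>transport\<close>: the solution of y' = i k y +
  \<gamma> with y(0) = 0.\<close>

definition duh :: "real \<Rightarrow> (real \<Rightarrow> complex) \<Rightarrow> real \<Rightarrow> complex" where
  "duh k \<gamma> t = (LINT s|lborel. indicator {0..t} s *\<^sub>R (cis (k * (t - s)) * \<gamma> s))"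

lemma integrable_Icc_continuous:
  fixes f :: "real \<Rightarrow> 'b::{banach, second_countable_topology}"
  shows "continuous_on {a..b} f \<Longrightarrow> integrable lborel (\<lambda>s. indicator {a..b} s *\<^sub>R f s)"
  by (rule borel_integrable_compact[OF compact_Icc])

lemma duh_eq:
  assumes "continuous_on {0..T} \<gamma>" "t \<in> {0..T}"
  shows "duh k \<gamma> t = cis (k * t) * integral {0..t} (\<lambda>s. cis (- k * s) * \<gamma> s)"
proof -
  have c: "continuous_on {0..t} (\<lambda>s. cis (- k * s) * \<gamma> s)"
    using assms by (intro continuous_intros) (auto intro: continuous_on_subset)
  have "duh k \<gamma> t = (LINT s|lborel. cis (k * t) * (indicator {0..t} s *\<^sub>R (cis (- k * s) * \<gamma> s)))"
    unfolding duh_def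
  proof (rule integral_cong[OF refl])
    fix s
    have "cis (k * (t - s)) = cis (k * t) * cis (- k * s)" by (simp add: cis_mult algebra_simps)
    then show "indicator {0..t} s *\<^sub>R (cis (k * (t - s)) * \<gamma> s) = cis (k * t) * (indicator {0..t} s *\<^sub>R (cis (- k * s) * \<gamma> s))"
      by (simp only: mult.assoc mult_scaleR_right)
  qed
  also have "... = cis (k * t) * (LINT s:{0..t}|lborel. cis (- k * s) * \<gamma> s)"
    unfolding set_lebesgue_integral_def by (rule integral_mult_right_zero)
  also have "(LINT s:{0..t}|lborel. cis (- k * s) * \<gamma> s) = integral {0..t} (\<lambda>s. cis (- k * s) * \<gamma> s)"
    by (rule set_borel_integral_eq_integral(2)) (unfold set_integrable_def, rule integrable_Icc_continuous[OF c])
  finally show ?thesis .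
qed

lemma duh_0: "duh k \<gamma> 0 = 0"
proof -
  have "AE s in lborel. indicator {0..0} s *\<^sub>R (cis (k * (0 - s)) * \<gamma> s) = 0"
    using AE_lborel_singleton[of 0] by eventually_elim auto
  then show ?thesis unfolding duh_def by (rule integral_eq_zero_AE)
qed

lemma duh_has_deriv:
  assumes \<gamma>: "continuous_on {0..T} \<gamma>" and t: "t \<in> {0..T}"
  shows "(duh k \<gamma> has_vector_derivative \<i> * of_real k * duh k \<gamma> t + \<gamma> t) (at t within {0..T})"
proof -
  let ?h = "\<lambda>s. cis (- k * s) * \<gamma> s"
  have "continuous_on {0..T} ?h" by (intro continuous_intros \<gamma>)
  then have "((\<lambda>t. integral {0..t} ?h) has_vector_derivative ?h t) (at t within {0..T})"
    using t by (rule integral_has_vector_derivative)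
  from has_vector_derivative_mult[OF has_vector_derivative_at_within[OF has_vector_derivative_cis] this]
  have "((\<lambda>t. cis (k * t) * integral {0..t} ?h) has_vector_derivative
      cis (k * t) * ?h t + (\<i> * of_real k * cis (k * t)) * integral {0..t} ?h) (at t within {0..T})" .
  then have "(duh k \<gamma> has_vector_derivative
      cis (k * t) * ?h t + (\<i> * of_real k * cis (k * t)) * integral {0..t} ?h) (at t within {0..T})"
    by (rule has_vector_derivative_transform[rotated 2]) (use t in \<open>auto simp: duh_eq[OF \<gamma>]\<close>)
  moreover have "cis (k * t) * ?h t = \<gamma> t"
    by (simp add: cis_mult mult.assoc[symmetric])
  moreover have "(\<i> * of_real k * cis (k * t)) * integral {0..t} ?h = \<i> * of_real k * duh k \<gamma> t"
    by (simp only: duh_eq[OF \<gamma> t] mult.assoc)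
  ultimately show ?thesis by (simp only: add.commute)
qed

lemma duh_continuous:
  assumes "continuous_on {0..T} \<gamma>" shows "continuous_on {0..T} (duh k \<gamma>)"
  unfolding continuous_on_eq_continuous_within
  by (intro ballI has_vector_derivative_continuous[OF duh_has_deriv[OF assms]])

lemma duh_bound:
  assumes \<gamma>: "continuous_on {0..T} \<gamma>" and B: "\<And>s. s \<in> {0..T} \<Longrightarrow> cmod (\<gamma> s) \<le> B" and t: "t \<in> {0..T}"
  shows "cmod (duh k \<gamma> t) \<le> T * B"
proof -
  have c: "continuous_on {0..t} (\<lambda>s. cis (- k * s) * \<gamma> s)"
    using \<gamma> t by (intro continuous_intros) (auto intro: continuous_on_subset)
  have B0: "0 \<le> B" using B[OF t] norm_ge_zero order_trans by blast
  have "norm (integral {0..t} (\<lambda>s. cis (- k * s) * \<gamma> s)) \<le> B * (t - 0)"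
    by (rule integral_bound) (use t c B in \<open>auto simp: norm_mult\<close>)
  also have "... \<le> T * B" using t B0 by (simp add: mult.commute mult_left_mono)
  finally show ?thesis using duh_eq[OF \<gamma> t, of k] by (simp add: norm_mult)
qed

text \<open>Partial fractions for the two half-wave propagators. The factor \<open>k\<close> on the
  left is a gain of one power of the frequency, on which the decay of the correction rests.\<close>

lemma duh_duh:
  assumes \<gamma>: "continuous_on {0..T} \<gamma>" and t: "t \<in> {0..T}"
  shows "2 * \<i> * of_real k * duh (- k) (duh k \<gamma>) t = duh k \<gamma> t - duh (- k) \<gamma> t"
proof -
  have ring: "C * ((I * K * a + g) - (I * - K * b + g) - 2 * I * K * (I * - K * w + a)) + (I * K * C) * (a - b - 2 * I * K * w) = 0"
    for C I K a b g w :: complex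
    by (simp add: algebra_simps)
  \<comment> \<open>The difference of the two sides solves y' = - i k y, so its product with
    \<open>cis (k * t)\<close> is constant, and it vanishes at time 0.\<close>
  define E where "E t = cis (k * t) * (duh k \<gamma> t - duh (- k) \<gamma> t - 2 * \<i> * of_real k * duh (- k) (duh k \<gamma>) t)" for t
  have "(E has_vector_derivative 0) (at t within {0..T})" if t: "t \<in> {0..T}" for t
  proof -
    have "(E has_vector_derivative cis (k * t) *
        ((\<i> * of_real k * duh k \<gamma> t + \<gamma> t) - (\<i> * of_real (- k) * duh (- k) \<gamma> t + \<gamma> t)
          - 2 * \<i> * of_real k * (\<i> * of_real (- k) * duh (- k) (duh k \<gamma>) t + duh k \<gamma> t))
        + (\<i> * of_real k * cis (k * t)) * (duh k \<gamma> t - duh (- k) \<gamma> t - 2 * \<i> * of_real k * duh (- k) (duh k \<gamma>) t))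
       (at t within {0..T})"
      unfolding E_def
      by (intro has_vector_derivative_mult has_vector_derivative_diff has_vector_derivative_mult_right
          has_vector_derivative_at_within[OF has_vector_derivative_cis] duh_has_deriv \<gamma> duh_continuous t)
    then show ?thesis unfolding of_real_minus ring .
  qed
  note d = this
  have "E t = E 0"
  proof (rule has_vector_derivative_zero_constant[OF convex_real_interval(5) d])
    fix c assume c: "\<And>x. x \<in> {0..T} \<Longrightarrow> E x = c"
    have 0: "0 \<in> {0..T}" using t by auto
    show "E t = E 0" unfolding c[OF t] c[OF 0] ..
  qed
  also have "E 0 = 0" by (simp add: E_def duh_0)
  finally show ?thesis by (simp add: E_def)
qed

text \<open>A shift in space becomes multiplication by \<open>cis (c * \<xi> * (t - s))\<close>; the
  support condition keeps the double integral over a compact set.\<close>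

lemma fourier_transport:
  assumes G: "continuous_on UNIV G" and supp: "\<And>s y. 0 \<le> s \<Longrightarrow> s \<le> t \<Longrightarrow> \<bar>y\<bar> > R \<Longrightarrow> G (s, y) = 0"
  shows "fourier (\<lambda>x. transport c G (t, x)) \<xi> = duh (c * \<xi>) (\<lambda>s. fourier (\<lambda>x. G (s, x)) \<xi>) t"
proof -
  let ?c = "complex_of_real (1 / sqrt (2 * pi))"
  define H where "H x s = (if 0 \<le> s \<and> s \<le> t then cis (- (x * \<xi>)) * G (s, x + c * (t - s)) else 0)" for x s
  define K where "K = {- (R + \<bar>c\<bar> * \<bar>t\<bar>)..R + \<bar>c\<bar> * \<bar>t\<bar>} \<times> {0..t}"
  have [measurable]: "G \<in> borel_measurable (borel \<Otimes>\<^sub>M borel)"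
    unfolding borel_prod using G by (auto intro!: borel_measurable_continuous_onI)
  have K: "compact K" by (simp add: K_def compact_Times)
  have H0: "H x s = 0" if "(x, s) \<notin> K" for x s
  proof (cases "0 \<le> s \<and> s \<le> t")
    case True
    then have "\<bar>x\<bar> > R + \<bar>c\<bar> * \<bar>t\<bar>" using that by (auto simp: K_def)
    moreover have "\<bar>c * (t - s)\<bar> \<le> \<bar>c\<bar> * \<bar>t\<bar>" unfolding abs_mult using True by (intro mult_left_mono) auto
    ultimately have "\<bar>x + c * (t - s)\<bar> > R" using abs_triangle_ineq4[of "x + c * (t - s)" "c * (t - s)"] by simp
    then show ?thesis using True supp by (simp add: H_def)
  qed (auto simp: H_def)
  have "compact ((\<lambda>(x, s). G (s, x + c * (t - s))) ` K)"
    by (intro compact_continuous_image K) (auto intro!: continuous_intros continuous_on_compose2[OF G] simp: split_beta')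
  then obtain B where "\<forall>v\<in>(\<lambda>(x, s). G (s, x + c * (t - s))) ` K. cmod v \<le> B"
    using compact_imp_bounded bounded_iff by blast
  then have B: "cmod (G (s, x + c * (t - s))) \<le> B" if "(x, s) \<in> K" for x s
    using that by force
  have HB: "cmod (H x s) \<le> \<bar>B\<bar>" for x s
    using B[of x s] H0[of x s] by (cases "(x, s) \<in> K") (auto simp: H_def norm_mult)
  have H1: "integrable lborel (\<lambda>(x, s). H x s)"
  proof (rule integrable_bounded_support[of _ K "\<bar>B\<bar>"])
    show "(\<lambda>(x, s). H x s) \<in> borel_measurable borel"
      unfolding H_def[abs_def] split_beta' borel_prod[symmetric] by measurable
  qed (use H0 HB K in auto)
  have "fourier (\<lambda>x. transport c G (t, x)) \<xi> = ?c * (LINT x|lborel. LINT s|lborel. H x s)"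
  proof -
    have "cis (- (x * \<xi>)) * transport c G (t, x) = (LINT s|lborel. H x s)" for x
    proof -
      have "cis (- (x * \<xi>)) * transport c G (t, x) = (LINT s|lborel. cis (- (x * \<xi>)) * (indicator {0..t} s *\<^sub>R G (s, x + c * (t - s))))"
        unfolding transport_def fst_conv snd_conv by (rule integral_mult_right_zero[symmetric])
      also have "... = (LINT s|lborel. H x s)"
        by (intro integral_cong) (auto simp: H_def indicator_def)
      finally show ?thesis .
    qed
    then show ?thesis unfolding fourier_def by simp
  qed
  also have "... = ?c * (LINT s|lborel. LINT x|lborel. H x s)"
    using lborel_prod_Fubini[OF H1] by simp
  also have "... = (LINT s|lborel. ?c * (LINT x|lborel. H x s))"
    by (rule integral_mult_right_zero[symmetric])
  also have "... = duh (c * \<xi>) (\<lambda>s. fourier (\<lambda>x. G (s, x)) \<xi>) t"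
    unfolding duh_def
  proof (rule integral_cong[OF refl])
    fix s
    show "?c * (LINT x|lborel. H x s) = indicator {0..t} s *\<^sub>R (cis (c * \<xi> * (t - s)) * fourier (\<lambda>x. G (s, x)) \<xi>)"
    proof (cases "0 \<le> s \<and> s \<le> t")
      case True
      then have "?c * (LINT x|lborel. H x s) = fourier (\<lambda>x. G (s, x + c * (t - s))) \<xi>"
        by (simp add: H_def fourier_def)
      then show ?thesis using True fourier_shift[of "\<lambda>x. G (s, x)" "c * (t - s)" \<xi>] by (simp add: mult_ac)
    qed (auto simp: H_def)
  qed
  finally show ?thesis .
qed

lemma slice_integrable:
  fixes G :: "real \<times> real \<Rightarrow> complex"
  assumes G: "continuous_on UNIV G" and supp: "\<And>y. \<bar>y\<bar> > R \<Longrightarrow> G (s, y) = 0"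
  shows "integrable lborel (\<lambda>x. G (s, x))"
proof (rule integrable_compact_support[of _ "{- R..R}"])
  show "continuous_on UNIV (\<lambda>x. G (s, x))"
    by (rule continuous_on_compose2[OF G]) (auto intro!: continuous_intros)
qed (use supp in \<open>auto simp: abs_le_iff not_le\<close>)

lemma fourier_slice:
  fixes G :: "real \<times> real \<Rightarrow> complex"
  assumes G: "continuous_on UNIV G" and supp: "\<And>s y. s \<in> {0..T} \<Longrightarrow> \<bar>y\<bar> > R \<Longrightarrow> G (s, y) = 0"
  shows "continuous_on {0..T} (\<lambda>s. fourier (\<lambda>x. G (s, x)) \<xi>)"
    and "\<exists>B\<ge>0. \<forall>s\<in>{0..T}. \<forall>\<xi>. cmod (fourier (\<lambda>x. G (s, x)) \<xi>) \<le> B"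
proof -
  have "compact (G ` ({0..T} \<times> {- R..R}))"
    by (intro compact_continuous_image compact_Times compact_Icc continuous_on_subset[OF G]) auto
  then obtain B where "\<forall>v\<in>G ` ({0..T} \<times> {- R..R}). cmod v \<le> B"
    using compact_imp_bounded bounded_iff by blast
  have B: "cmod (G (s, x)) \<le> \<bar>B\<bar> * indicator {- R..R} x" if "s \<in> {0..T}" for s x
  proof (cases "x \<in> {- R..R}")
    case True
    then have "cmod (G (s, x)) \<le> B" using \<open>\<forall>v\<in>G ` ({0..T} \<times> {- R..R}). cmod v \<le> B\<close> that by blast
    then show ?thesis using True by (simp add: indicator_def)
  next
    case False
    then have "\<bar>x\<bar> > R" by auto
    then show ?thesis using supp[OF that] by simp
  qed
  have iB: "integrable lborel (\<lambda>x. \<bar>B\<bar> * indicator {- R..R} x)"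
    by (intro integrable_mult_right integrable_real_indicator) (auto simp: emeasure_lborel_Icc_eq)
  have sl: "continuous_on UNIV (\<lambda>x. G (s, x))" for s
    by (rule continuous_on_compose2[OF G]) (auto intro!: continuous_intros)
  have [measurable]: "(\<lambda>x. G (s, x)) \<in> borel_measurable borel" for s
    using sl by (rule borel_measurable_continuous_onI)
  show "continuous_on {0..T} (\<lambda>s. fourier (\<lambda>x. G (s, x)) \<xi>)"
    unfolding continuous_on fourier_def
  proof (intro ballI tendsto_mult tendsto_const)
    fix s assume s: "s \<in> {0..T}"
    show "((\<lambda>s. LINT x|lborel. cis (- (x * \<xi>)) * G (s, x)) \<longlongrightarrow> (LINT x|lborel. cis (- (x * \<xi>)) * G (s, x))) (at s within {0..T})"
    proof (rule dominated_convergence_within[OF _ _ iB])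
      show "AE x in lborel. ((\<lambda>\<tau>. cis (- (x * \<xi>)) * G (\<tau>, x)) \<longlongrightarrow> cis (- (x * \<xi>)) * G (s, x)) (at s within {0..T})"
        using G by (intro AE_I2 tendsto_mult tendsto_const isCont_tendsto_compose[of _ G] tendsto_intros)
          (auto simp: continuous_on_eq_continuous_at)
      show "AE x in lborel. norm (cis (- (x * \<xi>)) * G (\<tau>, x)) \<le> \<bar>B\<bar> * indicator {- R..R} x" if "\<tau> \<in> {0..T} - {s}" for \<tau>
        using B[of \<tau>] that by (intro AE_I2) (simp add: norm_mult)
    qed measurable
  qed
  have "cmod (fourier (\<lambda>x. G (s, x)) \<xi>) \<le> (LINT x|lborel. \<bar>B\<bar> * indicator {- R..R} x)" if "s \<in> {0..T}" for s \<xi>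
  proof (rule order_trans[OF norm_fourier_le integral_mono[OF _ iB B[OF that]]])
    show "integrable lborel (\<lambda>x. cmod (G (s, x)))"
      using slice_integrable[OF G supp[OF that]] by (rule integrable_norm)
  qed
  moreover have "0 \<le> (LINT x|lborel. \<bar>B\<bar> * indicator {- R..R} x)" by (intro integral_nonneg_AE) auto
  ultimately show "\<exists>B\<ge>0. \<forall>s\<in>{0..T}. \<forall>\<xi>. cmod (fourier (\<lambda>x. G (s, x)) \<xi>) \<le> B" by blast
qed

section \<open>Curves of functions in Sobolev spaces\<close>

lemma integrable_weight_dominated:
  fixes f :: "real \<Rightarrow> complex"
  assumes "integrable lborel (\<lambda>\<xi>. wt s \<xi> * (M \<xi>)^2)" "f \<in> borel_measurable borel" "\<And>\<xi>. cmod (f \<xi>) \<le> M \<xi>"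
  shows "integrable lborel (\<lambda>\<xi>. wt s \<xi> * (cmod (f \<xi>))^2)"
proof (rule integrable_bound[OF assms(1)])
  show "AE \<xi> in lborel. norm (wt s \<xi> * (cmod (f \<xi>))^2) \<le> norm (wt s \<xi> * (M \<xi>)^2)"
    using assms(3) by (intro AE_I2) (auto intro!: mult_left_mono power_mono)
qed (use assms(2) in measurable)

text \<open>A majorant \<open>M\<close> independent of time turns continuity in time at each
  frequency into continuity in norm, by dominated convergence.\<close>

lemma continuous_sobolev_dist_of:
  assumes h: "\<And>t. t \<in> I \<Longrightarrow> integrable lborel (h t)"
    and M: "integrable lborel (\<lambda>\<xi>. wt s \<xi> * (M \<xi>)^2)" "\<And>t \<xi>. t \<in> I \<Longrightarrow> cmod (fourier (h t) \<xi>) \<le> M \<xi>"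
    and c: "\<And>\<xi>. continuous_on I (\<lambda>t. fourier (h t) \<xi>)"
  shows "continuous_sobolev s I (\<lambda>t. dist_of (h t))"
    and "\<And>t. t \<in> I \<Longrightarrow> sobolev_ft s (dist_of (h t)) (fourier (h t))"
proof -
  have m: "fourier (h t) \<in> borel_measurable borel" if "t \<in> I" for t
    using borel_measurable_integrable[OF h[OF that]] by measurable
  show ft: "sobolev_ft s (dist_of (h t)) (fourier (h t))" if "t \<in> I" for t
    using h[OF that] integrable_weight_dominated[OF M(1) m[OF that] M(2)[OF that]] by (rule sobolev_ft_dist_of)
  show "continuous_sobolev s I (\<lambda>t. dist_of (h t))"
    unfolding continuous_sobolev_def
  proof (intro conjI ballI)
    fix t assume t: "t \<in> I"
    show "dist_of (h t) \<in> sobolev s" using tempered_dist_of[OF h[OF t]] ft[OF t] by (rule sobolevI)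
    note [measurable] = m[OF t]
    have "((\<lambda>\<tau>. LINT \<xi>|lborel. wt s \<xi> * (cmod (fourier (h \<tau>) \<xi> - fourier (h t) \<xi>))^2) \<longlongrightarrow> (LINT \<xi>::real|lborel. (0::real))) (at t within I)"
    proof (rule dominated_convergence_within)
      show "integrable lborel (\<lambda>\<xi>. 4 * (wt s \<xi> * (M \<xi>)^2))" using M(1) by auto
      show "(\<lambda>\<xi>. wt s \<xi> * (cmod (fourier (h \<tau>) \<xi> - fourier (h t) \<xi>))^2) \<in> borel_measurable lborel" if "\<tau> \<in> I" for \<tau>
        using m[OF that] by measurable
      show "AE \<xi> in lborel. ((\<lambda>\<tau>. wt s \<xi> * (cmod (fourier (h \<tau>) \<xi> - fourier (h t) \<xi>))^2) \<longlongrightarrow> 0) (at t within I)"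
      proof (rule AE_I2)
        fix \<xi>
        have "((\<lambda>\<tau>. wt s \<xi> * (cmod (fourier (h \<tau>) \<xi> - fourier (h t) \<xi>))^2) \<longlongrightarrow> wt s \<xi> * (cmod (fourier (h t) \<xi> - fourier (h t) \<xi>))^2) (at t within I)"
          using c[of \<xi>] t by (intro tendsto_intros) (auto simp: continuous_on)
        then show "((\<lambda>\<tau>. wt s \<xi> * (cmod (fourier (h \<tau>) \<xi> - fourier (h t) \<xi>))^2) \<longlongrightarrow> 0) (at t within I)" by simp
      qed
      show "AE \<xi> in lborel. norm (wt s \<xi> * (cmod (fourier (h \<tau>) \<xi> - fourier (h t) \<xi>))^2) \<le> 4 * (wt s \<xi> * (M \<xi>)^2)"
        if "\<tau> \<in> I - {t}" for \<tau>
      proof (rule AE_I2)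
        fix \<xi>
        have "cmod (fourier (h \<tau>) \<xi> - fourier (h t) \<xi>) \<le> 2 * M \<xi>"
          using norm_triangle_ineq4[of "fourier (h \<tau>) \<xi>" "fourier (h t) \<xi>"] M(2)[of \<tau> \<xi>] M(2)[OF t, of \<xi>] that by simp
        then have "(cmod (fourier (h \<tau>) \<xi> - fourier (h t) \<xi>))^2 \<le> (2 * M \<xi>)^2" by (intro power_mono) auto
        from mult_left_mono[OF this, of "wt s \<xi>"]
        show "norm (wt s \<xi> * (cmod (fourier (h \<tau>) \<xi> - fourier (h t) \<xi>))^2) \<le> 4 * (wt s \<xi> * (M \<xi>)^2)"
          by (simp add: power_mult_distrib)
      qed
    qed measurable
    then have "((\<lambda>\<tau>. sqrt (LINT \<xi>|lborel. wt s \<xi> * (cmod (fourier (h \<tau>) \<xi> - fourier (h t) \<xi>))^2)) \<longlongrightarrow> sqrt 0) (at t within I)"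
      by (intro tendsto_real_sqrt) simp
    then show "((\<lambda>\<tau>. sobolev_norm s (minus_dist (dist_of (h \<tau>)) (dist_of (h t)))) \<longlongrightarrow> 0) (at t within I)"
      unfolding real_sqrt_zero
      by (rule Lim_transform_eventually)
        (auto simp: eventually_at_filter sobolev_norm_eq[OF sobolev_ft_minus[OF ft ft]] t intro!: always_eventually)
  qed
qed

text \<open>By the mean value inequality the majorant \<open>N\<close> of the time derivative also
  bounds the difference quotients, so dominated convergence applies again.\<close>

lemma has_sobolev_derivative_dist_of:
  assumes h: "\<And>t. t \<in> I \<Longrightarrow> sobolev_ft s (dist_of (h t)) (fourier (h t))"
    and k: "\<And>t. t \<in> I \<Longrightarrow> sobolev_ft s (dist_of (k t)) (fourier (k t))"
    and N: "integrable lborel (\<lambda>\<xi>. wt s \<xi> * (N \<xi>)^2)" "\<And>t \<xi>. t \<in> I \<Longrightarrow> cmod (fourier (k t) \<xi>) \<le> N \<xi>"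
    and d: "\<And>\<xi> t. t \<in> I \<Longrightarrow> ((\<lambda>t. fourier (h t) \<xi>) has_vector_derivative fourier (k t) \<xi>) (at t within I)"
    and I: "convex I"
  shows "has_sobolev_derivative s I (\<lambda>t. dist_of (h t)) (\<lambda>t. dist_of (k t))"
  unfolding has_sobolev_derivative_def
proof (intro ballI)
  fix t assume t: "t \<in> I"
  let ?q = "\<lambda>\<tau> \<xi>. of_real (1 / (\<tau> - t)) * (fourier (h \<tau>) \<xi> - fourier (h t) \<xi>) - fourier (k t) \<xi>"
  have [measurable]: "fourier (h t) \<in> borel_measurable borel" "fourier (k t) \<in> borel_measurable borel"
    using sobolev_ftD(1)[OF h[OF t]] sobolev_ftD(1)[OF k[OF t]] .
  have "((\<lambda>\<tau>. LINT \<xi>|lborel. wt s \<xi> * (cmod (?q \<tau> \<xi>))^2) \<longlongrightarrow> (LINT \<xi>::real|lborel. (0::real))) (at t within I)"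
  proof (rule dominated_convergence_within)
    show "integrable lborel (\<lambda>\<xi>. 4 * (wt s \<xi> * (N \<xi>)^2))" using N(1) by auto
    show "(\<lambda>\<xi>. wt s \<xi> * (cmod (?q \<tau> \<xi>))^2) \<in> borel_measurable lborel" if "\<tau> \<in> I" for \<tau>
      using sobolev_ftD(1)[OF h[OF that]] by measurable
    show "AE \<xi> in lborel. ((\<lambda>\<tau>. wt s \<xi> * (cmod (?q \<tau> \<xi>))^2) \<longlongrightarrow> 0) (at t within I)"
    proof (rule AE_I2)
      fix \<xi>
      have "((\<lambda>\<tau>. (fourier (h \<tau>) \<xi> - fourier (h t) \<xi>) /\<^sub>R (\<tau> - t)) \<longlongrightarrow> fourier (k t) \<xi>) (at t within I)"
        using d[OF t, of \<xi>] unfolding has_vector_derivative_iff_quotient .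
      then have q: "((\<lambda>\<tau>. of_real (1 / (\<tau> - t)) * (fourier (h \<tau>) \<xi> - fourier (h t) \<xi>)) \<longlongrightarrow> fourier (k t) \<xi>) (at t within I)"
        by (simp add: scaleR_conv_of_real inverse_eq_divide)
      have "((\<lambda>\<tau>. wt s \<xi> * (cmod (?q \<tau> \<xi>))^2) \<longlongrightarrow> wt s \<xi> * (cmod (fourier (k t) \<xi> - fourier (k t) \<xi>))^2) (at t within I)"
        by (intro tendsto_mult tendsto_power tendsto_norm tendsto_diff tendsto_const q)
      then show "((\<lambda>\<tau>. wt s \<xi> * (cmod (?q \<tau> \<xi>))^2) \<longlongrightarrow> 0) (at t within I)" by simp
    qed
    show "AE \<xi> in lborel. norm (wt s \<xi> * (cmod (?q \<tau> \<xi>))^2) \<le> 4 * (wt s \<xi> * (N \<xi>)^2)"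
      if \<tau>: "\<tau> \<in> I - {t}" for \<tau>
    proof (rule AE_I2)
      fix \<xi>
      have "norm (fourier (h \<tau>) \<xi> - fourier (h t) \<xi>) \<le> N \<xi> * \<bar>\<tau> - t\<bar>"
        by (rule has_vector_derivative_lipschitz[of I "\<lambda>t. fourier (h t) \<xi>" "\<lambda>t. fourier (k t) \<xi>"]) (use I d N(2) t \<tau> in auto)
      then have "cmod (of_real (1 / (\<tau> - t)) * (fourier (h \<tau>) \<xi> - fourier (h t) \<xi>)) \<le> N \<xi>"
        using \<tau> by (simp only: norm_mult norm_of_real) (simp add: pos_divide_le_eq)
      then have "cmod (?q \<tau> \<xi>) \<le> 2 * N \<xi>"
        using norm_triangle_ineq4[of "of_real (1 / (\<tau> - t)) * (fourier (h \<tau>) \<xi> - fourier (h t) \<xi>)" "fourier (k t) \<xi>"] N(2)[OF t, of \<xi>] by simp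
      then have "(cmod (?q \<tau> \<xi>))^2 \<le> (2 * N \<xi>)^2" by (intro power_mono) auto
      from mult_left_mono[OF this, of "wt s \<xi>"]
      show "norm (wt s \<xi> * (cmod (?q \<tau> \<xi>))^2) \<le> 4 * (wt s \<xi> * (N \<xi>)^2)" by (simp add: power_mult_distrib)
    qed
  qed measurable
  then have "((\<lambda>\<tau>. sqrt (LINT \<xi>|lborel. wt s \<xi> * (cmod (?q \<tau> \<xi>))^2)) \<longlongrightarrow> sqrt 0) (at t within I)"
    by (intro tendsto_real_sqrt) simp
  then show "((\<lambda>\<tau>. sobolev_norm s (minus_dist (scale_dist (1 / (\<tau> - t)) (minus_dist (dist_of (h \<tau>)) (dist_of (h t)))) (dist_of (k t)))) \<longlongrightarrow> 0) (at t within I)"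
    unfolding real_sqrt_zero
    by (rule Lim_transform_eventually)
      (auto simp: eventually_at_filter sobolev_norm_eq[OF sobolev_ft_minus[OF sobolev_ft_scale[OF sobolev_ft_minus[OF h h]] k]] t intro!: always_eventually)
qed

section \<open>Classical solutions are solutions\<close>

lemma duh_cong:
  assumes "\<And>s. s \<in> {0..t} \<Longrightarrow> \<gamma> s = \<gamma>' s" shows "duh k \<gamma> t = duh k \<gamma>' t"
  unfolding duh_def
proof (rule integral_cong[OF refl])
  fix s
  show "indicator {0..t} s *\<^sub>R (cis (k * (t - s)) * \<gamma> s) = indicator {0..t} s *\<^sub>R (cis (k * (t - s)) * \<gamma>' s)"
    using assms[of s] by (cases "s \<in> {0..t}") auto
qed

lemma wt_le_wt: "r \<le> s \<Longrightarrow> wt r \<xi> \<le> wt s \<xi>"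
  by (intro powr_mono) auto

lemma wt_mult: "wt r \<xi> * wt s \<xi> = wt (r + s) \<xi>"
  by (rule powr_add[symmetric])

lemma wt_1: "wt 1 \<xi> = 1 + \<xi>^2"
  by (rule powr_one) simp

lemma square_sum_le: "(a + b)^2 \<le> 2 * a^2 + 2 * (b::real)^2"
  using sum_squares_bound[of a b] by (simp add: power2_sum)

text \<open>Integral form of the equation with data \<open>(g, 0)\<close>: d'Alembert's free wave
  plus a Duhamel term that inverts the product of the two transport operators of speeds 1 and -1.
  That product is minus the wave operator, hence the sign in front of \<open>\<omega>\<close> in the
  condition on \<open>G\<close>.\<close>

locale duhamel =
  fixes \<omega> p T R :: real and g :: "real \<Rightarrow> complex" and f G :: "real \<times> real \<Rightarrow> complex"
  assumes T: "0 < T" and p: "1 < p"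
    and g: "smooth1 g" "\<And>x. \<bar>x\<bar> > R \<Longrightarrow> g x = 0"
    and f: "continuous_on UNIV f"
      "\<And>t x. t \<in> {0..T} \<Longrightarrow> f (t, x) = (g (x + t) + g (x - t)) / 2 + transport (- 1) (transport 1 G) (t, x)"
    and G: "continuous_on UNIV G" "\<And>t x. t \<in> {0..T} \<Longrightarrow> \<bar>x\<bar> > R + t \<Longrightarrow> G (t, x) = 0"
      "\<And>t x. t \<in> {0..T} \<Longrightarrow> G (t, x) = - of_real \<omega> * (of_real (cmod (f (t, x)) powr (p - 1)) * f (t, x))"
begin

abbreviation "P \<equiv> transport 1 G"
abbreviation "Q \<equiv> transport (- 1) G"
abbreviation "W \<equiv> transport (- 1) (transport 1 G)"

text \<open>The time derivative of \<open>f\<close>: \<open>P\<close> and \<open>Q\<close> are the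
  characteristic derivatives W_t + W_x and W_t - W_x of the Duhamel term, so W_t is half their sum.
  The odd shape of the sums fits \<open>fourier_shift\<close> and
  \<open>fourier_cmult\<close>.\<close>

definition v :: "real \<Rightarrow> real \<Rightarrow> complex" where
  "v t x = (1 / 2) * (deriv1 g (x + t) + - 1 * deriv1 g (x + - t)) + (1 / 2) * (P (t, x) + Q (t, x))"

abbreviation "\<gamma> \<xi> s \<equiv> fourier (\<lambda>x. G (s, x)) \<xi>"

lemma continuous_PQW: "continuous_on UNIV P" "continuous_on UNIV Q" "continuous_on UNIV W"
  by (intro continuous_transport G)+

lemma P_support: "t \<in> {0..T} \<Longrightarrow> \<bar>x\<bar> > R + t \<Longrightarrow> P (t, x) = 0"
  using G(2) by (intro transport_support[of t R]) auto

lemma support: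
  assumes "t \<in> {0..T}" "\<bar>x\<bar> > R + T"
  shows "G (t, x) = 0" "P (t, x) = 0" "Q (t, x) = 0" "W (t, x) = 0" "g (x + t) = 0" "g (x - t) = 0"
  using assms P_support G(2) g(2) by (auto intro!: transport_support[of t R])

lemma g_schwartz: "g \<in> schwartz"
  by (rule schwartz_compact_support[OF g(1), of "- R" R]) (use g(2) in \<open>auto simp: abs_le_iff not_le\<close>)

lemma shift_integrable:
  "integrable lborel (\<lambda>x. g (x + a))" "integrable lborel (\<lambda>x. deriv1 g (x + a))"
  using lborel_integrable_real_affine[OF schwartz_integrable[OF g_schwartz], of 1 a]
    lborel_integrable_real_affine[OF schwartz_integrable[OF schwartz_deriv1[OF g_schwartz]], of 1 a]
  by (simp_all add: add.commute)

lemma slices_integrable: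
  assumes "t \<in> {0..T}"
  shows "integrable lborel (\<lambda>x. G (t, x))" "integrable lborel (\<lambda>x. P (t, x))"
    "integrable lborel (\<lambda>x. Q (t, x))" "integrable lborel (\<lambda>x. W (t, x))"
  by (rule slice_integrable[of _ "R + T"]; use support[OF assms] G(1) continuous_PQW in blast)+

lemma f_eq: "t \<in> {0..T} \<Longrightarrow> (\<lambda>x. f (t, x)) = (\<lambda>x. (1 / 2) * (g (x + t) + g (x + - t)) + W (t, x))"
  by (auto simp: f(2))

lemma f_integrable: assumes "t \<in> {0..T}" shows "integrable lborel (\<lambda>x. f (t, x))"
  unfolding f_eq[OF assms]
  by (intro integrable_add integrable_mult_right shift_integrable slices_integrable assms)

lemma v_integrable: assumes "t \<in> {0..T}" shows "integrable lborel (v t)"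
  unfolding v_def[abs_def]
  by (intro integrable_add integrable_mult_right shift_integrable slices_integrable assms)

lemma \<gamma>_continuous: "continuous_on {0..T} (\<gamma> \<xi>)"
  by (rule fourier_slice[OF G(1), of T "R + T"]) (rule support)

lemma fourier_PQW:
  assumes t: "t \<in> {0..T}"
  shows "fourier (\<lambda>x. P (t, x)) \<xi> = duh \<xi> (\<gamma> \<xi>) t" "fourier (\<lambda>x. Q (t, x)) \<xi> = duh (- \<xi>) (\<gamma> \<xi>) t"
    "fourier (\<lambda>x. W (t, x)) \<xi> = duh (- \<xi>) (duh \<xi> (\<gamma> \<xi>)) t"
proof -
  have PQ: "fourier (\<lambda>x. transport c G (t, x)) \<xi> = duh (c * \<xi>) (\<gamma> \<xi>) t" if "t \<in> {0..T}" for t c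
    by (rule fourier_transport[OF G(1), of t "R + T"]) (use that in \<open>auto intro!: support\<close>)
  from PQ[OF t, of 1] PQ[OF t, of "- 1"] show "fourier (\<lambda>x. P (t, x)) \<xi> = duh \<xi> (\<gamma> \<xi>) t" "fourier (\<lambda>x. Q (t, x)) \<xi> = duh (- \<xi>) (\<gamma> \<xi>) t"
    by simp_all
  have "fourier (\<lambda>x. W (t, x)) \<xi> = duh (- 1 * \<xi>) (\<lambda>s. fourier (\<lambda>x. P (s, x)) \<xi>) t"
    by (rule fourier_transport[OF continuous_PQW(1), of t "R + T"]) (use t in \<open>auto intro!: support\<close>)
  also have "... = duh (- 1 * \<xi>) (duh \<xi> (\<gamma> \<xi>)) t"
    by (rule duh_cong) (use PQ[of _ 1] t in auto)
  finally show "fourier (\<lambda>x. W (t, x)) \<xi> = duh (- \<xi>) (duh \<xi> (\<gamma> \<xi>)) t" by simp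
qed

lemma fourier_f:
  assumes t: "t \<in> {0..T}"
  shows "fourier (\<lambda>x. f (t, x)) \<xi> = (1 / 2) * ((cis (\<xi> * t) + cis (- \<xi> * t)) * fourier g \<xi>) + duh (- \<xi>) (duh \<xi> (\<gamma> \<xi>)) t"
  unfolding f_eq[OF t] fourier_PQW(3)[OF t, symmetric]
  by (subst fourier_add, (intro integrable_mult_right integrable_add shift_integrable slices_integrable t)+,
      subst fourier_cmult, subst fourier_add, (rule shift_integrable)+, simp only: fourier_shift)
    (simp add: distrib_right mult.commute[of \<xi>])

lemma fourier_v:
  assumes t: "t \<in> {0..T}"
  shows "fourier (v t) \<xi> = (1 / 2) * ((cis (\<xi> * t) - cis (- \<xi> * t)) * (\<i> * of_real \<xi> * fourier g \<xi>))
    + (1 / 2) * (duh \<xi> (\<gamma> \<xi>) t + duh (- \<xi>) (\<gamma> \<xi>) t)"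
proof -
  have lin: "fourier (\<lambda>x. a * (p x + b * q x) + a * (r x + u x)) \<xi>
      = a * (fourier p \<xi> + b * fourier q \<xi>) + a * (fourier r \<xi> + fourier u \<xi>)"
    if "integrable lborel p" "integrable lborel q" "integrable lborel r" "integrable lborel u"
    for a b :: complex and p q r u
    using that by (simp only: fourier_add fourier_cmult integrable_mult_right integrable_add)
  show ?thesis
    unfolding v_def[abs_def] lin[OF shift_integrable(2) shift_integrable(2) slices_integrable(2)[OF t] slices_integrable(3)[OF t]]
      fourier_shift[of "deriv1 g" t] fourier_shift[of "deriv1 g" "- t"] fourier_PQW[OF t] schwartz_fourier_deriv1[OF g_schwartz]
    by (simp add: left_diff_distrib mult.commute[of \<xi>])
qed

lemma fourier_f_has_deriv:
  assumes t: "t \<in> {0..T}"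
  shows "((\<lambda>t. fourier (\<lambda>x. f (t, x)) \<xi>) has_vector_derivative fourier (v t) \<xi>) (at t within {0..T})"
proof -
  let ?c = "(1 / 2) * ((\<i> * of_real \<xi> * cis (\<xi> * t) + \<i> * of_real (- \<xi>) * cis (- \<xi> * t)) * fourier g \<xi>)
    + (\<i> * of_real (- \<xi>) * duh (- \<xi>) (duh \<xi> (\<gamma> \<xi>)) t + duh \<xi> (\<gamma> \<xi>) t)"
  have "((\<lambda>t. (1 / 2) * ((cis (\<xi> * t) + cis (- \<xi> * t)) * fourier g \<xi>) + duh (- \<xi>) (duh \<xi> (\<gamma> \<xi>)) t) has_vector_derivative ?c)
      (at t within {0..T})"
    by (intro has_vector_derivative_add has_vector_derivative_mult_right has_vector_derivative_mult_left
        has_vector_derivative_at_within[OF has_vector_derivative_cis] duh_has_deriv duh_continuous \<gamma>_continuous t)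
  then have "((\<lambda>t. fourier (\<lambda>x. f (t, x)) \<xi>) has_vector_derivative ?c) (at t within {0..T})"
    by (rule has_vector_derivative_transform[OF t, rotated]) (rule fourier_f)
  moreover have "?c = fourier (v t) \<xi>"
  proof -
    \<comment> \<open>\<open>duh_duh\<close> turns the term with the explicit factor
      \<open>\<xi>\<close> into half a difference of propagators, which combines with
      \<open>duh \<xi> (\<gamma> \<xi>) t\<close> to the mean of both.\<close>
    have eq: "\<i> * of_real (- \<xi>) * duh (- \<xi>) (duh \<xi> (\<gamma> \<xi>)) t = - (1 / 2) * (duh \<xi> (\<gamma> \<xi>) t - duh (- \<xi>) (\<gamma> \<xi>) t)"
      unfolding duh_duh[OF \<gamma>_continuous t, symmetric] by simp
    have ring: "(1 / 2) * ((I * c + - I * d) * z) + (- (1 / 2) * (A - B) + A) = (1 / 2) * ((c - d) * (I * z)) + (1 / 2) * (A + B)"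
      for I c d z A B :: complex by (simp add: field_simps)
    show ?thesis unfolding fourier_v[OF t] eq using ring by simp
  qed
  ultimately show ?thesis by simp
qed

lemma fourier_f_continuous: "continuous_on {0..T} (\<lambda>t. fourier (\<lambda>x. f (t, x)) \<xi>)"
  unfolding continuous_on_eq_continuous_within
  by (intro ballI has_vector_derivative_continuous[OF fourier_f_has_deriv])

lemma fourier_v_continuous: "continuous_on {0..T} (\<lambda>t. fourier (v t) \<xi>)"
proof -
  have "continuous_on {0..T} (\<lambda>t. (1 / 2) * ((cis (\<xi> * t) - cis (- \<xi> * t)) * (\<i> * of_real \<xi> * fourier g \<xi>))
    + (1 / 2) * (duh \<xi> (\<gamma> \<xi>) t + duh (- \<xi>) (\<gamma> \<xi>) t))"
    by (intro continuous_intros duh_continuous \<gamma>_continuous)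
  then show ?thesis by (rule continuous_on_eq) (simp only: fourier_v)
qed

text \<open>By \<open>duh_duh\<close> the Duhamel term decays like the inverse of the frequency
  although \<open>G\<close> is merely continuous; for its contribution to \<open>v\<close> a bound
  uniform in frequency is enough.\<close>

lemma fourier_bounds:
  obtains C where "C \<ge> 0" "\<And>t \<xi>. t \<in> {0..T} \<Longrightarrow> cmod (fourier (\<lambda>x. f (t, x)) \<xi>) \<le> cmod (fourier g \<xi>) + C * wt (- 1 / 2) \<xi>"
    "\<And>t \<xi>. t \<in> {0..T} \<Longrightarrow> cmod (fourier (v t) \<xi>) \<le> \<bar>\<xi>\<bar> * cmod (fourier g \<xi>) + C"
proof -
  have "\<exists>B\<ge>0. \<forall>s\<in>{0..T}. \<forall>\<xi>. cmod (\<gamma> \<xi> s) \<le> B"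
    by (rule fourier_slice[OF G(1), of T "R + T"]) (rule support)
  then obtain B where B: "B \<ge> 0" "\<And>s \<xi>. s \<in> {0..T} \<Longrightarrow> cmod (\<gamma> \<xi> s) \<le> B" by blast
  let ?C = "T * (T * B) + T * B"
  have d1: "cmod (duh k (\<gamma> \<xi>) t) \<le> T * B" if "t \<in> {0..T}" for k \<xi> t
    by (rule duh_bound[OF \<gamma>_continuous B(2) that])
  have c2: "cmod ((1 / 2) * ((cis a + cis b) * z)) \<le> cmod z" "cmod ((1 / 2) * ((cis a - cis b) * z)) \<le> cmod z" for a b z
    using norm_triangle_ineq[of "cis a" "cis b"] norm_triangle_ineq4[of "cis a" "cis b"]
      mult_right_mono[of "cmod (cis a + cis b)" 2 "cmod z"] mult_right_mono[of "cmod (cis a - cis b)" 2 "cmod z"]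
    by (simp_all add: norm_mult)
  show ?thesis
  proof (rule that[of ?C])
    show "?C \<ge> 0" using B T by simp
    fix t \<xi> assume t: "t \<in> {0..T}"
    have w: "cmod (duh (- \<xi>) (duh \<xi> (\<gamma> \<xi>)) t) \<le> T * (T * B)"
      by (rule duh_bound[OF duh_continuous[OF \<gamma>_continuous] d1 t])
    have "cmod (2 * \<i> * of_real \<xi> * duh (- \<xi>) (duh \<xi> (\<gamma> \<xi>)) t) \<le> 2 * (T * B)"
      unfolding duh_duh[OF \<gamma>_continuous t]
      using norm_triangle_ineq4[of "duh \<xi> (\<gamma> \<xi>) t" "duh (- \<xi>) (\<gamma> \<xi>) t"] d1[OF t, of \<xi> \<xi>] d1[OF t, of "- \<xi>" \<xi>] by simp
    then have \<xi>w: "\<bar>\<xi>\<bar> * cmod (duh (- \<xi>) (duh \<xi> (\<gamma> \<xi>)) t) \<le> T * B" by (simp add: norm_mult)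
    have "wt (1 / 2) \<xi> = sqrt (1 + \<xi>^2)" by (simp add: powr_half_sqrt)
    also have "... \<le> 1 + \<bar>\<xi>\<bar>" by (rule real_le_lsqrt) (simp_all add: power2_sum)
    finally have "wt (1 / 2) \<xi> * cmod (duh (- \<xi>) (duh \<xi> (\<gamma> \<xi>)) t) \<le> (1 + \<bar>\<xi>\<bar>) * cmod (duh (- \<xi>) (duh \<xi> (\<gamma> \<xi>)) t)"
      by (rule mult_right_mono) simp
    also have "... \<le> ?C" using w \<xi>w by (simp add: distrib_right)
    finally have "wt (- 1 / 2) \<xi> * (wt (1 / 2) \<xi> * cmod (duh (- \<xi>) (duh \<xi> (\<gamma> \<xi>)) t)) \<le> wt (- 1 / 2) \<xi> * ?C"
      by (rule mult_left_mono) simp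
    moreover have "wt (- 1 / 2) \<xi> * (wt (1 / 2) \<xi> * a) = a" for a
    proof -
      have "wt (- 1 / 2) \<xi> * wt (1 / 2) \<xi> = 1" using wt_minus[where s = "1 / 2" and \<xi> = \<xi>] by (simp add: mult.commute)
      then show ?thesis by (simp flip: mult.assoc)
    qed
    ultimately have "cmod (duh (- \<xi>) (duh \<xi> (\<gamma> \<xi>)) t) \<le> ?C * wt (- 1 / 2) \<xi>" by (simp only: mult.commute)
    then show "cmod (fourier (\<lambda>x. f (t, x)) \<xi>) \<le> cmod (fourier g \<xi>) + ?C * wt (- 1 / 2) \<xi>"
      unfolding fourier_f[OF t] using c2(1) by (intro norm_triangle_le add_mono)
    have "cmod ((1 / 2) * (duh \<xi> (\<gamma> \<xi>) t + duh (- \<xi>) (\<gamma> \<xi>) t)) \<le> T * B"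
      using norm_triangle_ineq[of "duh \<xi> (\<gamma> \<xi>) t" "duh (- \<xi>) (\<gamma> \<xi>) t"] d1[OF t, of \<xi> \<xi>] d1[OF t, of "- \<xi>" \<xi>]
      by (simp add: norm_mult)
    also have "... \<le> ?C" using T B by simp
    finally have 1: "cmod ((1 / 2) * (duh \<xi> (\<gamma> \<xi>) t + duh (- \<xi>) (\<gamma> \<xi>) t)) \<le> ?C" .
    have "cmod ((1 / 2) * ((cis (\<xi> * t) - cis (- \<xi> * t)) * (\<i> * of_real \<xi> * fourier g \<xi>))) \<le> cmod (\<i> * of_real \<xi> * fourier g \<xi>)"
      by (rule c2(2))
    also have "... = \<bar>\<xi>\<bar> * cmod (fourier g \<xi>)" by (simp add: norm_mult)
    finally show "cmod (fourier (v t) \<xi>) \<le> \<bar>\<xi>\<bar> * cmod (fourier g \<xi>) + ?C"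
      unfolding fourier_v[OF t] using 1 by (intro norm_triangle_le add_mono)
  qed
qed

text \<open>For \<open>s < 1 / 2\<close> the function \<open>wt (s - 1)\<close> is integrable. It is
  the weight \<open>wt s\<close> times the squared decay \<open>wt (- 1)\<close> of the Duhamel
  term, and also the weight of H^(s-1) applied to the bounded part of \<open>v\<close>.\<close>

lemma regularity:
  assumes s: "s < 1 / 2"
  shows "continuous_sobolev s {0..T} (\<lambda>t. dist_of (\<lambda>x. f (t, x)))"
    "continuous_sobolev (s - 1) {0..T} (\<lambda>t. dist_of (v t))"
    "has_sobolev_derivative (s - 1) {0..T} (\<lambda>t. dist_of (\<lambda>x. f (t, x))) (\<lambda>t. dist_of (v t))"
    "\<And>t. t \<in> {0..T} \<Longrightarrow> sobolev_ft s (dist_of (\<lambda>x. f (t, x))) (fourier (\<lambda>x. f (t, x)))"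
proof -
  obtain C where C: "C \<ge> 0" "\<And>t \<xi>. t \<in> {0..T} \<Longrightarrow> cmod (fourier (\<lambda>x. f (t, x)) \<xi>) \<le> cmod (fourier g \<xi>) + C * wt (- 1 / 2) \<xi>"
    "\<And>t \<xi>. t \<in> {0..T} \<Longrightarrow> cmod (fourier (v t) \<xi>) \<le> \<bar>\<xi>\<bar> * cmod (fourier g \<xi>) + C"
    by (rule fourier_bounds) blast
  let ?M = "\<lambda>\<xi>. cmod (fourier g \<xi>) + C * wt (- 1 / 2) \<xi>" and ?N = "\<lambda>\<xi>. \<bar>\<xi>\<bar> * cmod (fourier g \<xi>) + C"
  note gS = fourier_schwartz[OF g_schwartz]
  note [measurable] = schwartz_measurable[OF gS]
  have dom: "integrable lborel (\<lambda>\<xi>. 2 * (wt r \<xi> * (cmod (fourier g \<xi>))^2) + 2 * C^2 * wt (s - 1) \<xi>)" for r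
    using s by (intro integrable_add integrable_mult_right schwartz_integrable_weight_square gS integrable_weight) simp
  have M: "integrable lborel (\<lambda>\<xi>. wt r \<xi> * (?M \<xi>)^2)" if r: "r \<le> s" for r
  proof (rule integrable_bound[OF dom[of r]])
    show "AE \<xi> in lborel. norm (wt r \<xi> * (?M \<xi>)^2) \<le> norm (2 * (wt r \<xi> * (cmod (fourier g \<xi>))^2) + 2 * C^2 * wt (s - 1) \<xi>)"
    proof (rule AE_I2)
      fix \<xi>
      have "(wt (- 1 / 2) \<xi>)^2 = wt (- 1) \<xi>" by (simp only: power2_eq_square[of "wt (- 1 / 2) \<xi>"] wt_mult) simp
      then have "wt r \<xi> * (wt (- 1 / 2) \<xi>)^2 = wt (r - 1) \<xi>" by (simp only: wt_mult) simp
      also have "... \<le> wt (s - 1) \<xi>" by (rule wt_le_wt) (use r in simp)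
      finally have 1: "C\<^sup>2 * (wt r \<xi> * (wt (- 1 / 2) \<xi>)^2) \<le> C\<^sup>2 * wt (s - 1) \<xi>" by (rule mult_left_mono) simp
      have "wt r \<xi> * (?M \<xi>)^2 \<le> wt r \<xi> * (2 * (cmod (fourier g \<xi>))^2 + 2 * (C * wt (- 1 / 2) \<xi>)^2)"
        by (intro mult_left_mono square_sum_le) simp
      also have "... = 2 * (wt r \<xi> * (cmod (fourier g \<xi>))^2) + 2 * (C^2 * (wt r \<xi> * (wt (- 1 / 2) \<xi>)^2))"
        unfolding power_mult_distrib[of C] by (simp only: distrib_left mult_ac)
      also have "... \<le> 2 * (wt r \<xi> * (cmod (fourier g \<xi>))^2) + 2 * C^2 * wt (s - 1) \<xi>" using 1 by simp
      finally have "wt r \<xi> * (?M \<xi>)^2 \<le> 2 * (wt r \<xi> * (cmod (fourier g \<xi>))^2) + 2 * C^2 * wt (s - 1) \<xi>" .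
      moreover have "0 \<le> wt r \<xi> * (?M \<xi>)^2" by simp
      ultimately show "norm (wt r \<xi> * (?M \<xi>)^2) \<le> norm (2 * (wt r \<xi> * (cmod (fourier g \<xi>))^2) + 2 * C^2 * wt (s - 1) \<xi>)"
        unfolding real_norm_def by linarith
    qed
  qed measurable
  have N: "integrable lborel (\<lambda>\<xi>. wt (s - 1) \<xi> * (?N \<xi>)^2)"
  proof (rule integrable_bound[OF dom[of s]])
    show "AE \<xi> in lborel. norm (wt (s - 1) \<xi> * (?N \<xi>)^2) \<le> norm (2 * (wt s \<xi> * (cmod (fourier g \<xi>))^2) + 2 * C^2 * wt (s - 1) \<xi>)"
    proof (rule AE_I2)
      fix \<xi>
      have "wt (s - 1) \<xi> * \<xi>^2 \<le> wt (s - 1) \<xi> * wt 1 \<xi>" unfolding wt_1 by (intro mult_left_mono) auto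
      then have "wt (s - 1) \<xi> * \<xi>^2 \<le> wt s \<xi>" unfolding wt_mult by simp
      then have 1: "(wt (s - 1) \<xi> * \<xi>^2) * (cmod (fourier g \<xi>))^2 \<le> wt s \<xi> * (cmod (fourier g \<xi>))^2" by (rule mult_right_mono) simp
      have "wt (s - 1) \<xi> * (?N \<xi>)^2 \<le> wt (s - 1) \<xi> * (2 * (\<bar>\<xi>\<bar> * cmod (fourier g \<xi>))^2 + 2 * C^2)"
        by (intro mult_left_mono square_sum_le) simp
      also have "... = 2 * ((wt (s - 1) \<xi> * \<xi>^2) * (cmod (fourier g \<xi>))^2) + 2 * C^2 * wt (s - 1) \<xi>"
        unfolding power_mult_distrib[of "\<bar>\<xi>\<bar>"] power2_abs by (simp only: distrib_left mult_ac)
      also have "... \<le> 2 * (wt s \<xi> * (cmod (fourier g \<xi>))^2) + 2 * C^2 * wt (s - 1) \<xi>" using 1 by simp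
      finally have "wt (s - 1) \<xi> * (?N \<xi>)^2 \<le> 2 * (wt s \<xi> * (cmod (fourier g \<xi>))^2) + 2 * C^2 * wt (s - 1) \<xi>" .
      moreover have "0 \<le> wt (s - 1) \<xi> * (?N \<xi>)^2" by simp
      ultimately show "norm (wt (s - 1) \<xi> * (?N \<xi>)^2) \<le> norm (2 * (wt s \<xi> * (cmod (fourier g \<xi>))^2) + 2 * C^2 * wt (s - 1) \<xi>)"
        unfolding real_norm_def by linarith
    qed
  qed measurable
  show "continuous_sobolev s {0..T} (\<lambda>t. dist_of (\<lambda>x. f (t, x)))"
    by (rule continuous_sobolev_dist_of(1)[OF f_integrable M[OF order_refl] C(2) fourier_f_continuous])
  show ft: "sobolev_ft s (dist_of (\<lambda>x. f (t, x))) (fourier (\<lambda>x. f (t, x)))" if "t \<in> {0..T}" for t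
    by (rule continuous_sobolev_dist_of(2)[OF f_integrable M[OF order_refl] C(2) fourier_f_continuous that])
  have M1: "integrable lborel (\<lambda>\<xi>. wt (s - 1) \<xi> * (?M \<xi>)^2)" by (rule M) simp
  have ft': "sobolev_ft (s - 1) (dist_of (\<lambda>x. f (t, x))) (fourier (\<lambda>x. f (t, x)))" if "t \<in> {0..T}" for t
    by (rule continuous_sobolev_dist_of(2)[OF f_integrable M1 C(2) fourier_f_continuous that])
  show "continuous_sobolev (s - 1) {0..T} (\<lambda>t. dist_of (v t))"
    by (rule continuous_sobolev_dist_of(1)[OF v_integrable N C(3) fourier_v_continuous])
  have fv: "sobolev_ft (s - 1) (dist_of (v t)) (fourier (v t))" if "t \<in> {0..T}" for t
    by (rule continuous_sobolev_dist_of(2)[OF v_integrable N C(3) fourier_v_continuous that])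
  show "has_sobolev_derivative (s - 1) {0..T} (\<lambda>t. dist_of (\<lambda>x. f (t, x))) (\<lambda>t. dist_of (v t))"
    by (rule has_sobolev_derivative_dist_of[OF ft' fv N C(3) fourier_f_has_deriv]) auto
qed

lemma test_functionE:
  assumes "\<psi> \<in> test_functions (interior {0..T} \<times> UNIV)"
  obtains K where "smooth \<psi>" "compact K" "K \<subseteq> {0<..<T} \<times> UNIV" "\<And>z. z \<notin> K \<Longrightarrow> \<psi> z = 0"
  using assms by (auto simp: test_functions_def interior_atLeastAtMost_real)

lemma represents: "represents {0..T} f (\<lambda>t. dist_of (\<lambda>x. f (t, x)))"
  unfolding represents_def
proof
  fix \<psi> assume \<psi>: "\<psi> \<in> test_functions (interior {0..T} \<times> UNIV)"
  then obtain K where K: "smooth \<psi>" "compact K" "K \<subseteq> {0<..<T} \<times> UNIV" "\<And>z. z \<notin> K \<Longrightarrow> \<psi> z = 0"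
    by (rule test_functionE) blast
  have "integrable lborel (\<lambda>z. f z * \<psi> z)"
    by (rule integrable_compact_support[of _ K]) (use K f(1) smooth_continuous[OF K(1)] in \<open>auto intro!: continuous_intros\<close>)
  then have "(LINT z|lborel. f z * \<psi> z) = (LINT t|lborel. LINT x|lborel. f (t, x) * \<psi> (t, x))"
    by (rule lborel_prod_Fubini)
  also have "... = (LINT t:{0..T}|lborel. dist_of (\<lambda>x. f (t, x)) (\<lambda>x. \<psi> (t, x)))"
    unfolding set_lebesgue_integral_def
  proof (rule integral_cong[OF refl])
    fix t
    show "(LINT x|lborel. f (t, x) * \<psi> (t, x)) = indicator {0..T} t *\<^sub>R dist_of (\<lambda>x. f (t, x)) (\<lambda>x. \<psi> (t, x))"
    proof (cases "t \<in> {0..T}")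
      case True
      then show ?thesis using test_function_slice[OF \<psi>] by (simp add: dist_of_def)
    next
      case False
      then have "(t, x) \<notin> K" for x using K(3) by auto
      from K(4)[OF this] False show ?thesis by simp
    qed
  qed
  finally show "(LINT z|lborel. f z * \<psi> z) = (LINT t:{0..T}|lborel. dist_of (\<lambda>x. f (t, x)) (\<lambda>x. \<psi> (t, x)))" .
qed

lemma weak: "weak_gNLW \<omega> p {0..T} f"
  unfolding weak_gNLW_def
proof
  fix \<psi> assume "\<psi> \<in> test_functions (interior {0..T} \<times> UNIV)"
  then obtain K where K: "smooth \<psi>" "compact K" "K \<subseteq> {0<..<T} \<times> UNIV" "\<And>z. z \<notin> K \<Longrightarrow> \<psi> z = 0"
    by (rule test_functionE) blast
  have K': "K \<subseteq> {0<..} \<times> UNIV" using K(3) by auto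
  note cl = compact_imp_closed[OF K(2)]
  have z: "z \<notin> K \<Longrightarrow> dt \<psi> z = 0" "z \<notin> K \<Longrightarrow> dx \<psi> z = 0" for z
    using dt_eq_0_outside[OF cl K(4) _ K(1)] dx_eq_0_outside[OF cl K(4) _ K(1)] by blast+
  have zz: "z \<notin> K \<Longrightarrow> dt (dt \<psi>) z = 0" "z \<notin> K \<Longrightarrow> dx (dt \<psi>) z = 0" "z \<notin> K \<Longrightarrow> dx (dx \<psi>) z = 0" for z
    using dt_eq_0_outside[OF cl z(1) _ smooth_dt[OF K(1)]] dx_eq_0_outside[OF cl z(1) _ smooth_dt[OF K(1)]]
      dx_eq_0_outside[OF cl z(2) _ smooth_dx[OF K(1)]] by blast+
  have c: "continuous_on UNIV (dt (dt \<psi>))" "continuous_on UNIV (dx (dt \<psi>))" "continuous_on UNIV (dx (dx \<psi>))"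
    "continuous_on UNIV (dt \<psi>)" "continuous_on UNIV (dx \<psi>)"
    by (intro smooth_continuous smooth_dt smooth_dx K)+
  have i: "integrable lborel (\<lambda>z. h z * k z)" if "continuous_on UNIV h" "continuous_on UNIV k" "\<And>z. z \<notin> K \<Longrightarrow> k z = 0"
    for h k :: "real \<times> real \<Rightarrow> complex"
    by (rule integrable_compact_support[of _ K]) (use that K in \<open>auto intro!: continuous_intros\<close>)
  have gc: "continuous_on UNIV g" by (rule smooth1_continuous[OF g(1)])
  have gl: "continuous_on UNIV (\<lambda>z. g (snd z + a * fst z))" for a :: real
    by (rule continuous_on_compose2[OF gc]) (auto intro!: continuous_intros)
  \<comment> \<open>For \<open>a\<close> equal to 1 or -1, \<open>box \<psi>\<close> is minus the
    derivative \<open>dt - a * dx\<close> of \<open>dt \<psi> + a * dx \<psi>\<close>. So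
    \<open>free_wave_weak\<close> is used with the test functions \<open>dt \<psi>\<close> and
    \<open>dx \<psi>\<close>.\<close>
  have free: "(LINT z|lborel. g (snd z + a * fst z) * box \<psi> z) = 0" if a: "a = 1 \<or> a = - 1" for a
  proof -
    have 1: "(LINT z|lborel. g (snd z + a * fst z) * (dt (dt \<psi>) z - of_real a * dx (dt \<psi>) z)) = 0"
      by (rule free_wave_weak[OF smooth_dt[OF K(1)] K(2) K' z(1) gc])
    have 2: "(LINT z|lborel. g (snd z + a * fst z) * (dt (dx \<psi>) z - of_real a * dx (dx \<psi>) z)) = 0"
      by (rule free_wave_weak[OF smooth_dx[OF K(1)] K(2) K' z(2) gc])
    have "g (snd z + a * fst z) * box \<psi> z = - (g (snd z + a * fst z) * (dt (dt \<psi>) z - of_real a * dx (dt \<psi>) z))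
       - of_real a * (g (snd z + a * fst z) * (dt (dx \<psi>) z - of_real a * dx (dx \<psi>) z))" for z
      using a unfolding box_def dt_dx_commute[OF K(1)] by (auto simp: algebra_simps)
    then have "(LINT z|lborel. g (snd z + a * fst z) * box \<psi> z)
       = - (LINT z|lborel. g (snd z + a * fst z) * (dt (dt \<psi>) z - of_real a * dx (dt \<psi>) z))
       - of_real a * (LINT z|lborel. g (snd z + a * fst z) * (dt (dx \<psi>) z - of_real a * dx (dx \<psi>) z))"
      unfolding dt_dx_commute[OF K(1)] using zz c gl
      by (simp add: integral_diff i continuous_on_diff continuous_on_mult_left)
    then show ?thesis unfolding 1 2 by simp
  qed
  \<comment> \<open>The two transports are peeled off in turn: the outer one with test functions
    \<open>dt \<psi>\<close> and \<open>dx \<psi>\<close>, the inner one with \<open>\<psi>\<close>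
    itself.\<close>
  have W: "(LINT z|lborel. W z * box \<psi> z) = - (LINT z|lborel. G z * \<psi> z)"
  proof -
    have 1: "(LINT z|lborel. W z * (dt (dt \<psi>) z - of_real (- 1) * dx (dt \<psi>) z)) = - (LINT z|lborel. P z * dt \<psi> z)"
      by (rule transport_weak[OF smooth_dt[OF K(1)] K(2) K' z(1) continuous_PQW(1)])
    have 2: "(LINT z|lborel. W z * (dt (dx \<psi>) z - of_real (- 1) * dx (dx \<psi>) z)) = - (LINT z|lborel. P z * dx \<psi> z)"
      by (rule transport_weak[OF smooth_dx[OF K(1)] K(2) K' z(2) continuous_PQW(1)])
    have 3: "(LINT z|lborel. P z * (dt \<psi> z - of_real 1 * dx \<psi> z)) = - (LINT z|lborel. G z * \<psi> z)"
      by (rule transport_weak[OF K(1) K(2) K' K(4) G(1)])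
    have "W z * box \<psi> z = W z * (dt (dx \<psi>) z - of_real (- 1) * dx (dx \<psi>) z) - W z * (dt (dt \<psi>) z - of_real (- 1) * dx (dt \<psi>) z)" for z
      unfolding box_def dt_dx_commute[OF K(1)] by (simp add: algebra_simps)
    then have "(LINT z|lborel. W z * box \<psi> z) = (LINT z|lborel. W z * (dt (dx \<psi>) z - of_real (- 1) * dx (dx \<psi>) z))
        - (LINT z|lborel. W z * (dt (dt \<psi>) z - of_real (- 1) * dx (dt \<psi>) z))"
      unfolding dt_dx_commute[OF K(1)] using zz c continuous_PQW
      by (simp add: integral_diff i continuous_on_add)
    also have "... = (LINT z|lborel. P z * dt \<psi> z) - (LINT z|lborel. P z * dx \<psi> z)" unfolding 1 2 by simp
    also have "... = (LINT z|lborel. P z * (dt \<psi> z - of_real 1 * dx \<psi> z))"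
      using z c continuous_PQW by (simp add: integral_diff i right_diff_distrib)
    finally show ?thesis unfolding 3 .
  qed
  have box0: "box \<psi> z = 0" if "z \<notin> K" for z using zz[OF that] by (simp add: box_def)
  have boxc: "continuous_on UNIV (box \<psi>)" unfolding box_def[abs_def] by (intro continuous_intros c)
  have "(LINT z|lborel. f z * box \<psi> z)
     = (LINT z|lborel. (1 / 2) * (g (snd z + 1 * fst z) * box \<psi> z) + (1 / 2) * (g (snd z + - 1 * fst z) * box \<psi> z) + W z * box \<psi> z)"
  proof (rule integral_cong[OF refl])
    fix z :: "real \<times> real"
    show "f z * box \<psi> z = (1 / 2) * (g (snd z + 1 * fst z) * box \<psi> z) + (1 / 2) * (g (snd z + - 1 * fst z) * box \<psi> z) + W z * box \<psi> z"
    proof (cases "z \<in> K")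
      case True
      then have "fst z \<in> {0..T}" using K(3) by (cases z) auto
      from f(2)[OF this, of "snd z"] show ?thesis by (simp add: algebra_simps add_divide_distrib)
    qed (simp add: box0)
  qed
  also have "... = (1 / 2) * (LINT z|lborel. g (snd z + 1 * fst z) * box \<psi> z) + (1 / 2) * (LINT z|lborel. g (snd z + - 1 * fst z) * box \<psi> z)
      + (LINT z|lborel. W z * box \<psi> z)"
    by (subst integral_add, (intro integrable_add integrable_mult_right i gl boxc box0 continuous_PQW; assumption)+,
        subst integral_add, (intro integrable_mult_right i gl boxc box0; assumption)+) (simp only: integral_mult_right_zero)
  also have "... = - (LINT z|lborel. G z * \<psi> z)" unfolding W free[OF disjI1[OF refl]] free[OF disjI2[OF refl]] by simp
  also have "... = (LINT z|lborel. of_real \<omega> * (of_real (cmod (f z) powr (p - 1)) * f z * \<psi> z))"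
  proof -
    have "G z * \<psi> z = - (of_real \<omega> * (of_real (cmod (f z) powr (p - 1)) * f z * \<psi> z))" for z
    proof (cases "z \<in> K")
      case True
      then have "fst z \<in> {0..T}" using K(3) by (cases z) auto
      from G(3)[OF this, of "snd z"] show ?thesis by simp
    qed (simp add: K(4))
    then show ?thesis by simp
  qed
  finally show "(LINT z|lborel. f z * box \<psi> z) = of_real \<omega> * (LINT z|lborel. of_real (cmod (f z) powr (p - 1)) * f z * \<psi> z)"
    by simp
qed

lemma f_Lp_loc: "f \<in> Lp_loc p {0..T}"
  unfolding Lp_loc_def
proof (intro CollectI conjI allI impI)
  show "f \<in> borel_measurable lborel" using borel_measurable_continuous_onI[OF f(1)] by simp
  fix K :: "(real \<times> real) set" assume K: "compact K \<and> K \<subseteq> {0..T} \<times> UNIV"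
  have "continuous_on K (\<lambda>z. cmod (f z) powr p)"
    using p by (intro continuous_on_powr' continuous_intros continuous_on_subset[OF f(1)]) auto
  then show "set_integrable lborel K (\<lambda>z. cmod (f z) powr p)"
    unfolding set_integrable_def using K by (intro borel_integrable_compact) auto
qed

lemma v_0: "dist_of (v 0) = zero_dist"
  unfolding zero_dist_eq by (rule arg_cong[of _ _ dist_of]) (auto simp: v_def transport_initial)

lemma f_0: "f (0, x) = g x"
  using T by (simp add: f(2) transport_initial)

theorem solution: "s < 1 / 2 \<Longrightarrow> gNLW_solution \<omega> p s {0..T} (\<lambda>t. dist_of (\<lambda>x. f (t, x))) (\<lambda>t. dist_of (v t))"
  unfolding gNLW_solution_def using regularity T f_Lp_loc represents weak by (auto intro!: is_interval_cc)

end

section \<open>The nonlinearity\<close>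

definition power_nl :: "real \<Rightarrow> real \<Rightarrow> real" where
  "power_nl p r = \<bar>r\<bar> powr (p - 1) * r"

lemma power_nl_0 [simp]: "power_nl p 0 = 0"
  by (simp add: power_nl_def)

lemma power_nl_nonneg: "0 \<le> r \<Longrightarrow> power_nl p r = r powr p"
  by (cases "r = 0") (simp_all add: power_nl_def powr_diff)

lemma abs_power_nl: "\<bar>power_nl p r\<bar> = \<bar>r\<bar> powr p"
  using power_nl_nonneg[of "\<bar>r\<bar>" p] by (simp add: power_nl_def abs_mult)

lemma power_nl_has_deriv:
  assumes p: "p > 1"
  shows "(power_nl p has_real_derivative p * \<bar>r\<bar> powr (p - 1)) (at r)"
proof -
  consider "r > 0" | "r < 0" | "r = 0" by linarith
  then show ?thesis
  proof cases
    case 1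
    have "((\<lambda>r. r powr p) has_real_derivative p * r powr (p - 1)) (at r)" by (rule has_real_derivative_powr[OF 1])
    then show ?thesis
      by (rule has_field_derivative_transform_within_open[of _ _ _ "{0<..}", THEN DERIV_cong]) (use 1 in \<open>auto simp: power_nl_nonneg\<close>)
  next
    case 2
    have "((\<lambda>r. - ((- r) powr p)) has_real_derivative p * (- r) powr (p - 1)) (at r)"
      using 2 by (auto intro!: derivative_eq_intros)
    then show ?thesis
      by (rule has_field_derivative_transform_within_open[of _ _ _ "{..<0}", THEN DERIV_cong])
        (use 2 in \<open>auto simp: power_nl_def powr_diff\<close>)
  next
    case 3
    have "((\<lambda>h. \<bar>h\<bar> powr (p - 1)) \<longlongrightarrow> \<bar>0\<bar> powr (p - 1)) (at (0::real))"
      using p by (intro tendsto_powr' tendsto_intros) auto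
    then have "((\<lambda>h. (power_nl p (0 + h) - power_nl p 0) / h) \<longlongrightarrow> 0) (at 0)"
      by (rule Lim_transform_eventually[OF tendsto_eq_rhs]) (use p in \<open>auto simp: eventually_at_filter power_nl_def\<close>)
    then show ?thesis using 3 p by (simp add: DERIV_def)
  qed
qed

lemma continuous_power_nl: "p > 1 \<Longrightarrow> continuous_on UNIV (power_nl p)"
  by (intro continuous_at_imp_continuous_on ballI DERIV_isCont[OF power_nl_has_deriv])

lemma power_nl_lipschitz:
  assumes p: "p > 1" and ab: "\<bar>a\<bar> \<le> M" "\<bar>b\<bar> \<le> M"
  shows "\<bar>power_nl p a - power_nl p b\<bar> \<le> p * M powr (p - 1) * \<bar>a - b\<bar>"
proof -
  have "norm (power_nl p a - power_nl p b) \<le> p * M powr (p - 1) * \<bar>a - b\<bar>"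
  proof (rule has_vector_derivative_lipschitz[of "{- M..M}" _ "\<lambda>r. p * \<bar>r\<bar> powr (p - 1)"])
    show "(power_nl p has_vector_derivative p * \<bar>r\<bar> powr (p - 1)) (at r within {- M..M})" for r
      using power_nl_has_deriv[OF p, of r]
      by (simp add: has_real_derivative_iff_has_vector_derivative has_vector_derivative_at_within)
    show "norm (p * \<bar>r\<bar> powr (p - 1)) \<le> p * M powr (p - 1)" if "r \<in> {- M..M}" for r
      using that p by (auto simp: abs_mult intro!: powr_mono2)
  qed (use ab in auto)
  then show ?thesis by simp
qed

text \<open>Goes through the maximum of the three terms. Convexity would not do, because the
  exponent \<open>p - 1\<close> may be below one.\<close>

lemma powr_sum3_le:
  fixes a b c q :: real
  assumes "0 \<le> a" "0 \<le> b" "0 \<le> c" "0 < q"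
  shows "(a + b + c) powr q \<le> 3 powr q * (a powr q + b powr q + c powr q)"
proof -
  define m where "m = max a (max b c)"
  have "(a + b + c) powr q \<le> (3 * m) powr q" using assms by (intro powr_mono2) (auto simp: m_def)
  also have "... = 3 powr q * m powr q" by (rule powr_mult)
  also have "m powr q \<le> a powr q + b powr q + c powr q"
    unfolding m_def max_def by (auto intro: add_nonneg_nonneg)
  finally show ?thesis by simp
qed

section \<open>The Duhamel operator in physical space\<close>

definition Wop :: "(real \<times> real \<Rightarrow> real) \<Rightarrow> real \<times> real \<Rightarrow> real" where
  "Wop G = transport (- 1) (transport 1 G)"

lemma transport_mono:
  fixes G H :: "real \<times> real \<Rightarrow> real"
  assumes "continuous_on UNIV G" "continuous_on UNIV H" "\<And>s y. 0 \<le> s \<Longrightarrow> s \<le> t \<Longrightarrow> \<bar>G (s, y)\<bar> \<le> H (s, y)"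
  shows "\<bar>transport c G (t, x)\<bar> \<le> transport c H (t, x)"
proof -
  have "\<bar>transport c G (t, x)\<bar> \<le> (LINT s|lborel. norm (indicator {0..t} s *\<^sub>R G (s, x + c * (t - s))))"
    unfolding transport_def fst_conv snd_conv using integral_norm_bound by (simp only: real_norm_def[symmetric])
  also have "... \<le> (LINT s|lborel. indicator {0..t} s *\<^sub>R H (s, x + c * (t - s)))"
    using assms(3) by (intro integral_mono integrable_norm transport_integrable assms) (auto simp: indicator_def)
  finally show ?thesis unfolding transport_def by simp
qed

lemma transport_add:
  fixes G H :: "real \<times> real \<Rightarrow> real"
  assumes "continuous_on UNIV G" "continuous_on UNIV H"
  shows "transport c (\<lambda>z. G z + H z) z = transport c G z + transport c H z"
  unfolding transport_def scaleR_add_right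
  by (rule integral_add) (intro transport_integrable assms)+

lemma transport_cmult:
  fixes G :: "real \<times> real \<Rightarrow> real"
  shows "transport c (\<lambda>z. a * G z) z = a * transport c G z"
  unfolding transport_def integral_mult_right_zero[symmetric] by (simp add: mult_ac)

lemma continuous_Wop: "continuous_on UNIV G \<Longrightarrow> continuous_on UNIV (Wop G)"
  unfolding Wop_def by (intro continuous_transport)

lemma Wop_mono:
  assumes "continuous_on UNIV G" "continuous_on UNIV H" "\<And>s y. 0 \<le> s \<Longrightarrow> s \<le> t \<Longrightarrow> \<bar>G (s, y)\<bar> \<le> H (s, y)"
  shows "\<bar>Wop G (t, x)\<bar> \<le> Wop H (t, x)"
  unfolding Wop_def
  by (rule transport_mono[OF continuous_transport[OF assms(1)] continuous_transport[OF assms(2)]])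
    (rule transport_mono[OF assms(1,2)], use assms(3) in auto)

lemma Wop_add:
  assumes "continuous_on UNIV G" "continuous_on UNIV H"
  shows "Wop (\<lambda>z. G z + H z) z = Wop G z + Wop H z"
  unfolding Wop_def transport_add[OF assms, abs_def]
  by (rule transport_add) (intro continuous_transport assms)+

lemma Wop_cmult: "Wop (\<lambda>z. a * G z) z = a * Wop G z"
  unfolding Wop_def transport_cmult[abs_def] by (rule refl)

lemma Wop_diff:
  assumes "continuous_on UNIV G" "continuous_on UNIV H"
  shows "Wop (\<lambda>z. G z - H z) z = Wop G z - Wop H z"
  using Wop_add[OF assms(1), of "\<lambda>z. - 1 * H z" z] Wop_cmult[of "- 1" H z] assms
  by (simp add: continuous_on_minus)

lemma Wop_support:
  assumes "\<And>s y. 0 \<le> s \<Longrightarrow> s \<le> t \<Longrightarrow> \<bar>y\<bar> > R + s \<Longrightarrow> G (s, y) = 0" "\<bar>x\<bar> > R + t"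
  shows "Wop G (t, x) = 0"
  unfolding Wop_def
  by (rule transport_support[of t R]) (use assms in \<open>auto intro!: transport_support[of _ R]\<close>)

text \<open>A wave moving against the characteristic is swept at double speed. This is the origin of
  windows of length \<open>2 * T\<close> and of the factor one half.\<close>

lemma integral_double_speed:
  fixes k :: "real \<Rightarrow> real"
  shows "(LINT r|lborel. indicator {0..s} r * k (y + 2 * r)) = (LINT z|lborel. indicator {y..y + 2 * s} z * k z) / 2"
proof -
  have "(LINT z|lborel. indicator {y..y + 2 * s} z * k z)
     = \<bar>2\<bar> *\<^sub>R (LINT r|lborel. indicator {y..y + 2 * s} (y + 2 * r) * k (y + 2 * r))"
    by (rule lborel_integral_real_affine) simp
  also have "(\<lambda>r. indicator {y..y + 2 * s} (y + 2 * r) * k (y + 2 * r)) = (\<lambda>r. indicator {0..s} r * k (y + 2 * r))"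
    by (auto simp: indicator_def)
  finally show ?thesis by simp
qed

lemma integral_reflect_interval:
  fixes k :: "real \<Rightarrow> real"
  shows "(LINT r|lborel. indicator {0..s} r * k (y + s - 2 * r)) = (LINT r|lborel. indicator {0..s} r * k (y - s + 2 * r))"
proof -
  have "(LINT r|lborel. indicator {0..s} r * k (y + s - 2 * r))
     = \<bar>- 1\<bar> *\<^sub>R (LINT r|lborel. indicator {0..s} (s + - 1 * r) * k (y + s - 2 * (s + - 1 * r)))"
    by (rule lborel_integral_real_affine) simp
  also have "(\<lambda>r. indicator {0..s} (s + - 1 * r) * k (y + s - 2 * (s + - 1 * r))) = (\<lambda>r. indicator {0..s} r * k (y - s + 2 * r))"
    by (auto simp: indicator_def algebra_simps)
  finally show ?thesis by simp
qed

lemma window_bound: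
  fixes k :: "real \<Rightarrow> real"
  assumes k: "continuous_on UNIV k" "\<And>x. 0 \<le> k x"
    and m: "\<And>a. (LINT x|lborel. indicator {a..a + 2 * T} x * k x) \<le> m" and s: "s \<le> T"
  shows "(LINT r|lborel. indicator {0..s} r * k (y + 2 * r)) \<le> m / 2"
proof -
  have i: "integrable lborel (\<lambda>x. indicator {a..b} x * k x)" for a b
    using integrable_Icc_continuous[OF continuous_on_subset[OF k(1)], of a b] by simp
  have "(LINT z|lborel. indicator {y..y + 2 * s} z * k z) \<le> (LINT z|lborel. indicator {y..y + 2 * T} z * k z)"
    using s k(2) by (intro integral_mono i) (auto simp: indicator_def)
  also have "... \<le> m" by (rule m)
  finally show ?thesis unfolding integral_double_speed by simp
qed

text \<open>Turns local integrals into a pointwise bound. Each of the two waves is constant along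
  one family of characteristics and swept at double speed along the other, so one of the two
  integrations sees a window of \<open>k\<close> while the other costs a factor of at most
  \<open>T\<close>.\<close>

lemma Wop_window_bound:
  fixes k :: "real \<Rightarrow> real"
  assumes k: "continuous_on UNIV k" "\<And>x. 0 \<le> k x" and c: "0 \<le> c" and t: "t \<in> {0..T}"
    and m: "\<And>a. (LINT x|lborel. indicator {a..a + 2 * T} x * k x) \<le> m"
  shows "Wop (\<lambda>z. k (snd z + fst z) + k (snd z - fst z) + c) (t, x) \<le> T * m + T^2 * c"
proof -
  have kc: "continuous_on A (\<lambda>z. k (f z))" if "continuous_on A f" for f :: "'a::topological_space \<Rightarrow> real" and A
    by (rule continuous_on_compose2[OF k(1) that]) auto
  have i: "integrable lborel (\<lambda>x. indicator {a..b} x * q x)" if "continuous_on UNIV q" for a b and q :: "real \<Rightarrow> real"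
    using integrable_Icc_continuous[OF continuous_on_subset[OF that], of a b] by simp
  let ?H = "\<lambda>z. k (snd z + fst z) + k (snd z - fst z) + c"
  let ?K = "\<lambda>z. T * k (snd z + fst z) + (m / 2 + c * T)"
  have ic: "(LINT r|lborel. indicator {0..s} r * a) = s * a" if "0 \<le> s" for s a :: real
    using that by simp
  have t0: "0 \<le> t" using t by simp
  have m0: "0 \<le> m" using m[of 0] by (rule order_trans[rotated]) (auto intro!: integral_nonneg_AE simp: k(2))
  have "\<bar>Wop ?H (t, x)\<bar> \<le> transport (- 1) ?K (t, x)"
    unfolding Wop_def
  proof (rule transport_mono)
    show "continuous_on UNIV (transport 1 ?H)" by (intro continuous_transport continuous_intros kc)
    show "continuous_on UNIV ?K" by (intro continuous_intros kc)
    fix s y assume s: "0 \<le> s" "s \<le> t"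
    have "transport 1 ?H (s, y) = (LINT r|lborel. indicator {0..s} r * k (y + s) + (indicator {0..s} r * k (y + s - 2 * r) + indicator {0..s} r * c))"
      unfolding transport_def by (intro integral_cong) (auto simp: algebra_simps)
    also have "... = s * k (y + s) + ((LINT r|lborel. indicator {0..s} r * k (y + s - 2 * r)) + s * c)"
      using s by (subst integral_add, (intro i integrable_add continuous_intros kc)+,
          subst integral_add, (intro i continuous_intros kc)+, simp only: ic)
    also have "(LINT r|lborel. indicator {0..s} r * k (y + s - 2 * r)) \<le> m / 2"
      unfolding integral_reflect_interval by (rule window_bound[OF k m]) (use s t in auto)
    finally have "transport 1 ?H (s, y) \<le> s * k (y + s) + (m / 2 + s * c)" by simp
    also have "... \<le> T * k (y + s) + (m / 2 + c * T)"
      using s t k(2) c by (intro add_mono mult_right_mono) (auto simp: mult.commute[of c T] intro!: mult_right_mono)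
    finally have "transport 1 ?H (s, y) \<le> ?K (s, y)" by simp
    moreover have "0 \<le> transport 1 ?H (s, y)"
      unfolding transport_def using k(2) c by (intro integral_nonneg_AE AE_I2) auto
    ultimately show "\<bar>transport 1 ?H (s, y)\<bar> \<le> ?K (s, y)" by simp
  qed
  also have "transport (- 1) ?K (t, x) = (LINT s|lborel. T * (indicator {0..t} s * k (x - t + 2 * s)) + indicator {0..t} s * (m / 2 + c * T))"
    unfolding transport_def by (intro integral_cong) (auto simp: algebra_simps)
  also have "... = T * (LINT s|lborel. indicator {0..t} s * k (x - t + 2 * s)) + t * (m / 2 + c * T)"
    using t by (subst integral_add, (intro i integrable_mult_right continuous_intros kc)+, simp only: ic[OF t0] integral_mult_right_zero)
  also have "... \<le> T * (m / 2) + T * (m / 2 + c * T)"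
    using t c m0 by (intro add_mono mult_left_mono mult_right_mono window_bound[OF k m]) auto
  also have "... = T * m + T^2 * c" by (simp add: algebra_simps power2_eq_square)
  finally show ?thesis by simp
qed

text \<open>An exact formula, needed for the lower bound: the inner integration runs along lines on
  which the wave is constant, which yields the factor \<open>s\<close>.\<close>

lemma Wop_travelling:
  fixes k :: "real \<Rightarrow> real"
  assumes t: "0 \<le> t"
  shows "Wop (\<lambda>z. k (snd z + fst z)) (t, x) = (LINT s|lborel. indicator {0..t} s * (s * k (x - t + 2 * s)))"
proof -
  have 1: "transport 1 (\<lambda>z. k (snd z + fst z)) (s, y) = s * k (y + s)" if "0 \<le> s" for s y
  proof -
    have "transport 1 (\<lambda>z. k (snd z + fst z)) (s, y) = (LINT r|lborel. indicator {0..s} r * k (y + s))"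
      unfolding transport_def by (intro integral_cong) (auto simp: algebra_simps)
    then show ?thesis using that by simp
  qed
  show ?thesis
    unfolding Wop_def transport_def[of "- 1"] fst_conv snd_conv
  proof (rule integral_cong[OF refl])
    fix s
    show "indicator {0..t} s *\<^sub>R transport 1 (\<lambda>z. k (snd z + fst z)) (s, x + - 1 * (t - s)) = indicator {0..t} s * (s * k (x - t + 2 * s))"
      using 1[of s "x + - 1 * (t - s)"] by (cases "s \<in> {0..t}") (auto simp: algebra_simps)
  qed
qed

section \<open>Small data in the sense of local integrals\<close>

text \<open>\<open>\<rho>\<close> is the radius of the ball in which the correction is sought. The
  first condition in \<open>small\<close> makes the fixed point map preserve this ball, the second
  makes it contract by one half; \<open>\<kappa>\<close> and \<open>e\<close> are the window bounds
  that enter them.\<close>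

locale small_data =
  fixes \<omega> p T R \<rho> \<kappa> e :: real and h :: "real \<Rightarrow> real"
  assumes \<omega>: "\<bar>\<omega>\<bar> = 1" and p: "1 < p" and T: "0 < T" and \<rho>: "0 < \<rho>"
    and h: "smooth1 (cplx h)" "\<And>x. 0 \<le> h x" "\<And>x. \<bar>x\<bar> > R \<Longrightarrow> h x = 0"
    and window: "\<And>a. (LINT x|lborel. indicator {a..a + 2 * T} x * h x powr p) \<le> \<kappa>"
      "\<And>a. (LINT x|lborel. indicator {a..a + 2 * T} x * h x powr (p - 1)) \<le> e"
    and small: "3 powr p * (T * \<kappa> + T^2 * \<rho> powr p) \<le> \<rho>"
      "p * 3 powr (p - 1) * (T * e + T^2 * \<rho> powr (p - 1)) \<le> 1 / 2"
begin

text \<open>Freezes time outside \<open>{0..T}\<close>, so that the fixed point can be sought among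
  bounded continuous functions on the whole plane.\<close>

definition clamp :: "real \<times> real \<Rightarrow> real \<times> real" where
  "clamp z = (max 0 (min T (fst z)), snd z)"

definition U :: "real \<times> real \<Rightarrow> real" where
  "U z = (h (snd z + fst z) + h (snd z - fst z)) / 2"

definition source :: "(real \<times> real \<Rightarrow> real) \<Rightarrow> real \<times> real \<Rightarrow> real" where
  "source w z = - \<omega> * power_nl p (U (clamp z) + w (clamp z))"

lemma clamp_id: "t \<in> {0..T} \<Longrightarrow> clamp (t, x) = (t, x)"
  by (auto simp: clamp_def)

lemma clamp_range: "fst (clamp z) \<in> {0..T}"
  using T by (auto simp: clamp_def)

lemma continuous_clamp: "continuous_on UNIV clamp"
  unfolding clamp_def[abs_def] by (intro continuous_intros)

lemma continuous_h: "continuous_on UNIV h"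
proof -
  have "continuous_on UNIV (\<lambda>x. Re (complex_of_real (h x)))"
    by (intro continuous_intros smooth1_continuous h)
  then show ?thesis by simp
qed

lemma continuous_h_compose: "continuous_on A f \<Longrightarrow> continuous_on A (\<lambda>z. h (f z))"
  by (rule continuous_on_compose2[OF continuous_h]) auto

lemma continuous_U: "continuous_on UNIV U"
  unfolding U_def[abs_def] by (intro continuous_intros continuous_h_compose) auto

lemma continuous_source:
  assumes "continuous_on UNIV w" shows "continuous_on UNIV (source w)"
proof -
  have "continuous_on UNIV (\<lambda>z. U (clamp z) + w (clamp z))"
    by (intro continuous_intros continuous_on_compose2[OF continuous_U continuous_clamp] continuous_on_compose2[OF assms continuous_clamp]) auto
  from continuous_on_compose2[OF continuous_power_nl[OF p] this]
  have "continuous_on UNIV (\<lambda>z. power_nl p (U (clamp z) + w (clamp z)))" by simp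
  then show ?thesis unfolding source_def[abs_def] by (intro continuous_intros)
qed

lemma U_nonneg: "0 \<le> U z"
  by (simp add: U_def h)

lemma U_support: "0 \<le> t \<Longrightarrow> \<bar>x\<bar> > R + t \<Longrightarrow> U (t, x) = 0"
  by (simp add: U_def h)

text \<open>Dominates \<open>(U z + \<rho>) powr q\<close> up to the factor \<open>3 powr q\<close>,
  and has the form to which \<open>Wop_window_bound\<close> applies.\<close>

definition majorant :: "real \<Rightarrow> real \<times> real \<Rightarrow> real" where
  "majorant q z = h (snd z + fst z) powr q + h (snd z - fst z) powr q + \<rho> powr q"

lemma majorant_nonneg: "0 \<le> majorant q z"
  by (simp add: majorant_def)

lemma continuous_powr_h: "0 < q \<Longrightarrow> continuous_on UNIV (\<lambda>x. h x powr q)"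
  by (intro continuous_on_powr' continuous_h continuous_intros) (auto simp: h)

lemma continuous_majorant: "0 < q \<Longrightarrow> continuous_on UNIV (majorant q)"
  unfolding majorant_def[abs_def]
  by (intro continuous_intros continuous_on_compose2[OF continuous_powr_h]) auto

lemma U_majorant:
  assumes "0 < q" shows "(U z + \<rho>) powr q \<le> 3 powr q * majorant q z"
proof -
  have "(U z + \<rho>) powr q \<le> (h (snd z + fst z) + h (snd z - fst z) + \<rho>) powr q"
    using h(2) \<rho> assms by (intro powr_mono2) (auto simp: U_def intro!: add_nonneg_nonneg)
  also have "... \<le> 3 powr q * majorant q z"
    unfolding majorant_def using h(2) \<rho> assms by (intro powr_sum3_le) auto
  finally show ?thesis .
qed

lemma Wop_majorant:
  assumes t: "t \<in> {0..T}"
  shows "Wop (majorant p) (t, x) \<le> T * \<kappa> + T^2 * \<rho> powr p"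
    "Wop (majorant (p - 1)) (t, x) \<le> T * e + T^2 * \<rho> powr (p - 1)"
  unfolding majorant_def[abs_def]
  using p by (intro Wop_window_bound[OF continuous_powr_h] t window; simp)+

lemma Wop_source_bound:
  assumes w: "continuous_on UNIV w" "\<And>z. \<bar>w z\<bar> \<le> \<rho>" and t: "t \<in> {0..T}"
  shows "\<bar>Wop (source w) (t, x)\<bar> \<le> \<rho>"
proof -
  have "\<bar>Wop (source w) (t, x)\<bar> \<le> Wop (\<lambda>z. 3 powr p * majorant p z) (t, x)"
  proof (rule Wop_mono[OF continuous_source[OF w(1)]])
    show "continuous_on UNIV (\<lambda>z. 3 powr p * majorant p z)" using p by (intro continuous_intros continuous_majorant) auto
    fix s y assume s: "0 \<le> s" "s \<le> t"
    then have c: "clamp (s, y) = (s, y)" using t by (intro clamp_id) auto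
    have "\<bar>source w (s, y)\<bar> = \<bar>U (s, y) + w (s, y)\<bar> powr p" by (simp add: source_def c abs_mult \<omega> abs_power_nl)
    also have "... \<le> (U (s, y) + \<rho>) powr p"
      using U_nonneg[of "(s, y)"] w(2)[of "(s, y)"] p by (intro powr_mono2) (auto simp: abs_le_iff)
    also have "... \<le> 3 powr p * majorant p (s, y)" using p by (intro U_majorant) auto
    finally show "\<bar>source w (s, y)\<bar> \<le> 3 powr p * majorant p (s, y)" .
  qed
  also have "... \<le> 3 powr p * (T * \<kappa> + T^2 * \<rho> powr p)"
    unfolding Wop_cmult by (intro mult_left_mono Wop_majorant t) auto
  finally show ?thesis using small by simp
qed

text \<open>The local Lipschitz constant of the nonlinearity is
  \<open>p * (U z + \<rho>) powr (p - 1)\<close>, which is where the L^(p-1) windows come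
  in.\<close>

lemma Wop_source_diff:
  assumes w: "continuous_on UNIV w" "\<And>z. \<bar>w z\<bar> \<le> \<rho>" and w': "continuous_on UNIV w'" "\<And>z. \<bar>w' z\<bar> \<le> \<rho>"
    and d: "\<And>z. \<bar>w z - w' z\<bar> \<le> d" and t: "t \<in> {0..T}"
  shows "\<bar>Wop (source w) (t, x) - Wop (source w') (t, x)\<bar> \<le> d * (p * 3 powr (p - 1) * (T * e + T^2 * \<rho> powr (p - 1)))"
proof -
  have d0: "0 \<le> d" using d[of "(0, 0)"] by linarith
  have "\<bar>Wop (source w) (t, x) - Wop (source w') (t, x)\<bar> = \<bar>Wop (\<lambda>z. source w z - source w' z) (t, x)\<bar>"
    by (simp add: Wop_diff continuous_source w w')
  also have "... \<le> Wop (\<lambda>z. (d * p * 3 powr (p - 1)) * majorant (p - 1) z) (t, x)"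
  proof (rule Wop_mono)
    show "continuous_on UNIV (\<lambda>z. source w z - source w' z)" by (intro continuous_intros continuous_source w w')
    show "continuous_on UNIV (\<lambda>z. (d * p * 3 powr (p - 1)) * majorant (p - 1) z)"
      using p by (intro continuous_intros continuous_majorant) auto
    fix s y assume s: "0 \<le> s" "s \<le> t"
    then have c: "clamp (s, y) = (s, y)" using t by (intro clamp_id) auto
    let ?z = "(s, y)"
    have "\<bar>source w ?z - source w' ?z\<bar> = \<bar>power_nl p (U ?z + w ?z) - power_nl p (U ?z + w' ?z)\<bar>"
      unfolding source_def c right_diff_distrib[symmetric] abs_mult using \<omega> by simp
    also have "... \<le> p * (U ?z + \<rho>) powr (p - 1) * \<bar>(U ?z + w ?z) - (U ?z + w' ?z)\<bar>"
      using U_nonneg[of ?z] w(2)[of ?z] w'(2)[of ?z] by (intro power_nl_lipschitz p) (auto simp: abs_le_iff)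
    also have "... \<le> p * (3 powr (p - 1) * majorant (p - 1) ?z) * d"
      using p d[of ?z] d0 U_majorant[of "p - 1" ?z] majorant_nonneg[of "p - 1" ?z] by (intro mult_mono) auto
    also have "... = (d * p * 3 powr (p - 1)) * majorant (p - 1) ?z" by simp
    finally show "\<bar>source w ?z - source w' ?z\<bar> \<le> (d * p * 3 powr (p - 1)) * majorant (p - 1) ?z" .
  qed
  also have "... \<le> (d * p * 3 powr (p - 1)) * (T * e + T^2 * \<rho> powr (p - 1))"
    unfolding Wop_cmult using d0 p by (intro mult_left_mono Wop_majorant t) auto
  finally show ?thesis by (simp add: mult_ac)
qed

text \<open>Banach's theorem for the correction alone, in the sup norm. The free wave stays outside
  the unknown, because it is controlled through window integrals and not through its size.\<close>

lemma fixed_point: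
  obtains w where "continuous_on UNIV w" "\<And>z. \<bar>w z\<bar> \<le> \<rho>" "\<And>t x. t \<in> {0..T} \<Longrightarrow> \<bar>x\<bar> > R + t \<Longrightarrow> w (t, x) = 0"
    "\<And>t x. t \<in> {0..T} \<Longrightarrow> w (t, x) = Wop (source w) (t, x)"
proof -
  \<comment> \<open>Pointwise constraints: values of modulus at most \<open>\<rho>\<close> inside
    the light cone, zero outside. They make \<open>S\<close> closed and build finite speed of
    propagation into the fixed point.\<close>
  define X where "X z = (if \<bar>snd z\<bar> > R + fst (clamp z) then {0} else {- \<rho>..\<rho>})" for z
  define S where "S = PiC (UNIV :: (real \<times> real) set) X"
  define A where "A w = Bcontfun (\<lambda>z. Wop (source (apply_bcontfun w)) (clamp z))" for w :: "(real \<times> real) \<Rightarrow>\<^sub>C real"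
  have S: "continuous_on UNIV (apply_bcontfun w)" "\<bar>w z\<bar> \<le> \<rho>" "\<bar>snd z\<bar> > R + fst (clamp z) \<Longrightarrow> w z = 0" if "w \<in> S" for w z
  proof -
    have "w z \<in> X z" using that unfolding S_def mem_PiC_iff by auto
    then show "\<bar>w z\<bar> \<le> \<rho>" "\<bar>snd z\<bar> > R + fst (clamp z) \<Longrightarrow> w z = 0"
      using \<rho> by (auto simp: X_def abs_le_iff split: if_splits)
  qed auto
  have A: "apply_bcontfun (A w) z = Wop (source (apply_bcontfun w)) (clamp z)" "\<bar>Wop (source (apply_bcontfun w)) (clamp z)\<bar> \<le> \<rho>"
    if "w \<in> S" for w z
  proof -
    have b: "\<bar>Wop (source (apply_bcontfun w)) (clamp z)\<bar> \<le> \<rho>" for z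
      using Wop_source_bound[OF S(1,2)[OF that] clamp_range[of z], of "snd (clamp z)"] by simp
    then show "\<bar>Wop (source (apply_bcontfun w)) (clamp z)\<bar> \<le> \<rho>" .
    have "(\<lambda>z. Wop (source (apply_bcontfun w)) (clamp z)) \<in> bcontfun"
      by (rule bcontfun_normI[of _ \<rho>])
        (use b continuous_on_compose2[OF continuous_Wop[OF continuous_source[OF S(1)[OF that]]] continuous_clamp] in auto)
    then show "apply_bcontfun (A w) z = Wop (source (apply_bcontfun w)) (clamp z)"
      unfolding A_def by (simp add: Bcontfun_inverse)
  qed
  have "\<exists>!w. w \<in> S \<and> A w = w"
  proof (rule Banach_fix)
    show "complete S" unfolding S_def complete_eq_closed by (rule closed_PiC) (auto simp: X_def)
    show "S \<noteq> {}"
    proof -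
      have "const_bcontfun 0 \<in> S" unfolding S_def mem_PiC_iff using \<rho> by (auto simp: X_def)
      then show ?thesis by blast
    qed
    show "A ` S \<subseteq> S"
    proof (rule image_subsetI)
      fix w assume w: "w \<in> S"
      have "A w z \<in> X z" for z
      proof (cases "\<bar>snd z\<bar> > R + fst (clamp z)")
        case True
        have "Wop (source (apply_bcontfun w)) (fst (clamp z), snd z) = 0"
        proof (rule Wop_support)
          show "source (apply_bcontfun w) (s, y) = 0" if "0 \<le> s" "s \<le> fst (clamp z)" "\<bar>y\<bar> > R + s" for s y
          proof -
            have c: "clamp (s, y) = (s, y)" using that clamp_range[of z] by (intro clamp_id) auto
            then show ?thesis using that S(3)[OF w, of "(s, y)"] U_support[of s y] by (simp add: source_def)
          qed
        qed (rule True)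
        then show ?thesis using True A[OF w, of z] by (simp add: X_def clamp_def)
      next
        case False
        then show ?thesis using A[OF w, of z] by (auto simp: X_def abs_le_iff)
      qed
      then show "A w \<in> S" unfolding S_def mem_PiC_iff by auto
    qed
    show "dist (A w) (A w') \<le> 1 / 2 * dist w w'" if w: "w \<in> S" "w' \<in> S" for w w'
    proof (rule dist_bound)
      fix z
      have "\<bar>Wop (source (apply_bcontfun w)) (fst (clamp z), snd (clamp z)) - Wop (source (apply_bcontfun w')) (fst (clamp z), snd (clamp z))\<bar>
         \<le> dist w w' * (p * 3 powr (p - 1) * (T * e + T^2 * \<rho> powr (p - 1)))"
        using dist_bounded[of w _ w']
        by (intro Wop_source_diff S(1,2)[OF w(1)] S(1,2)[OF w(2)] clamp_range) (auto simp: dist_real_def)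
      also have "... \<le> dist w w' * (1 / 2)" by (intro mult_left_mono small) auto
      finally show "dist (A w z) (A w' z) \<le> 1 / 2 * dist w w'"
        unfolding A(1)[OF w(1)] A(1)[OF w(2)] by (simp add: dist_real_def)
    qed
  qed auto
  then obtain w where w: "w \<in> S" "A w = w" by blast
  show ?thesis
  proof (rule that[of "apply_bcontfun w"])
    show "w (t, x) = 0" if "t \<in> {0..T}" "\<bar>x\<bar> > R + t" for t x
      using S(3)[OF w(1), of "(t, x)"] clamp_id[OF that(1)] that by simp
    show "w (t, x) = Wop (source (apply_bcontfun w)) (t, x)" if "t \<in> {0..T}" for t x
      using A(1)[OF w(1), of "(t, x)"] clamp_id[OF that] w(2) by simp
  qed (use S[OF w(1)] in auto)
qed

end

section \<open>Lower bounds for Sobolev norms\<close>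

lemma ramp_mono: "x \<le> y \<Longrightarrow> ramp x \<le> ramp y"
  by (auto simp: ramp_def frac_le)

definition bump_floor :: real where
  "bump_floor = ramp (1 / 4) * ramp (1 / 4)"

lemma bump_floor_pos: "0 < bump_floor"
  by (simp add: bump_floor_def ramp_simps)

lemma bump_ge_floor: "1 / 4 \<le> x \<Longrightarrow> x \<le> 3 / 4 \<Longrightarrow> bump_floor \<le> bump x"
  unfolding bump_floor_def bump_def by (intro mult_mono ramp_mono ramp_simps) auto

lemma schwartz_bump: "(cplx bump) \<in> schwartz"
  by (rule schwartz_compact_support[OF smooth1_bump, of 0 1]) (simp add: bump_simps)

lemma schwartz_bump_scaled: "\<Lambda> > 0 \<Longrightarrow> (\<lambda>x. complex_of_real (bump (x / \<Lambda>))) \<in> schwartz"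
  using schwartz_scale[OF schwartz_bump, of "1 / \<Lambda>"] by simp

lemma inv_fourier_bump_scaled:
  assumes "\<Lambda> > 0"
  shows "inv_fourier (\<lambda>x. complex_of_real (bump (x / \<Lambda>))) \<xi> = of_real \<Lambda> * inv_fourier (cplx bump) (\<Lambda> * \<xi>)"
  unfolding inv_fourier_def using fourier_scale[OF assms, of "cplx bump" "- \<xi>"] by simp

text \<open>A bump dilated by \<open>\<Lambda> \<ge> 1\<close> concentrates at frequencies of order
  \<open>1 / \<Lambda>\<close>, where every Sobolev weight is harmless. So its H^(-s) norm is of the
  order \<open>sqrt \<Lambda>\<close> of its L^2 norm, for either sign of \<open>s\<close>.\<close>

lemma bump_pairing_bound:
  "\<exists>D>0. \<forall>\<Lambda>\<ge>1. \<forall>u g. sobolev_ft s u g \<longrightarrow> cmod (u (\<lambda>x. complex_of_real (bump (x / \<Lambda>)))) \<le> sobolev_norm s u * sqrt (\<Lambda> * D)"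
proof -
  let ?\<beta> = "cplx bump"
  let ?\<zeta> = "inv_fourier ?\<beta>"
  have \<zeta>: "?\<zeta> \<in> schwartz" by (intro inv_fourier_schwartz schwartz_bump)
  note [measurable] = schwartz_measurable[OF \<zeta>]
  define D where "D = (LINT \<eta>|lborel. wt \<bar>s\<bar> \<eta> * (cmod (?\<zeta> \<eta>))^2) + 1"
  have D: "0 < D" unfolding D_def by (intro add_nonneg_pos integral_nonneg_AE) auto
  show ?thesis
  proof (intro exI[of _ D] conjI allI impI D)
    fix \<Lambda> :: real and u g assume \<Lambda>: "1 \<le> \<Lambda>" and u: "sobolev_ft s u g"
    let ?\<chi> = "\<lambda>x. complex_of_real (bump (x / \<Lambda>))"
    have \<chi>: "?\<chi> \<in> schwartz" using \<Lambda> by (intro schwartz_bump_scaled) simp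
    have "(LINT \<xi>|lborel. wt (- s) \<xi> * (cmod (inv_fourier ?\<chi> \<xi>))^2)
       = \<bar>1 / \<Lambda>\<bar> *\<^sub>R (LINT \<eta>|lborel. wt (- s) (0 + 1 / \<Lambda> * \<eta>) * (cmod (inv_fourier ?\<chi> (0 + 1 / \<Lambda> * \<eta>)))^2)"
      using \<Lambda> by (intro lborel_integral_real_affine) auto
    also have "... = \<Lambda> * (LINT \<eta>|lborel. wt (- s) (\<eta> / \<Lambda>) * (cmod (?\<zeta> \<eta>))^2)"
    proof -
      have "wt (- s) (0 + 1 / \<Lambda> * \<eta>) * (cmod (inv_fourier ?\<chi> (0 + 1 / \<Lambda> * \<eta>)))^2 = \<Lambda>\<^sup>2 * (wt (- s) (\<eta> / \<Lambda>) * (cmod (?\<zeta> \<eta>))^2)" for \<eta>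
        using \<Lambda> by (subst inv_fourier_bump_scaled) (auto simp: norm_mult power_mult_distrib)
      then have "(LINT \<eta>|lborel. wt (- s) (0 + 1 / \<Lambda> * \<eta>) * (cmod (inv_fourier ?\<chi> (0 + 1 / \<Lambda> * \<eta>)))^2)
         = \<Lambda>\<^sup>2 * (LINT \<eta>|lborel. wt (- s) (\<eta> / \<Lambda>) * (cmod (?\<zeta> \<eta>))^2)" by (simp only: integral_mult_right_zero)
      then show ?thesis using \<Lambda> by (simp only:) (simp add: power2_eq_square)
    qed
    also have "... \<le> \<Lambda> * (LINT \<eta>|lborel. wt \<bar>s\<bar> \<eta> * (cmod (?\<zeta> \<eta>))^2)"
    proof (rule mult_left_mono)
      have le: "wt (- s) (\<eta> / \<Lambda>) * (cmod (?\<zeta> \<eta>))^2 \<le> wt \<bar>s\<bar> \<eta> * (cmod (?\<zeta> \<eta>))^2" for \<eta>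
      proof (rule mult_right_mono)
        have "(\<eta> / \<Lambda>)^2 \<le> \<eta>\<^sup>2 / 1" unfolding power_divide using \<Lambda> by (intro divide_left_mono) (auto simp: one_le_power)
        then have "wt \<bar>s\<bar> (\<eta> / \<Lambda>) \<le> wt \<bar>s\<bar> \<eta>" by (intro powr_mono2) auto
        moreover have "wt (- s) (\<eta> / \<Lambda>) \<le> wt \<bar>s\<bar> (\<eta> / \<Lambda>)" by (rule wt_le_wt) simp
        ultimately show "wt (- s) (\<eta> / \<Lambda>) \<le> wt \<bar>s\<bar> \<eta>" by simp
      qed simp
      have i: "integrable lborel (\<lambda>\<eta>. wt \<bar>s\<bar> \<eta> * (cmod (?\<zeta> \<eta>))^2)" by (rule schwartz_integrable_weight_square[OF \<zeta>])
      have "integrable lborel (\<lambda>\<eta>. wt (- s) (\<eta> / \<Lambda>) * (cmod (?\<zeta> \<eta>))^2)"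
        by (rule integrable_bound[OF i]) (use le in \<open>auto intro!: AE_I2\<close>)
      then show "(LINT \<eta>|lborel. wt (- s) (\<eta> / \<Lambda>) * (cmod (?\<zeta> \<eta>))^2) \<le> (LINT \<eta>|lborel. wt \<bar>s\<bar> \<eta> * (cmod (?\<zeta> \<eta>))^2)"
        using i le by (rule integral_mono)
    qed (use \<Lambda> in simp)
    also have "... \<le> \<Lambda> * D" using \<Lambda> by (intro mult_left_mono) (auto simp: D_def)
    finally have le: "sqrt (LINT \<xi>|lborel. wt (- s) \<xi> * (cmod (inv_fourier ?\<chi> \<xi>))^2) \<le> sqrt (\<Lambda> * D)" by (rule real_sqrt_le_mono)
    have "fourier (inv_fourier ?\<chi>) = ?\<chi>" by (intro ext fourier_inversion \<chi>)
    with sobolev_pairing_bound[OF u inv_fourier_schwartz[OF \<chi>]]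
    have "cmod (u ?\<chi>) \<le> sobolev_norm s u * sqrt (LINT \<xi>|lborel. wt (- s) \<xi> * (cmod (inv_fourier ?\<chi> \<xi>))^2)" by simp
    also have "... \<le> sobolev_norm s u * sqrt (\<Lambda> * D)" by (intro mult_left_mono le sobolev_norm_nonneg)
    finally show "cmod (u ?\<chi>) \<le> sobolev_norm s u * sqrt (\<Lambda> * D)" .
  qed
qed

lemma transport_of_real:
  fixes G :: "real \<times> real \<Rightarrow> real"
  shows "transport c (\<lambda>z. complex_of_real (G z)) z = complex_of_real (transport c G z)"
proof -
  have "transport c (\<lambda>z. complex_of_real (G z)) z
     = (LINT s|lborel. complex_of_real (indicator {0..fst z} s *\<^sub>R G (s, snd z + c * (fst z - s))))"
    unfolding transport_def by (simp add: scaleR_conv_of_real)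
  then show ?thesis unfolding transport_def by (simp only: integral_complex_of_real)
qed

lemma real_valued_dist_of: "real_valued (dist_of (cplx f))"
  unfolding real_valued_def
proof (intro ballI impI)
  fix \<phi> assume \<phi>: "\<phi> \<in> schwartz" "\<forall>x. \<phi> x \<in> \<real>"
  have "complex_of_real (f x) * \<phi> x = complex_of_real (f x * Re (\<phi> x))" for x
    using \<phi>(2)[rule_format, of x] by (auto simp: Reals_def)
  then have "dist_of (cplx f) \<phi> = complex_of_real (LINT x|lborel. f x * Re (\<phi> x))"
    using \<phi>(1) by (simp only: dist_of_def if_True integral_complex_of_real)
  then show "dist_of (cplx f) \<phi> \<in> \<real>" by simp
qed

context small_data
begin

definition remainder :: real where
  "remainder = p * 3 powr (p - 1) * (T * e + T^2 * \<rho> powr (p - 1))"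

text \<open>\<open>Wop\<close> preserves positivity, and without \<open>w\<close> the source has a
  sign and dominates the p-th power of half the left-moving wave. The presence of \<open>w\<close>
  costs at most \<open>\<rho> * remainder\<close>.\<close>

lemma Wop_source_lower:
  assumes w: "continuous_on UNIV w" "\<And>z. \<bar>w z\<bar> \<le> \<rho>"
  shows "2 powr (- p) * (LINT s|lborel. indicator {0..T} s * (s * h (x - T + 2 * s) powr p)) - \<rho> * remainder
     \<le> - \<omega> * Wop (source w) (T, x)"
proof -
  have TT: "T \<in> {0..T}" using T by simp
  let ?k = "\<lambda>z. h (snd z + fst z) powr p" and ?c = "\<rho> * p * 3 powr (p - 1)"
  let ?H = "\<lambda>z. - \<omega> * source w z" and ?B = "\<lambda>z. 2 powr (- p) * ?k z - ?c * majorant (p - 1) z"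
  have ck: "continuous_on UNIV (\<lambda>z. 2 powr (- p) * ?k z)" "continuous_on UNIV (\<lambda>z. ?c * majorant (p - 1) z)" "continuous_on UNIV ?H"
    using p by (intro continuous_intros continuous_majorant continuous_source w continuous_on_compose2[OF continuous_powr_h]; auto intro!: continuous_intros)+
  \<comment> \<open>Monotonicity with the zero function on the left: the difference of the two
    sources is nonnegative, hence so is its image.\<close>
  have "\<bar>Wop (\<lambda>_. 0) (T, x)\<bar> \<le> Wop (\<lambda>z. ?H z - ?B z) (T, x)"
  proof (rule Wop_mono)
    show "continuous_on UNIV (\<lambda>z. ?H z - ?B z)" by (intro continuous_on_diff ck)
    fix s y :: real assume s: "0 \<le> s" "s \<le> T"
    let ?z = "(s, y)"
    have c: "clamp ?z = ?z" using s by (intro clamp_id) auto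
    have "\<omega> * \<omega> = 1" using \<omega> by (metis abs_mult_self_eq mult_1)
    then have "?H ?z = power_nl p (U ?z + w ?z)" by (simp add: source_def c flip: mult.assoc)
    moreover have "power_nl p (U ?z) - power_nl p (U ?z + w ?z) \<le> p * (U ?z + \<rho>) powr (p - 1) * \<bar>U ?z - (U ?z + w ?z)\<bar>"
      using power_nl_lipschitz[OF p, of "U ?z" "U ?z + \<rho>" "U ?z + w ?z"] U_nonneg[of ?z] w(2)[of ?z] \<rho>
      by (auto simp: abs_le_iff)
    moreover have "p * (U ?z + \<rho>) powr (p - 1) * \<bar>U ?z - (U ?z + w ?z)\<bar> \<le> p * (3 powr (p - 1) * majorant (p - 1) ?z) * \<rho>"
      using p w(2)[of ?z] \<rho> U_majorant[of "p - 1" ?z] majorant_nonneg[of "p - 1" ?z] by (intro mult_mono) auto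
    moreover have "2 powr (- p) * ?k ?z \<le> power_nl p (U ?z)"
    proof -
      have "2 powr (- p) * ?k ?z = (h (y + s) / 2) powr p"
        unfolding powr_divide powr_minus_divide fst_conv snd_conv by simp
      also have "... \<le> U ?z powr p" using p h(2) by (intro powr_mono2) (auto simp: U_def)
      finally show ?thesis by (simp add: power_nl_nonneg U_nonneg)
    qed
    moreover have "?c * majorant (p - 1) ?z = p * (3 powr (p - 1) * majorant (p - 1) ?z) * \<rho>" by simp
    ultimately show "\<bar>0\<bar> \<le> ?H ?z - ?B ?z" unfolding abs_zero by linarith
  qed simp
  also have "Wop (\<lambda>z. ?H z - ?B z) (T, x) = - \<omega> * Wop (source w) (T, x)
      - (2 powr (- p) * Wop ?k (T, x) - ?c * Wop (majorant (p - 1)) (T, x))"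
    by (simp only: Wop_diff continuous_on_diff ck Wop_cmult)
  finally have 1: "2 powr (- p) * Wop ?k (T, x) - ?c * Wop (majorant (p - 1)) (T, x) \<le> - \<omega> * Wop (source w) (T, x)"
    by simp
  have 2: "?c * Wop (majorant (p - 1)) (T, x) \<le> ?c * (T * e + T^2 * \<rho> powr (p - 1))"
    using p \<rho> by (intro mult_left_mono Wop_majorant TT) auto
  have 3: "Wop ?k (T, x) = (LINT s|lborel. indicator {0..T} s * (s * h (x - T + 2 * s) powr p))"
    using T Wop_travelling[of T "\<lambda>y. h y powr p" x] by simp
  have 4: "?c * (T * e + T^2 * \<rho> powr (p - 1)) = \<rho> * remainder" by (simp add: remainder_def)
  show ?thesis unfolding 3[symmetric] 4[symmetric] by (rule order_trans[OF diff_left_mono[OF 2] 1])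
qed

text \<open>Exports the state at time \<open>T\<close> as free wave plus correction, the form in
  which the two parts can be paired with a wide bump separately.\<close>

lemma solution_exists:
  assumes s: "s < 1 / 2"
  shows "\<exists>u v w. gNLW_solution \<omega> p s {0..T} u v \<and> (\<forall>\<tau>\<in>{0..T}. real_valued (u \<tau>)) \<and>
    u 0 = dist_of (cplx h) \<and> v 0 = zero_dist \<and> (\<exists>g. sobolev_ft s (u T) g) \<and>
    continuous_on UNIV w \<and> (\<forall>x. \<bar>x\<bar> > R + T \<longrightarrow> w x = 0) \<and>
    u T = dist_of (\<lambda>x. complex_of_real (U (T, x) + w x)) \<and>
    (\<forall>x. 2 powr (- p) * (LINT s|lborel. indicator {0..T} s * (s * h (x - T + 2 * s) powr p)) - \<rho> * remainder \<le> - \<omega> * w x)"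
proof -
  obtain w where w: "continuous_on UNIV w" "\<And>z. \<bar>w z\<bar> \<le> \<rho>" "\<And>t x. t \<in> {0..T} \<Longrightarrow> \<bar>x\<bar> > R + t \<Longrightarrow> w (t, x) = 0"
    "\<And>t x. t \<in> {0..T} \<Longrightarrow> w (t, x) = Wop (source w) (t, x)"
    by (rule fixed_point) blast
  define f where "f z = complex_of_real (U (clamp z) + w (clamp z))" for z
  define G where "G z = complex_of_real (source w z)" for z
  have f_real: "f (t, x) = complex_of_real (U (t, x) + w (t, x))" if "t \<in> {0..T}" for t x
    using clamp_id[OF that] by (simp add: f_def)
  have WG: "transport (- 1) (transport 1 G) z = complex_of_real (Wop (source w) z)" for z
    unfolding G_def transport_of_real[abs_def] Wop_def by (simp only: transport_of_real)
  interpret duhamel \<omega> p T R "cplx h" f G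
  proof
    show "continuous_on UNIV f"
      unfolding f_def[abs_def]
      by (intro continuous_intros continuous_on_compose2[OF continuous_U continuous_clamp] continuous_on_compose2[OF w(1) continuous_clamp]) auto
    show "continuous_on UNIV G" unfolding G_def[abs_def] by (intro continuous_intros continuous_source w)
    fix t x assume t: "t \<in> {0..T}"
    show "f (t, x) = (complex_of_real (h (x + t)) + complex_of_real (h (x - t))) / 2 + transport (- 1) (transport 1 G) (t, x)"
      unfolding WG w(4)[OF t, symmetric] f_real[OF t] by (simp add: U_def)
    show "G (t, x) = - of_real \<omega> * (of_real (cmod (f (t, x)) powr (p - 1)) * f (t, x))"
      unfolding f_real[OF t] norm_of_real G_def source_def clamp_id[OF t] power_nl_def by simp
    show "G (t, x) = 0" if "\<bar>x\<bar> > R + t"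
      unfolding G_def source_def clamp_id[OF t] using w(3)[OF t that] U_support[of t x] t that by simp
  qed (use T p h in auto)
  have TT: "T \<in> {0..T}" "0 \<in> {0..T}" using T by auto
  show ?thesis
  proof (intro exI conjI)
    show "gNLW_solution \<omega> p s {0..T} (\<lambda>t. dist_of (\<lambda>x. f (t, x))) (\<lambda>t. dist_of (v t))" by (rule solution[OF s])
    show "\<forall>\<tau>\<in>{0..T}. real_valued (dist_of (\<lambda>x. f (\<tau>, x)))" unfolding f_def by (intro ballI real_valued_dist_of)
    show "dist_of (\<lambda>x. f (0, x)) = dist_of (cplx h)" by (simp add: f_0)
    show "dist_of (v 0) = zero_dist" by (rule v_0)
    show "sobolev_ft s (dist_of (\<lambda>x. f (T, x))) (fourier (\<lambda>x. f (T, x)))" by (rule regularity(4)[OF s TT(1)])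
    show "continuous_on UNIV (\<lambda>x. w (T, x))" by (rule continuous_on_compose2[OF w(1)]) (auto intro!: continuous_intros)
    show "\<forall>x. R + T < \<bar>x\<bar> \<longrightarrow> w (T, x) = 0" using w(3)[OF TT(1)] by blast
    show "dist_of (\<lambda>x. f (T, x)) = dist_of (\<lambda>x. complex_of_real (U (T, x) + w (T, x)))" by (simp add: f_real[OF TT(1)])
    show "\<forall>x. 2 powr (- p) * (LINT s|lborel. indicator {0..T} s * (s * h (x - T + 2 * s) powr p)) - \<rho> * remainder \<le> - \<omega> * w (T, x)"
      unfolding w(4)[OF TT(1)] using Wop_source_lower[OF w(1,2)] by blast
  qed
qed

end

section \<open>Trains of concentrated bumps\<close>

lemma smooth1_continuous_real:
  assumes "smooth1 (cplx b)" shows "continuous_on UNIV b"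
proof -
  have "continuous_on UNIV (\<lambda>x. Re (complex_of_real (b x)))" by (intro continuous_intros smooth1_continuous assms)
  then show ?thesis by simp
qed

lemma integrable_powr_compact_support:
  fixes b :: "real \<Rightarrow> real"
  assumes "continuous_on UNIV b" "\<And>x. 0 \<le> b x" "\<And>x. x \<notin> {l..r} \<Longrightarrow> b x = 0" "0 < q"
  shows "integrable lborel (\<lambda>x. b x powr q)" "continuous_on UNIV (\<lambda>x. b x powr q)"
proof -
  show "continuous_on UNIV (\<lambda>x. b x powr q)" using assms by (intro continuous_on_powr' continuous_intros) auto
  then show "integrable lborel (\<lambda>x. b x powr q)"
    by (rule integrable_compact_support[of _ "{l..r}"]) (use assms in auto)
qed

text \<open>Nonnegativity excludes cancellation in sums and pairings. The support
  \<open>{1..2}\<close> avoids the origin, which matters when a profile serves as a cut-off in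
  time.\<close>

definition profile :: "(real \<Rightarrow> real) \<Rightarrow> bool" where
  "profile b \<longleftrightarrow> smooth1 (cplx b) \<and> (\<forall>x. 0 \<le> b x) \<and> (\<forall>x. x \<notin> {1..2} \<longrightarrow> b x = 0)"

abbreviation profile_norm2 :: "real \<Rightarrow> (real \<Rightarrow> real) \<Rightarrow> real" where
  "profile_norm2 s b \<equiv> LINT \<xi>|lborel. wt s \<xi> * (cmod (fourier (cplx b) \<xi>))^2"

lemma profileD:
  assumes "profile b"
  shows "smooth1 (cplx b)" "\<And>x. 0 \<le> b x" "\<And>x. x \<notin> {1..2} \<Longrightarrow> b x = 0"
    "(cplx b) \<in> schwartz" "continuous_on UNIV b" "integrable lborel b"
proof -
  show b: "smooth1 (cplx b)" "\<And>x. 0 \<le> b x" "\<And>x. x \<notin> {1..2} \<Longrightarrow> b x = 0"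
    using assms by (auto simp: profile_def)
  show "(cplx b) \<in> schwartz" by (rule schwartz_compact_support[OF b(1), of 1 2]) (use b(3) in auto)
  show c: "continuous_on UNIV b" by (rule smooth1_continuous_real[OF b(1)])
  show "integrable lborel b" by (rule integrable_compact_support[OF c, of "{1..2}"]) (use b(3) in auto)
qed

lemma profile_powr:
  assumes "profile b" "0 < q"
  shows "integrable lborel (\<lambda>x. b x powr q)" "continuous_on UNIV (\<lambda>x. b x powr q)"
  by (rule integrable_powr_compact_support[of b 1 2 q]; use profileD[OF assms(1)] assms(2) in auto)+

lemma profile_mult:
  assumes "profile b" "profile \<phi>"
  shows "continuous_on UNIV (\<lambda>x. b x * \<phi> x)" "integrable lborel (\<lambda>x. b x * \<phi> x)"
proof -
  show c: "continuous_on UNIV (\<lambda>x. b x * \<phi> x)" using assms by (intro continuous_intros profileD)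
  show "integrable lborel (\<lambda>x. b x * \<phi> x)" by (rule integrable_compact_support[OF c, of "{1..2}"]) (use profileD(3)[OF assms(1)] in auto)
qed

lemma profile_cmult: "profile b \<Longrightarrow> 0 \<le> c \<Longrightarrow> profile (\<lambda>x. c * b x)"
  by (auto simp: profile_def smooth1_cmult)

lemma profile_norm2_cmult: "profile_norm2 s (\<lambda>x. c * b x) = c^2 * profile_norm2 s b"
proof -
  have "wt s \<xi> * (cmod (fourier (\<lambda>x. complex_of_real (c * b x)) \<xi>))^2 = c^2 * (wt s \<xi> * (cmod (fourier (cplx b) \<xi>))^2)" for \<xi>
    using fourier_cmult[of "of_real c" "cplx b" \<xi>] by (simp add: norm_mult power_mult_distrib)
  then show ?thesis by (simp only: integral_mult_right_zero)
qed

lemma profile_norm2_nonneg: "0 \<le> profile_norm2 s b"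
  by (intro integral_nonneg_AE) auto

lemma integrable_profile_norm2:
  "profile b \<Longrightarrow> integrable lborel (\<lambda>\<xi>. wt s \<xi> * (cmod (fourier (cplx b) \<xi>))^2)"
  by (intro schwartz_integrable_weight_square fourier_schwartz profileD)

lemma sobolev_ft_profile:
  "profile b \<Longrightarrow> sobolev_ft s (dist_of (cplx b)) (fourier (cplx b))"
  by (intro sobolev_ft_dist_of schwartz_integrable profileD integrable_profile_norm2)

text \<open>For nonnegative \<open>b\<close> the integral is controlled by the pairing with one
  fixed bump. So smallness in H^s, even for negative \<open>s\<close>, implies smallness in
  L^1.\<close>

lemma profile_integral_bounded:
  obtains L where "0 < L" "\<And>b. profile b \<Longrightarrow> (LINT x|lborel. b x) \<le> L * sqrt (profile_norm2 s b)"
proof -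
  obtain D where D: "D > 0" "\<And>\<Lambda> u g. 1 \<le> \<Lambda> \<Longrightarrow> sobolev_ft s u g \<Longrightarrow> cmod (u (\<lambda>x. complex_of_real (bump (x / \<Lambda>)))) \<le> sobolev_norm s u * sqrt (\<Lambda> * D)"
    using bump_pairing_bound[of s] by blast
  show ?thesis
  proof (rule that[of "sqrt (4 * D) / bump_floor"])
    show "0 < sqrt (4 * D) / bump_floor" using D bump_floor_pos by simp
    fix b assume b: "profile b"
    \<comment> \<open>Dilation by 4 moves \<open>{1..2}\<close> to \<open>{1/4..1/2}\<close>, where
      the bump is at least \<open>bump_floor\<close>.\<close>
    let ?\<theta> = "\<lambda>x. bump (x / 4)" and ?b = "cplx b"
    have \<theta>: "(cplx ?\<theta>) \<in> schwartz" by (rule schwartz_bump_scaled) simp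
    have "(LINT x|lborel. b x) * bump_floor = (LINT x|lborel. b x * bump_floor)" by (rule integral_mult_left_zero[symmetric])
    also have "... \<le> (LINT x|lborel. b x * ?\<theta> x)"
    proof (rule integral_mono)
      show "integrable lborel (\<lambda>x. b x * bump_floor)" by (intro integrable_mult_left profileD b)
      show "integrable lborel (\<lambda>x. b x * ?\<theta> x)"
        by (rule integrable_compact_support[of _ "{1..2}"])
          (use profileD(3)[OF b] continuous_on_mult[OF profileD(5)[OF b] smooth1_continuous_real[OF schwartz_smooth1[OF \<theta>]]] in auto)
      show "b x * bump_floor \<le> b x * ?\<theta> x" for x
      proof (cases "x \<in> {1..2}")
        case True then show ?thesis by (intro mult_left_mono bump_ge_floor profileD b) auto
      qed (simp add: profileD(3)[OF b])
    qed
    also have "... \<le> cmod (dist_of ?b (cplx ?\<theta>))"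
      using \<theta> by (simp add: dist_of_def flip: of_real_mult)
    also have "... \<le> sobolev_norm s (dist_of ?b) * sqrt (4 * D)" by (rule D(2)[OF _ sobolev_ft_profile[OF b]]) simp
    finally show "(LINT x|lborel. b x) \<le> sqrt (4 * D) / bump_floor * sqrt (profile_norm2 s b)"
      unfolding sobolev_norm_eq[OF sobolev_ft_profile[OF b]] using bump_floor_pos by (simp add: field_simps)
  qed
qed

definition base_profile :: "real \<Rightarrow> real \<Rightarrow> real \<Rightarrow> (real \<Rightarrow> real) \<Rightarrow> bool" where
  "base_profile p s \<epsilon> b \<longleftrightarrow> profile b \<and> (LINT x|lborel. b x powr p) = 1 \<and> sqrt (profile_norm2 s b) \<le> \<epsilon>"

text \<open>Values below \<open>\<delta>\<close> fall under the constant, values up to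
  \<open>1 / \<delta>\<close> under the linear term, larger ones under the p-th power. The constant
  is there because \<open>p - 1\<close> may be smaller than one.\<close>

lemma powr_interpolation:
  fixes r \<delta> :: real
  assumes r: "0 \<le> r" and \<delta>: "0 < \<delta>" "\<delta> \<le> 1" and p: "1 < p"
  shows "r powr (p - 1) \<le> \<delta> powr (p - 1) + \<delta> powr (- p) * r + \<delta> * r powr p"
proof -
  consider "r \<le> \<delta>" | "\<delta> < r" "r \<le> 1 / \<delta>" | "1 / \<delta> < r" by linarith
  then show ?thesis
  proof cases
    case 1
    then have "r powr (p - 1) \<le> \<delta> powr (p - 1)" using r p by (intro powr_mono2) auto
    then show ?thesis using r \<delta> by (simp add: add_increasing2)
  next
    case 2
    have "r powr (p - 1) \<le> (1 / \<delta>) powr (p - 1)" using 2 \<delta> p by (intro powr_mono2) auto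
    also have "... = \<delta> powr (- p + 1)"
      using powr_minus_divide[of \<delta> "p - 1"] by (simp add: powr_divide)
    also have "... = \<delta> powr (- p) * \<delta>" using \<delta> by (simp only: powr_add) simp
    also have "... \<le> \<delta> powr (- p) * r" using 2 by (intro mult_left_mono) auto
    finally show ?thesis using r \<delta> by (simp add: add_increasing add_increasing2)
  next
    case 3
    then have "0 < r" using \<delta> by (meson divide_pos_pos less_trans zero_less_one)
    then have "r powr (p - 1) = (1 / r) * r powr p" by (simp add: powr_diff)
    also have "... \<le> \<delta> * r powr p"
      using 3 \<delta> \<open>0 < r\<close> by (intro mult_right_mono) (auto simp: field_simps)
    finally show ?thesis using r \<delta> by (simp add: add_increasing)
  qed
qed

text \<open>The L^1 norm can be made small through the H^s norm while the L^p norm is one; the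
  L^(p-1) norm is then interpolated.\<close>

lemma base_profile_integrals_small:
  assumes p: "1 < p" and data: "\<And>\<epsilon>. 0 < \<epsilon> \<Longrightarrow> \<exists>b. base_profile p s \<epsilon> b" and \<epsilon>: "0 < \<epsilon>"
  shows "\<exists>b. base_profile p s \<epsilon> b \<and> (LINT x|lborel. b x) \<le> \<epsilon> \<and> (LINT x|lborel. b x powr (p - 1)) \<le> \<epsilon>"
proof -
  obtain L where L: "0 < L" "\<And>b. profile b \<Longrightarrow> (LINT x|lborel. b x) \<le> L * sqrt (profile_norm2 s b)"
    using profile_integral_bounded[of s] by blast
  \<comment> \<open>\<open>\<delta>\<close> settles the two outer terms of the interpolation,
    \<open>\<eta>\<close> the middle one once \<open>\<delta>\<close> is fixed, and
    \<open>\<epsilon>'\<close> forces the integral below \<open>\<eta>\<close>.\<close>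
  define \<delta> where "\<delta> = min 1 (min (\<epsilon> / 3) ((\<epsilon> / 3) powr (1 / (p - 1))))"
  have \<delta>: "0 < \<delta>" "\<delta> \<le> 1" "\<delta> \<le> \<epsilon> / 3" using \<epsilon> by (auto simp: \<delta>_def)
  have "\<delta> powr (p - 1) \<le> ((\<epsilon> / 3) powr (1 / (p - 1))) powr (p - 1)"
    using p \<delta> by (intro powr_mono2) (auto simp: \<delta>_def)
  then have \<delta>': "\<delta> powr (p - 1) \<le> \<epsilon> / 3" using p \<epsilon> by (simp add: powr_powr)
  define \<eta> where "\<eta> = min \<epsilon> (\<delta> powr p * (\<epsilon> / 3))"
  have \<eta>: "0 < \<eta>" "\<eta> \<le> \<epsilon>" "\<eta> \<le> \<delta> powr p * (\<epsilon> / 3)" using \<epsilon> \<delta> by (auto simp: \<eta>_def)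
  define \<epsilon>' where "\<epsilon>' = min \<epsilon> (\<eta> / L)"
  have \<epsilon>': "0 < \<epsilon>'" using \<epsilon> \<eta> L by (simp add: \<epsilon>'_def)
  obtain b where b: "base_profile p s \<epsilon>' b" using data[OF \<epsilon>'] by blast
  then have pb: "profile b" and b': "(LINT x|lborel. b x powr p) = 1" "sqrt (profile_norm2 s b) \<le> \<epsilon>'"
    by (auto simp: base_profile_def)
  note ib = profileD(6)[OF pb] and ibp = profile_powr(1)[OF pb]
  have "(LINT x|lborel. b x) \<le> L * \<epsilon>'" using L(1) b'(2) by (intro order_trans[OF L(2)[OF pb]] mult_left_mono) auto
  also have "... \<le> L * (\<eta> / L)" using L(1) by (intro mult_left_mono) (auto simp: \<epsilon>'_def)
  finally have I: "(LINT x|lborel. b x) \<le> \<eta>" using L(1) by simp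
  have "(LINT x|lborel. b x powr (p - 1)) \<le> (LINT x|lborel. indicator {1..2} x * \<delta> powr (p - 1) + (\<delta> powr (- p) * b x + \<delta> * b x powr p))"
  proof (rule integral_mono)
    show "integrable lborel (\<lambda>x. b x powr (p - 1))"
      using p by (intro ibp) simp
    show "integrable lborel (\<lambda>x. indicator {1..2} x * \<delta> powr (p - 1) + (\<delta> powr (- p) * b x + \<delta> * b x powr p))"
      using p ib ibp[of p]
      by (intro integrable_add integrable_mult_right integrable_mult_left integrable_real_indicator) (auto simp: emeasure_lborel_Icc_eq)
    show "b x powr (p - 1) \<le> indicator {1..2} x * \<delta> powr (p - 1) + (\<delta> powr (- p) * b x + \<delta> * b x powr p)" for x
      using powr_interpolation[OF profileD(2)[OF pb, of x] \<delta>(1,2) p] profileD(3)[OF pb, of x] by (cases "x \<in> {1..2}") auto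
  qed
  also have "... = \<delta> powr (p - 1) + (\<delta> powr (- p) * (LINT x|lborel. b x) + \<delta> * (LINT x|lborel. b x powr p))"
    using p ib ibp[of p]
    by (subst integral_add) (auto simp: emeasure_lborel_Icc_eq)
  also have "... \<le> \<epsilon> / 3 + (\<delta> powr (- p) * \<eta> + \<epsilon> / 3)"
    using \<delta>' \<delta>(3) I b'(1) by (intro add_mono mult_left_mono) auto
  also have "\<delta> powr (- p) * \<eta> \<le> \<delta> powr (- p) * (\<delta> powr p * (\<epsilon> / 3))" using \<eta> by (intro mult_left_mono) auto
  also have "... = \<epsilon> / 3" using \<delta> by (simp add: powr_minus flip: mult.assoc)
  finally have "(LINT x|lborel. b x powr (p - 1)) \<le> \<epsilon>" by simp
  moreover have "base_profile p s \<epsilon> b" using b by (auto simp: base_profile_def \<epsilon>'_def)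
  ultimately show ?thesis using I \<eta> by auto
qed

section \<open>Trains of translated profiles\<close>

lemma powr_superadditive:
  fixes a b p :: real
  assumes "0 \<le> a" "0 \<le> b" "1 \<le> p" shows "a powr p + b powr p \<le> (a + b) powr p"
proof -
  have *: "x powr p = x * x powr (p - 1)" if "0 \<le> x" for x :: real
    using that by (cases "x = 0") (auto simp: powr_diff)
  have "a powr p + b powr p = a * a powr (p - 1) + b * b powr (p - 1)" using * assms by simp
  also have "... \<le> a * (a + b) powr (p - 1) + b * (a + b) powr (p - 1)"
    using assms by (intro add_mono mult_left_mono powr_mono2) auto
  also have "... = (a + b) powr p" using *[of "a + b"] assms by (simp add: distrib_right)
  finally show ?thesis .
qed

lemma powr_sum_superadditive:
  fixes f :: "nat \<Rightarrow> real" and p :: real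
  assumes "\<And>j. 0 \<le> f j" "1 \<le> p" shows "(\<Sum>j<L. f j powr p) \<le> (\<Sum>j<L. f j) powr p"
proof (induction L)
  case (Suc L)
  have "(\<Sum>j<Suc L. f j powr p) \<le> (\<Sum>j<L. f j) powr p + f L powr p" using Suc by simp
  also have "... \<le> (\<Sum>j<Suc L. f j) powr p"
    using powr_superadditive[of "\<Sum>j<L. f j" "f L" p] assms by (simp add: sum_nonneg)
  finally show ?case .
qed simp

definition train :: "real \<Rightarrow> (real \<Rightarrow> real) \<Rightarrow> (nat \<Rightarrow> real) \<Rightarrow> nat \<Rightarrow> real \<Rightarrow> real" where
  "train A b y L x = A * (\<Sum>j<L. b (x - y j))"

lemma smooth1_train:
  assumes "smooth1 (cplx b)" shows "smooth1 (\<lambda>x. complex_of_real (train A b y L x))"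
proof -
  have "smooth1 (\<lambda>x. complex_of_real A * (\<Sum>j<L. complex_of_real (b (x + - y j))))"
    using assms by (intro smooth1_cmult smooth1_sum smooth1_shift[of "cplx b"])
  then show ?thesis by (simp add: train_def)
qed

lemma train_nonneg: "0 \<le> A \<Longrightarrow> (\<And>x. 0 \<le> b x) \<Longrightarrow> 0 \<le> train A b y L x"
  by (simp add: train_def sum_nonneg)

lemma integral_shift:
  fixes f :: "real \<Rightarrow> real" shows "(LINT x|lborel. f (x - a)) = (LINT x|lborel. f x)"
  using lborel_integral_real_affine[of 1 f "- a"] by (simp add: add.commute)

text \<open>An interval of length \<open>2 T\<close> meets at most one bump of the train.\<close>

lemma train_window:
  assumes pb: "profile b" and A: "0 \<le> A" and q: "0 < q" and y: "\<And>i j. i \<noteq> j \<Longrightarrow> 2 * T + 2 \<le> \<bar>y i - y j\<bar>" and T: "0 < T"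
  shows "(LINT x|lborel. indicator {a..a + 2 * T} x * train A b y L x powr q) \<le> A powr q * (LINT x|lborel. b x powr q)"
proof -
  note b = profileD(1-3)[OF pb] and ib = profile_powr(1)[OF pb q]
  have I0: "0 \<le> (LINT x|lborel. b x powr q)" by (intro integral_nonneg_AE) auto
  show ?thesis
  proof (cases "\<exists>j<L. \<exists>x\<in>{a..a + 2 * T}. b (x - y j) \<noteq> 0")
    case True
    then obtain j x0 where j: "j < L" "x0 \<in> {a..a + 2 * T}" "b (x0 - y j) \<noteq> 0" by blast
    have eq: "train A b y L x = A * b (x - y j)" if x: "x \<in> {a..a + 2 * T}" for x
    proof -
      have "b (x - y i) = 0" if "i \<noteq> j" for i
      proof (rule ccontr)
        assume "b (x - y i) \<noteq> 0"
        then have "x - y i \<in> {1..2}" "x0 - y j \<in> {1..2}" using b(3) j(3) by blast+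
        then have "\<bar>y i - y j\<bar> \<le> 2 * T + 1" using x j(2) by (auto simp: abs_le_iff)
        then show False using y[OF that] by simp
      qed
      then have "(\<Sum>i<L. b (x - y i)) = (\<Sum>i\<in>{j}. b (x - y i))"
        using j(1) by (intro sum.mono_neutral_right) auto
      then show ?thesis by (simp add: train_def)
    qed
    have "(LINT x|lborel. indicator {a..a + 2 * T} x * train A b y L x powr q) \<le> (LINT x|lborel. A powr q * b (x - y j) powr q)"
    proof (rule integral_mono)
      have "continuous_on UNIV (train A b y L)" by (intro smooth1_continuous_real smooth1_train b)
      then have "continuous_on UNIV (\<lambda>x. train A b y L x powr q)"
        using q train_nonneg[OF A b(2)] by (intro continuous_on_powr' continuous_intros) auto
      from integrable_Icc_continuous[OF continuous_on_subset[OF this], of a "a + 2 * T"]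
      show "integrable lborel (\<lambda>x. indicator {a..a + 2 * T} x * train A b y L x powr q)" by simp
      show "integrable lborel (\<lambda>x. A powr q * b (x - y j) powr q)"
        using lborel_integrable_real_affine[OF ib, of 1 "- y j"] by simp
      show "indicator {a..a + 2 * T} x * train A b y L x powr q \<le> A powr q * b (x - y j) powr q" for x
        using eq[of x] by (cases "x \<in> {a..a + 2 * T}") (auto simp: powr_mult)
    qed
    also have "... = A powr q * (LINT x|lborel. b x powr q)"
      using integral_shift[of "\<lambda>x. b x powr q" "y j"] by simp
    finally show ?thesis .
  next
    case False
    then have "indicator {a..a + 2 * T} x * train A b y L x powr q = 0" for x
      by (cases "x \<in> {a..a + 2 * T}") (auto simp: train_def)
    then have "(LINT x|lborel. indicator {a..a + 2 * T} x * train A b y L x powr q) = 0" by (simp only:) simp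
    then show ?thesis using I0 by simp
  qed
qed

lemma train_integral:
  assumes "integrable lborel b"
  shows "integrable lborel (train A b y L)" "(LINT x|lborel. train A b y L x) = A * (real L * (LINT x|lborel. b x))"
proof -
  have i: "integrable lborel (\<lambda>x. b (x - y j))" for j
    using lborel_integrable_real_affine[OF assms, of 1 "- y j"] by simp
  show "integrable lborel (train A b y L)" unfolding train_def[abs_def] by (intro integrable_mult_right integrable_sum i)
  show "(LINT x|lborel. train A b y L x) = A * (real L * (LINT x|lborel. b x))"
    unfolding train_def integral_mult_right_zero by (subst integral_sum[OF i]) (simp add: integral_shift)
qed

text \<open>A plain triangle inequality over the translates; the loss of a factor \<open>L\<close>
  is harmless because the profile is chosen after \<open>L\<close>.\<close>

lemma train_fourier:
  assumes b: "(cplx b) \<in> schwartz" and A: "0 \<le> A"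
  shows "cmod (fourier (\<lambda>x. complex_of_real (train A b y L x)) \<xi>) \<le> A * real L * cmod (fourier (cplx b) \<xi>)"
proof -
  let ?b = "cplx b"
  have i: "integrable lborel (\<lambda>x. ?b (x + a))" for a
    using lborel_integrable_real_affine[OF schwartz_integrable[OF b], of 1 a] by (simp add: add.commute)
  have "fourier (\<lambda>x. \<Sum>j<L. ?b (x + - y j)) \<xi> = (\<Sum>j<L. fourier (\<lambda>x. ?b (x + - y j)) \<xi>)"
  proof (induction L)
    case 0 then show ?case by (simp add: fourier_def)
  next
    case (Suc L)
    have "integrable lborel (\<lambda>x. \<Sum>j<L. ?b (x + - y j))" by (intro integrable_sum i)
    from fourier_add[OF this i, of "- y L" \<xi>] show ?case using Suc by simp
  qed
  also have "... = (\<Sum>j<L. cis (- y j * \<xi>) * fourier ?b \<xi>)" by (simp only: fourier_shift[of ?b])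
  finally have "fourier (\<lambda>x. complex_of_real (train A b y L x)) \<xi> = of_real A * (\<Sum>j<L. cis (- y j * \<xi>) * fourier ?b \<xi>)"
    using fourier_cmult[of "of_real A" "\<lambda>x. \<Sum>j<L. ?b (x + - y j)" \<xi>] by (simp add: train_def)
  then have "cmod (fourier (\<lambda>x. complex_of_real (train A b y L x)) \<xi>) = A * cmod (\<Sum>j<L. cis (- y j * \<xi>) * fourier ?b \<xi>)"
    using A by (simp add: norm_mult)
  also have "... \<le> A * (\<Sum>j<L. cmod (cis (- y j * \<xi>) * fourier ?b \<xi>))" by (intro mult_left_mono norm_sum A)
  finally show ?thesis by (simp add: norm_mult mult.assoc)
qed

text \<open>By Fubini's theorem the shifts of \<open>k\<close> are paired with
  \<open>\<theta>\<close> one at a time, and the weight \<open>s\<close> integrates to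
  \<open>T^2 / 2\<close>.\<close>

lemma double_integral_lower:
  fixes k \<theta> :: "real \<Rightarrow> real"
  assumes k: "continuous_on UNIV k" and \<theta>: "continuous_on UNIV \<theta>" "\<And>x. x \<notin> {0..\<Lambda>} \<Longrightarrow> \<theta> x = 0"
    and m: "\<And>s. s \<in> {0..T} \<Longrightarrow> m \<le> (LINT x|lborel. k (x - T + 2 * s) * \<theta> x)" and T: "0 \<le> T"
  shows "integrable lborel (\<lambda>x. (LINT s|lborel. indicator {0..T} s * (s * k (x - T + 2 * s))) * \<theta> x)"
    and "m * T^2 / 2 \<le> (LINT x|lborel. (LINT s|lborel. indicator {0..T} s * (s * k (x - T + 2 * s))) * \<theta> x)"
proof -
  define H where "H z = indicator {0..T} (snd z) * (snd z * k (fst z - T + 2 * snd z)) * \<theta> (fst z)" for z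
  have kc: "continuous_on A (\<lambda>z. k (f z))" if "continuous_on A f" for f :: "real \<times> real \<Rightarrow> real" and A
    by (rule continuous_on_compose2[OF k that]) auto
  have \<theta>c: "continuous_on A (\<lambda>z. \<theta> (f z))" if "continuous_on A f" for f :: "real \<times> real \<Rightarrow> real" and A
    by (rule continuous_on_compose2[OF \<theta>(1) that]) auto
  have "integrable lborel (\<lambda>z. indicator ({0..\<Lambda>} \<times> {0..T}) z *\<^sub>R (snd z * k (fst z - T + 2 * snd z) * \<theta> (fst z)))"
    by (intro borel_integrable_compact compact_Times compact_Icc continuous_intros kc \<theta>c)
  also have "(\<lambda>z. indicator ({0..\<Lambda>} \<times> {0..T}) z *\<^sub>R (snd z * k (fst z - T + 2 * snd z) * \<theta> (fst z))) = H"
  proof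
    fix z :: "real \<times> real"
    show "indicator ({0..\<Lambda>} \<times> {0..T}) z *\<^sub>R (snd z * k (fst z - T + 2 * snd z) * \<theta> (fst z)) = H z"
      using \<theta>(2)[of "fst z"] by (cases "fst z \<in> {0..\<Lambda>}") (auto simp: H_def indicator_def mem_Times_iff)
  qed
  finally have iH: "integrable lborel H" .
  have inner: "(LINT s|lborel. indicator {0..T} s * (s * k (x - T + 2 * s))) * \<theta> x = (LINT s|lborel. H (x, s))" for x
    unfolding H_def fst_conv snd_conv by (rule integral_mult_left_zero[symmetric])
  show "integrable lborel (\<lambda>x. (LINT s|lborel. indicator {0..T} s * (s * k (x - T + 2 * s))) * \<theta> x)"
    unfolding inner using lborel_pair.integrable_fst'[of H] iH by (simp add: lborel_prod)
  have sT: "(LINT s|lborel. indicator {0..T} s * s) = T^2 / 2"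
  proof -
    have "(LINT s|lborel. indicator {0..T} s *\<^sub>R s) = T^2 / 2 - 0\<^sup>2 / 2"
    proof (rule integral_FTC_atLeastAtMost[OF T])
      show "((\<lambda>s. s\<^sup>2 / 2) has_vector_derivative s) (at s within {0..T})" for s
        by (auto intro!: derivative_eq_intros simp: has_real_derivative_iff_has_vector_derivative[symmetric])
    qed (intro continuous_intros)
    then show ?thesis by simp
  qed
  have "m * T^2 / 2 = (LINT s|lborel. m * (indicator {0..T} s * s))" by (simp only: integral_mult_right_zero sT)
  also have "... \<le> (LINT s|lborel. LINT x|lborel. H (x, s))"
  proof (rule integral_mono)
    have "continuous_on {0..T} (\<lambda>s::real. s)" by (rule continuous_on_id)
    from integrable_Icc_continuous[OF this] show "integrable lborel (\<lambda>s. m * (indicator {0..T} s * s))" by simp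
    have "integrable (lborel \<Otimes>\<^sub>M lborel) H" using iH by (simp add: lborel_prod)
    then show "integrable lborel (\<lambda>s. LINT x|lborel. H (x, s))" using lborel_pair.integrable_snd[of "\<lambda>x s. H (x, s)"] by simp
    fix s
    have "(LINT x|lborel. H (x, s)) = (indicator {0..T} s * s) * (LINT x|lborel. k (x - T + 2 * s) * \<theta> x)"
      unfolding H_def integral_mult_right_zero[symmetric] by (simp add: mult_ac)
    then show "m * (indicator {0..T} s * s) \<le> (LINT x|lborel. H (x, s))"
      using mult_left_mono[OF m[of s], of s] by (cases "s \<in> {0..T}") (auto simp: mult.commute[of m])
  qed
  also have "... = (LINT x|lborel. LINT s|lborel. H (x, s))"
    using lborel_prod_Fubini[OF iH] by simp
  finally show "m * T^2 / 2 \<le> (LINT x|lborel. (LINT s|lborel. indicator {0..T} s * (s * k (x - T + 2 * s))) * \<theta> x)"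
    unfolding inner .
qed

section \<open>Norm inflation\<close>

text \<open>Even when displaced by up to \<open>T\<close>, all bumps stay in the middle half of
  \<open>{0..\<Lambda>}\<close>, where the wide bump is at least \<open>bump_floor\<close>; so each
  contributes a fixed amount.\<close>

lemma train_pairing_lower:
  fixes L :: nat and T d \<Lambda> :: real
  defines "y \<equiv> \<lambda>j::nat. 3 * d * real L + d * real j"
  assumes pb: "profile b" and b1: "(LINT x|lborel. b x powr p) = 1"
    and A: "0 \<le> A" and p: "1 < p" and T: "0 < T" and d: "d = 2 * T + 2" and \<Lambda>: "\<Lambda> = 8 * d * real L"
    and L: "0 < L" and s: "s \<in> {0..T}"
  shows "bump_floor * A powr p * real L \<le> (LINT x|lborel. train A b y L (x - T + 2 * s) powr p * bump (x / \<Lambda>))"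
proof -
  have p0: "0 < p" using p by simp
  note b = profileD(1-3)[OF pb] b1 and ibp = profile_powr(1)[OF pb p0]
  have \<Lambda>0: "0 < \<Lambda>" using L d T by (simp add: \<Lambda>)
  have ij: "integrable lborel (\<lambda>x. b (x - c) powr p)" for c
    using lborel_integrable_real_affine[OF ibp, of 1 "- c"] by simp
  have "bump_floor * A powr p * real L = (LINT x|lborel. (bump_floor * A powr p) * (\<Sum>j<L. b (x - (T - 2 * s + y j)) powr p))"
    unfolding integral_mult_right_zero by (subst integral_sum[OF ij]) (simp add: integral_shift[of "\<lambda>x. b x powr p"] b)
  also have "... \<le> (LINT x|lborel. train A b y L (x - T + 2 * s) powr p * bump (x / \<Lambda>))"
  proof (rule integral_mono)
    show "integrable lborel (\<lambda>x. (bump_floor * A powr p) * (\<Sum>j<L. b (x - (T - 2 * s + y j)) powr p))"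
      by (intro integrable_mult_right integrable_sum ij)
    show "integrable lborel (\<lambda>x. train A b y L (x - T + 2 * s) powr p * bump (x / \<Lambda>))"
    proof (rule integrable_compact_support[of _ "{0..\<Lambda>}"])
      have 1: "continuous_on UNIV (\<lambda>x. bump (x / \<Lambda>))"
        using schwartz_smooth1[OF schwartz_bump_scaled[OF \<Lambda>0]] by (intro smooth1_continuous_real) simp
      have "continuous_on UNIV (train A b y L)" by (intro smooth1_continuous_real smooth1_train b)
      then have "continuous_on UNIV (\<lambda>x. train A b y L (x - T + 2 * s))"
        by (rule continuous_on_compose2) (auto intro!: continuous_intros)
      then have "continuous_on UNIV (\<lambda>x. train A b y L (x - T + 2 * s) powr p)"
        using p train_nonneg[OF A b(2)] by (intro continuous_on_powr' continuous_intros) auto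
      then show "continuous_on UNIV (\<lambda>x. train A b y L (x - T + 2 * s) powr p * bump (x / \<Lambda>))" by (rule continuous_on_mult[OF _ 1])
      show "train A b y L (x - T + 2 * s) powr p * bump (x / \<Lambda>) = 0" if "x \<notin> {0..\<Lambda>}" for x
        using that \<Lambda>0 bump_simps(6)[of "x / \<Lambda>"] by (auto simp: field_simps)
    qed simp
    fix x
    have summand: "bump_floor * b (x - (T - 2 * s + y j)) powr p \<le> b (x - (T - 2 * s + y j)) powr p * bump (x / \<Lambda>)" if j: "j < L" for j
    proof (cases "x - (T - 2 * s + y j) \<in> {1..2}")
      case True
      have "d * real j \<le> d * (real L - 1)" using j d T by (intro mult_left_mono) auto
      moreover have "0 \<le> d * real j" using d T by simp
      moreover have "d \<le> d * real L" using L d T by simp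
      moreover have "\<bar>T - 2 * s\<bar> \<le> T" using s by auto
      moreover have "y j = 3 * (d * real L) + d * real j" "d * (real L - 1) = d * real L - d"
        "1 \<le> x - (T - 2 * s + y j)" "x - (T - 2 * s + y j) \<le> 2"
        using True by (auto simp: y_def algebra_simps)
      \<comment> \<open>The bounds are \<open>\<Lambda> / 4\<close> and
        \<open>3 * \<Lambda> / 4\<close>. The offset \<open>3 * d * real L\<close> leaves a margin
        \<open>d * real L\<close> below the train, more than the displacement.\<close>
      ultimately have "2 * (d * real L) \<le> x" "x \<le> 6 * (d * real L)"
        using d T by linarith+
      then have "1 / 4 \<le> x / \<Lambda>" "x / \<Lambda> \<le> 3 / 4" using \<Lambda>0 by (auto simp: \<Lambda> field_simps)
      then have "bump_floor \<le> bump (x / \<Lambda>)" by (rule bump_ge_floor)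
      from mult_left_mono[OF this, of "b (x - (T - 2 * s + y j)) powr p"] show ?thesis by (simp add: mult.commute)
    qed (simp add: b(3))
    have "(bump_floor * A powr p) * (\<Sum>j<L. b (x - (T - 2 * s + y j)) powr p)
        = A powr p * (\<Sum>j<L. bump_floor * b (x - (T - 2 * s + y j)) powr p)"
      by (simp add: sum_distrib_left mult_ac)
    also have "... \<le> A powr p * (\<Sum>j<L. b (x - (T - 2 * s + y j)) powr p * bump (x / \<Lambda>))"
      using summand by (intro mult_left_mono sum_mono) auto
    also have "... = A powr p * (\<Sum>j<L. b (x - (T - 2 * s + y j)) powr p) * bump (x / \<Lambda>)"
      by (simp add: sum_distrib_right mult.assoc)
    \<comment> \<open>The power of the sum dominates the sum of the powers, so disjointness of the
      bumps need not be invoked.\<close>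
    also have "... \<le> A powr p * (\<Sum>j<L. b (x - (T - 2 * s + y j))) powr p * bump (x / \<Lambda>)"
      using p b(2) by (intro mult_right_mono mult_left_mono powr_sum_superadditive) (auto simp: bump_simps)
    also have "A powr p * (\<Sum>j<L. b (x - (T - 2 * s + y j))) powr p = train A b y L (x - T + 2 * s) powr p"
      unfolding train_def powr_mult by (simp add: algebra_simps)
    finally show "(bump_floor * A powr p) * (\<Sum>j<L. b (x - (T - 2 * s + y j)) powr p) \<le> train A b y L (x - T + 2 * s) powr p * bump (x / \<Lambda>)" .
  qed
  finally show ?thesis .
qed

text \<open>Three contributions to the pairing of the final state with the wide bump are compared,
  each with a bound proportional to \<open>L\<close>: the leading part of the correction, its error
  \<open>\<rho> * remainder\<close> integrated over the length \<open>\<Lambda>\<close>, and the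
  free wave. The constants make the last two a fraction of the first.\<close>

theorem norm_inflation:
  assumes \<omega>: "\<bar>\<omega>\<bar> = 1" and p: "1 < p" and s: "s < 1 / 2"
    and data: "\<And>\<epsilon>. 0 < \<epsilon> \<Longrightarrow> \<exists>b. base_profile p s \<epsilon> b" and T: "0 < T" and \<epsilon>: "0 < \<epsilon>"
  shows "\<exists>u v. gNLW_solution \<omega> p s {0..T} u v \<and> (\<forall>\<tau>\<in>{0..T}. real_valued (u \<tau>)) \<and>
    u 0 \<in> dist_of ` schwartz \<and> sobolev_norm s (u 0) < \<epsilon> \<and> v 0 = zero_dist \<and> M \<le> sobolev_norm s (u T)"
proof -
  obtain D where D: "D > 0" "\<And>\<Lambda> u g. 1 \<le> \<Lambda> \<Longrightarrow> sobolev_ft s u g \<Longrightarrow> cmod (u (\<lambda>x. complex_of_real (bump (x / \<Lambda>)))) \<le> sobolev_norm s u * sqrt (\<Lambda> * D)"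
    using bump_pairing_bound[of s] by blast
  define d where "d = 2 * T + 2"
  define c3 where "c3 = 3 powr p"
  define cl where "cl = p * 3 powr (p - 1)"
  \<comment> \<open>With this value \<open>\<rho> * \<theta> * \<Lambda>\<close> is a quarter of the
    leading term \<open>2 powr (- p) * (bump_floor * \<kappa> * real L * T^2 / 2)\<close>.\<close>
  define \<theta> where "\<theta> = 2 powr (- p) * T * bump_floor / (128 * c3 * d)"
  \<comment> \<open>\<open>m\<close> will be \<open>\<rho> powr (p - 1)\<close>. The bounds are what
    the two conditions in \<open>small\<close> and the demand
    \<open>remainder \<le> \<theta>\<close> ask of the terms in \<open>\<rho>\<close> alone.\<close>
  define m where "m = min (1 / (2 * c3 * T^2)) (min (1 / 4) (\<theta> / 2) / (cl * T^2))"
  define \<rho> where "\<rho> = m powr (1 / (p - 1))"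
  \<comment> \<open>Makes the data term \<open>3 powr p * T * \<kappa>\<close> in the first
    smallness condition equal to \<open>\<rho> / 2\<close>.\<close>
  define \<kappa> where "\<kappa> = \<rho> / (2 * c3 * T)"
  define A where "A = \<kappa> powr (1 / p)"
  define c1 where "c1 = 2 powr (- p) * T^2 * bump_floor / 4"
  have pos: "0 < d" "0 < c3" "0 < cl" using T p by (auto simp: d_def c3_def cl_def)
  have \<theta>: "0 < \<theta>" using pos T bump_floor_pos by (simp add: \<theta>_def)
  have m: "0 < m" using pos T \<theta> by (simp add: m_def)
  have \<rho>: "0 < \<rho>" using m by (simp add: \<rho>_def)
  have \<kappa>: "0 < \<kappa>" using \<rho> pos T by (simp add: \<kappa>_def)
  have A: "0 < A" "A powr p = \<kappa>" using \<kappa> p by (simp_all add: A_def powr_powr)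
  have c1: "0 < c1" using T bump_floor_pos by (simp add: c1_def)
  have \<rho>m: "\<rho> powr (p - 1) = m" using m p by (simp add: \<rho>_def powr_powr)
  have \<rho>p: "\<rho> powr p = m * \<rho>" using \<rho> by (simp add: \<rho>m[symmetric] powr_diff)
  have m1: "c3 * T^2 * m \<le> 1 / 2"
  proof -
    have "c3 * T^2 * m \<le> c3 * T^2 * (1 / (2 * c3 * T^2))" using pos by (intro mult_left_mono) (auto simp: m_def)
    then show ?thesis using pos T by simp
  qed
  have m2: "cl * T^2 * m \<le> min (1 / 4) (\<theta> / 2)"
  proof -
    have "cl * T^2 * m \<le> cl * T^2 * (min (1 / 4) (\<theta> / 2) / (cl * T^2))" using pos by (intro mult_left_mono) (auto simp: m_def)
    then show ?thesis using pos T by simp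
  qed
  \<comment> \<open>The pairing grows like \<open>L\<close> and the dual norm of the wide bump like
    \<open>sqrt L\<close>; their quotient has to reach \<open>M\<close>.\<close>
  obtain L0 :: nat where L0: "(M * (2 * sqrt (8 * d * D)) / (c1 * \<kappa>))^2 \<le> real L0" using real_arch_simple by blast
  define L where "L = Suc L0"
  have L: "0 < L" "M * (2 * sqrt (8 * d * D)) / (c1 * \<kappa>) \<le> sqrt (real L)"
    using L0 by (auto simp: L_def intro!: real_le_rsqrt)
  define \<Lambda> where "\<Lambda> = 8 * d * real L"
  have dL: "d \<le> d * real L" using L(1) pos by simp
  have d2: "2 \<le> d" using T by (simp add: d_def)
  have "\<Lambda> = 8 * (d * real L)" by (simp add: \<Lambda>_def)
  with dL have "8 * d \<le> \<Lambda>" by simp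
  then have \<Lambda>: "1 \<le> \<Lambda>" "0 < \<Lambda>" "T \<le> \<Lambda>" using T by (auto simp: d_def)
  define y where "y j = 3 * d * real L + d * real j" for j :: nat
  \<comment> \<open>Three demands: a small L^(p-1) window bound \<open>e\<close>, a free wave whose
    pairing is at most half the lower bound for that of the correction, and a datum of norm below
    \<open>\<epsilon>\<close> after summing \<open>L\<close> bumps.\<close>
  define \<epsilon>1 where "\<epsilon>1 = min (min (1 / 4) (\<theta> / 2) / (cl * T * A powr (p - 1))) (min (c1 * \<kappa> / (2 * A)) (\<epsilon> / (2 * (A * real L))))"
  have \<epsilon>1: "0 < \<epsilon>1" using pos T A \<theta> c1 \<kappa> \<epsilon> L by (auto simp: \<epsilon>1_def)
  obtain b where b: "base_profile p s \<epsilon>1 b" "(LINT x|lborel. b x) \<le> \<epsilon>1" "(LINT x|lborel. b x powr (p - 1)) \<le> \<epsilon>1"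
    using base_profile_integrals_small[OF p data \<epsilon>1] by blast
  then have pb: "profile b" and bn: "(LINT x|lborel. b x powr p) = 1" "sqrt (profile_norm2 s b) \<le> \<epsilon>1"
    by (auto simp: base_profile_def)
  note b' = profileD(1-3)[OF pb] bn and bS = profileD(4)[OF pb] and ib = profileD(6)[OF pb]
  define h where "h = train A b y L"
  define e where "e = A powr (p - 1) * (LINT x|lborel. b x powr (p - 1))"
  have sep: "2 * T + 2 \<le> \<bar>y i - y j\<bar>" if "i \<noteq> j" for i j
  proof -
    have "1 \<le> \<bar>real i - real j\<bar>" using that by (cases i j rule: linorder_cases) auto
    from mult_left_mono[OF this, of d] have "d \<le> \<bar>d * (real i - real j)\<bar>" using pos by (simp add: abs_mult)
    then show ?thesis by (simp add: y_def d_def right_diff_distrib)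
  qed
  have e: "cl * T * e \<le> min (1 / 4) (\<theta> / 2)"
  proof -
    have "cl * T * e \<le> cl * T * A powr (p - 1) * \<epsilon>1" unfolding e_def mult.assoc using pos T b(3) by (intro mult_left_mono) auto
    also have "... \<le> cl * T * A powr (p - 1) * (min (1 / 4) (\<theta> / 2) / (cl * T * A powr (p - 1)))"
      using pos T by (intro mult_left_mono) (auto simp: \<epsilon>1_def)
    also have "... = min (1 / 4) (\<theta> / 2)" using pos T A by simp
    finally show ?thesis .
  qed
  have h0: "h x = 0" if "x < 0 \<or> \<Lambda> < x" for x
  proof -
    have "b (x - y j) = 0" if j: "j < L" for j
    proof (rule b'(3))
      have "d * real j \<le> d * (real L - 1)" using j pos by (intro mult_left_mono) auto
      moreover have "0 \<le> d * real j" using pos by simp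
      moreover have "y j = 3 * (d * real L) + d * real j" "\<Lambda> = 8 * (d * real L)" "d * (real L - 1) = d * real L - d"
        by (simp_all add: y_def \<Lambda>_def algebra_simps)
      ultimately have "x - y j < 1 \<or> 2 < x - y j" using \<open>x < 0 \<or> \<Lambda> < x\<close> dL d2 by linarith
      then show "x - y j \<notin> {1..2}" by auto
    qed
    then show ?thesis by (simp add: h_def train_def)
  qed
  interpret small_data \<omega> p T \<Lambda> \<rho> \<kappa> e h
  proof
    show "smooth1 (cplx h)" unfolding h_def by (rule smooth1_train[OF b'(1)])
    show "0 \<le> h x" for x unfolding h_def using A b'(2) by (intro train_nonneg) auto
    show "h x = 0" if "\<Lambda> < \<bar>x\<bar>" for x using h0[of x] that \<Lambda> by (auto simp: abs_real_def split: if_splits)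
    show "(LINT x|lborel. indicator {a..a + 2 * T} x * h x powr p) \<le> \<kappa>" for a
      using train_window[of b A p T y a L] pb b' A p sep T by (simp add: h_def)
    show "(LINT x|lborel. indicator {a..a + 2 * T} x * h x powr (p - 1)) \<le> e" for a
      using train_window[of b A "p - 1" T y a L] pb b' A p sep T by (simp add: h_def e_def)
    have "3 powr p * (T * \<kappa> + T^2 * \<rho> powr p) = \<rho> / 2 + c3 * T^2 * m * \<rho>"
      using pos T by (simp add: \<rho>p \<kappa>_def c3_def[symmetric] distrib_left)
    also have "... \<le> \<rho> / 2 + 1 / 2 * \<rho>" using m1 \<rho> by (intro add_left_mono mult_right_mono) auto
    finally show "3 powr p * (T * \<kappa> + T^2 * \<rho> powr p) \<le> \<rho>" by simp
    have "p * 3 powr (p - 1) * (T * e + T^2 * \<rho> powr (p - 1)) = cl * T * e + cl * T^2 * m"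
      by (simp add: cl_def \<rho>m algebra_simps)
    also have "... \<le> 1 / 4 + 1 / 4" using e m2 by (intro add_mono) auto
    finally show "p * 3 powr (p - 1) * (T * e + T^2 * \<rho> powr (p - 1)) \<le> 1 / 2" by simp
  qed (use \<omega> p T \<rho> in auto)
  have rem: "remainder \<le> \<theta>"
  proof -
    have "remainder = cl * T * e + cl * T^2 * m" by (simp add: remainder_def cl_def \<rho>m algebra_simps)
    also have "... \<le> \<theta> / 2 + \<theta> / 2" using e m2 by (intro add_mono) auto
    finally show ?thesis by simp
  qed
  obtain u v w where sol: "gNLW_solution \<omega> p s {0..T} u v" "\<forall>\<tau>\<in>{0..T}. real_valued (u \<tau>)"
    and u0: "u 0 = dist_of (cplx h)" and v0: "v 0 = zero_dist" and ftT: "\<exists>g. sobolev_ft s (u T) g"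
    and w: "continuous_on UNIV w" "\<forall>x. \<bar>x\<bar> > \<Lambda> + T \<longrightarrow> w x = 0"
    and uT: "u T = dist_of (\<lambda>x. complex_of_real (U (T, x) + w x))"
    and low: "\<forall>x. 2 powr (- p) * (LINT s|lborel. indicator {0..T} s * (s * h (x - T + 2 * s) powr p)) - \<rho> * remainder \<le> - \<omega> * w x"
    using solution_exists[OF s] by blast
  let ?\<theta> = "\<lambda>x. bump (x / \<Lambda>)"
  have \<chi>S: "(cplx ?\<theta>) \<in> schwartz" by (rule schwartz_bump_scaled[OF \<Lambda>(2)])
  have \<chi>c: "continuous_on UNIV ?\<theta>" using schwartz_smooth1[OF \<chi>S] by (rule smooth1_continuous_real)
  have \<chi>0: "?\<theta> x = 0" if "x \<notin> {0..\<Lambda>}" for x using that \<Lambda> bump_simps(6)[of "x / \<Lambda>"] by (auto simp: field_simps)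
  have i\<chi>: "integrable lborel (\<lambda>x. k x * ?\<theta> x)" if "continuous_on UNIV k" for k :: "real \<Rightarrow> real"
    by (rule integrable_compact_support[of _ "{0..\<Lambda>}"]) (use \<chi>0 that \<chi>c in \<open>auto intro!: continuous_intros\<close>)
  have Uc: "continuous_on UNIV (\<lambda>x. U (T, x))" by (rule continuous_on_compose2[OF continuous_U]) (auto intro!: continuous_intros)
  have W_low: "c1 * \<kappa> * real L \<le> \<bar>LINT x|lborel. w x * ?\<theta> x\<bar>"
  proof -
    have lo: "bump_floor * \<kappa> * real L \<le> (LINT x|lborel. h (x - T + 2 * s) powr p * ?\<theta> x)" if "s \<in> {0..T}" for s
      unfolding h_def A(2)[symmetric] y_def[abs_def]
      by (rule train_pairing_lower[OF pb b'(4) _ p T d_def \<Lambda>_def L(1) that]) (use A in auto)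
    let ?I = "\<lambda>x. (LINT s|lborel. indicator {0..T} s * (s * h (x - T + 2 * s) powr p))"
    have kp: "continuous_on UNIV (\<lambda>x. h x powr p)" using p by (intro continuous_powr_h) simp
    have I: "integrable lborel (\<lambda>x. ?I x * ?\<theta> x)" "bump_floor * \<kappa> * real L * T^2 / 2 \<le> (LINT x|lborel. ?I x * ?\<theta> x)"
      using double_integral_lower[where k = "\<lambda>x. h x powr p" and \<theta> = ?\<theta> and \<Lambda> = \<Lambda> and T = T and m = "bump_floor * \<kappa> * real L",
          OF kp \<chi>c \<chi>0 lo] T by auto
    have "integrable lborel (\<lambda>x. ?\<theta> x)" using i\<chi>[of "\<lambda>_. 1"] by simp
    moreover have "(LINT x|lborel. ?\<theta> x) \<le> \<Lambda>"
    proof -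
      have "(LINT x|lborel. ?\<theta> x) \<le> (LINT x|lborel. indicator {0..\<Lambda>} x)"
      proof (rule integral_mono)
        show "integrable lborel (\<lambda>x. ?\<theta> x)" by fact
        show "?\<theta> x \<le> indicator {0..\<Lambda>} x" for x using \<chi>0[of x] bump_simps(5)[of "x / \<Lambda>"] by (auto simp: indicator_def)
      qed (auto simp: emeasure_lborel_Icc_eq)
      also have "... = \<Lambda>" using \<Lambda> by simp
      finally show ?thesis .
    qed
    moreover have \<rho>r: "\<rho> * remainder * \<Lambda> \<le> \<rho> * \<theta> * \<Lambda>" using rem \<rho> \<Lambda> by (intro mult_right_mono mult_left_mono) auto
    moreover have r0: "0 \<le> \<rho> * remainder"
    proof -
      have "0 \<le> (LINT x|lborel. b x powr (p - 1))" by (intro integral_nonneg_AE) auto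
      then have "0 \<le> e" by (simp add: e_def)
      then show ?thesis using \<rho> p T by (simp add: remainder_def)
    qed
    ultimately have \<chi>i: "integrable lborel ?\<theta>" "(\<rho> * remainder) * (LINT x|lborel. ?\<theta> x) \<le> \<rho> * \<theta> * \<Lambda>"
      using mult_left_mono[of "LINT x|lborel. ?\<theta> x" \<Lambda> "\<rho> * remainder"] by auto
    have "2 powr (- p) * (bump_floor * \<kappa> * real L * T^2 / 2) - \<rho> * \<theta> * \<Lambda>
       \<le> 2 powr (- p) * (LINT x|lborel. ?I x * ?\<theta> x) - (\<rho> * remainder) * (LINT x|lborel. ?\<theta> x)"
      using I(2) \<chi>i(2) by (intro diff_mono mult_left_mono) auto
    also have "... = (LINT x|lborel. 2 powr (- p) * (?I x * ?\<theta> x) - (\<rho> * remainder) * ?\<theta> x)"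
      using I(1) \<chi>i(1) by (subst integral_diff) auto
    also have "... \<le> (LINT x|lborel. - \<omega> * (w x * ?\<theta> x))"
    proof (rule integral_mono)
      show "integrable lborel (\<lambda>x. 2 powr (- p) * (?I x * ?\<theta> x) - (\<rho> * remainder) * ?\<theta> x)"
        using I(1) \<chi>i(1) by (intro integrable_diff integrable_mult_right)
      show "integrable lborel (\<lambda>x. - \<omega> * (w x * ?\<theta> x))" by (intro integrable_mult_right i\<chi> w)
      fix x
      from mult_right_mono[OF low[rule_format, of x], of "?\<theta> x"]
      show "2 powr (- p) * (?I x * ?\<theta> x) - (\<rho> * remainder) * ?\<theta> x \<le> - \<omega> * (w x * ?\<theta> x)"
        by (simp add: bump_simps left_diff_distrib mult.assoc)
    qed
    also have "... \<le> \<bar>LINT x|lborel. w x * ?\<theta> x\<bar>"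
    proof -
      have "\<bar>- \<omega> * (LINT x|lborel. w x * ?\<theta> x)\<bar> = \<bar>LINT x|lborel. w x * ?\<theta> x\<bar>" using \<omega> by (simp add: abs_mult)
      then show ?thesis by (metis abs_ge_self integral_mult_right_zero)
    qed
    also have "2 powr (- p) * (bump_floor * \<kappa> * real L * T^2 / 2) - \<rho> * \<theta> * \<Lambda>
       = 2 powr (- p) * T^2 * bump_floor * \<kappa> * real L * (1 / 2 - 1 / 8)"
    proof -
      have "\<rho> = 2 * c3 * T * \<kappa>" using pos T by (simp add: \<kappa>_def)
      then have "\<rho> * \<theta> * \<Lambda> = 2 powr (- p) * T^2 * bump_floor * \<kappa> * real L / 8"
        using pos by (simp add: \<theta>_def \<Lambda>_def power2_eq_square field_simps)
      then show ?thesis by (simp add: algebra_simps)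
    qed
    finally have "2 powr (- p) * T^2 * bump_floor * \<kappa> * real L * (1 / 2 - 1 / 8) \<le> \<bar>LINT x|lborel. w x * ?\<theta> x\<bar>" .
    moreover have "c1 * \<kappa> * real L \<le> 2 powr (- p) * T^2 * bump_floor * \<kappa> * real L * (1 / 2 - 1 / 8)"
    proof -
      have "c1 * \<kappa> * real L = 2 powr (- p) * T^2 * bump_floor * \<kappa> * real L * (1 / 4)" by (simp add: c1_def)
      also have "... \<le> 2 powr (- p) * T^2 * bump_floor * \<kappa> * real L * (1 / 2 - 1 / 8)"
        using bump_floor_pos \<kappa> by (intro mult_left_mono) auto
      finally show ?thesis .
    qed
    ultimately show ?thesis by linarith
  qed
  have hi: "integrable lborel h" "(LINT x|lborel. h x) \<le> A * (real L * \<epsilon>1)"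
    using train_integral[OF ib, of A y L] b(2) A by (auto simp: h_def intro!: mult_left_mono)
  \<comment> \<open>The free wave is nonnegative with the same integral as \<open>h\<close>, and the
    wide bump is at most one.\<close>
  have U_up: "\<bar>LINT x|lborel. U (T, x) * ?\<theta> x\<bar> \<le> c1 * \<kappa> * real L / 2"
  proof -
    have i1: "integrable lborel (\<lambda>x. h (x + T))" "integrable lborel (\<lambda>x. h (x - T))"
      using lborel_integrable_real_affine[OF hi(1), of 1 T] lborel_integrable_real_affine[OF hi(1), of 1 "- T"]
      by (simp_all add: add.commute)
    have iU: "integrable lborel (\<lambda>x. U (T, x))" using i1 by (simp add: U_def)
    have "\<bar>LINT x|lborel. U (T, x) * ?\<theta> x\<bar> = (LINT x|lborel. U (T, x) * ?\<theta> x)"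
      by (intro abs_of_nonneg integral_nonneg_AE AE_I2 mult_nonneg_nonneg U_nonneg bump_simps)
    also have "... \<le> (LINT x|lborel. U (T, x))"
      using iU i\<chi>[OF Uc] by (intro integral_mono) (auto intro!: mult_left_le bump_simps U_nonneg)
    also have "... = (LINT x|lborel. h x)"
      using i1 integral_shift[of h T] integral_shift[of h "- T"] by (simp add: U_def)
    also have "... \<le> A * (real L * (c1 * \<kappa> / (2 * A)))"
      using A by (intro order_trans[OF hi(2)] mult_left_mono) (auto simp: \<epsilon>1_def)
    also have "... = c1 * \<kappa> * real L / 2" using A by simp
    finally show ?thesis .
  qed
  obtain g where g: "sobolev_ft s (u T) g" using ftT by blast
  have "u T (cplx ?\<theta>) = complex_of_real ((LINT x|lborel. U (T, x) * ?\<theta> x) + (LINT x|lborel. w x * ?\<theta> x))"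
  proof -
    have "u T (cplx ?\<theta>) = (LINT x|lborel. complex_of_real (U (T, x) * ?\<theta> x + w x * ?\<theta> x))"
      unfolding uT dist_of_def using \<chi>S by (simp add: distrib_right)
    also have "... = complex_of_real (LINT x|lborel. U (T, x) * ?\<theta> x + w x * ?\<theta> x)" by (rule integral_complex_of_real)
    finally show ?thesis using i\<chi>[OF Uc] i\<chi>[OF w(1)] by simp
  qed
  then have "cmod (u T (cplx ?\<theta>)) = \<bar>(LINT x|lborel. U (T, x) * ?\<theta> x) + (LINT x|lborel. w x * ?\<theta> x)\<bar>"
    by (simp only: norm_of_real)
  then have "c1 * \<kappa> * real L / 2 \<le> cmod (u T (cplx ?\<theta>))"
    using W_low U_up by linarith
  also have "... \<le> sobolev_norm s (u T) * sqrt (\<Lambda> * D)" by (rule D(2)[OF \<Lambda>(1) g])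
  also have "sqrt (\<Lambda> * D) = sqrt (8 * d * D) * sqrt (real L)" by (simp add: \<Lambda>_def mult_ac flip: real_sqrt_mult)
  finally have "c1 * \<kappa> * real L / 2 \<le> sobolev_norm s (u T) * (sqrt (8 * d * D) * sqrt (real L))" .
  moreover have "real L = sqrt (real L) * sqrt (real L)" by simp
  ultimately have "sqrt (real L) * (c1 * \<kappa> * sqrt (real L) / 2) \<le> sqrt (real L) * (sobolev_norm s (u T) * sqrt (8 * d * D))"
    by (simp add: mult_ac)
  then have n1: "c1 * \<kappa> * sqrt (real L) / 2 \<le> sobolev_norm s (u T) * sqrt (8 * d * D)" using L(1) by simp
  have "M * (2 * sqrt (8 * d * D)) \<le> sqrt (real L) * (c1 * \<kappa>)"
    using L(2) c1 \<kappa> by (simp add: pos_divide_le_eq)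
  with n1 have "M * sqrt (8 * d * D) \<le> sobolev_norm s (u T) * sqrt (8 * d * D)" by (simp add: mult_ac)
  then have MT: "M \<le> sobolev_norm s (u T)" using pos D by simp
  have hS: "(cplx h) \<in> schwartz"
    by (rule schwartz_compact_support[OF h(1), of 0 \<Lambda>]) (use h0 in \<open>auto simp: not_le\<close>)
  have ft0: "sobolev_ft s (u 0) (fourier (cplx h))"
    unfolding u0 by (intro sobolev_ft_dist_of schwartz_integrable hS schwartz_integrable_weight_square fourier_schwartz)
  have "sobolev_norm s (u 0) \<le> A * real L * \<epsilon>1"
  proof -
    have "(profile_norm2 s h)
      \<le> (LINT \<xi>|lborel. (A * real L)^2 * (wt s \<xi> * (cmod (fourier (cplx b) \<xi>))^2))"
    proof (rule integral_mono)
      show "integrable lborel (\<lambda>\<xi>. wt s \<xi> * (cmod (fourier (cplx h) \<xi>))^2)" by (rule sobolev_ftD(2)[OF ft0])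
      show "integrable lborel (\<lambda>\<xi>. (A * real L)^2 * (wt s \<xi> * (cmod (fourier (cplx b) \<xi>))^2))"
        by (intro integrable_mult_right schwartz_integrable_weight_square fourier_schwartz bS)
      fix \<xi>
      have "cmod (fourier (cplx h) \<xi>) \<le> A * real L * cmod (fourier (cplx b) \<xi>)"
        unfolding h_def using A by (intro train_fourier bS) simp
      then have "(cmod (fourier (cplx h) \<xi>))^2 \<le> (A * real L * cmod (fourier (cplx b) \<xi>))^2"
        by (intro power_mono) auto
      from mult_left_mono[OF this, of "wt s \<xi>"]
      show "wt s \<xi> * (cmod (fourier (cplx h) \<xi>))^2 \<le> (A * real L)^2 * (wt s \<xi> * (cmod (fourier (cplx b) \<xi>))^2)"
        by (simp add: power_mult_distrib mult_ac)
    qed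
    then have "sobolev_norm s (u 0) \<le> sqrt ((A * real L)^2 * (profile_norm2 s b))"
      unfolding sobolev_norm_eq[OF ft0] by (intro real_sqrt_le_mono) simp
    also have "... = A * real L * sqrt (profile_norm2 s b)"
      using A by (simp add: real_sqrt_mult)
    also have "... \<le> A * real L * \<epsilon>1" using A b'(5) by (intro mult_left_mono) auto
    finally show ?thesis .
  qed
  also have "... \<le> A * real L * (\<epsilon> / (2 * (A * real L)))" using A by (intro mult_left_mono) (auto simp: \<epsilon>1_def)
  also have "... < \<epsilon>" using A L(1) \<epsilon> by simp
  finally show ?thesis
    using sol u0 hS v0 MT by (intro exI[of _ u] exI[of _ v]) auto
qed

section \<open>Profiles with small Sobolev norm\<close>

text \<open>A shift by half a period \<open>pi / k\<close> reverses the sign of the cosine, so twice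
  the integral is bounded by the L^1 distance between \<open>f\<close> and its shift, which tends to
  zero.\<close>

lemma Riemann_Lebesgue:
  fixes f :: "real \<Rightarrow> real"
  assumes c: "continuous_on UNIV f" and f: "\<And>x. x \<notin> {l..r} \<Longrightarrow> f x = 0" and N: "filterlim N at_top sequentially"
  shows "(\<lambda>n. LINT x|lborel. f x * cos (N n * x)) \<longlonglongrightarrow> 0"
proof (rule Lim_null_comparison)
  have cc: "continuous_on UNIV (\<lambda>x. f (x + a))" for a by (rule continuous_on_compose2[OF c]) (auto intro!: continuous_intros)
  have i: "integrable lborel (\<lambda>x. f (x + a))" for a
    by (rule integrable_compact_support[OF cc, of "{l - a..r - a}"]) (use f in auto)
  have ik: "integrable lborel (\<lambda>x. f (x + a) * cos (k * x))" for a k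
    by (rule integrable_compact_support[of _ "{l - a..r - a}"]) (use f cc in \<open>auto intro!: continuous_intros\<close>)
  have bound: "norm (LINT x|lborel. f x * cos (k * x)) \<le> (LINT x|lborel. \<bar>f (x + 0) - f (x + pi / k)\<bar>)" if k: "0 < k" for k
  proof -
    have "(LINT x|lborel. f x * cos (k * x)) = (LINT x|lborel. f (pi / k + 1 * x) * cos (k * (pi / k + 1 * x)))"
      using lborel_integral_real_affine[of 1 "\<lambda>x. f x * cos (k * x)" "pi / k"] by simp
    also have "... = (LINT x|lborel. - (f (x + pi / k) * cos (k * x)))"
    proof (rule integral_cong[OF refl])
      fix x
      have "k * (pi / k + 1 * x) = k * x + pi" using k by (simp add: distrib_left)
      then show "f (pi / k + 1 * x) * cos (k * (pi / k + 1 * x)) = - (f (x + pi / k) * cos (k * x))"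
        by (simp add: add.commute)
    qed
    finally have e: "(LINT x|lborel. f x * cos (k * x)) = - (LINT x|lborel. f (x + pi / k) * cos (k * x))" by simp
    have "2 * (LINT x|lborel. f x * cos (k * x)) = (LINT x|lborel. f (x + 0) * cos (k * x)) - (LINT x|lborel. f (x + pi / k) * cos (k * x))"
      using e by simp
    also have "... = (LINT x|lborel. f (x + 0) * cos (k * x) - f (x + pi / k) * cos (k * x))"
      by (rule integral_diff[symmetric, OF ik ik])
    also have "norm ... \<le> (LINT x|lborel. \<bar>f (x + 0) - f (x + pi / k)\<bar>)"
    proof (rule integral_norm_bound_integral)
      show "integrable lborel (\<lambda>x. f (x + 0) * cos (k * x) - f (x + pi / k) * cos (k * x))"
        by (intro integrable_diff ik)
      show "integrable lborel (\<lambda>x. \<bar>f (x + 0) - f (x + pi / k)\<bar>)" by (intro integrable_abs integrable_diff i)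
      show "norm (f (x + 0) * cos (k * x) - f (x + pi / k) * cos (k * x)) \<le> \<bar>f (x + 0) - f (x + pi / k)\<bar>" for x
        by (simp add: abs_mult mult_left_le flip: left_diff_distrib)
    qed
    finally show ?thesis by simp
  qed
  have "\<forall>\<^sub>F n in sequentially. 1 \<le> N n" using N by (simp add: filterlim_at_top)
  then show "\<forall>\<^sub>F n in sequentially. norm (LINT x|lborel. f x * cos (N n * x)) \<le> (LINT x|lborel. \<bar>f (x + 0) - f (x + pi / max 1 (N n))\<bar>)"
    by eventually_elim (use bound in auto)
  have "bounded (f ` {l..r})" by (intro compact_imp_bounded compact_continuous_image continuous_on_subset[OF c]) auto
  then obtain B where "\<forall>y\<in>f ` {l..r}. norm y \<le> B" unfolding bounded_iff by blast
  then have B: "\<bar>f x\<bar> \<le> B" if "x \<in> {l..r}" for x using that by auto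
  have B': "\<bar>f x\<bar> \<le> \<bar>B\<bar>" for x using B[of x] f[of x] by (cases "x \<in> {l..r}") auto
  \<comment> \<open>Taking the maximum with 1 keeps all shifts at most \<open>pi\<close>, so one
    interval supports all differences.\<close>
  have N': "filterlim (\<lambda>n. max 1 (N n)) at_top sequentially"
    by (rule filterlim_at_top_mono[OF N]) simp
  have lim: "(\<lambda>n. pi / max 1 (N n)) \<longlonglongrightarrow> 0" by (rule tendsto_divide_0[OF tendsto_const filterlim_mono[OF N' at_top_le_at_infinity order_refl]])
  have "(\<lambda>n. LINT x|lborel. \<bar>f (x + 0) - f (x + pi / max 1 (N n))\<bar>) \<longlonglongrightarrow> (LINT x|(lborel::real measure). (0::real))"
  proof (rule integral_dominated_convergence[where w = "\<lambda>x. indicator {l - pi..r} x * (2 * \<bar>B\<bar>)"])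
    show "(\<lambda>x. \<bar>f (x + 0) - f (x + pi / max 1 (N n))\<bar>) \<in> borel_measurable lborel" for n
      using borel_measurable_continuous_onI[OF cc, of 0] borel_measurable_continuous_onI[OF cc, of "pi / max 1 (N n)"] by measurable
    show "integrable lborel (\<lambda>x. indicator {l - pi..r} x * (2 * \<bar>B\<bar>))" by (intro integrable_mult_left) (simp add: emeasure_lborel_Icc_eq)
    show "AE x in lborel. (\<lambda>n. \<bar>f (x + 0) - f (x + pi / max 1 (N n))\<bar>) \<longlonglongrightarrow> 0"
    proof (rule AE_I2)
      fix x
      have "isCont f (x + 0)" using c by (simp add: continuous_on_eq_continuous_at)
      then have "(\<lambda>n. f (x + pi / max 1 (N n))) \<longlonglongrightarrow> f (x + 0)"
        by (rule isCont_tendsto_compose) (intro tendsto_intros lim)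
      then have "(\<lambda>n. \<bar>f (x + 0) - f (x + pi / max 1 (N n))\<bar>) \<longlonglongrightarrow> \<bar>f (x + 0) - f (x + 0)\<bar>" by (intro tendsto_intros)
      then show "(\<lambda>n. \<bar>f (x + 0) - f (x + pi / max 1 (N n))\<bar>) \<longlonglongrightarrow> 0" by simp
    qed
    show "AE x in lborel. norm \<bar>f (x + 0) - f (x + pi / max 1 (N n))\<bar> \<le> indicator {l - pi..r} x * (2 * \<bar>B\<bar>)" for n
    proof (rule AE_I2)
      fix x
      have h: "0 \<le> pi / max 1 (N n)" "pi / max 1 (N n) \<le> pi" by (auto simp: divide_le_eq mult_le_cancel_left1)
      show "norm \<bar>f (x + 0) - f (x + pi / max 1 (N n))\<bar> \<le> indicator {l - pi..r} x * (2 * \<bar>B\<bar>)"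
      proof (cases "x \<in> {l - pi..r}")
        case True
        then show ?thesis using B'[of x] B'[of "x + pi / max 1 (N n)"] abs_triangle_ineq4[of "f x" "f (x + pi / max 1 (N n))"] by simp
      next
        case False
        then have "x \<notin> {l..r}" "x + pi / max 1 (N n) \<notin> {l..r}" using h pi_gt_zero unfolding atLeastAtMost_iff by linarith+
        then have "f x = 0" "f (x + pi / max 1 (N n)) = 0" by (auto intro: f)
        then show ?thesis using False by simp
      qed
    qed
  qed auto
  then show "(\<lambda>n. LINT x|lborel. \<bar>f (x + 0) - f (x + pi / max 1 (N n))\<bar>) \<longlonglongrightarrow> 0" by simp
qed

text \<open>After a change of variables the weight is evaluated at a frequency tending to infinity,
  where for negative \<open>s\<close> it vanishes; it never exceeds one.\<close>

lemma negative_weight_shift_tendsto_0: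
  assumes s: "s < 0" and \<psi>: "\<psi> \<in> schwartz" and c: "filterlim c at_infinity sequentially"
  shows "(\<lambda>n. LINT \<xi>|lborel. wt s \<xi> * (cmod (\<psi> (\<xi> - c n)))^2) \<longlonglongrightarrow> 0"
proof -
  note [measurable] = schwartz_measurable[OF \<psi>]
  have "(LINT \<xi>|lborel. wt s \<xi> * (cmod (\<psi> (\<xi> - c n)))^2) = (LINT \<xi>|lborel. wt s (\<xi> + c n) * (cmod (\<psi> \<xi>))^2)" for n
    using lborel_integral_real_affine[of 1 "\<lambda>\<xi>. wt s \<xi> * (cmod (\<psi> (\<xi> - c n)))^2" "c n"] by (simp add: add.commute)
  moreover have "(\<lambda>n. LINT \<xi>|lborel. wt s (\<xi> + c n) * (cmod (\<psi> \<xi>))^2) \<longlonglongrightarrow> (LINT \<xi>|(lborel::real measure). (0::real))"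
  proof (rule integral_dominated_convergence[where w = "\<lambda>\<xi>. wt 0 \<xi> * (cmod (\<psi> \<xi>))^2"])
    show "integrable lborel (\<lambda>\<xi>. wt 0 \<xi> * (cmod (\<psi> \<xi>))^2)" by (rule schwartz_integrable_weight_square[OF \<psi>])
    show "AE \<xi> in lborel. (\<lambda>n. wt s (\<xi> + c n) * (cmod (\<psi> \<xi>))^2) \<longlonglongrightarrow> 0"
    proof (rule AE_I2)
      fix \<xi>
      have "filterlim (\<lambda>n. \<xi> + c n) at_infinity sequentially" by (rule tendsto_add_filterlim_at_infinity[OF tendsto_const c])
      then have "filterlim (\<lambda>n. norm (\<xi> + c n)) at_top sequentially" by (rule filterlim_at_infinity_imp_norm_at_top)
      then have "filterlim (\<lambda>n. norm (\<xi> + c n) ^ 2) at_top sequentially" by (rule filterlim_pow_at_top[rotated]) simp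
      then have "filterlim (\<lambda>n. 1 + (\<xi> + c n)^2) at_top sequentially"
        by (intro filterlim_tendsto_add_at_top[OF tendsto_const]) simp
      from tendsto_neg_powr[OF s this] have "(\<lambda>n. wt s (\<xi> + c n) * (cmod (\<psi> \<xi>))^2) \<longlonglongrightarrow> 0 * (cmod (\<psi> \<xi>))^2" by (intro tendsto_intros)
      then show "(\<lambda>n. wt s (\<xi> + c n) * (cmod (\<psi> \<xi>))^2) \<longlonglongrightarrow> 0" by simp
    qed
    show "AE \<xi> in lborel. norm (wt s (\<xi> + c n) * (cmod (\<psi> \<xi>))^2) \<le> wt 0 \<xi> * (cmod (\<psi> \<xi>))^2" for n
    proof (rule AE_I2)
      fix \<xi> :: real
      have "wt s (\<xi> + c n) \<le> wt 0 (\<xi> + c n)" using s by (intro powr_mono) auto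
      also have "... = wt 0 \<xi>" by (simp add: add_nonneg_eq_0_iff)
      finally show "norm (wt s (\<xi> + c n) * (cmod (\<psi> \<xi>))^2) \<le> wt 0 \<xi> * (cmod (\<psi> \<xi>))^2"
        using mult_right_mono[of "wt s (\<xi> + c n)" "wt 0 \<xi>" "(cmod (\<psi> \<xi>))^2"] by (simp only: real_norm_def abs_mult) simp
    qed
  qed auto
  ultimately show ?thesis by simp
qed

lemma profile_modulate:
  assumes b: "profile b" and a: "0 \<le> a" "a \<le> 1"
  shows "profile (\<lambda>x. b x * (1 + a * cos (k * x)))"
proof -
  have e: "complex_of_real (b x * (1 + a * cos (k * x)))
      = complex_of_real (b x) * (1 + (of_real (a / 2) * cis (k * x) + of_real (a / 2) * cis (- k * x)))" for x
    by (simp add: complex_eq_iff field_simps)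
  have "smooth1 (\<lambda>x. complex_of_real (b x) * (1 + (of_real (a / 2) * cis (k * x) + of_real (a / 2) * cis (- k * x))))"
    by (intro smooth1_mult smooth1_add smooth1_const smooth1_cis profileD b)
  moreover have "0 \<le> 1 + a * cos (k * x)" for x
  proof -
    have "\<bar>a * cos (k * x)\<bar> \<le> 1" unfolding abs_mult using a by (intro mult_le_one) auto
    then show ?thesis by linarith
  qed
  ultimately show ?thesis unfolding profile_def e using profileD[OF b] by auto
qed

lemma fourier_profile_modulate:
  assumes b: "profile b"
  shows "fourier (\<lambda>x. complex_of_real (b x * (1 + cos (k * x)))) \<xi> =
    fourier (cplx b) \<xi> +
    (fourier (cplx b) (\<xi> - k) + fourier (cplx b) (\<xi> - - k)) / 2"
proof -
  let ?b = "cplx b"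
  have i: "integrable lborel ?b" by (intro schwartz_integrable profileD b)
  have e: "complex_of_real (b x * (1 + cos (k * x))) = ?b x + (1 / 2) * (cis (k * x) * ?b x + cis (- k * x) * ?b x)" for x
    by (simp add: complex_eq_iff field_simps)
  show ?thesis
    unfolding e fourier_add[OF i integrable_mult_right[OF integrable_add[OF integrable_cis_mult[OF i] integrable_cis_mult[OF i]]]]
      fourier_cmult fourier_add[OF integrable_cis_mult[OF i] integrable_cis_mult[OF i]] fourier_modulate
    by simp
qed

text \<open>For negative \<open>s\<close> the two shifted copies of the Fourier transform disappear in the limit, so
  the modulated profile has asymptotically the same norm.\<close>

lemma profile_norm2_modulate:
  assumes s: "s < 0" and b: "profile b" and q: "profile_norm2 s b < Q"
  shows "\<forall>\<^sub>F n in sequentially. profile_norm2 s (\<lambda>x. b x * (1 + cos (real n * x))) < Q"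
proof -
  let ?F = "fourier (cplx b)"
  have F: "?F \<in> schwartz" by (intro fourier_schwartz profileD b)
  \<comment> \<open>The slack in Young's inequality for the cross terms: the unshifted part keeps a
    factor \<open>1 + \<eta>\<close>, close enough to one to stay below \<open>Q\<close>, while the
    vanishing shifted parts may carry the large factor \<open>1 + 1 / \<eta>\<close>.\<close>
  define \<eta> where "\<eta> = (Q - profile_norm2 s b) / (2 * (profile_norm2 s b + 1))"
  have "0 < profile_norm2 s b + 1" using profile_norm2_nonneg[of s b] by linarith
  then have \<eta>: "0 < \<eta>" unfolding \<eta>_def using q by (intro divide_pos_pos mult_pos_pos) simp_all
  have "\<eta> * profile_norm2 s b \<le> \<eta> * (profile_norm2 s b + 1)" using \<eta> by simp
  also have "... = (Q - profile_norm2 s b) / 2" 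
  proof -
    have "r / (2 * c) * c = r / 2" if "0 < c" for r c :: real using that by simp
    from this[OF \<open>0 < profile_norm2 s b + 1\<close>] show ?thesis by (simp only: \<eta>_def)
  qed
  finally have Q: "(1 + \<eta>) * profile_norm2 s b < Q" using q by (simp add: distrib_right)
  let ?G = "\<lambda>n. LINT \<xi>|lborel. wt s \<xi> * (cmod (?F (\<xi> - n)))^2"
  have shift: "(\<lambda>\<xi>. ?F (\<xi> - n)) \<in> schwartz" for n
  proof -
    have "fourier (\<lambda>x. cis (n * x) * complex_of_real (b x)) \<in> schwartz"
    proof (intro fourier_schwartz schwartz_compact_support[of _ 1 2])
      show "smooth1 (\<lambda>x. cis (n * x) * complex_of_real (b x))" by (intro smooth1_mult smooth1_cis profileD b)
    qed (use profileD(3)[OF b] in auto)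
    then show ?thesis by (simp add: fourier_modulate[abs_def])
  qed
  have iG: "integrable lborel (\<lambda>\<xi>. wt s \<xi> * (cmod (?F (\<xi> - n)))^2)" for n
    by (rule schwartz_integrable_weight_square[OF shift])
  have "filterlim real at_infinity sequentially" by (rule filterlim_mono[OF filterlim_real_sequentially at_top_le_at_infinity order_refl])
  moreover have "filterlim (\<lambda>n. - real n) at_infinity sequentially"
    using filterlim_mono[OF _ at_bot_le_at_infinity order_refl, of "\<lambda>n. - real n" sequentially] by (simp add: filterlim_uminus_at_bot filterlim_real_sequentially)
  ultimately have lim: "(\<lambda>n. ?G (real n)) \<longlonglongrightarrow> 0" "(\<lambda>n. ?G (- real n)) \<longlonglongrightarrow> 0"
    using negative_weight_shift_tendsto_0[OF s F] by blast+
  have "(\<lambda>n. (1 + \<eta>) * profile_norm2 s b + (1 + 1 / \<eta>) * (?G (real n) + ?G (- real n)))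
      \<longlonglongrightarrow> (1 + \<eta>) * profile_norm2 s b + (1 + 1 / \<eta>) * (0 + 0)"
    by (intro tendsto_intros lim)
  then have "(\<lambda>n. (1 + \<eta>) * profile_norm2 s b + (1 + 1 / \<eta>) * (?G (real n) + ?G (- real n))) \<longlonglongrightarrow> (1 + \<eta>) * profile_norm2 s b" by simp
  then have "\<forall>\<^sub>F n in sequentially. (1 + \<eta>) * profile_norm2 s b + (1 + 1 / \<eta>) * (?G (real n) + ?G (- real n)) < Q"
    using Q by (rule order_tendstoD(2))
  then show ?thesis
  proof eventually_elim
    fix n :: nat
    assume less: "(1 + \<eta>) * profile_norm2 s b + (1 + 1 / \<eta>) * (?G (real n) + ?G (- real n)) < Q"
    have sq: "(cmod (z + (x + y) / 2))^2 \<le> (1 + \<eta>) * (cmod z)^2 + (1 + 1 / \<eta>) * ((cmod x)^2 + (cmod y)^2)" for x y z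
    proof -
      define r where "r = (cmod x + cmod y) / 2"
      have r: "r\<^sup>2 \<le> (cmod x)^2 + (cmod y)^2"
      proof -
        have "((\<alpha> + \<gamma>) / 2)^2 \<le> \<alpha>\<^sup>2 + \<gamma>^2" for \<alpha> \<gamma> :: real
        proof -
          have "0 \<le> ((\<alpha> - \<gamma>)^2 + 2 * \<alpha>^2 + 2 * \<gamma>^2) / 4" by simp
          also have "... = \<alpha>^2 + \<gamma>^2 - ((\<alpha> + \<gamma>) / 2)^2" by (simp add: power2_eq_square field_simps)
          finally show ?thesis by simp
        qed
        then show ?thesis by (simp add: r_def)
      qed
      have "cmod ((x + y) / 2) \<le> r" using norm_triangle_ineq[of x y] by (simp add: r_def norm_divide)
      then have "cmod (z + (x + y) / 2) \<le> cmod z + r" using norm_triangle_ineq[of z "(x + y) / 2"] by linarith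
      then have "(cmod (z + (x + y) / 2))^2 \<le> (cmod z + r)^2" by (intro power_mono) auto
      also have "... \<le> (1 + \<eta>) * (cmod z)^2 + (1 + 1 / \<eta>) * r^2"
      proof -
        have "0 \<le> (\<eta> * cmod z - r)^2 / \<eta>" using \<eta> by simp
        also have "... = (1 + \<eta>) * (cmod z)^2 + (1 + 1 / \<eta>) * r^2 - (cmod z + r)^2"
          using \<eta> by (simp add: power2_eq_square field_simps)
        finally show ?thesis by simp
      qed
      also have "... \<le> (1 + \<eta>) * (cmod z)^2 + (1 + 1 / \<eta>) * ((cmod x)^2 + (cmod y)^2)"
        using r \<eta> by (intro add_left_mono mult_left_mono) auto
      finally show ?thesis .
    qed
    have m: "profile (\<lambda>x. b x * (1 + cos (real n * x)))" using profile_modulate[OF b, of 1 "real n"] by simp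
    let ?R = "\<lambda>\<xi>. (1 + \<eta>) * (wt s \<xi> * (cmod (?F \<xi>))^2) + (1 + 1 / \<eta>) * (wt s \<xi> * (cmod (?F (\<xi> - real n)))^2 + wt s \<xi> * (cmod (?F (\<xi> - - real n)))^2)"
    have "profile_norm2 s (\<lambda>x. b x * (1 + cos (real n * x))) \<le> (LINT \<xi>|lborel. ?R \<xi>)"
    proof (rule integral_mono)
      show "integrable lborel ?R" using iG integrable_profile_norm2[OF b]
        by (intro integrable_add integrable_mult_right)
      show "wt s \<xi> * (cmod (fourier (\<lambda>x. complex_of_real (b x * (1 + cos (real n * x)))) \<xi>))^2 \<le> ?R \<xi>" for \<xi>
        unfolding fourier_profile_modulate[OF b]
        using mult_left_mono[OF sq[of "?F \<xi>" "?F (\<xi> - real n)" "?F (\<xi> - - real n)"], of "wt s \<xi>"]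
        by (simp add: algebra_simps)
    qed (rule integrable_profile_norm2[OF m])
    also have "... = (1 + \<eta>) * profile_norm2 s b + (1 + 1 / \<eta>) * (?G (real n) + ?G (- real n))"
      unfolding integral_add[OF integrable_mult_right[OF integrable_profile_norm2[OF b]] integrable_mult_right[OF integrable_add[OF iG iG]]]
        integral_add[OF iG iG] integral_mult_right_zero ..
    finally show "profile_norm2 s (\<lambda>x. b x * (1 + cos (real n * x))) < Q" using less by linarith
  qed
qed

text \<open>From \<open>ln (1 + y) \<le> y\<close> and a quadratic bound for the exponential. The
  linear term is kept exact, since it will average out against the oscillation and only the
  quadratic one costs.\<close>

lemma one_plus_powr_le:
  fixes y q :: real
  assumes q: "0 < q" and y: "q * \<bar>y\<bar> \<le> 1" "\<bar>y\<bar> < 1"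
  shows "(1 + y) powr q \<le> 1 + q * y + (q * y)^2"
proof -
  have "(1 + y) powr q = exp (q * ln (1 + y))" using y by (simp add: powr_def)
  also have "... \<le> exp (q * y)" using q y ln_add_one_self_le_self2[of y] by simp
  also have "... \<le> 1 + q * y + (q * y)^2"
  proof (cases "0 \<le> q * y")
    case True
    moreover have "q * y \<le> 1" using y(1) q by (intro order_trans[OF mult_left_mono[of y "\<bar>y\<bar>" q]]) auto
    ultimately show ?thesis by (rule exp_bound)
  next
    case False
    define w where "w = - (q * y)"
    have w: "0 \<le> w" using False by (simp add: w_def)
    have "1 \<le> (1 + w + w^2 / 2) * (1 - w + w^2)"
    proof -
      have "(1 + w + w^2 / 2) * (1 - w + w^2) = 1 + (w^2 / 2 + w ^ 3 / 2 + w ^ 4 / 2)"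
        by (simp add: power2_eq_square power3_eq_cube power4_eq_xxxx field_simps)
      then show ?thesis using w by simp
    qed
    also have "... \<le> exp w * (1 - w + w^2)"
    proof (rule mult_right_mono[OF exp_lower_Taylor_quadratic[OF w]])
      have "0 \<le> (1 - w / 2)^2 + 3 / 4 * w^2" by simp
      also have "... = 1 - w + w^2" by (simp add: power2_eq_square field_simps)
      finally show "0 \<le> 1 - w + w^2" .
    qed
    finally have "exp (- w) \<le> 1 - w + w^2" by (simp add: exp_minus divide_simps mult.commute inverse_eq_divide)
    then show ?thesis by (simp add: w_def)
  qed
  finally show ?thesis .
qed


section \<open>Rescaled bumps and iterated oscillation\<close>

lemma profile_bump_scaled:
  assumes l: "0 < l" "l \<le> 1" shows "profile (\<lambda>x. bump ((x - 1) / l))"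
proof -
  have "smooth1 (\<lambda>x. complex_of_real (bump (1 / l * x + - 1 / l)))"
    by (rule smooth1_affine[OF smooth1_bump])
  moreover have "1 / l * x + - 1 / l = (x - 1) / l" for x by (simp add: diff_divide_distrib)
  moreover have "bump ((x - 1) / l) = 0" if "x \<notin> {1..2}" for x
  proof (cases "x < 1")
    case True then show ?thesis using l by (intro bump_simps) (simp add: divide_le_0_iff)
  next
    case False then show ?thesis using l that by (intro bump_simps) (simp add: le_divide_eq)
  qed
  ultimately show ?thesis by (simp add: profile_def bump_simps)
qed

lemma bump_powr_integral_scaled:
  assumes l: "0 < l" and q: "0 < q"
  shows "(LINT x|lborel. bump ((x - 1) / l) powr q) = l * (LINT x|lborel. bump x powr q)"
  using lborel_integral_real_affine[of l "\<lambda>x. bump ((x - 1) / l) powr q" 1] l by simp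

lemma bump_powr_integral_pos:
  assumes q: "0 < q" shows "0 < (LINT x|lborel. bump x powr q)"
proof -
  have c: "continuous_on UNIV bump" by (rule smooth1_continuous_real[OF smooth1_bump])
  have i: "integrable lborel (\<lambda>x. bump x powr q)"
    by (rule integrable_powr_compact_support[of bump 0 1 q]) (use c q bump_simps in auto)
  have "bump_floor powr q * (1 / 2) = (LINT x|lborel. bump_floor powr q * indicator {1/4..3/4::real} x)" by simp
  also have "... \<le> (LINT x|lborel. bump x powr q)"
  proof (rule integral_mono[OF _ i])
    show "bump_floor powr q * indicator {1/4..3/4} x \<le> bump x powr q" for x
      using bump_ge_floor[of x] bump_floor_pos q by (auto simp: indicator_def intro!: powr_mono2)
    show "integrable lborel (\<lambda>x. bump_floor powr q * indicator {1/4..3/4::real} x)"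
      by (intro integrable_mult_right integrable_real_indicator[OF _ emeasure_compact_finite[OF compact_Icc]]) simp
  qed
  moreover have "0 < bump_floor powr q * (1 / 2)" using bump_floor_pos by simp
  ultimately show ?thesis by linarith
qed

text \<open>One modulation step multiplies the pairing by \<open>1 + a / 2\<close> but the $L^q$ integral of the
  dual profile only by \<open>1 + O(a^2)\<close>.\<close>

lemma oscillating_profiles:
  fixes q s Q P I :: real and k :: nat
  defines "a \<equiv> 1 / (4 * q^2)"
  assumes s: "s < 0" and q: "1 < q"
    and \<beta>: "profile \<beta>" "profile_norm2 s \<beta> < Q" "(LINT x|lborel. \<beta> x powr q) < P" "I < (LINT x|lborel. \<beta> x * \<beta> x)"
  shows "\<exists>b \<phi>. profile b \<and> profile \<phi> \<and> profile_norm2 s b < Q \<and>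
    (LINT x|lborel. \<phi> x powr q) < (1 + a / 4) ^ k * P \<and> (1 + a / 2) ^ k * I < (LINT x|lborel. b x * \<phi> x)"
proof (induction k)
  case 0 then show ?case using \<beta> by (intro exI[of _ \<beta>]) simp
next
  case (Suc k)
  then obtain b \<phi> where b: "profile b" "profile \<phi>" "profile_norm2 s b < Q"
    and P: "(LINT x|lborel. \<phi> x powr q) < (1 + a / 4) ^ k * P" and I: "(1 + a / 2) ^ k * I < (LINT x|lborel. b x * \<phi> x)" by blast
  have q0: "0 < q" using q by simp
  have "1 < q\<^sup>2" using q by (simp add: power2_eq_square less_1_mult)
  then have a: "0 < a" "a \<le> 1 / 4" "q * a \<le> 1"
    using q by (auto simp: a_def divide_simps power2_eq_square mult_less_cancel_left1)
  \<comment> \<open>The reason for the value of \<open>a\<close>: the quadratic loss in the L^q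
    integral is \<open>a / 4\<close>, half of the gain \<open>a / 2\<close> in the pairing.\<close>
  have qa: "q\<^sup>2 * a^2 = a / 4" using q by (simp add: a_def power2_eq_square)
  have N: "filterlim real at_top sequentially" "filterlim (\<lambda>n. 2 * real n) at_top sequentially"
    by (auto intro!: filterlim_tendsto_pos_mult_at_top[OF tendsto_const] filterlim_real_sequentially)
  note [simp] = profileD(3)[OF b(1)] profileD(3)[OF b(2)]
  have lim1: "(\<lambda>n. LINT x|lborel. \<phi> x powr q * cos (real n * x)) \<longlonglongrightarrow> 0"
    by (rule Riemann_Lebesgue[OF profile_powr(2)[OF b(2) q0] _ N(1), of 1 2]) (use q0 in auto)
  have lim2: "(\<lambda>n. LINT x|lborel. b x * \<phi> x * cos (real n * x)) \<longlonglongrightarrow> 0"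
    by (rule Riemann_Lebesgue[OF profile_mult(1)[OF b(1,2)] _ N(1), of 1 2]) auto
  have lim3: "(\<lambda>n. LINT x|lborel. b x * \<phi> x * cos (2 * real n * x)) \<longlonglongrightarrow> 0"
    by (rule Riemann_Lebesgue[OF profile_mult(1)[OF b(1,2)] _ N(2), of 1 2]) auto
  \<comment> \<open>The strict inequalities of the induction hypothesis leave room for the
    oscillating integrals, which tend to zero as the frequency \<open>n\<close> grows.\<close>
  have "(\<lambda>n. (1 + a / 4) * (LINT x|lborel. \<phi> x powr q) + q * a * (LINT x|lborel. \<phi> x powr q * cos (real n * x)))
     \<longlonglongrightarrow> (1 + a / 4) * (LINT x|lborel. \<phi> x powr q) + q * a * 0" by (intro tendsto_intros lim1)
  moreover have "(1 + a / 4) * (LINT x|lborel. \<phi> x powr q) + q * a * 0 < (1 + a / 4) ^ Suc k * P"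
    using P a by (simp add: mult.assoc)
  ultimately have ev1: "\<forall>\<^sub>F n in sequentially. (1 + a / 4) * (LINT x|lborel. \<phi> x powr q) + q * a * (LINT x|lborel. \<phi> x powr q * cos (real n * x)) < (1 + a / 4) ^ Suc k * P"
    by (rule order_tendstoD(2))
  have "(\<lambda>n. (1 + a / 2) * (LINT x|lborel. b x * \<phi> x) + (1 + a) * (LINT x|lborel. b x * \<phi> x * cos (real n * x))
        + a / 2 * (LINT x|lborel. b x * \<phi> x * cos (2 * real n * x)))
     \<longlonglongrightarrow> (1 + a / 2) * (LINT x|lborel. b x * \<phi> x) + (1 + a) * 0 + a / 2 * 0" by (intro tendsto_intros lim2 lim3)
  moreover have "(1 + a / 2) ^ Suc k * I < (1 + a / 2) * (LINT x|lborel. b x * \<phi> x) + (1 + a) * 0 + a / 2 * 0"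
    using I a by (simp add: mult.assoc)
  ultimately have ev2: "\<forall>\<^sub>F n in sequentially. (1 + a / 2) ^ Suc k * I < (1 + a / 2) * (LINT x|lborel. b x * \<phi> x)
      + (1 + a) * (LINT x|lborel. b x * \<phi> x * cos (real n * x)) + a / 2 * (LINT x|lborel. b x * \<phi> x * cos (2 * real n * x))"
    by (rule order_tendstoD(1))
  from eventually_conj[OF profile_norm2_modulate[OF s b(1,3)] eventually_conj[OF ev1 ev2]]
  obtain n :: nat where n: "profile_norm2 s (\<lambda>x. b x * (1 + cos (real n * x))) < Q"
    "(1 + a / 4) * (LINT x|lborel. \<phi> x powr q) + q * a * (LINT x|lborel. \<phi> x powr q * cos (real n * x)) < (1 + a / 4) ^ Suc k * P"
    "(1 + a / 2) ^ Suc k * I < (1 + a / 2) * (LINT x|lborel. b x * \<phi> x)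
      + (1 + a) * (LINT x|lborel. b x * \<phi> x * cos (real n * x)) + a / 2 * (LINT x|lborel. b x * \<phi> x * cos (2 * real n * x))"
    unfolding eventually_sequentially by blast
  let ?b = "\<lambda>x. b x * (1 + 1 * cos (real n * x))" and ?\<phi> = "\<lambda>x. \<phi> x * (1 + a * cos (real n * x))"
  have pb: "profile ?b" by (rule profile_modulate[OF b(1)]) auto
  have p\<phi>: "profile ?\<phi>" by (rule profile_modulate[OF b(2)]) (use a in auto)
  have i1: "integrable lborel (\<lambda>x. \<phi> x powr q * cos (real n * x))"
    by (rule integrable_compact_support[of _ "{1..2}"]) (use q0 in \<open>auto intro!: continuous_intros profile_powr(2) b\<close>)
  have i2: "integrable lborel (\<lambda>x. b x * \<phi> x * cos (k * x))" for k
    by (rule integrable_compact_support[of _ "{1..2}"]) (auto intro!: continuous_on_mult[OF profile_mult(1)[OF b(1,2)]] continuous_intros)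
  have "(LINT x|lborel. ?\<phi> x powr q) \<le> (LINT x|lborel. (1 + a / 4) * \<phi> x powr q + q * a * (\<phi> x powr q * cos (real n * x)))"
  proof (rule integral_mono)
    show "integrable lborel (\<lambda>x. ?\<phi> x powr q)" by (rule profile_powr(1)[OF p\<phi> q0])
    show "integrable lborel (\<lambda>x. (1 + a / 4) * \<phi> x powr q + q * a * (\<phi> x powr q * cos (real n * x)))"
      by (intro integrable_add integrable_mult_right i1 profile_powr b q0)
    fix x
    have c: "\<bar>a * cos (real n * x)\<bar> \<le> a" unfolding abs_mult using a by (simp add: mult_left_le)
    have c2: "(q * (a * cos (real n * x)))^2 \<le> a / 4"
    proof -
      have "(q * (a * cos (real n * x)))^2 = q^2 * (a * cos (real n * x))^2" by (simp add: power_mult_distrib)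
      also have "... \<le> q\<^sup>2 * a^2" using c by (intro mult_left_mono) (auto intro: power2_le_iff_abs_le[THEN iffD2] simp: a less_imp_le abs_le_square_iff[symmetric])
      finally show ?thesis by (simp add: qa)
    qed
    have "q * \<bar>a * cos (real n * x)\<bar> \<le> q * a" using c q0 by (intro mult_left_mono) auto
    then have "(1 + a * cos (real n * x)) powr q \<le> 1 + q * (a * cos (real n * x)) + (q * (a * cos (real n * x)))^2"
      using a c by (intro one_plus_powr_le q0) auto
    also have "... \<le> 1 + a / 4 + q * a * cos (real n * x)" using c2 by simp
    finally have "\<phi> x powr q * (1 + a * cos (real n * x)) powr q \<le> \<phi> x powr q * (1 + a / 4 + q * a * cos (real n * x))"
      by (intro mult_left_mono) auto
    then show "?\<phi> x powr q \<le> (1 + a / 4) * \<phi> x powr q + q * a * (\<phi> x powr q * cos (real n * x))"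
      unfolding powr_mult by (simp add: algebra_simps)
  qed
  also have "... = (1 + a / 4) * (LINT x|lborel. \<phi> x powr q) + q * a * (LINT x|lborel. \<phi> x powr q * cos (real n * x))"
    unfolding integral_add[OF integrable_mult_right[OF profile_powr(1)[OF b(2) q0]] integrable_mult_right[OF i1]]
      integral_mult_right_zero ..
  finally have "(LINT x|lborel. ?\<phi> x powr q) < (1 + a / 4) ^ Suc k * P" using n(2) by linarith
  moreover have "(LINT x|lborel. ?b x * ?\<phi> x) = (1 + a / 2) * (LINT x|lborel. b x * \<phi> x)
      + (1 + a) * (LINT x|lborel. b x * \<phi> x * cos (real n * x)) + a / 2 * (LINT x|lborel. b x * \<phi> x * cos (2 * real n * x))"
  proof -
    \<comment> \<open>The squared cosine has mean one half, whence the factor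
      \<open>1 + a / 2\<close>; the remaining terms oscillate.\<close>
    have "?b x * ?\<phi> x = (1 + a / 2) * (b x * \<phi> x) + (1 + a) * (b x * \<phi> x * cos (real n * x)) + a / 2 * (b x * \<phi> x * cos (2 * real n * x))" for x
    proof -
      have "cos (2 * real n * x) = 2 * (cos (real n * x))^2 - 1" using cos_double_cos[of "real n * x"] by (simp add: mult.assoc)
      then show ?thesis by (simp only:) (simp add: power2_eq_square algebra_simps)
    qed
    moreover note im = profile_mult(2)[OF b(1,2)]
    ultimately show ?thesis
      by (simp only: integral_add[OF integrable_add[OF integrable_mult_right[OF im] integrable_mult_right[OF i2]] integrable_mult_right[OF i2]]
        integral_add[OF integrable_mult_right[OF im] integrable_mult_right[OF i2]] integral_mult_right_zero)
  qed
  ultimately show ?case using pb p\<phi> n(1,3) by (intro exI[of _ ?b] exI[of _ ?\<phi>]) simp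
qed


section \<open>Failure of the Sobolev embedding in dual form\<close>

lemma normalised_profiles:
  assumes b: "profile b" "profile \<phi>" and q: "1 < q" and Q: "0 < Q" "profile_norm2 s b \<le> Q"
    and P: "0 < P" "(LINT x|lborel. \<phi> x powr q) \<le> P"
    and M: "M * (sqrt Q * P powr (1 / q)) \<le> (LINT x|lborel. b x * \<phi> x)"
  shows "\<exists>b \<phi>. profile b \<and> profile \<phi> \<and> profile_norm2 s b \<le> 1 \<and> (LINT x|lborel. \<phi> x powr q) \<le> 1 \<and> M \<le> (LINT x|lborel. b x * \<phi> x)"
proof (intro exI conjI)
  let ?b = "\<lambda>x. 1 / sqrt Q * b x" and ?\<phi> = "\<lambda>x. 1 / P powr (1 / q) * \<phi> x"
  show "profile ?b" "profile ?\<phi>" using Q P by (intro profile_cmult b; simp)+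
  have "profile_norm2 s ?b = profile_norm2 s b / Q" unfolding profile_norm2_cmult using Q by (simp add: power_divide)
  also have "... \<le> 1" using Q by (simp only: divide_le_eq_1_pos)
  finally show "profile_norm2 s ?b \<le> 1" .
  have "(LINT x|lborel. ?\<phi> x powr q) = (LINT x|lborel. 1 / P * \<phi> x powr q)"
    using P q profileD(2)[OF b(2)] by (simp add: powr_divide powr_powr)
  also have "... = (LINT x|lborel. \<phi> x powr q) / P" by (simp only: integral_mult_right_zero) simp
  also have "... \<le> 1" using P by simp
  finally show "(LINT x|lborel. ?\<phi> x powr q) \<le> 1" .
  have "M \<le> (LINT x|lborel. b x * \<phi> x) / (sqrt Q * P powr (1 / q))" using M Q P by (simp add: le_divide_eq)
  also have "... = (LINT x|lborel. 1 / (sqrt Q * P powr (1 / q)) * (b x * \<phi> x))" by (simp only: integral_mult_right_zero) simp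
  finally show "M \<le> (LINT x|lborel. ?b x * ?\<phi> x)" by (simp add: mult_ac)
qed

text \<open>Up to a phase the transform of the concentrated bump is
  \<open>l * F (l * \<xi>)\<close>. For \<open>s \<ge> 0\<close> and \<open>l \<le> 1\<close> the
  weight at \<open>\<xi>\<close> is at most \<open>l powr (- 2 * s)\<close> times the weight at
  \<open>l * \<xi>\<close>.\<close>

lemma concentrated_norm2:
  assumes s: "0 \<le> s" and l: "0 < l" "l \<le> 1"
  shows "profile_norm2 s (\<lambda>x. bump ((x - 1) / l)) \<le> l powr (1 - 2 * s) * profile_norm2 s bump"
proof -
  let ?F = "fourier (cplx bump)"
  have i: "integrable lborel (\<lambda>\<xi>. wt s \<xi> * (cmod (?F \<xi>))^2)"
    by (intro schwartz_integrable_weight_square fourier_schwartz schwartz_bump)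
  have F: "cmod (fourier (\<lambda>x. complex_of_real (bump ((x - 1) / l))) \<xi>) = l * cmod (?F (l * \<xi>))" for \<xi>
    using fourier_shift[of "\<lambda>x. complex_of_real (bump (x / l))" "-1" \<xi>] fourier_scale[OF l(1), of "cplx bump" \<xi>] l
    by (simp add: norm_mult)
  have i': "integrable lborel (\<lambda>\<xi>. wt s (l * \<xi>) * (cmod (?F (l * \<xi>)))^2)"
    using lborel_integrable_real_affine[OF i, of l 0] l by simp
  have "profile_norm2 s (\<lambda>x. bump ((x - 1) / l)) \<le> (LINT \<xi>|lborel. (l powr (2 - 2 * s)) * (wt s (l * \<xi>) * (cmod (?F (l * \<xi>)))^2))"
  proof (rule integral_mono)
    show "integrable lborel (\<lambda>\<xi>. wt s \<xi> * (cmod (fourier (\<lambda>x. complex_of_real (bump ((x - 1) / l))) \<xi>))^2)"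
      by (rule integrable_profile_norm2[OF profile_bump_scaled[OF l]])
    show "integrable lborel (\<lambda>\<xi>. (l powr (2 - 2 * s)) * (wt s (l * \<xi>) * (cmod (?F (l * \<xi>)))^2))" by (intro integrable_mult_right i')
    fix \<xi>
    have "l\<^sup>2 \<le> 1" using l by (simp add: power_le_one)
    then have "1 + \<xi>^2 \<le> l powr (- 2) * (1 + (l * \<xi>)^2)"
      using l by (simp add: powr_minus field_simps power_mult_distrib)
    then have "wt s \<xi> \<le> (l powr (- 2) * (1 + (l * \<xi>)^2)) powr s" using s by (intro powr_mono2) auto
    also have "... = l powr (- 2 * s) * wt s (l * \<xi>)" by (simp add: powr_mult powr_powr)
    finally have "wt s \<xi> * (l * cmod (?F (l * \<xi>)))^2 \<le> (l powr (- 2 * s) * wt s (l * \<xi>)) * (l * cmod (?F (l * \<xi>)))^2"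
      by (rule mult_right_mono) simp
    also have "... = l powr (2 - 2 * s) * (wt s (l * \<xi>) * (cmod (?F (l * \<xi>)))^2)"
      using l powr_add[of l 2 "- 2 * s"] by (simp add: power_mult_distrib)
    finally show "wt s \<xi> * (cmod (fourier (\<lambda>x. complex_of_real (bump ((x - 1) / l))) \<xi>))^2
        \<le> l powr (2 - 2 * s) * (wt s (l * \<xi>) * (cmod (?F (l * \<xi>)))^2)" by (simp only: F)
  qed
  also have "... = l powr (1 - 2 * s) * profile_norm2 s bump"
  proof -
    have "profile_norm2 s bump = l * (LINT \<xi>|lborel. wt s (l * \<xi>) * (cmod (?F (l * \<xi>)))^2)"
      using lborel_integral_real_affine[of l "\<lambda>\<xi>. wt s \<xi> * (cmod (?F \<xi>))^2" 0] l by simp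
    moreover have "l powr (2 - 2 * s) = l powr (1 - 2 * s) * l" using l powr_add[of l "1 - 2 * s" 1] by simp
    ultimately show ?thesis by (simp only: integral_mult_right_zero mult.assoc)
  qed
  finally show ?thesis .
qed

text \<open>Expresses that H^s does not control L^p. The dual form is chosen because ill-posedness
  is later tested against the profiles \<open>\<phi>\<close> bounded in L^q with
  \<open>q = p / (p - 1)\<close>.\<close>

lemma dual_profiles:
  assumes p: "1 < p" and s: "s < s_sob p"
  shows "\<exists>b \<phi>. profile b \<and> profile \<phi> \<and> profile_norm2 s b \<le> 1 \<and> (LINT x|lborel. \<phi> x powr (p / (p - 1))) \<le> 1 \<and> M \<le> (LINT x|lborel. b x * \<phi> x)"
proof -
  define q where "q = p / (p - 1)"
  have q: "1 < q" "1 / q = 1 - 1 / p" using p by (auto simp: q_def field_simps)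
  then have q0: "0 < q" by simp
  have sq: "bump x * bump x = bump x powr 2" for x
    using bump_simps(4)[of x] by (cases "bump x = 0") (auto simp: power2_eq_square)
  define J I where "J = (LINT x|lborel. bump x powr q)" and "I = (LINT x|lborel. bump x powr 2)"
  have J: "0 < J" and I: "0 < I" using bump_powr_integral_pos q0 by (auto simp: J_def I_def)
  show ?thesis
    unfolding q_def[symmetric]
  proof (cases "s < 0")
    case True
    let ?\<beta> = "\<lambda>x. bump ((x - 1) / 1)"
    define Q where "Q = profile_norm2 s ?\<beta> + 1"
    have Q: "0 < Q" unfolding Q_def by (rule add_nonneg_pos[OF profile_norm2_nonneg]) simp
    define a where "a = 1 / (4 * q^2)"
    have a: "0 < a" using q by (simp add: a_def)
    have "1 < (1 + a / 2) / (1 + a / 4)" using a by (simp add: field_simps)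
    \<comment> \<open>Each oscillation improves the available bound on pairing against norms by the
      factor \<open>(1 + a / 2) / (1 + a / 4) > 1\<close>, so finitely many of them reach any
      \<open>M\<close>.\<close>
    then obtain k where k: "M * (sqrt Q * (J + 1)) * 2 / I < ((1 + a / 2) / (1 + a / 4)) ^ k" using real_arch_pow by blast
    have "\<exists>b \<phi>. profile b \<and> profile \<phi> \<and> profile_norm2 s b < Q \<and>
      (LINT x|lborel. \<phi> x powr q) < (1 + a / 4) ^ k * (J + 1) \<and> (1 + a / 2) ^ k * (I / 2) < (LINT x|lborel. b x * \<phi> x)"
      unfolding a_def
    proof (rule oscillating_profiles[OF True q(1), of ?\<beta>])
      show "profile ?\<beta>" by (rule profile_bump_scaled) auto
      show "profile_norm2 s ?\<beta> < Q" by (simp add: Q_def)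
      show "(LINT x|lborel. ?\<beta> x powr q) < J + 1" using bump_powr_integral_scaled[of 1 q] q0 by (simp add: J_def)
      show "I / 2 < (LINT x|lborel. ?\<beta> x * ?\<beta> x)" unfolding sq using bump_powr_integral_scaled[of 1 2] I by (simp add: I_def)
    qed
    then obtain b \<phi> where b: "profile b" "profile \<phi>" "profile_norm2 s b < Q"
      "(LINT x|lborel. \<phi> x powr q) < (1 + a / 4) ^ k * (J + 1)" "(1 + a / 2) ^ k * (I / 2) < (LINT x|lborel. b x * \<phi> x)" by blast
    \<comment> \<open>Normalisation in L^q involves a root of the integral bound. As the bound is at
      least one (hence \<open>J + 1\<close> above), the root may be estimated by the bound
      itself.\<close>
    have P: "1 \<le> (1 + a / 4) ^ k * (J + 1)" using a J by (intro mult_ge1_I one_le_power) auto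
    then have root: "((1 + a / 4) ^ k * (J + 1)) powr (1 / q) \<le> (1 + a / 4) ^ k * (J + 1)"
      using powr_mono[of "1 / q" 1 "(1 + a / 4) ^ k * (J + 1)"] q(1) by simp
    show "\<exists>b \<phi>. profile b \<and> profile \<phi> \<and> profile_norm2 s b \<le> 1 \<and> (LINT x|lborel. \<phi> x powr q) \<le> 1 \<and> M \<le> (LINT x|lborel. b x * \<phi> x)"
    proof (rule normalised_profiles[OF b(1,2) q(1) Q])
      show "0 < (1 + a / 4) ^ k * (J + 1)" using P by linarith
      have "M * (sqrt Q * ((1 + a / 4) ^ k * (J + 1)) powr (1 / q)) \<le> max 0 M * (sqrt Q * ((1 + a / 4) ^ k * (J + 1)))"
        using Q root by (intro mult_mono) auto
      also have "... \<le> (1 + a / 2) ^ k * (I / 2)"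
      proof (cases "0 \<le> M")
        case True
        have "M * (sqrt Q * (J + 1)) * 2 / I * (1 + a / 4) ^ k \<le> ((1 + a / 2) / (1 + a / 4)) ^ k * (1 + a / 4) ^ k"
          using k a by (intro mult_right_mono) auto
        also have "... = (1 + a / 2) ^ k" using a by (simp add: power_divide)
        finally have "M * (sqrt Q * (J + 1)) * 2 / I * (1 + a / 4) ^ k * (I / 2) \<le> (1 + a / 2) ^ k * (I / 2)"
          by (rule mult_right_mono) (use I in simp)
        moreover have "M * (sqrt Q * (J + 1)) * 2 / I * (1 + a / 4) ^ k * (I / 2) = M * (sqrt Q * ((1 + a / 4) ^ k * (J + 1)))"
          using I by simp
        ultimately show ?thesis using True by (simp only: max_absorb2)
      qed (use a I in simp)
      finally show "M * (sqrt Q * ((1 + a / 4) ^ k * (J + 1)) powr (1 / q)) \<le> (LINT x|lborel. b x * \<phi> x)" using b(5) by linarith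
    qed (use b in auto)
  next
    case False
    then have s0: "0 \<le> s" and se: "s - 1 / 2 + 1 / p < 0" using s by (auto simp: s_sob_def max_def split: if_splits)
    \<comment> \<open>The scaling exponent of the pairing over the norms: 1 from the pairing, less
      \<open>1 / 2 - s\<close> from H^s and \<open>1 / q\<close> from L^q. It is negative precisely
      for \<open>s < 1 / 2 - 1 / p\<close>.\<close>
    define e where "e = s - 1 / 2 + 1 / p"
    define Q where "Q = profile_norm2 s bump + 1"
    have Q: "0 < Q" unfolding Q_def by (rule add_nonneg_pos[OF profile_norm2_nonneg]) simp
    define c where "c = I / (sqrt Q * J powr (1 / q))"
    have c: "0 < c" using I Q J by (simp add: c_def)
    define l where "l = max 1 (M / c) powr (1 / e)"
    have e: "e < 0" using se by (simp add: e_def)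
    have l: "0 < l" "l \<le> 1"
    proof -
      show "0 < l" by (simp add: l_def)
      have "max 1 (M / c) powr (1 / e) \<le> max 1 (M / c) powr 0" using e by (intro powr_mono) auto
      moreover have "max 1 (M / c) \<noteq> 0" by linarith
      ultimately show "l \<le> 1" by (simp add: l_def)
    qed
    have le: "l powr e = max 1 (M / c)" using e by (simp add: l_def powr_powr)
    let ?\<beta> = "\<lambda>x. bump ((x - 1) / l)"
    show "\<exists>b \<phi>. profile b \<and> profile \<phi> \<and> profile_norm2 s b \<le> 1 \<and> (LINT x|lborel. \<phi> x powr q) \<le> 1 \<and> M \<le> (LINT x|lborel. b x * \<phi> x)"
    proof (rule normalised_profiles[of ?\<beta> ?\<beta> q "l powr (1 - 2 * s) * Q" s "l * J"])
      show "profile ?\<beta>" "profile ?\<beta>" by (rule profile_bump_scaled[OF l])+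
      show "0 < l powr (1 - 2 * s) * Q" "0 < l * J" using l Q J by auto
      have "l powr (1 - 2 * s) * profile_norm2 s bump \<le> l powr (1 - 2 * s) * Q" by (intro mult_left_mono) (auto simp: Q_def)
      then show "profile_norm2 s ?\<beta> \<le> l powr (1 - 2 * s) * Q" by (rule order_trans[OF concentrated_norm2[OF s0 l]])
      show "(LINT x|lborel. ?\<beta> x powr q) \<le> l * J" using bump_powr_integral_scaled[OF l(1) q0] by (simp add: J_def)
      have sl: "sqrt (l powr (1 - 2 * s)) = l powr (1 / 2 - s)" using l by (simp add: powr_half_sqrt[symmetric] powr_powr diff_divide_distrib)
      have "M \<le> c * l powr e" using c by (simp add: le max_def field_simps)
      then have "M * (sqrt (l powr (1 - 2 * s) * Q) * (l * J) powr (1 / q)) \<le> c * l powr e * (sqrt (l powr (1 - 2 * s) * Q) * (l * J) powr (1 / q))"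
        using l Q J by (intro mult_right_mono) auto
      also have "... = I * (l powr e * l powr (1 / 2 - s) * l powr (1 / q))"
        using Q J l by (simp add: c_def real_sqrt_mult powr_mult sl)
      also have "l powr e * l powr (1 / 2 - s) * l powr (1 / q) = l"
        unfolding powr_add[symmetric] using l by (simp add: e_def q(2))
      finally show "M * (sqrt (l powr (1 - 2 * s) * Q) * (l * J) powr (1 / q)) \<le> (LINT x|lborel. ?\<beta> x * ?\<beta> x)"
        unfolding sq using bump_powr_integral_scaled[OF l(1), of 2] by (simp add: I_def mult.commute)
    qed (rule q)
  qed
qed


text \<open>Young's inequality, applied after normalisation, plays the part of Hoelder's: a large
  pairing forces a large L^p norm \<open>r\<close>, and division by \<open>r\<close> makes the H^s
  norm small.\<close>

lemma base_profile_exists: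
  assumes p: "1 < p" and s: "s < s_sob p" and \<epsilon>: "0 < \<epsilon>"
  shows "\<exists>b. base_profile p s \<epsilon> b"
proof -
  define q where "q = p / (p - 1)"
  have q: "1 < q" "1 / p + 1 / q = 1" using p by (auto simp: q_def field_simps)
  obtain b \<phi> where b: "profile b" "profile \<phi>" "profile_norm2 s b \<le> 1" "(LINT x|lborel. \<phi> x powr q) \<le> 1" "1 / \<epsilon> \<le> (LINT x|lborel. b x * \<phi> x)"
    using dual_profiles[OF p s, of "1 / \<epsilon>"] unfolding q_def by blast
  define X where "X = (LINT x|lborel. b x powr p)"
  have ib: "integrable lborel (\<lambda>x. b x powr p)" and i\<phi>: "integrable lborel (\<lambda>x. \<phi> x powr q)"
    using profile_powr(1) b p q by auto
  have "X \<noteq> 0"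
  proof
    assume "X = 0"
    then have "AE x in lborel. b x powr p = 0"
      using integral_nonneg_eq_0_iff_AE[OF ib] by (simp add: X_def)
    then have "AE x in lborel. b x * \<phi> x = 0" by eventually_elim simp
    then have "(LINT x|lborel. b x * \<phi> x) = 0" by (rule integral_eq_zero_AE)
    with b(5) \<epsilon> show False by (simp add: divide_le_0_iff)
  qed
  moreover have "0 \<le> X" unfolding X_def by (intro integral_nonneg_AE) auto
  ultimately have X: "0 < X" by simp
  define r where "r = X powr (1 / p)"
  have r: "0 < r" "r powr p = X" using X p by (auto simp: r_def powr_powr)
  let ?b = "\<lambda>x. 1 / r * b x"
  have "profile ?b" using r by (intro profile_cmult b) simp
  moreover have I: "(LINT x|lborel. ?b x powr p) = 1" and ib': "integrable lborel (\<lambda>x. ?b x powr p)"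
  proof -
    have e: "?b x powr p = 1 / X * b x powr p" for x unfolding powr_mult using r by (simp add: powr_divide)
    show "(LINT x|lborel. ?b x powr p) = 1" unfolding e integral_mult_right_zero using X by (simp add: X_def[symmetric])
    show "integrable lborel (\<lambda>x. ?b x powr p)" unfolding e by (intro integrable_mult_right ib)
  qed
  moreover have "sqrt (profile_norm2 s ?b) \<le> \<epsilon>"
  proof -
    have "1 / \<epsilon> \<le> r * (LINT x|lborel. ?b x * \<phi> x)" using b(5) r unfolding mult.assoc integral_mult_right_zero by simp
    also have "(LINT x|lborel. ?b x * \<phi> x) \<le> (LINT x|lborel. 1 / p * ?b x powr p + 1 / q * \<phi> x powr q)"
    proof (rule integral_mono)
      show "integrable lborel (\<lambda>x. ?b x * \<phi> x)" using profile_mult(2)[OF b(1,2)] by (simp add: mult.assoc)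
      show "integrable lborel (\<lambda>x. 1 / p * ?b x powr p + 1 / q * \<phi> x powr q)"
        by (intro integrable_add integrable_mult_right ib' i\<phi>)
      show "?b x * \<phi> x \<le> 1 / p * ?b x powr p + 1 / q * \<phi> x powr q" for x
        using Youngs_inequality[OF p q, of "?b x" "\<phi> x"] r profileD(2)[OF b(1)] profileD(2)[OF b(2)] by simp
    qed
    also have "... = 1 / p * (LINT x|lborel. ?b x powr p) + 1 / q * (LINT x|lborel. \<phi> x powr q)"
      unfolding integral_add[OF integrable_mult_right[OF ib'] integrable_mult_right[OF i\<phi>]] integral_mult_right_zero ..
    also have "... \<le> 1 / p * 1 + 1 / q * 1" unfolding I using b(4) q by (intro add_left_mono mult_left_mono) auto
    finally have "1 / \<epsilon> \<le> r" using r q by simp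
    then have "1 / r \<le> \<epsilon>" using r \<epsilon> by (simp add: field_simps)
    moreover have "sqrt (profile_norm2 s ?b) \<le> 1 / r"
    proof -
      have "profile_norm2 s ?b \<le> (1 / r)^2" unfolding profile_norm2_cmult using b(3) by (simp add: mult_left_le)
      from real_sqrt_le_mono[OF this] show ?thesis using r by simp
    qed
    ultimately show ?thesis by linarith
  qed
  ultimately have "base_profile p s \<epsilon> ?b" unfolding base_profile_def by blast
  then show ?thesis by blast
qed

section \<open>Solutions have initial values of $L^p$ type\<close>

text \<open>The building blocks of the test functions, a cut-off in time times a travelling wave.
  Derivatives remain in the span of such products with the same speed.\<close>

lemma smooth_wave:
  assumes "smooth1 h" "smooth1 g"
  shows "smooth (\<lambda>z. h (fst z) * g (snd z + c * fst z))"
proof -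
  let ?B = "{\<lambda>z. h (fst z) * g (snd z + c * fst z) |h g. smooth1 h \<and> smooth1 g}"
  have comp: "continuous_on A (\<lambda>z. g (w z))" if "smooth1 g" "continuous_on A w" for g and w :: "real \<times> real \<Rightarrow> real" and A
    by (rule continuous_on_compose2[OF smooth1_continuous[OF that(1)] that(2)]) auto
  have lin: "\<exists>g'\<in>fspan ?B. \<forall>t x. ((\<lambda>\<tau>. g (\<tau>, x)) has_vector_derivative g' (t, x)) (at t)" if "g \<in> fspan ?B" for g
    using that
  proof (rule fspan_relation)
    fix b assume "b \<in> ?B"
    then obtain h g where b: "b = (\<lambda>z. h (fst z) * g (snd z + c * fst z))" and s: "smooth1 h" "smooth1 g" by blast
    have "((\<lambda>\<tau>. h \<tau> * g (x + c * \<tau>)) has_vector_derivative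
        h t * (of_real c * deriv1 g (x + c * t)) + deriv1 h t * g (x + c * t)) (at t)" for t x
      using has_vector_derivative_mult[OF smooth1_has_deriv[OF s(1)] has_vector_derivative_affine[OF smooth1_has_deriv[OF s(2)], of c x t]]
      by (simp add: add.commute)
    moreover have "(\<lambda>z. h (fst z) * (of_real c * deriv1 g (snd z + c * fst z)) + deriv1 h (fst z) * g (snd z + c * fst z)) \<in> fspan ?B"
    proof (rule fspan.add; rule fspan.base)
      show "(\<lambda>z. h (fst z) * (of_real c * deriv1 g (snd z + c * fst z))) \<in> ?B"
        using s smooth1_cmult[OF smooth1_deriv1[OF s(2)], of "of_real c"]
        by (intro CollectI exI[of _ h] exI[of _ "\<lambda>x. of_real c * deriv1 g x"]) auto
      show "(\<lambda>z. deriv1 h (fst z) * g (snd z + c * fst z)) \<in> ?B"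
        using s smooth1_deriv1[OF s(1)] by (intro CollectI exI[of _ "deriv1 h"] exI[of _ g]) auto
    qed
    ultimately show "\<exists>g'\<in>fspan ?B. \<forall>t x. ((\<lambda>\<tau>. b (\<tau>, x)) has_vector_derivative g' (t, x)) (at t)" unfolding b by (rule_tac bexI) auto
  qed (auto intro: has_vector_derivative_add has_vector_derivative_mult_right)
  have linx: "\<exists>g'\<in>fspan ?B. \<forall>t x. ((\<lambda>y. g (t, y)) has_vector_derivative g' (t, x)) (at x)" if "g \<in> fspan ?B" for g
    using that
  proof (rule fspan_relation)
    fix b assume "b \<in> ?B"
    then obtain h g where b: "b = (\<lambda>z. h (fst z) * g (snd z + c * fst z))" and s: "smooth1 h" "smooth1 g" by blast
    have "((\<lambda>y. h t * g (y + c * t)) has_vector_derivative h t * deriv1 g (x + c * t)) (at x)" for t x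
      using has_vector_derivative_mult_right[OF has_vector_derivative_affine[OF smooth1_has_deriv[OF s(2)], of 1 "c * t" x], of "h t"] by simp
    moreover have "(\<lambda>z. h (fst z) * deriv1 g (snd z + c * fst z)) \<in> ?B"
      using s smooth1_deriv1[OF s(2)] by (intro CollectI exI[of _ h] exI[of _ "deriv1 g"]) auto
    ultimately show "\<exists>g'\<in>fspan ?B. \<forall>t x. ((\<lambda>y. b (t, y)) has_vector_derivative g' (t, x)) (at x)" unfolding b by (intro bexI[OF _ fspan.base]) auto
  qed (auto intro: has_vector_derivative_add has_vector_derivative_mult_right)
  show ?thesis
  proof (rule smooth_coinduct[OF fspan.base, of _ ?B])
    show "(\<lambda>z. h (fst z) * g (snd z + c * fst z)) \<in> ?B" using assms by blast
    show "continuous_on UNIV g" if "g \<in> fspan ?B" for g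
      using that by induction (auto intro!: continuous_intros comp)
  qed (use lin linx in blast)+
qed

lemma smooth_add:
  assumes "smooth f" "smooth g" shows "smooth (\<lambda>z. f z + g z)"
proof (rule smooth_coinduct)
  let ?S = "{\<lambda>z. f z + g z |f g. smooth f \<and> smooth g}"
  show "(\<lambda>z. f z + g z) \<in> ?S" using assms by blast
  fix h assume "h \<in> ?S"
  then obtain f g where h: "h = (\<lambda>z. f z + g z)" "smooth f" "smooth g" by blast
  show "continuous_on UNIV h" unfolding h by (intro continuous_intros smooth_continuous h)
  have "(\<lambda>z. dt f z + dt g z) \<in> ?S" using h smooth_dt by blast
  then show "\<exists>g'\<in>?S. \<forall>t x. ((\<lambda>\<tau>. h (\<tau>, x)) has_vector_derivative g' (t, x)) (at t)"
    unfolding h by (rule rev_bexI) (auto intro!: has_vector_derivative_add smooth_has_dt h)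
  have "(\<lambda>z. dx f z + dx g z) \<in> ?S" using h smooth_dx by blast
  then show "\<exists>g'\<in>?S. \<forall>t x. ((\<lambda>y. h (t, y)) has_vector_derivative g' (t, x)) (at x)"
    unfolding h by (rule rev_bexI) (auto intro!: has_vector_derivative_add smooth_has_dx h)
qed

lemma antiderivative_exists:
  fixes b :: "real \<Rightarrow> real"
  assumes "continuous_on UNIV b"
  obtains F where "\<And>x. (F has_vector_derivative complex_of_real (b x)) (at x)"
proof -
  have "isCont (cplx b) x" for x
    using assms by (auto simp: continuous_on_eq_continuous_at intro!: continuous_intros)
  then have "\<exists>F. \<forall>x::real. - \<infinity> < ereal x \<longrightarrow> ereal x < \<infinity> \<longrightarrow> (F has_vector_derivative complex_of_real (b x)) (at x)"
    by (intro einterval_antiderivative) auto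
  then show ?thesis using that by auto
qed

lemma antiderivative_diff:
  fixes b :: "real \<Rightarrow> real"
  assumes c: "continuous_on UNIV b" and F: "\<And>x. (F has_vector_derivative complex_of_real (b x)) (at x)"
    and b: "\<And>x. 0 \<le> b x" "integrable lborel b"
  shows "x \<le> y \<Longrightarrow> (\<And>z. x < z \<Longrightarrow> z < y \<Longrightarrow> b z = 0) \<Longrightarrow> F y = F x" "cmod (F y - F x) \<le> (LINT z|lborel. b z)"
proof -
  have D: "F y - F x = complex_of_real (LINT z|lborel. indicator {x..y} z * b z)" if "x \<le> y" for x y
  proof -
    have "(LINT z|lborel. indicator {x..y} z *\<^sub>R complex_of_real (b z)) = F y - F x"
      using that by (rule integral_FTC_atLeastAtMost)
        (rule has_vector_derivative_at_within[OF F], intro continuous_intros continuous_on_subset[OF c] subset_UNIV)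
    then have "F y - F x = (LINT z|lborel. complex_of_real (indicator {x..y} z * b z))" by (simp add: scaleR_conv_of_real)
    also have "... = complex_of_real (LINT z|lborel. indicator {x..y} z * b z)" by (rule integral_complex_of_real)
    finally show ?thesis .
  qed
  show "F y = F x" if "x \<le> y" "\<And>z. x < z \<Longrightarrow> z < y \<Longrightarrow> b z = 0"
  proof -
    have "AE z in lborel. indicator {x..y} z * b z = 0"
      using AE_lborel_singleton[of x] AE_lborel_singleton[of y] by eventually_elim (use that(2) in \<open>auto simp: indicator_def\<close>)
    then have "(LINT z|lborel. indicator {x..y} z * b z) = 0" by (rule integral_eq_zero_AE)
    with D[OF that(1)] show ?thesis by simp
  qed
  have "cmod (F y - F x) \<le> (LINT z|lborel. b z)" if "x \<le> y" for x y
  proof -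
    have "0 \<le> (LINT z|lborel. indicator {x..y} z * b z)" using b by (intro integral_nonneg_AE) auto
    moreover have "(LINT z|lborel. indicator {x..y} z * b z) \<le> (LINT z|lborel. b z)"
    proof (rule integral_mono)
      show "integrable lborel (\<lambda>z. indicator {x..y} z * b z)"
        using integrable_Icc_continuous[of x y b] continuous_on_subset[OF c] by simp
    qed (use b in \<open>auto simp: indicator_def\<close>)
    ultimately show ?thesis unfolding D[OF that] norm_of_real by simp
  qed
  from this[of x y] this[of y x] show "cmod (F y - F x) \<le> (LINT z|lborel. b z)"
    by (cases "x \<le> y") (auto simp: norm_minus_commute)
qed

text \<open>Distribution and test function both move with time. Norm continuity of \<open>u\<close>
  handles the first, with \<open>W\<close> providing a common H^(-s) bound, and dominated
  convergence on the Fourier side handles the second.\<close>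

lemma pairing_continuous:
  assumes u: "continuous_sobolev s I u" and t: "t \<in> I"
    and X: "\<And>\<tau>. \<tau> \<in> I \<Longrightarrow> X \<tau> \<in> schwartz"
    and W: "W \<in> schwartz" "\<And>\<tau>. \<tau> \<in> I \<Longrightarrow> AE \<xi> in lborel. cmod (inv_fourier (X \<tau>) \<xi>) \<le> cmod (W \<xi>)"
    and lim: "AE \<xi> in lborel. ((\<lambda>\<tau>. inv_fourier (X \<tau>) \<xi>) \<longlongrightarrow> inv_fourier (X t) \<xi>) (at t within I)"
  shows "((\<lambda>\<tau>. u \<tau> (X \<tau>)) \<longlongrightarrow> u t (X t)) (at t within I)"
proof -
  have "\<exists>g. sobolev_ft s (u \<tau>) g" if "\<tau> \<in> I" for \<tau> using u that by (auto simp: continuous_sobolev_def sobolev_def)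
  then obtain g where g: "\<And>\<tau>. \<tau> \<in> I \<Longrightarrow> sobolev_ft s (u \<tau>) (g \<tau>)" by metis
  let ?\<zeta> = "\<lambda>\<tau>. inv_fourier (X \<tau>)"
  have \<zeta>: "?\<zeta> \<tau> \<in> schwartz" "fourier (?\<zeta> \<tau>) = X \<tau>" if "\<tau> \<in> I" for \<tau>
    using inv_fourier_schwartz[OF X[OF that]] fourier_inversion[OF X[OF that]] by auto
  have ut: "u t (X \<tau>) = (LINT \<xi>|lborel. g t \<xi> * ?\<zeta> \<tau> \<xi>)" if "\<tau> \<in> I" for \<tau>
    using sobolev_ftD(3)[OF g[OF t] \<zeta>(1)[OF that]] \<zeta>(2)[OF that] by simp
  note [measurable] = sobolev_ftD(1)[OF g[OF t]] schwartz_measurable[OF W(1)]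
  have "((\<lambda>\<tau>. LINT \<xi>|lborel. g t \<xi> * ?\<zeta> \<tau> \<xi>) \<longlongrightarrow> (LINT \<xi>|lborel. g t \<xi> * ?\<zeta> t \<xi>)) (at t within I)"
  proof (rule dominated_convergence_within)
    show "(\<lambda>\<xi>. g t \<xi> * ?\<zeta> t \<xi>) \<in> borel_measurable lborel"
      using schwartz_measurable[OF \<zeta>(1)[OF t]] by measurable
    show "(\<lambda>\<xi>. g t \<xi> * ?\<zeta> \<tau> \<xi>) \<in> borel_measurable lborel" if "\<tau> \<in> I" for \<tau>
      using schwartz_measurable[OF \<zeta>(1)[OF that]] by measurable
    show "integrable lborel (\<lambda>\<xi>. cmod (g t \<xi> * W \<xi>))" by (intro integrable_norm sobolev_ft_integrable[OF g[OF t] W(1)])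
    show "AE \<xi> in lborel. ((\<lambda>\<tau>. g t \<xi> * ?\<zeta> \<tau> \<xi>) \<longlongrightarrow> g t \<xi> * ?\<zeta> t \<xi>) (at t within I)"
      using lim by eventually_elim (intro tendsto_intros)
    show "AE \<xi> in lborel. norm (g t \<xi> * ?\<zeta> \<tau> \<xi>) \<le> cmod (g t \<xi> * W \<xi>)" if "\<tau> \<in> I - {t}" for \<tau>
      using W(2)[of \<tau>] that by (auto elim!: eventually_mono simp: norm_mult intro: mult_left_mono)
  qed
  moreover have "\<forall>\<^sub>F \<tau> in at t within I. \<tau> \<in> I" by (auto simp: eventually_at_filter)
  then have "\<forall>\<^sub>F \<tau> in at t within I. (LINT \<xi>|lborel. g t \<xi> * ?\<zeta> \<tau> \<xi>) = u t (X \<tau>)"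
    by eventually_elim (simp add: ut)
  ultimately have 1: "((\<lambda>\<tau>. u t (X \<tau>)) \<longlongrightarrow> u t (X t)) (at t within I)"
    using ut[OF t] by (simp add: tendsto_cong)
  define Z where "Z = sqrt (LINT \<xi>|lborel. wt (- s) \<xi> * (cmod (W \<xi>))^2)"
  have bound: "cmod (u \<tau> (X \<tau>) - u t (X \<tau>)) \<le> sobolev_norm s (minus_dist (u \<tau>) (u t)) * Z" if \<tau>: "\<tau> \<in> I" for \<tau>
  proof -
    have "cmod (minus_dist (u \<tau>) (u t) (fourier (?\<zeta> \<tau>))) \<le> sobolev_norm s (minus_dist (u \<tau>) (u t)) * sqrt (LINT \<xi>|lborel. wt (- s) \<xi> * (cmod (?\<zeta> \<tau> \<xi>))^2)"
      by (rule sobolev_pairing_bound[OF sobolev_ft_minus[OF g[OF \<tau>] g[OF t]] \<zeta>(1)[OF \<tau>]])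
    also have "... \<le> sobolev_norm s (minus_dist (u \<tau>) (u t)) * Z"
      unfolding Z_def
    proof (intro mult_left_mono real_sqrt_le_mono integral_mono_AE sobolev_norm_nonneg schwartz_integrable_weight_square \<zeta>(1) \<tau> W(1))
      show "AE \<xi> in lborel. wt (- s) \<xi> * (cmod (?\<zeta> \<tau> \<xi>))^2 \<le> wt (- s) \<xi> * (cmod (W \<xi>))^2"
        using W(2)[OF \<tau>] by eventually_elim (auto intro!: mult_left_mono power_mono)
    qed
    finally show ?thesis using \<zeta>(2)[OF \<tau>] by (simp add: minus_dist_def)
  qed
  have "((\<lambda>\<tau>. sobolev_norm s (minus_dist (u \<tau>) (u t)) * Z) \<longlongrightarrow> 0 * Z) (at t within I)"
    using u t by (intro tendsto_intros) (auto simp: continuous_sobolev_def)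
  then have "((\<lambda>\<tau>. sobolev_norm s (minus_dist (u \<tau>) (u t)) * Z) \<longlongrightarrow> 0) (at t within I)" by simp
  then have "((\<lambda>\<tau>. u \<tau> (X \<tau>) - u t (X \<tau>)) \<longlongrightarrow> 0) (at t within I)"
    by (rule Lim_null_comparison[rotated]) (use bound in \<open>auto simp: eventually_at_filter\<close>)
  from tendsto_add[OF this 1] show ?thesis by simp
qed

lemma le_one_plus_powr:
  fixes r p :: real
  assumes "1 \<le> p" "0 \<le> r" shows "r \<le> 1 + r powr p"
proof (cases "r \<le> 1")
  case False
  then show ?thesis using powr_mono[of 1 p r] assms by simp
qed (use powr_ge_zero[of r p] in linarith)

lemma powr_diff_one_mult: "0 \<le> r \<Longrightarrow> r powr (p - 1) * r = r powr p" for r p :: real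
  by (cases "r = 0") (auto simp: powr_diff)

text \<open>On \<open>K\<close> the modulus of \<open>f\<close> and its p-th power are both at most
  \<open>1 + cmod (f z) powr p\<close>, which is integrable there.\<close>

lemma Lp_loc_integrable:
  fixes f g :: "real \<times> real \<Rightarrow> complex"
  assumes f: "f \<in> Lp_loc p I" and p: "1 < p" and K: "compact K" "K \<subseteq> I \<times> UNIV"
    and g: "g \<in> borel_measurable borel" "\<And>z. cmod (g z) \<le> B" "\<And>z. z \<notin> K \<Longrightarrow> g z = 0"
  shows "integrable lborel (\<lambda>z. f z * g z)"
    and "integrable lborel (\<lambda>z. complex_of_real (cmod (f z) powr (p - 1)) * f z * g z)"
proof -
  have [measurable]: "f \<in> borel_measurable borel" and i: "integrable lborel (\<lambda>z. indicator K z * cmod (f z) powr p)"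
    using f K by (auto simp: Lp_loc_def set_integrable_def)
  have iK: "integrable lborel (\<lambda>z. indicator K z :: real)"
    using borel_integrable_compact[OF K(1), of "\<lambda>_. 1::real"] by simp
  note [measurable] = g(1)
  have B: "0 \<le> B" using g(2)[of undefined] norm_ge_zero order_trans by blast
  have i': "integrable lborel (\<lambda>z. B * (indicator K z + indicator K z * cmod (f z) powr p))" using i iK by auto
  note one = le_one_plus_powr[OF less_imp_le[OF p]]
  show "integrable lborel (\<lambda>z. f z * g z)"
  proof (rule integrable_bound[OF i'])
    show "AE z in lborel. norm (f z * g z) \<le> norm (B * (indicator K z + indicator K z * cmod (f z) powr p))"
    proof (rule AE_I2)
      fix z
      show "norm (f z * g z) \<le> norm (B * (indicator K z + indicator K z * cmod (f z) powr p))"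
      proof (cases "z \<in> K")
        case True
        have "norm (f z * g z) \<le> (1 + cmod (f z) powr p) * B" unfolding norm_mult using one g by (intro mult_mono) auto
        then show ?thesis using True B by (simp add: mult.commute)
      qed (simp add: g)
    qed
  qed measurable
  show "integrable lborel (\<lambda>z. complex_of_real (cmod (f z) powr (p - 1)) * f z * g z)"
  proof (rule integrable_bound[OF i'])
    show "AE z in lborel. norm (complex_of_real (cmod (f z) powr (p - 1)) * f z * g z) \<le> norm (B * (indicator K z + indicator K z * cmod (f z) powr p))"
    proof (rule AE_I2)
      fix z
      show "norm (complex_of_real (cmod (f z) powr (p - 1)) * f z * g z) \<le> norm (B * (indicator K z + indicator K z * cmod (f z) powr p))"
      proof (cases "z \<in> K")
        case True
        have "norm (complex_of_real (cmod (f z) powr (p - 1)) * f z * g z) = cmod (f z) powr p * cmod (g z)"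
          by (simp add: norm_mult powr_diff_one_mult)
        also have "... \<le> (1 + cmod (f z) powr p) * B" using g by (intro mult_mono) auto
        finally show ?thesis using True B by (simp add: mult.commute)
      qed (simp add: g)
    qed
  qed measurable
qed


text \<open>The function \<open>A\<close> solves the wave equation with data \<open>A = 0\<close>, \<open>\<partial>\<^sub>t A = \<phi>\<close> at time 0, and
  \<open>B = \<partial>\<^sub>t A\<close>; hence \<open>box (h A) = - (h'' A + 2 h' B)\<close>.\<close>

locale wave_profile =
  fixes \<phi> :: "real \<Rightarrow> real" and \<Phi> :: "real \<Rightarrow> complex"
  assumes \<phi>: "profile \<phi>" and \<Phi>: "\<And>x. (\<Phi> has_vector_derivative complex_of_real (\<phi> x)) (at x)"
begin

definition A :: "real \<Rightarrow> real \<Rightarrow> complex" where "A t x = (\<Phi> (x + t) - \<Phi> (x - t)) / 2"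
definition B :: "real \<Rightarrow> real \<Rightarrow> complex" where "B t x = (complex_of_real (\<phi> (x + t)) + complex_of_real (\<phi> (x - t))) / 2"
definition S :: "(real \<Rightarrow> complex) \<Rightarrow> (real \<Rightarrow> complex) \<Rightarrow> real \<times> real \<Rightarrow> complex" where
  "S h' h'' z = h'' (fst z) * A (fst z) (snd z) + 2 * (h' (fst z) * B (fst z) (snd z))"

lemma smooth1_Phi: "smooth1 \<Phi>" by (rule smooth1_antideriv[OF \<Phi> profileD(1)[OF \<phi>]])

lemma A_le: "cmod (A t x) \<le> (LINT z|lborel. \<phi> z) / 2"
  using antiderivative_diff(2)[OF profileD(5)[OF \<phi>] \<Phi> profileD(2,6)[OF \<phi>], of "x + t" "x - t"] by (simp add: A_def norm_divide)

lemma A_support: "0 \<le> t \<Longrightarrow> x \<notin> {1 - t..2 + t} \<Longrightarrow> A t x = 0"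
  using antiderivative_diff(1)[OF profileD(5)[OF \<phi>] \<Phi> profileD(2,6)[OF \<phi>], of "x - t" "x + t"] profileD(3)[OF \<phi>]
  by (auto simp: A_def)

lemma B_support: "0 \<le> t \<Longrightarrow> x \<notin> {1 - t..2 + t} \<Longrightarrow> B t x = 0"
  using profileD(3)[OF \<phi>] by (auto simp: B_def)

lemma A_schwartz: assumes "0 \<le> t" shows "A t \<in> schwartz"
proof (rule schwartz_compact_support[of _ "1 - t" "2 + t"])
  have "smooth1 (\<lambda>x. (1 / 2) * (\<Phi> (x + t) - \<Phi> (x + - t)))" by (intro smooth1_cmult smooth1_diff smooth1_shift smooth1_Phi)
  then show "smooth1 (A t)" by (simp add: A_def[abs_def])
qed (rule A_support[OF assms])

lemma B_schwartz: assumes "0 \<le> t" shows "B t \<in> schwartz"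
proof (rule schwartz_compact_support[of _ "1 - t" "2 + t"])
  have "smooth1 (\<lambda>x. (1 / 2) * (complex_of_real (\<phi> (x + t)) + complex_of_real (\<phi> (x + - t))))"
    by (intro smooth1_cmult smooth1_add smooth1_shift[of "cplx \<phi>"] profileD \<phi>)
  then show "smooth1 (B t)" by (simp add: B_def[abs_def])
qed (rule B_support[OF assms])

lemma A_dx: "(A t has_vector_derivative (complex_of_real (\<phi> (x + t)) - complex_of_real (\<phi> (x - t))) / 2) (at x)"
proof -
  have "((\<lambda>x. (\<Phi> (1 * x + t) - \<Phi> (1 * x + - t)) * (1 / 2)) has_vector_derivative
      (of_real 1 * complex_of_real (\<phi> (1 * x + t)) - of_real 1 * complex_of_real (\<phi> (1 * x + - t))) * (1 / 2)) (at x)"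
    by (intro has_vector_derivative_mult_left has_vector_derivative_diff has_vector_derivative_affine \<Phi>)
  then show ?thesis by (simp add: A_def[abs_def])
qed

lemma A_dt: "((\<lambda>t. A t x) has_vector_derivative B t x) (at t)"
proof -
  have "((\<lambda>t. (\<Phi> (1 * t + x) - \<Phi> (-1 * t + x)) * (1 / 2)) has_vector_derivative
      (of_real 1 * complex_of_real (\<phi> (1 * t + x)) - of_real (-1) * complex_of_real (\<phi> (-1 * t + x))) * (1 / 2)) (at t)"
    by (intro has_vector_derivative_mult_left has_vector_derivative_diff has_vector_derivative_affine \<Phi>)
  then show ?thesis by (simp add: A_def[abs_def] B_def[abs_def] add.commute)
qed

definition D :: "real \<Rightarrow> real \<Rightarrow> complex" where
  "D t x = (deriv1 (cplx \<phi>) (x + t) - deriv1 (cplx \<phi>) (x - t)) / 2"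

lemma B_dt: "((\<lambda>t. B t x) has_vector_derivative D t x) (at t)"
proof -
  let ?\<phi> = "cplx \<phi>"
  have "((\<lambda>t. (?\<phi> (1 * t + x) + ?\<phi> (-1 * t + x)) * (1 / 2)) has_vector_derivative
      (of_real 1 * deriv1 ?\<phi> (1 * t + x) + of_real (-1) * deriv1 ?\<phi> (-1 * t + x)) * (1 / 2)) (at t)"
    by (intro has_vector_derivative_mult_left has_vector_derivative_add has_vector_derivative_affine[of ?\<phi>] smooth1_has_deriv profileD \<phi>)
  then show ?thesis by (simp add: D_def[abs_def] B_def[abs_def] add.commute)
qed

lemma A_dxx: "((\<lambda>x. (complex_of_real (\<phi> (x + t)) - complex_of_real (\<phi> (x - t))) / 2) has_vector_derivative D t x) (at x)"
proof -
  let ?\<phi> = "cplx \<phi>"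
  have "((\<lambda>x. (?\<phi> (1 * x + t) - ?\<phi> (1 * x + - t)) * (1 / 2)) has_vector_derivative
      (of_real 1 * deriv1 ?\<phi> (1 * x + t) - of_real 1 * deriv1 ?\<phi> (1 * x + - t)) * (1 / 2)) (at x)"
    by (intro has_vector_derivative_mult_left has_vector_derivative_diff has_vector_derivative_affine[of ?\<phi>] smooth1_has_deriv profileD \<phi>)
  then show ?thesis by (simp add: D_def)
qed

lemma smooth_A: assumes "smooth1 h" shows "smooth (\<lambda>z. h (fst z) * A (fst z) (snd z))"
proof -
  have "smooth (\<lambda>z. (1 / 2) * h (fst z) * \<Phi> (snd z + 1 * fst z) + (- 1 / 2) * h (fst z) * \<Phi> (snd z + - 1 * fst z))"
    using assms by (intro smooth_add smooth_wave[of "\<lambda>t. (1 / 2) * h t"] smooth_wave[of "\<lambda>t. (- 1 / 2) * h t"] smooth1_cmult smooth1_Phi)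
  moreover have "(1 / 2) * h (fst z) * \<Phi> (snd z + 1 * fst z) + (- 1 / 2) * h (fst z) * \<Phi> (snd z + - 1 * fst z) = h (fst z) * A (fst z) (snd z)" for z
    by (simp add: A_def field_simps)
  ultimately show ?thesis by simp
qed

lemma smooth_B: assumes "smooth1 h" shows "smooth (\<lambda>z. h (fst z) * B (fst z) (snd z))"
proof -
  let ?\<phi> = "cplx \<phi>"
  have "smooth (\<lambda>z. (1 / 2) * h (fst z) * ?\<phi> (snd z + 1 * fst z) + (1 / 2) * h (fst z) * ?\<phi> (snd z + - 1 * fst z))"
    using assms by (intro smooth_add smooth_wave[of "\<lambda>t. (1 / 2) * h t" ?\<phi>] smooth1_cmult profileD \<phi>)
  moreover have "(1 / 2) * h (fst z) * ?\<phi> (snd z + 1 * fst z) + (1 / 2) * h (fst z) * ?\<phi> (snd z + - 1 * fst z) = h (fst z) * B (fst z) (snd z)" for z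
    by (simp add: B_def field_simps)
  ultimately show ?thesis by simp
qed

lemma smooth_S: assumes "smooth1 h'" "smooth1 h''" shows "smooth (S h' h'')"
proof -
  have "smooth (\<lambda>z. h'' (fst z) * A (fst z) (snd z) + (2 * h' (fst z)) * B (fst z) (snd z))"
    using assms by (intro smooth_add smooth_A smooth_B[of "\<lambda>t. 2 * h' t"] smooth1_cmult)
  then show ?thesis by (simp add: S_def[abs_def] mult.assoc)
qed

lemma box_A:
  assumes h: "\<And>t. (h has_vector_derivative h' t) (at t)" and h': "\<And>t. (h' has_vector_derivative h'' t) (at t)"
  shows "box (\<lambda>z. h (fst z) * A (fst z) (snd z)) z = - S h' h'' z"
proof -
  let ?\<psi> = "\<lambda>z. h (fst z) * A (fst z) (snd z)"
  have 1: "dt ?\<psi> = (\<lambda>z. h (fst z) * B (fst z) (snd z) + h' (fst z) * A (fst z) (snd z))"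
    unfolding dt_def fst_conv snd_conv by (intro ext vector_derivative_at has_vector_derivative_mult h A_dt)
  have 2: "dt (dt ?\<psi>) = (\<lambda>z. (h (fst z) * D (fst z) (snd z) + h' (fst z) * B (fst z) (snd z)) + (h' (fst z) * B (fst z) (snd z) + h'' (fst z) * A (fst z) (snd z)))"
    unfolding 1 dt_def fst_conv snd_conv by (intro ext vector_derivative_at has_vector_derivative_add has_vector_derivative_mult h h' A_dt B_dt)
  have 3: "dx ?\<psi> = (\<lambda>z. h (fst z) * ((complex_of_real (\<phi> (snd z + fst z)) - complex_of_real (\<phi> (snd z - fst z))) / 2))"
    unfolding dx_def fst_conv snd_conv by (intro ext vector_derivative_at has_vector_derivative_mult_right A_dx)
  have 4: "dx (dx ?\<psi>) = (\<lambda>z. h (fst z) * D (fst z) (snd z))"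
    unfolding 3 dx_def fst_conv snd_conv by (intro ext vector_derivative_at has_vector_derivative_mult_right A_dxx)
  show ?thesis unfolding box_def 2 4 S_def by (simp add: algebra_simps)
qed

lemma fourier_B: "fourier (B t) \<xi> = of_real (cos (t * \<xi>)) * fourier (cplx \<phi>) \<xi>"
proof -
  let ?\<phi> = "cplx \<phi>"
  have i: "integrable lborel (\<lambda>x. ?\<phi> (x + a))" for a
    using lborel_integrable_real_affine[OF profileD(6)[OF \<phi>], of 1 a] by (simp add: add.commute)
  have "B t = (\<lambda>x. (1 / 2) * (?\<phi> (x + t) + ?\<phi> (x + - t)))" by (simp add: B_def fun_eq_iff)
  then have "fourier (B t) \<xi> = (1 / 2) * (cis (t * \<xi>) * fourier ?\<phi> \<xi> + cis (- t * \<xi>) * fourier ?\<phi> \<xi>)"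
    by (simp only: fourier_cmult fourier_add[OF i i] fourier_shift[of ?\<phi>])
  also have "... = ((cis (t * \<xi>) + cis (- t * \<xi>)) / 2) * fourier ?\<phi> \<xi>" by (simp add: algebra_simps)
  also have "(cis (t * \<xi>) + cis (- t * \<xi>)) / 2 = of_real (cos (t * \<xi>))" by (simp add: complex_eq_iff)
  finally show ?thesis .
qed

lemma fourier_A:
  assumes t: "0 \<le> t" and \<xi>: "\<xi> \<noteq> 0"
  shows "fourier (A t) \<xi> = of_real t * (of_real (sinc (t * \<xi>)) * fourier (cplx \<phi>) \<xi>)"
proof -
  let ?\<phi> = "cplx \<phi>"
  have i: "integrable lborel (\<lambda>x. ?\<phi> (x + a))" for a
    using lborel_integrable_real_affine[OF profileD(6)[OF \<phi>], of 1 a] by (simp add: add.commute)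
  have i': "integrable lborel (\<lambda>x. -1 * ?\<phi> (x + a))" for a by (intro integrable_mult_right i)
  have "deriv1 (A t) = (\<lambda>x. (1 / 2) * (?\<phi> (x + t) + -1 * ?\<phi> (x + - t)))"
    using deriv1_eqI[OF A_dx] by (simp add: fun_eq_iff)
  then have "\<i> * of_real \<xi> * fourier (A t) \<xi> = fourier (\<lambda>x. (1 / 2) * (?\<phi> (x + t) + -1 * ?\<phi> (x + - t))) \<xi>"
    using schwartz_fourier_deriv1[OF A_schwartz[OF t], of \<xi>] by simp
  also have "... = (1 / 2) * (cis (t * \<xi>) * fourier ?\<phi> \<xi> + -1 * (cis (- t * \<xi>) * fourier ?\<phi> \<xi>))"
    by (simp only: fourier_cmult fourier_add[OF i i'] fourier_shift[of ?\<phi>])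
  also have "... = ((cis (t * \<xi>) - cis (- t * \<xi>)) / 2) * fourier ?\<phi> \<xi>" by (simp add: algebra_simps)
  also have "(cis (t * \<xi>) - cis (- t * \<xi>)) / 2 = \<i> * of_real (sin (t * \<xi>))" by (simp add: complex_eq_iff)
  finally have "\<i> * (of_real \<xi> * fourier (A t) \<xi>) = \<i> * (of_real (sin (t * \<xi>)) * fourier ?\<phi> \<xi>)" by (simp only: mult.assoc)
  then have "of_real \<xi> * fourier (A t) \<xi> = of_real (sin (t * \<xi>)) * fourier ?\<phi> \<xi>" by simp
  moreover define r where "r = sinc (t * \<xi>)"
  moreover from this have "sin (t * \<xi>) = \<xi> * (t * r)" using \<xi> by simp
  ultimately have "of_real \<xi> * fourier (A t) \<xi> = of_real \<xi> * (of_real t * (of_real r * fourier ?\<phi> \<xi>))" by (simp add: mult.assoc)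
  then have "fourier (A t) \<xi> = of_real t * (of_real r * fourier ?\<phi> \<xi>)" using \<xi> by simp
  then show ?thesis unfolding r_def .
qed

text \<open>\<open>A t\<close> divided by \<open>t\<close>, continued by its limit at
  \<open>t = 0\<close>. The linear vanishing of \<open>A\<close> at time 0 compensates the extra
  factor \<open>k\<close> that the second derivative of the cut-off brings into
  \<open>Sk k\<close>.\<close>

definition X :: "real \<Rightarrow> real \<Rightarrow> complex" where
  "X t x = (if t = 0 then complex_of_real (\<phi> x) else complex_of_real (1 / t) * A t x)"

lemma A_eq_X: "A t x = of_real t * X t x"
  by (cases "t = 0") (auto simp: X_def A_def)

lemma X_schwartz: "0 \<le> t \<Longrightarrow> X t \<in> schwartz"
  using A_schwartz[of t] profileD(4)[OF \<phi>] schwartz_cmult[of "A t" "complex_of_real (1 / t)"] by (cases "t = 0") (auto simp: X_def[abs_def])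

lemma fourier_X:
  assumes "0 \<le> t" "\<xi> \<noteq> 0"
  shows "fourier (X t) \<xi> = of_real (sinc (t * \<xi>)) * fourier (cplx \<phi>) \<xi>"
proof (cases "t = 0")
  case False
  then have "X t = (\<lambda>x. complex_of_real (1 / t) * A t x)" by (simp add: X_def fun_eq_iff)
  then show ?thesis using False fourier_A[OF assms] by (simp only: fourier_cmult) simp
qed (simp add: X_def[abs_def])

text \<open>On the Fourier side \<open>X\<close> and \<open>B\<close> multiply the transform of
  \<open>\<phi>\<close> by a sinc and a cosine of \<open>t * \<xi>\<close>, both of modulus at most
  one; so the transform of \<open>\<phi>\<close> is the common majorant.\<close>

lemma pairing_X_B_continuous:
  assumes u: "continuous_sobolev s {0..T} u" and t: "t \<in> {0..T}"
  shows "((\<lambda>\<tau>. u \<tau> (X \<tau>)) \<longlongrightarrow> u t (X t)) (at t within {0..T})"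
    and "((\<lambda>\<tau>. u \<tau> (B \<tau>)) \<longlongrightarrow> u t (B t)) (at t within {0..T})"
proof -
  let ?W = "inv_fourier (cplx \<phi>)"
  have W: "?W \<in> schwartz" by (intro inv_fourier_schwartz profileD \<phi>)
  have ne: "AE \<xi>::real in lborel. \<xi> \<noteq> 0" by (rule AE_lborel_singleton)
  have X: "inv_fourier (X \<tau>) \<xi> = of_real (sinc (\<tau> * - \<xi>)) * ?W \<xi>" if "\<tau> \<in> {0..T}" "\<xi> \<noteq> 0" for \<tau> \<xi>
    using fourier_X[of \<tau> "- \<xi>"] that by (simp only: inv_fourier_def) simp
  have Bf: "inv_fourier (B \<tau>) \<xi> = of_real (cos (\<tau> * - \<xi>)) * ?W \<xi>" for \<tau> \<xi>
    by (simp only: inv_fourier_def fourier_B)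
  have ev: "\<forall>\<^sub>F \<tau> in at t within {0..T}. \<tau> \<in> {0..T}" by (auto simp: eventually_at_filter)
  show "((\<lambda>\<tau>. u \<tau> (X \<tau>)) \<longlongrightarrow> u t (X t)) (at t within {0..T})"
  proof (rule pairing_continuous[OF u t _ W])
    show "X \<tau> \<in> schwartz" if "\<tau> \<in> {0..T}" for \<tau> using that by (intro X_schwartz) simp
    show "AE \<xi> in lborel. cmod (inv_fourier (X \<tau>) \<xi>) \<le> cmod (?W \<xi>)" if \<tau>: "\<tau> \<in> {0..T}" for \<tau>
      using ne
    proof eventually_elim
      case (elim \<xi>)
      have "\<bar>sinc y\<bar> \<le> 1" for y
      proof (cases "y = 0")
        case False
        then show ?thesis using abs_sin_le_one abs_sin_x_le_abs_x[of y] by (simp add: abs_divide divide_le_eq_1)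
      qed simp
      from mult_right_mono[OF this[of "\<tau> * - \<xi>"], of "cmod (?W \<xi>)"] show ?case
        unfolding X[OF \<tau> elim] norm_mult norm_of_real by simp
    qed
    show "AE \<xi> in lborel. ((\<lambda>\<tau>. inv_fourier (X \<tau>) \<xi>) \<longlongrightarrow> inv_fourier (X t) \<xi>) (at t within {0..T})"
      using ne
    proof eventually_elim
      case (elim \<xi>)
      have "((\<lambda>\<tau>. sinc (\<tau> * - \<xi>)) \<longlongrightarrow> sinc (t * - \<xi>)) (at t within {0..T})"
        by (rule isCont_tendsto_compose[OF isCont_sinc]) (intro tendsto_intros)
      then have "((\<lambda>\<tau>. of_real (sinc (\<tau> * - \<xi>)) * ?W \<xi>) \<longlongrightarrow> of_real (sinc (t * - \<xi>)) * ?W \<xi>) (at t within {0..T})"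
        by (intro tendsto_mult tendsto_of_real tendsto_const)
      moreover have "\<forall>\<^sub>F \<tau> in at t within {0..T}. of_real (sinc (\<tau> * - \<xi>)) * ?W \<xi> = inv_fourier (X \<tau>) \<xi>"
        using ev by eventually_elim (rule X[OF _ elim, symmetric])
      ultimately show ?case unfolding X[OF t elim] by (rule Lim_transform_eventually)
    qed
  qed
  show "((\<lambda>\<tau>. u \<tau> (B \<tau>)) \<longlongrightarrow> u t (B t)) (at t within {0..T})"
  proof (rule pairing_continuous[OF u t _ W])
    show "B \<tau> \<in> schwartz" if "\<tau> \<in> {0..T}" for \<tau> using that by (intro B_schwartz) simp
    show "AE \<xi> in lborel. cmod (inv_fourier (B \<tau>) \<xi>) \<le> cmod (?W \<xi>)" for \<tau>
      unfolding Bf norm_mult norm_of_real by (intro AE_I2 mult_left_le_one_le) auto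
    show "AE \<xi> in lborel. ((\<lambda>\<tau>. inv_fourier (B \<tau>) \<xi>) \<longlongrightarrow> inv_fourier (B t) \<xi>) (at t within {0..T})"
      unfolding Bf by (intro AE_I2 tendsto_intros)
  qed
qed

end

section \<open>A mollified step in time and the recovery of the initial value\<close>

definition unit_bump :: "real \<Rightarrow> real" where
  "unit_bump x = 1 / (LINT x|lborel. bump x) * bump ((x - 1) / 1)"

lemma profile_unit_bump: "profile unit_bump"
  and integral_unit_bump: "(LINT x|lborel. unit_bump x) = 1"
proof -
  have J: "0 < (LINT x|lborel. bump x)" using bump_powr_integral_pos[of 1] by (simp add: bump_simps)
  show "profile unit_bump"
    unfolding unit_bump_def[abs_def] using J by (intro profile_cmult profile_bump_scaled) auto
  have "(LINT x|lborel. bump ((x - 1) / 1)) = (LINT x|lborel. bump x)"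
    using integral_shift[of bump 1] by simp
  then show "(LINT x|lborel. unit_bump x) = 1" unfolding unit_bump_def integral_mult_right_zero using J by simp
qed

abbreviation unit_bump' :: "real \<Rightarrow> complex" where
  "unit_bump' \<equiv> deriv1 (\<lambda>x. complex_of_real (unit_bump x))"

lemma unit_bump'_support: "x \<notin> {1..2} \<Longrightarrow> unit_bump' x = 0"
  by (rule deriv1_eq_0_outside[of 1 2]) (use profileD(3)[OF profile_unit_bump] in auto)

lemma unit_bump'_schwartz: "unit_bump' \<in> schwartz"
  by (intro schwartz_deriv1 profileD profile_unit_bump)

text \<open>Integration by parts. In \<open>step_limit\<close> this -1 meets twice the integral of
  \<open>unit_bump\<close>, leaving the factor one.\<close>

lemma integral_x_unit_bump': "(LINT x|lborel. of_real x * unit_bump' x) = - 1"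
proof -
  note e = profileD(4)[OF profile_unit_bump]
  have i: "integrable lborel (\<lambda>x. complex_of_real (unit_bump x))" "integrable lborel (\<lambda>x. of_real x * unit_bump' x)"
    by (intro schwartz_integrable schwartz_mult_x unit_bump'_schwartz e)+
  have 0: "((\<lambda>x. of_real x * complex_of_real (unit_bump x)) \<longlongrightarrow> 0) at_infinity"
    by (intro schwartz_tendsto_0 schwartz_mult_x e)
  have "(LINT x|lborel. of_real x * unit_bump' x + complex_of_real (unit_bump x)) = 0"
  proof (rule integral_derivative_eq_0)
    show "((\<lambda>x. of_real x * complex_of_real (unit_bump x)) has_vector_derivative of_real x * unit_bump' x + complex_of_real (unit_bump x)) (at x)" for x
      using has_vector_derivative_mult[OF has_vector_derivative_of_real[OF DERIV_ident] smooth1_has_deriv[OF profileD(1)[OF profile_unit_bump]]] by simp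
    show "continuous_on UNIV (\<lambda>x. of_real x * unit_bump' x + complex_of_real (unit_bump x))"
      by (intro continuous_intros smooth1_continuous schwartz_smooth1 unit_bump'_schwartz e)
    show "((\<lambda>x. of_real x * complex_of_real (unit_bump x)) \<longlongrightarrow> 0) at_top" "((\<lambda>x. of_real x * complex_of_real (unit_bump x)) \<longlongrightarrow> 0) at_bot"
      using 0 by (auto intro: tendsto_mono at_top_le_at_infinity at_bot_le_at_infinity)
  qed (use i in auto)
  then have "(LINT x|lborel. of_real x * unit_bump' x) + 1 = 0" using i integral_unit_bump by simp
  then show ?thesis by (simp only: eq_neg_iff_add_eq_0)
qed

context wave_profile
begin

text \<open>Minus the wave operator applied to \<open>A\<close> times a step in time that rises by
  one between \<open>1 / k\<close> and \<open>2 / k\<close>: the two arguments of \<open>S\<close>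
  are the derivatives of that step.\<close>

definition Sk :: "real \<Rightarrow> real \<times> real \<Rightarrow> complex" where
  "Sk k = S (\<lambda>t. of_real k * complex_of_real (unit_bump (k * t))) (\<lambda>t. of_real k * (of_real k * unit_bump' (k * t)))"

lemma smooth_Sk: "smooth (Sk k)"
  unfolding Sk_def
proof (intro smooth_S smooth1_cmult)
  show "smooth1 (\<lambda>t. complex_of_real (unit_bump (k * t)))"
    using smooth1_affine[OF profileD(1)[OF profile_unit_bump], of k 0] by simp
  show "smooth1 (\<lambda>t. unit_bump' (k * t))"
    using smooth1_affine[OF schwartz_smooth1[OF unit_bump'_schwartz], of k 0] by simp
qed

lemma Sk_support:
  assumes k: "0 < k" and z: "z \<notin> {1 / k..2 / k} \<times> {1 - 2 / k..2 + 2 / k}" shows "Sk k z = 0"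
proof (cases "fst z \<in> {1 / k..2 / k}")
  case True
  then have "0 \<le> fst z" "snd z \<notin> {1 - fst z..2 + fst z}" using z k by (auto simp: mem_Times_iff intro: order_trans[rotated])
  then show ?thesis by (simp add: Sk_def S_def A_support B_support)
next
  case False
  then have "k * fst z \<notin> {1..2}" using k by (auto simp: field_simps)
  then show ?thesis using profileD(3)[OF profile_unit_bump] unit_bump'_support by (simp add: Sk_def S_def)
qed

lemma Sk_test:
  assumes k: "0 < k" "2 / k < T" shows "Sk k \<in> test_functions ({- T<..<T} \<times> UNIV)"
proof -
  have "0 < 1 / k" using k by simp
  then have "{1 / k..2 / k} \<times> {1 - 2 / k..2 + 2 / k} \<subseteq> {- T<..<T} \<times> UNIV" using k by auto
  moreover have "compact ({1 / k..2 / k} \<times> {1 - 2 / k..2 + 2 / k})" by (intro compact_Times compact_Icc)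
  ultimately show ?thesis using smooth_Sk Sk_support[OF k(1)] unfolding test_functions_def by blast
qed

text \<open>After the substitution \<open>\<sigma> = k * t\<close> the integrand involves
  \<open>u\<close> at the time \<open>\<sigma> / k\<close>, which tends to 0, where \<open>X\<close>
  and \<open>B\<close> both equal \<open>\<phi>\<close>. So the pairings recover the initial
  value.\<close>

lemma step_limit:
  assumes T: "0 < T" and u: "continuous_sobolev s {- T..T} u" and k: "filterlim k at_top sequentially" "\<And>n. 2 / T \<le> k n"
  shows "(\<lambda>n. LINT t:{- T..T}|lborel. u t (\<lambda>x. Sk (k n) (t, x))) \<longlonglongrightarrow> u 0 (cplx \<phi>)"
proof -
  let ?e = "\<lambda>x. complex_of_real (unit_bump x)"
  have tempered: "tempered (u t)" if "t \<in> {- T..T}" for t using u that by (auto simp: continuous_sobolev_def sobolev_def)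
  have u': "continuous_sobolev s {0..T} u"
    unfolding continuous_sobolev_def
  proof (intro conjI ballI)
    fix t assume t: "t \<in> {0..T}"
    then show "u t \<in> sobolev s" using u by (simp add: continuous_sobolev_def)
    have "((\<lambda>\<tau>. sobolev_norm s (minus_dist (u \<tau>) (u t))) \<longlongrightarrow> 0) (at t within {- T..T})"
      using u t by (simp add: continuous_sobolev_def)
    then show "((\<lambda>\<tau>. sobolev_norm s (minus_dist (u \<tau>) (u t))) \<longlongrightarrow> 0) (at t within {0..T})"
      by (rule tendsto_within_subset) (use T in auto)
  qed
  \<comment> \<open>Time is clamped to \<open>{0..T}\<close>, so that both curves are continuous and
    bounded on the whole line.\<close>
  define Y where "Y t = u (max 0 (min T t)) (X (max 0 (min T t)))" for t
  define z where "z t = u (max 0 (min T t)) (B (max 0 (min T t)))" for t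
  have "continuous_on {0..T} (\<lambda>t. u t (X t))" "continuous_on {0..T} (\<lambda>t. u t (B t))"
    using pairing_X_B_continuous[OF u'] by (auto simp: continuous_on_def)
  then have cont: "continuous_on UNIV Y" "continuous_on UNIV z" and bdd: "bounded (range Y)" "bounded (range z)"
  proof -
    assume c: "continuous_on {0..T} (\<lambda>t. u t (X t))" "continuous_on {0..T} (\<lambda>t. u t (B t))"
    show "continuous_on UNIV Y" "continuous_on UNIV z"
      unfolding Y_def[abs_def] z_def[abs_def] using T
      by (auto intro!: continuous_on_compose2[OF c(1), of UNIV "\<lambda>t. max 0 (min T t)"] continuous_on_compose2[OF c(2), of UNIV "\<lambda>t. max 0 (min T t)"] continuous_intros)
    have "bounded ((\<lambda>t. u t (X t)) ` {0..T})" "bounded ((\<lambda>t. u t (B t)) ` {0..T})"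
      by (intro compact_imp_bounded compact_continuous_image compact_Icc c)+
    moreover have "range Y \<subseteq> (\<lambda>t. u t (X t)) ` {0..T}" "range z \<subseteq> (\<lambda>t. u t (B t)) ` {0..T}"
      using T by (auto simp: Y_def z_def intro!: imageI)
    ultimately show "bounded (range Y)" "bounded (range z)" by (auto intro: bounded_subset)
  qed
  obtain CY Cz where C: "\<And>t. cmod (Y t) \<le> CY" "\<And>t. cmod (z t) \<le> Cz" using bdd by (auto simp: bounded_iff)
  have B0: "B 0 = (cplx \<phi>)" and X0: "X 0 = (cplx \<phi>)" by (auto simp: B_def X_def)
  have kpos: "0 < k n" for n using k(2)[of n] T by (smt (verit) divide_pos_pos)
  have k2: "2 / k n \<le> T" for n using k(2)[of n] T kpos[of n] by (simp add: field_simps)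
  let ?q = "\<lambda>n \<sigma>. (of_real \<sigma> * unit_bump' \<sigma>) * Y (\<sigma> / k n) + (2 * ?e \<sigma>) * z (\<sigma> / k n)"
  have eq: "(LINT t:{- T..T}|lborel. u t (\<lambda>x. Sk (k n) (t, x))) = (LINT \<sigma>|lborel. ?q n \<sigma>)" for n
  proof -
    let ?k = "k n"
    \<comment> \<open>Writing \<open>A\<close> as \<open>t * X\<close> turns one of the factors
      \<open>k\<close> into \<open>\<sigma>\<close>; the factor left in front is the Jacobian of the
      substitution.\<close>
    have pt: "indicator {- T..T} t *\<^sub>R u t (\<lambda>x. Sk ?k (t, x)) = of_real ?k * ?q n (?k * t)" for t
    proof (cases "?k * t \<in> {1..2}")
      case True
      then have "0 < ?k * t" "t \<le> 2 / ?k" using kpos[of n] by (auto simp: field_simps)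
      then have t: "0 < t" "t \<le> T" using kpos[of n] k2[of n] by (auto simp: zero_less_mult_iff)
      have S: "(\<lambda>x. Sk ?k (t, x)) = (\<lambda>x. (of_real ?k * (of_real ?k * unit_bump' (?k * t)) * of_real t) * X t x + (2 * (of_real ?k * ?e (?k * t))) * B t x)"
        by (simp add: Sk_def S_def A_eq_X fun_eq_iff mult.assoc)
      have sch: "X t \<in> schwartz" "B t \<in> schwartz" using t by (auto intro: X_schwartz B_schwartz)
      have "u t (\<lambda>x. Sk ?k (t, x)) = (of_real ?k * (of_real ?k * unit_bump' (?k * t)) * of_real t) * u t (X t) + (2 * (of_real ?k * ?e (?k * t))) * u t (B t)"
        unfolding S using tempered[of t] t sch schwartz_cmult[OF sch(1)] schwartz_cmult[OF sch(2)] by (simp add: tempered_def)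
      moreover have "Y t = u t (X t)" "z t = u t (B t)" using t by (auto simp: Y_def z_def)
      ultimately show ?thesis using t kpos[of n] by (simp add: algebra_simps)
    next
      case False
      then have 0: "unit_bump (?k * t) = 0" "unit_bump' (?k * t) = 0" using profileD(3)[OF profile_unit_bump] unit_bump'_support by auto
      have "u t (\<lambda>x. 0 * complex_of_real (\<phi> x)) = 0 * u t (cplx \<phi>)" if "t \<in> {- T..T}"

      proof -
        have "\<forall>\<phi>\<in>schwartz. \<forall>c. u t (\<lambda>x. c * \<phi> x) = c * u t \<phi>" using tempered[OF that] unfolding tempered_def by (elim conjE)
        from this[rule_format, OF profileD(4)[OF \<phi>], of 0] show ?thesis .
      qed
      then have "indicator {- T..T} t *\<^sub>R u t (\<lambda>x. Sk ?k (t, x)) = 0" using 0 by (auto simp: Sk_def S_def indicator_def)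
      then show ?thesis using 0 by simp
    qed
    have "(LINT t:{- T..T}|lborel. u t (\<lambda>x. Sk ?k (t, x))) = (LINT t|lborel. of_real ?k * ?q n (?k * t))"
      unfolding set_lebesgue_integral_def pt ..
    also have "... = of_real ?k * (LINT t|lborel. ?q n (?k * t))" by (rule integral_mult_right_zero)
    also have "... = (LINT \<sigma>|lborel. ?q n \<sigma>)"
      using lborel_integral_real_affine[of ?k "?q n" 0] kpos[of n] by (simp add: scaleR_conv_of_real)
    finally show ?thesis .
  qed
  have "(\<lambda>n. LINT \<sigma>|lborel. ?q n \<sigma>) \<longlonglongrightarrow> (LINT \<sigma>|lborel. (of_real \<sigma> * unit_bump' \<sigma>) * Y 0 + (2 * ?e \<sigma>) * z 0)"
  proof (rule integral_dominated_convergence[where w = "\<lambda>\<sigma>. CY * cmod (of_real \<sigma> * unit_bump' \<sigma>) + (2 * Cz) * cmod (?e \<sigma>)"])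
    have m: "(\<lambda>\<sigma>. of_real \<sigma> * unit_bump' \<sigma>) \<in> borel_measurable borel" "?e \<in> borel_measurable borel"
      by (intro schwartz_measurable schwartz_mult_x unit_bump'_schwartz profileD profile_unit_bump)+
    have mm: "(\<lambda>\<sigma>. Y (\<sigma> / k n)) \<in> borel_measurable borel" "(\<lambda>\<sigma>. z (\<sigma> / k n)) \<in> borel_measurable borel" for n
      using kpos[of n] by (auto intro!: borel_measurable_continuous_onI continuous_on_compose2[OF cont(1)] continuous_on_compose2[OF cont(2)] continuous_intros)
    show "(\<lambda>\<sigma>. (of_real \<sigma> * unit_bump' \<sigma>) * Y 0 + (2 * ?e \<sigma>) * z 0) \<in> borel_measurable lborel" using m by measurable
    show "?q n \<in> borel_measurable lborel" for n using m mm by measurable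
    show "integrable lborel (\<lambda>\<sigma>. CY * cmod (of_real \<sigma> * unit_bump' \<sigma>) + (2 * Cz) * cmod (?e \<sigma>))"
      by (intro integrable_add integrable_mult_right integrable_norm schwartz_integrable schwartz_mult_x unit_bump'_schwartz profileD profile_unit_bump)
    show "AE \<sigma> in lborel. (\<lambda>n. ?q n \<sigma>) \<longlonglongrightarrow> (of_real \<sigma> * unit_bump' \<sigma>) * Y 0 + (2 * ?e \<sigma>) * z 0"
    proof (rule AE_I2)
      fix \<sigma>
      have "(\<lambda>n. \<sigma> / k n) \<longlonglongrightarrow> 0" by (rule tendsto_divide_0[OF tendsto_const filterlim_mono[OF k(1) at_top_le_at_infinity order_refl]])
      then have "(\<lambda>n. Y (\<sigma> / k n)) \<longlonglongrightarrow> Y 0" "(\<lambda>n. z (\<sigma> / k n)) \<longlonglongrightarrow> z 0"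
        using cont by (auto simp: continuous_on_eq_continuous_at intro: isCont_tendsto_compose[rotated])
      then show "(\<lambda>n. ?q n \<sigma>) \<longlonglongrightarrow> (of_real \<sigma> * unit_bump' \<sigma>) * Y 0 + (2 * ?e \<sigma>) * z 0"
        by (intro tendsto_add tendsto_mult tendsto_const)
    qed
    show "AE \<sigma> in lborel. norm (?q n \<sigma>) \<le> CY * cmod (of_real \<sigma> * unit_bump' \<sigma>) + (2 * Cz) * cmod (?e \<sigma>)" for n
    proof (rule AE_I2)
      fix \<sigma>
      have "norm (?q n \<sigma>) \<le> cmod (of_real \<sigma> * unit_bump' \<sigma>) * cmod (Y (\<sigma> / k n)) + (2 * cmod (?e \<sigma>)) * cmod (z (\<sigma> / k n))"
        by (rule norm_triangle_le) (simp add: norm_mult)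
      also have "... \<le> cmod (of_real \<sigma> * unit_bump' \<sigma>) * CY + (2 * cmod (?e \<sigma>)) * Cz" using C by (intro add_mono mult_left_mono) auto
      finally show "norm (?q n \<sigma>) \<le> CY * cmod (of_real \<sigma> * unit_bump' \<sigma>) + (2 * Cz) * cmod (?e \<sigma>)" by (simp add: mult_ac)
    qed
  qed
  also have "(LINT \<sigma>|lborel. (of_real \<sigma> * unit_bump' \<sigma>) * Y 0 + (2 * ?e \<sigma>) * z 0) = u 0 (cplx \<phi>)"
  proof -
    have i: "integrable lborel (\<lambda>\<sigma>. of_real \<sigma> * unit_bump' \<sigma>)" "integrable lborel ?e"
      by (intro schwartz_integrable schwartz_mult_x unit_bump'_schwartz profileD profile_unit_bump)+
    have "(LINT \<sigma>|lborel. ?e \<sigma>) = 1" using integral_unit_bump by (simp only: integral_complex_of_real) simp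
    moreover have "Y 0 = u 0 (cplx \<phi>)" "z 0 = u 0 (cplx \<phi>)" using T by (auto simp: Y_def z_def X0 B0)
    ultimately show ?thesis
      using integral_add[OF integrable_mult_left[OF i(1), of "Y 0"] integrable_mult_left[OF integrable_mult_right[OF i(2), of 2], of "z 0"]]
      by (simp only: integral_mult_left_zero integral_mult_right_zero integral_x_unit_bump') simp
  qed
  finally show ?thesis unfolding eq .
qed


text \<open>The support has length one, so the integral of \<open>\<phi>\<close> is at most 2, and
  \<open>A_le\<close> halves it.\<close>

lemma A_le_1:
  assumes q: "1 < q" and n: "(LINT x|lborel. \<phi> x powr q) \<le> 1"
  shows "cmod (A t x) \<le> 1"
proof -
  have q0: "0 < q" using q by simp
  have "(LINT x|lborel. \<phi> x) \<le> (LINT x|lborel. indicator {1..2} x + \<phi> x powr q)"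
  proof (rule integral_mono)
    show "integrable lborel \<phi>" by (rule profileD[OF \<phi>])
    show "integrable lborel (\<lambda>x. indicator {1..2} x + \<phi> x powr q)"
      by (intro integrable_add profile_powr[OF \<phi>] q0 integrable_real_indicator emeasure_compact_finite compact_Icc) simp
    fix x
    show "\<phi> x \<le> indicator {1..2} x + \<phi> x powr q"
    proof (cases "x \<in> {1..2}")
      case True
      have "\<phi> x \<le> 1 + \<phi> x powr q" using q profileD(2)[OF \<phi>] by (intro le_one_plus_powr) auto
      then show ?thesis using True by simp
    qed (use profileD(3)[OF \<phi>] in simp)
  qed
  also have "... = 1 + (LINT x|lborel. \<phi> x powr q)"
    using profile_powr(1)[OF \<phi> q0] by (subst integral_add) auto
  finally show ?thesis using A_le[of t x] n by linarith
qed

lemma travelling_integral_le: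
  assumes q: "0 < q" and n: "(LINT x|lborel. \<phi> x powr q) \<le> 1" and T: "0 \<le> T"
  shows "integrable lborel (\<lambda>z. indicator ({0..T} \<times> {- R..R}) z * \<phi> (snd z + c * fst z) powr q)"
    and "(LINT z|lborel. indicator ({0..T} \<times> {- R..R}) z * \<phi> (snd z + c * fst z) powr q) \<le> T"
proof -
  have c: "continuous_on D (\<lambda>z. \<phi> (snd z + c * fst z) powr q)" for D
    by (rule continuous_on_compose2[OF profile_powr(2)[OF \<phi> q]]) (auto intro!: continuous_intros)
  show i: "integrable lborel (\<lambda>z. indicator ({0..T} \<times> {- R..R}) z * \<phi> (snd z + c * fst z) powr q)"
    using borel_integrable_compact[OF compact_Times[OF compact_Icc compact_Icc] c, of 0 T "- R" R] by simp
  have sh: "integrable lborel (\<lambda>x. \<phi> (x + a) powr q)" for a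
    using lborel_integrable_real_affine[OF profile_powr(1)[OF \<phi> q], of 1 a] by (simp add: add.commute)
  have "(LINT z|lborel. indicator ({0..T} \<times> {- R..R}) z * \<phi> (snd z + c * fst z) powr q)
      = (LINT t|lborel. LINT x|lborel. indicator ({0..T} \<times> {- R..R}) (t, x) * \<phi> (x + c * t) powr q)"
    using lborel_prod_Fubini(1)[OF i] by simp
  also have "... \<le> (LINT t|lborel. indicator {0..T} t)"
  proof (rule integral_mono)
    have "integrable (lborel \<Otimes>\<^sub>M lborel) (\<lambda>z. indicator ({0..T} \<times> {- R..R}) z * \<phi> (snd z + c * fst z) powr q)"
      using i by (simp add: lborel_prod)
    from lborel_pair.integrable_fst'[OF this]
    show "integrable lborel (\<lambda>t. LINT x|lborel. indicator ({0..T} \<times> {- R..R}) (t, x) * \<phi> (x + c * t) powr q)" by simp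
    show "integrable lborel (\<lambda>t. indicator {0..T} t :: real)"
      by (intro integrable_real_indicator emeasure_compact_finite compact_Icc) simp
    fix t
    show "(LINT x|lborel. indicator ({0..T} \<times> {- R..R}) (t, x) * \<phi> (x + c * t) powr q) \<le> indicator {0..T} t"
    proof (cases "t \<in> {0..T}")
      case True
      have "(LINT x|lborel. indicator ({0..T} \<times> {- R..R}) (t, x) * \<phi> (x + c * t) powr q) \<le> (LINT x|lborel. \<phi> (x + c * t) powr q)"
      proof (rule integral_mono[OF _ sh])
        have "continuous_on {- R..R} (\<lambda>x. \<phi> (x + c * t) powr q)"
          by (rule continuous_on_compose2[OF profile_powr(2)[OF \<phi> q]]) (auto intro!: continuous_intros)
        from integrable_Icc_continuous[OF this]
        show "integrable lborel (\<lambda>x. indicator ({0..T} \<times> {- R..R}) (t, x) * \<phi> (x + c * t) powr q)"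
          using True by (simp add: indicator_times)
      qed (auto simp: indicator_def)
      also have "... \<le> 1" using integral_shift[of "\<lambda>x. \<phi> x powr q" "- (c * t)"] n by simp
      finally show ?thesis using True by simp
    qed (simp add: indicator_times)
  qed
  also have "... = T" using T by simp
  finally show "(LINT z|lborel. indicator ({0..T} \<times> {- R..R}) z * \<phi> (snd z + c * fst z) powr q) \<le> T" .
qed

end

text \<open>Testing the equation against \<open>h A\<close>, where \<open>h\<close> rises from 0 to 1 at time scale \<open>1 / k\<close> and
  returns to 0 before time \<open>T / 2\<close>, bounds the pairing with \<open>Sk k\<close> uniformly in \<open>k\<close>.\<close>

lemma test_bound:
  assumes \<omega>: "\<bar>\<omega>\<bar> = 1" and p: "1 < p" and q: "q = p / (p - 1)" and T: "0 < T"
    and f: "f \<in> Lp_loc p {- T..T}" "weak_gNLW \<omega> p {- T..T} f"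
  obtains C where "\<And>\<phi> \<Phi> k. wave_profile \<phi> \<Phi> \<Longrightarrow> (LINT x|lborel. \<phi> x powr q) \<le> 1 \<Longrightarrow> 4 / T \<le> k \<Longrightarrow>
    cmod (LINT z|lborel. f z * wave_profile.Sk \<phi> \<Phi> k z) \<le> C"
proof -
  define R where "R = 2 + T"
  define K where "K = {0..T} \<times> {- R..R}"
  define k0 where "k0 = 4 / T"
  define F where "F = (LINT z|lborel. indicator K z * cmod (f z) powr p)"
  have q': "1 < q" "1 / p + 1 / q = 1" using p by (auto simp: q field_simps)
  then have q0: "0 < q" by simp
  have k0: "0 < k0" "2 / k0 = T / 2" using T by (auto simp: k0_def)
  have K: "compact K" "K \<subseteq> {- T..T} \<times> UNIV" using T by (auto simp: K_def intro: compact_Times)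
  obtain C1 where C1: "\<And>x. cmod (complex_of_real (unit_bump x)) \<le> C1" using schwartz_bounded[OF profileD(4)[OF profile_unit_bump]] by blast
  obtain C2 where C2: "\<And>x. cmod (unit_bump' x) \<le> C2" using schwartz_bounded[OF unit_bump'_schwartz] by blast
  have C0: "0 \<le> C1" "0 \<le> C2" using C1[of 0] C2[of 0] norm_ge_zero order_trans by blast+
  \<comment> \<open>Dominates both time factors in \<open>Sk k0\<close>, independently of
    \<open>\<phi>\<close> and \<open>k\<close>.\<close>
  define M where "M = k0 * (k0 * C2) + k0 * C1"
  have M: "0 \<le> M" using C0 k0 by (simp add: M_def)
  have iK: "integrable lborel (\<lambda>z. indicator K z :: real)"
    using borel_integrable_compact[OF K(1), of "\<lambda>_. 1::real"] by simp
  have fm [measurable]: "f \<in> borel_measurable borel" and iF: "integrable lborel (\<lambda>z. indicator K z * cmod (f z) powr p)"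
    using f(1) K by (auto simp: Lp_loc_def set_integrable_def)
  note one = le_one_plus_powr[OF less_imp_le[OF p]]
  \<comment> \<open>Separates \<open>f\<close> in L^p from the travelling copies of
    \<open>\<phi>\<close> in L^q, so that \<open>\<phi>\<close> enters the bound through its
    normalisation alone.\<close>
  have young: "r * y \<le> r powr p + y powr q" if "0 \<le> r" "0 \<le> y" for r y :: real
  proof -
    have "r powr p / p \<le> r powr p / 1" "y powr q / q \<le> y powr q / 1" using p q' by (intro divide_left_mono; simp)+
    then show ?thesis using Youngs_inequality[OF p q' that] by linarith
  qed
  show ?thesis
  proof (rule that[of "M * ((LINT z|lborel. indicator K z) + 3 * F + 2 * T) + F"])
    fix \<phi> \<Phi> k assume wp: "wave_profile \<phi> \<Phi>" and n: "(LINT x|lborel. \<phi> x powr q) \<le> 1" and k: "4 / T \<le> k"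
    interpret wave_profile \<phi> \<Phi> by fact
    have kk: "0 < k" "k0 \<le> k" "2 / k \<le> T / 2"
    proof -
      show "0 < k" using k T by (smt (verit) divide_pos_pos)
      then show "2 / k \<le> T / 2" using k T by (simp add: field_simps)
    qed (use k in \<open>simp add: k0_def\<close>)
    obtain E where E: "\<And>x. (E has_vector_derivative complex_of_real (unit_bump x)) (at x)"
      using antiderivative_exists[OF profileD(5)[OF profile_unit_bump]] by blast
    note E_diff = antiderivative_diff[OF profileD(5)[OF profile_unit_bump] E profileD(2,6)[OF profile_unit_bump]]
    \<comment> \<open>A fast step minus a slow one. The difference vanishes before time 0 and after
      \<open>2 / k0 = T / 2\<close>, hence gives an admissible cut-off.\<close>
    define h where "h t = E (k * t) - E (k0 * t)" for t
    let ?h' = "\<lambda>k t. of_real k * complex_of_real (unit_bump (k * t))" and ?h'' = "\<lambda>k t. of_real k * (of_real k * unit_bump' (k * t))"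
    have dE: "((\<lambda>t. E (k * t)) has_vector_derivative ?h' k t) (at t)" for k t
      using has_vector_derivative_affine[OF E, of k 0 t] by simp
    have dh: "((\<lambda>t. ?h' k t) has_vector_derivative ?h'' k t) (at t)" for k t
      using has_vector_derivative_mult_right[OF has_vector_derivative_affine[OF smooth1_has_deriv[OF profileD(1)[OF profile_unit_bump]], of k 0 t], of "of_real k"] by simp
    have sE: "smooth1 (\<lambda>t. E (k * t))" for k
      using smooth1_affine[OF smooth1_antideriv[OF E profileD(1)[OF profile_unit_bump]], of k 0] by simp
    have h: "smooth1 h" unfolding h_def[abs_def] by (intro smooth1_diff sE)
    let ?\<psi> = "\<lambda>z. h (fst z) * A (fst z) (snd z)"
    \<comment> \<open>Hence the weak equation compares the pairing with \<open>Sk k\<close> to the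
      one at the fixed scale \<open>k0\<close>, the discrepancy being the nonlinear term.\<close>
    have box: "box ?\<psi> z = Sk k0 z - Sk k z" for z
    proof -
      have "box ?\<psi> z = - S (\<lambda>t. ?h' k t - ?h' k0 t) (\<lambda>t. ?h'' k t - ?h'' k0 t) z"
        unfolding h_def[abs_def] by (rule box_A) (intro has_vector_derivative_diff dE dh)+
      then show ?thesis by (simp add: S_def Sk_def algebra_simps)
    qed
    have h0: "h t = 0" if "t \<notin> {0..T / 2}" for t
    proof (cases "t < 0")
      case True
      have "k * t \<le> k0 * t" "k0 * t < 0" using True kk k0 by (auto simp: mult_right_mono_neg mult_pos_neg)
      then have "E (k0 * t) = E (k * t)" by (intro E_diff(1)) (auto intro!: profileD(3)[OF profile_unit_bump])
      then show ?thesis by (simp add: h_def)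
    next
      case False
      then have t: "T / 2 < t" using that by simp
      then have "k0 * t \<le> k * t" using kk T by (intro mult_right_mono) auto
      moreover have "2 \<le> k0 * t" using t T by (simp add: k0_def field_simps)
      ultimately have "E (k * t) = E (k0 * t)" by (intro E_diff(1)) (auto intro!: profileD(3)[OF profile_unit_bump])
      then show ?thesis by (simp add: h_def)
    qed
    have h1: "cmod (h t) \<le> 1" for t using E_diff(2)[of "k * t" "k0 * t"] integral_unit_bump by (simp add: h_def)
    have \<psi>0: "?\<psi> z = 0" if "z \<notin> {0..T / 2} \<times> {- R..R}" for z
    proof (cases "fst z \<in> {0..T / 2}")
      case True
      then have "snd z \<notin> {1 - fst z..2 + fst z}" using that T by (auto simp: mem_Times_iff R_def)
      then show ?thesis using True A_support[of "fst z" "snd z"] by simp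
    qed (simp add: h0)
    have \<psi>1: "cmod (?\<psi> z) \<le> 1" for z unfolding norm_mult using h1 A_le_1[OF q'(1) n] by (intro mult_le_one) auto
    have "{0..T / 2} \<times> {- R..R} \<subseteq> interior {- T..T} \<times> UNIV" using T by auto
    then have \<psi>: "?\<psi> \<in> test_functions (interior {- T..T} \<times> UNIV)"
      unfolding test_functions_def using smooth_A[OF h] \<psi>0 by (intro CollectI conjI exI[of _ "{0..T / 2} \<times> {- R..R}"]) (auto intro: compact_Times)
    have \<psi>K: "?\<psi> z = 0" if "z \<notin> K" for z using that T by (intro \<psi>0) (auto simp: K_def)
    have SkK: "Sk \<kappa> z = 0" if "z \<notin> K" "k0 \<le> \<kappa>" for \<kappa> z
    proof (rule Sk_support)
      show "0 < \<kappa>" using that k0 by simp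
      have "2 / \<kappa> \<le> 2 / k0" "0 < 1 / \<kappa>" using that k0 by (auto intro: divide_left_mono)
      then show "z \<notin> {1 / \<kappa>..2 / \<kappa>} \<times> {1 - 2 / \<kappa>..2 + 2 / \<kappa>}"
        using that(1) T unfolding k0(2) by (auto simp: K_def R_def mem_Times_iff)
    qed
    have Skc: "continuous_on UNIV (Sk \<kappa>)" for \<kappa> by (rule smooth_continuous[OF smooth_Sk])
    have iS: "integrable lborel (\<lambda>z. f z * Sk \<kappa> z)" if "k0 \<le> \<kappa>" for \<kappa>
    proof -
      have "bounded (Sk \<kappa> ` K)" by (intro compact_imp_bounded compact_continuous_image K continuous_on_subset[OF Skc]) auto
      then obtain b where "\<forall>y\<in>Sk \<kappa> ` K. norm y \<le> b" unfolding bounded_iff by blast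
      then have "cmod (Sk \<kappa> z) \<le> \<bar>b\<bar>" for z using SkK[OF _ that, of z] by (cases "z \<in> K") auto
      then show ?thesis
        by (intro Lp_loc_integrable(1)[OF f(1) p K]) (use SkK[OF _ that] borel_measurable_continuous_onI[OF Skc] in auto)
    qed
    have \<psi>m: "?\<psi> \<in> borel_measurable borel" by (intro borel_measurable_continuous_onI smooth_continuous smooth_A h)
    have "(LINT z|lborel. f z * box ?\<psi> z) = complex_of_real \<omega> * (LINT z|lborel. complex_of_real (cmod (f z) powr (p - 1)) * f z * ?\<psi> z)"
      using f(2) \<psi> by (simp add: weak_gNLW_def)
    moreover have "(LINT z|lborel. f z * box ?\<psi> z) = (LINT z|lborel. f z * Sk k0 z) - (LINT z|lborel. f z * Sk k z)"
      unfolding box right_diff_distrib by (rule integral_diff[OF iS iS]) (use kk in auto)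
    ultimately have "(LINT z|lborel. f z * Sk k z) = (LINT z|lborel. f z * Sk k0 z) - complex_of_real \<omega> * (LINT z|lborel. complex_of_real (cmod (f z) powr (p - 1)) * f z * ?\<psi> z)"
      by (simp add: algebra_simps)
    then have "cmod (LINT z|lborel. f z * Sk k z) \<le> cmod (LINT z|lborel. f z * Sk k0 z) + cmod (LINT z|lborel. complex_of_real (cmod (f z) powr (p - 1)) * f z * ?\<psi> z)"
      using norm_triangle_ineq4[of "LINT z|lborel. f z * Sk k0 z" "complex_of_real \<omega> * (LINT z|lborel. complex_of_real (cmod (f z) powr (p - 1)) * f z * ?\<psi> z)"] \<omega>
      by (simp add: norm_mult)
    also have "cmod (LINT z|lborel. complex_of_real (cmod (f z) powr (p - 1)) * f z * ?\<psi> z) \<le> F"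
      unfolding F_def
    proof (rule integral_norm_bound_integral[OF Lp_loc_integrable(2)[OF f(1) p K \<psi>m \<psi>1 \<psi>K] iF])
      fix z
      have "norm (complex_of_real (cmod (f z) powr (p - 1)) * f z * ?\<psi> z) = cmod (f z) powr p * cmod (?\<psi> z)"
        by (simp add: norm_mult powr_diff_one_mult)
      also have "... \<le> indicator K z * cmod (f z) powr p"
        using \<psi>1[of z] \<psi>K[of z] by (cases "z \<in> K") (auto intro: mult_left_le)
      finally show "norm (complex_of_real (cmod (f z) powr (p - 1)) * f z * ?\<psi> z) \<le> indicator K z * cmod (f z) powr p" .
    qed
    also have "cmod (LINT z|lborel. f z * Sk k0 z) \<le> M * ((LINT z|lborel. indicator K z) + 3 * F + 2 * T)"
    proof -
      let ?P = "\<lambda>c z. indicator K z * \<phi> (snd z + c * fst z) powr q"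
      have P: "integrable lborel (?P c)" "(LINT z|lborel. ?P c z) \<le> T" for c
        unfolding K_def by (intro travelling_integral_le q0 n; use T in simp)+
      let ?H = "\<lambda>z. M * (((indicator K z + 3 * (indicator K z * cmod (f z) powr p)) + ?P 1 z) + ?P (- 1) z)"
      have "cmod (LINT z|lborel. f z * Sk k0 z) \<le> (LINT z|lborel. ?H z)"
      proof (rule integral_norm_bound_integral[OF iS[OF order_refl]])
        show "integrable lborel ?H" by (intro integrable_mult_right integrable_add iK iF P)
        fix z
        show "norm (f z * Sk k0 z) \<le> ?H z"
        proof (cases "z \<in> K")
          case True
          define y y' where "y = \<phi> (snd z + 1 * fst z)" and "y' = \<phi> (snd z + - 1 * fst z)"
          have y: "0 \<le> y" "0 \<le> y'" using profileD(2)[OF \<phi>] by (auto simp: y_def y'_def)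
          have "cmod (2 * B (fst z) (snd z)) = y + y'"
            using y by (simp add: B_def y_def y'_def flip: of_real_add)
          have "cmod (Sk k0 z) \<le> cmod (?h'' k0 (fst z)) * cmod (A (fst z) (snd z)) + cmod (?h' k0 (fst z)) * cmod (2 * B (fst z) (snd z))"
            unfolding Sk_def S_def by (rule norm_triangle_le) (simp add: norm_mult)
          also have "... \<le> (k0 * (k0 * C2)) * 1 + (k0 * C1) * (y + y')"
          proof (intro add_mono mult_mono)
            show "cmod (?h'' k0 (fst z)) \<le> k0 * (k0 * C2)" using k0 C2 by (simp add: norm_mult)
            show "cmod (?h' k0 (fst z)) \<le> k0 * C1" using k0 C1[of "k0 * fst z"] by (simp add: norm_mult)
          qed (use A_le_1[OF q'(1) n] C0 k0 y \<open>cmod (2 * B (fst z) (snd z)) = y + y'\<close> in auto)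
          also have "... \<le> M * 1 + M * (y + y')" using C0 k0 y by (intro add_mono mult_right_mono) (auto simp: M_def)
          finally have Sk: "cmod (Sk k0 z) \<le> M * (1 + y + y')" by (simp add: algebra_simps)
          have "norm (f z * Sk k0 z) \<le> cmod (f z) * (M * (1 + y + y'))" unfolding norm_mult by (intro mult_left_mono Sk) simp
          also have "... = M * (cmod (f z) + cmod (f z) * y + cmod (f z) * y')" by (simp add: algebra_simps)
          also have "... \<le> M * ((1 + cmod (f z) powr p) + (cmod (f z) powr p + y powr q) + (cmod (f z) powr p + y' powr q))"
            using M y by (intro mult_left_mono add_mono one young) auto
          also have "... = ?H z" using True by (simp add: y_def y'_def algebra_simps)
          finally show ?thesis .
        qed (use SkK[OF _ order_refl] in simp)
      qed
      also have "... = M * ((((LINT z|lborel. indicator K z) + 3 * F) + (LINT z|lborel. ?P 1 z)) + (LINT z|lborel. ?P (- 1) z))"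
        unfolding F_def integral_mult_right_zero
          integral_add[OF integrable_add[OF integrable_add[OF iK integrable_mult_right[OF iF]] P(1)] P(1)]
          integral_add[OF integrable_add[OF iK integrable_mult_right[OF iF]] P(1)]
          integral_add[OF iK integrable_mult_right[OF iF]] ..
      also have "... \<le> M * ((LINT z|lborel. indicator K z) + 3 * F + 2 * T)"
        using P(2)[of 1] P(2)[of "- 1"] M by (intro mult_left_mono) linarith+
      finally show ?thesis .
    qed
    finally show "cmod (LINT z|lborel. f z * Sk k z) \<le> M * ((LINT z|lborel. indicator K z) + 3 * F + 2 * T) + F" by simp
  qed
qed

text \<open>The bound from \<open>test_bound\<close> is uniform in \<open>k\<close> and
  \<open>\<phi>\<close>, and \<open>step_limit\<close> identifies the limit of the pairings for
  large \<open>k\<close>.\<close>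

lemma solution_initial_bound:
  assumes \<omega>: "\<bar>\<omega>\<bar> = 1" and p: "1 < p" and T: "0 < T" and sol: "gNLW_solution \<omega> p s {- T..T} u v"
  obtains C where "\<And>\<phi>. profile \<phi> \<Longrightarrow> (LINT x|lborel. \<phi> x powr (p / (p - 1))) \<le> 1 \<Longrightarrow> cmod (u 0 (cplx \<phi>)) \<le> C"
proof -
  obtain f where f: "f \<in> Lp_loc p {- T..T}" "represents {- T..T} f u" "weak_gNLW \<omega> p {- T..T} f" and u: "continuous_sobolev s {- T..T} u"
    using sol by (auto simp: gNLW_solution_def)
  obtain C where C: "\<And>\<phi> \<Phi> k. wave_profile \<phi> \<Phi> \<Longrightarrow> (LINT x|lborel. \<phi> x powr (p / (p - 1))) \<le> 1 \<Longrightarrow> 4 / T \<le> k \<Longrightarrow>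
    cmod (LINT z|lborel. f z * wave_profile.Sk \<phi> \<Phi> k z) \<le> C"
    using test_bound[OF \<omega> p refl T f(1,3)] by blast
  show ?thesis
  proof (rule that[of C])
    fix \<phi> assume \<phi>: "profile \<phi>" and n: "(LINT x|lborel. \<phi> x powr (p / (p - 1))) \<le> 1"
    obtain \<Phi> where "\<And>x. (\<Phi> has_vector_derivative complex_of_real (\<phi> x)) (at x)"
      using antiderivative_exists[OF profileD(5)[OF \<phi>]] by blast
    with \<phi> interpret wave_profile \<phi> \<Phi> by unfold_locales
    define k where "k n = 4 / T + real n" for n
    have k: "4 / T \<le> k n" "0 < k n" "2 / k n < T" for n
    proof -
      show k4: "4 / T \<le> k n" by (simp add: k_def)
      moreover have "0 < 4 / T" using T by simp
      ultimately show "0 < k n" by linarith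
      then show "2 / k n < T" using k4 T by (simp add: field_simps)
    qed
    have "filterlim k at_top sequentially" unfolding k_def[abs_def]
      by (rule filterlim_tendsto_add_at_top[OF tendsto_const filterlim_real_sequentially])
    then have lim: "(\<lambda>n. LINT t:{- T..T}|lborel. u t (\<lambda>x. Sk (k n) (t, x))) \<longlonglongrightarrow> u 0 (cplx \<phi>)"
    proof (rule step_limit[OF T u])
      show "2 / T \<le> k n" for n using k(1)[of n] T by (simp add: field_simps)
    qed
    have "(LINT t:{- T..T}|lborel. u t (\<lambda>x. Sk (k n) (t, x))) = (LINT z|lborel. f z * Sk (k n) z)" for n
      using f(2) Sk_test[OF k(2,3)] by (simp add: represents_def)
    then have "cmod (LINT t:{- T..T}|lborel. u t (\<lambda>x. Sk (k n) (t, x))) \<le> C" for n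
      using C[OF wave_profile_axioms n k(1)] by simp
    then show "cmod (u 0 (cplx \<phi>)) \<le> C"
      by (intro LIMSEQ_le_const2[OF tendsto_norm[OF lim]]) auto
  qed
qed

section \<open>Ill-posedness\<close>

text \<open>The variance of \<open>r\<close> under the probability weights \<open>c\<close> is
  nonnegative.\<close>

lemma weighted_sum_square_le:
  fixes c r :: "nat \<Rightarrow> real"
  assumes c: "\<And>n. 0 \<le> c n" "c sums 1" and r: "\<And>n. \<bar>r n\<bar> \<le> L"
  shows "summable (\<lambda>n. c n * r n)" "summable (\<lambda>n. c n * (r n)^2)" "(\<Sum>n. c n * r n)^2 \<le> (\<Sum>n. c n * (r n)^2)"
proof -
  have L: "0 \<le> L" using r[of 0] by linarith
  show 1: "summable (\<lambda>n. c n * r n)"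
  proof (rule summable_comparison_test'[of "\<lambda>n. c n * L" 0])
    show "summable (\<lambda>n. c n * L)" using c(2) by (intro summable_mult2 sums_summable)
    show "norm (c n * r n) \<le> c n * L" for n using c(1) r by (simp add: abs_mult mult_left_mono)
  qed
  show 2: "summable (\<lambda>n. c n * (r n)^2)"
  proof (rule summable_comparison_test'[of "\<lambda>n. c n * L^2" 0])
    show "summable (\<lambda>n. c n * L^2)" using c(2) by (intro summable_mult2 sums_summable)
    show "norm (c n * (r n)^2) \<le> c n * L^2" for n
      using c(1) r L by (simp add: abs_mult mult_left_mono abs_le_square_iff[symmetric])
  qed
  define m where "m = (\<Sum>n. c n * r n)"
  have m: "(\<lambda>n. c n * (r n)^2 - 2 * m * (c n * r n) + m^2 * c n) sums ((\<Sum>n. c n * (r n)^2) - 2 * m * m + m^2 * 1)"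
    using summable_sums[OF 1] summable_sums[OF 2] c(2) by (intro sums_add sums_diff sums_mult) (simp_all add: m_def)
  have "0 \<le> c n * (r n)^2 - 2 * m * (c n * r n) + m^2 * c n" for n
  proof -
    have "0 \<le> c n * (r n - m)^2" using c by simp
    then show ?thesis by (simp add: power2_eq_square algebra_simps)
  qed
  from sums_le[OF this sums_zero m] have "0 \<le> (\<Sum>n. c n * (r n)^2) - 2 * m * m + m^2 * 1" .
  then show "(\<Sum>n. c n * r n)^2 \<le> (\<Sum>n. c n * (r n)^2)" by (simp add: m_def power2_eq_square)
qed

text \<open>The sum has a finite integral by monotone convergence, hence is finite almost
  everywhere.\<close>

lemma AE_summable_if_integrals_summable:
  fixes f :: "nat \<Rightarrow> real \<Rightarrow> real"
  assumes f: "\<And>n. integrable lborel (f n)" "\<And>n x. 0 \<le> f n x" and s: "summable (\<lambda>n. LINT x|lborel. f n x)"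
  shows "AE x in lborel. summable (\<lambda>n. f n x)"
proof -
  have [measurable]: "f n \<in> borel_measurable borel" for n using borel_measurable_integrable[OF f(1)[of n]] by simp
  have "(\<integral>\<^sup>+x. (\<Sum>n. ennreal (f n x)) \<partial>lborel) = (\<Sum>n. \<integral>\<^sup>+x. ennreal (f n x) \<partial>lborel)"
    by (rule nn_integral_suminf) measurable
  also have "... = (\<Sum>n. ennreal (LINT x|lborel. f n x))"
    using f by (simp add: nn_integral_eq_integral)
  also have "... = ennreal (\<Sum>n. LINT x|lborel. f n x)"
    by (rule suminf_ennreal_eq[OF _ summable_sums[OF s]]) (use f(2) in \<open>auto intro: integral_nonneg_AE\<close>)
  also have "... \<noteq> \<infinity>" by simp
  finally have "AE x in lborel. (\<Sum>n. ennreal (f n x)) \<noteq> \<infinity>" by (intro nn_integral_PInf_AE) auto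
  then show ?thesis by eventually_elim (intro summable_suminf_not_top f(2), simp)
qed

text \<open>By the previous section such a datum is the initial value of no solution.\<close>

lemma unbounded_datum:
  assumes p: "1 < p" and s: "s < s_sob p"
  obtains u0 where "u0 \<in> sobolev s" "sobolev_norm s u0 \<le> 1"
    "\<And>C. \<exists>\<phi>. profile \<phi> \<and> (LINT x|lborel. \<phi> x powr (p / (p - 1))) \<le> 1 \<and> C < cmod (u0 (cplx \<phi>))"
proof -
  \<comment> \<open>Probability weights, so that convexity of the square bounds the H^s norm of the
    superposition by one.\<close>
  define c :: "nat \<Rightarrow> real" where "c n = (1 / 2) ^ Suc n" for n
  have c: "\<And>n. 0 < c n" "c sums 1" using power_half_series by (auto simp: c_def[abs_def])
  \<comment> \<open>A pairing of size \<open>real n / c n\<close> makes up for the weight: the n-th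
    summand alone then contributes at least \<open>n\<close>.\<close>
  have "\<forall>n. \<exists>b \<phi>. profile b \<and> profile \<phi> \<and> profile_norm2 s b \<le> 1 \<and> (LINT x|lborel. \<phi> x powr (p / (p - 1))) \<le> 1 \<and> real n / c n \<le> (LINT x|lborel. b x * \<phi> x)"
    using dual_profiles[OF p s] by blast
  from choice[OF this] obtain b where "\<forall>n. \<exists>\<phi>. profile (b n) \<and> profile \<phi> \<and> profile_norm2 s (b n) \<le> 1 \<and>
    (LINT x|lborel. \<phi> x powr (p / (p - 1))) \<le> 1 \<and> real n / c n \<le> (LINT x|lborel. b n x * \<phi> x)" by (elim exE)
  from choice[OF this] obtain \<phi> where b\<phi>: "\<forall>n. profile (b n) \<and> profile (\<phi> n) \<and> profile_norm2 s (b n) \<le> 1 \<and>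
    (LINT x|lborel. \<phi> n x powr (p / (p - 1))) \<le> 1 \<and> real n / c n \<le> (LINT x|lborel. b n x * \<phi> n x)" by (elim exE)
  then have b: "profile (b n)" "profile_norm2 s (b n) \<le> 1" and \<phi>: "profile (\<phi> n)"
    "(LINT x|lborel. \<phi> n x powr (p / (p - 1))) \<le> 1" and M: "real n / c n \<le> (LINT x|lborel. b n x * \<phi> n x)" for n by blast+
  obtain L where L: "0 < L" "\<And>b. profile b \<Longrightarrow> (LINT x|lborel. b x) \<le> L * sqrt (profile_norm2 s b)"
    using profile_integral_bounded[of s] by blast
  have bL: "(LINT x|lborel. b n x) \<le> L" "0 \<le> (LINT x|lborel. b n x)" for n
  proof -
    have "L * sqrt (profile_norm2 s (b n)) \<le> L * 1" using L(1) b(2) by (intro mult_left_mono) simp_all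
    then show "(LINT x|lborel. b n x) \<le> L" using L(2)[OF b(1), of n] by simp
  qed (use profileD(2)[OF b(1)] in \<open>auto intro: integral_nonneg_AE\<close>)
  let ?F = "\<lambda>n. fourier (cplx (b n))"
  have FL: "cmod (?F n \<xi>) \<le> L" for n \<xi>
    using norm_fourier_le[of "\<lambda>x. complex_of_real (b n x)" \<xi>] bL(1)[of n] profileD(2)[OF b(1)] by simp
  define g where "g x = (\<Sum>n. c n * b n x)" for x
  let ?G = "cplx g"
  have ib: "integrable lborel (\<lambda>x. c n * b n x)" for n by (intro integrable_mult_right profileD b)
  have nn: "0 \<le> c n * b n x" for n x using c(1)[of n] profileD(2)[OF b(1)] by simp
  have sI: "summable (\<lambda>n. LINT x|lborel. c n * b n x)"
  proof (rule summable_comparison_test'[of "\<lambda>n. c n * L" 0])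
    show "summable (\<lambda>n. c n * L)" using c(2) by (intro summable_mult2 sums_summable)
    show "norm (LINT x|lborel. c n * b n x) \<le> c n * L" for n
      unfolding integral_mult_right_zero using c(1)[of n] bL[of n] by (simp add: abs_mult)
  qed
  have sm: "AE x in lborel. summable (\<lambda>n. c n * b n x)" by (rule AE_summable_if_integrals_summable[OF ib nn sI])
  have ig: "integrable lborel g"
    unfolding g_def[abs_def] by (rule integrable_suminf[OF ib]) (use sm sI nn in auto)
  then have iG: "integrable lborel ?G" by simp
  have FG: "fourier ?G \<xi> = (\<Sum>n. of_real (c n) * ?F n \<xi>)" for \<xi>
  proof -
    let ?f = "\<lambda>n x. cis (- (x * \<xi>)) * complex_of_real (c n * b n x)"
    have if': "integrable lborel (?f n)" for n by (intro integrable_fourier_kernel integrable_of_real ib)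
    have nf: "norm (?f n x) = c n * b n x" for n x unfolding norm_mult norm_cis norm_of_real using nn[of n x] by simp
    have "(LINT x|lborel. cis (- (x * \<xi>)) * ?G x) = (LINT x|lborel. (\<Sum>n. ?f n x))"
    proof (rule integral_cong_AE)
      show "AE x in lborel. cis (- (x * \<xi>)) * ?G x = (\<Sum>n. ?f n x)"
        using sm
      proof eventually_elim
        case (elim x)
        have "?G x = (\<Sum>n. complex_of_real (c n * b n x))" unfolding g_def by (rule suminf_of_real[OF elim])
        then show ?case using suminf_mult[OF summable_of_real[OF elim], of "cis (- (x * \<xi>))"] by simp
      qed
      show "(\<lambda>x. cis (- (x * \<xi>)) * ?G x) \<in> borel_measurable lborel"
        by (rule borel_measurable_integrable[OF integrable_fourier_kernel[OF iG]])
      show "(\<lambda>x. \<Sum>n. ?f n x) \<in> borel_measurable lborel"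
        using borel_measurable_integrable[OF if'] by (rule borel_measurable_suminf)
    qed
    also have "... = (\<Sum>n. LINT x|lborel. ?f n x)"
    proof (rule integral_suminf[OF if'])
      show "AE x in lborel. summable (\<lambda>n. norm (?f n x))" unfolding nf by (rule sm)
      show "summable (\<lambda>n. LINT x|lborel. norm (?f n x))" unfolding nf by (rule sI)
    qed
    finally have e: "fourier ?G \<xi> = complex_of_real (1 / sqrt (2 * pi)) * (\<Sum>n. LINT x|lborel. ?f n x)" by (simp add: fourier_def)
    have "summable (\<lambda>n. LINT x|lborel. ?f n x)"
    proof (rule summable_comparison_test'[OF sI])
      show "norm (LINT x|lborel. ?f n x) \<le> (LINT x|lborel. c n * b n x)" for n
        using integral_norm_bound[of lborel "?f n"] unfolding nf .
    qed
    from suminf_mult[OF this, of "complex_of_real (1 / sqrt (2 * pi))"] e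
    have "fourier ?G \<xi> = (\<Sum>n. fourier (\<lambda>x. complex_of_real (c n * b n x)) \<xi>)" by (simp add: fourier_def)
    then show ?thesis using fourier_cmult[of "of_real (c _)" "\<lambda>x. complex_of_real (b _ x)" \<xi>] by simp
  qed
  \<comment> \<open>The convex bound for the squared transform at each frequency; its weighted
    integral is at most the sum of the weights \<open>c n\<close>.\<close>
  define H where "H \<xi> = (\<Sum>n. c n * (cmod (?F n \<xi>))^2)" for \<xi>
  have sq: "(cmod (fourier ?G \<xi>))^2 \<le> H \<xi>" and sH: "summable (\<lambda>n. c n * (cmod (?F n \<xi>))^2)" for \<xi>
  proof -
    have w: "summable (\<lambda>n. c n * cmod (?F n \<xi>))" "(\<Sum>n. c n * cmod (?F n \<xi>))^2 \<le> H \<xi>" and s: "summable (\<lambda>n. c n * (cmod (?F n \<xi>))^2)"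
    proof -
      have "0 \<le> c n" "\<bar>cmod (?F n \<xi>)\<bar> \<le> L" for n using c(1)[of n] FL[of n \<xi>] by simp_all
      note weighted_sum_square_le[OF this(1) c(2) this(2)]
      then show "summable (\<lambda>n. c n * cmod (?F n \<xi>))" "(\<Sum>n. c n * cmod (?F n \<xi>))^2 \<le> H \<xi>" "summable (\<lambda>n. c n * (cmod (?F n \<xi>))^2)"
        unfolding H_def by fast+
    qed
    show "summable (\<lambda>n. c n * (cmod (?F n \<xi>))^2)" by (rule s)
    have nF: "norm (of_real (c n) * ?F n \<xi>) = c n * cmod (?F n \<xi>)" for n using c(1)[of n] by (simp add: norm_mult)
    have "cmod (fourier ?G \<xi>) \<le> (\<Sum>n. c n * cmod (?F n \<xi>))"
      unfolding FG using summable_norm[of "\<lambda>n. of_real (c n) * ?F n \<xi>"] w(1) by (simp only: nF)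
    then have "(cmod (fourier ?G \<xi>))^2 \<le> (\<Sum>n. c n * cmod (?F n \<xi>))^2" by (intro power_mono) auto
    with w(2) show "(cmod (fourier ?G \<xi>))^2 \<le> H \<xi>" by linarith
  qed
  let ?w = "\<lambda>n \<xi>. c n * (wt s \<xi> * (cmod (?F n \<xi>))^2)"
  have iw: "integrable lborel (?w n)" for n by (intro integrable_mult_right integrable_profile_norm2 b)
  have wH: "(\<lambda>n. ?w n \<xi>) sums (wt s \<xi> * H \<xi>)" for \<xi>
    using sums_mult[OF summable_sums[OF sH[of \<xi>]], of "wt s \<xi>"] by (simp add: H_def mult_ac)
  have nw: "norm (?w n \<xi>) = ?w n \<xi>" for n \<xi> using c(1)[of n] by simp
  have Iw: "(LINT \<xi>|lborel. ?w n \<xi>) \<le> c n" "0 \<le> (LINT \<xi>|lborel. ?w n \<xi>)" for n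
    unfolding integral_mult_right_zero using c(1)[of n] b(2)[of n] profile_norm2_nonneg[of s "b n"] by (auto intro: mult_left_le)
  have sIw: "summable (\<lambda>n. LINT \<xi>|lborel. ?w n \<xi>)"
    by (rule summable_comparison_test'[OF sums_summable[OF c(2)], of 0]) (use Iw in \<open>simp only: real_norm_def abs_of_nonneg\<close>)
  have A: "AE \<xi> in lborel. summable (\<lambda>n. norm (?w n \<xi>))" unfolding nw using wH by (intro AE_I2 sums_summable)
  have B: "summable (\<lambda>n. LINT \<xi>|lborel. norm (?w n \<xi>))" unfolding nw by (rule sIw)
  have "(\<lambda>\<xi>. \<Sum>n. ?w n \<xi>) = (\<lambda>\<xi>. wt s \<xi> * H \<xi>)" using sums_unique[OF wH] by simp
  with integrable_suminf[OF iw A B] integral_suminf[OF iw A B]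
  have iH: "integrable lborel (\<lambda>\<xi>. wt s \<xi> * H \<xi>)" and IH: "(LINT \<xi>|lborel. wt s \<xi> * H \<xi>) = (\<Sum>n. LINT \<xi>|lborel. ?w n \<xi>)" by simp_all
  have "(\<Sum>n. LINT \<xi>|lborel. ?w n \<xi>) \<le> (\<Sum>n. c n)" by (rule suminf_le[OF Iw(1) sIw sums_summable[OF c(2)]])
  then have H1: "(LINT \<xi>|lborel. wt s \<xi> * H \<xi>) \<le> 1" using IH sums_unique[OF c(2)] by simp
  have le: "wt s \<xi> * (cmod (fourier ?G \<xi>))^2 \<le> wt s \<xi> * H \<xi>" for \<xi> by (intro mult_left_mono sq) simp
  have iw2: "integrable lborel (\<lambda>\<xi>. wt s \<xi> * (cmod (fourier ?G \<xi>))^2)"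
  proof (rule integrable_bound[OF iH])
    have [measurable]: "fourier ?G \<in> borel_measurable borel" using borel_measurable_integrable[OF iG] by (intro measurable_fourier) simp
    show "(\<lambda>\<xi>. wt s \<xi> * (cmod (fourier ?G \<xi>))^2) \<in> borel_measurable lborel" by measurable
    show "AE \<xi> in lborel. norm (wt s \<xi> * (cmod (fourier ?G \<xi>))^2) \<le> norm (wt s \<xi> * H \<xi>)"
      using order_trans[OF le abs_ge_self] by (intro AE_I2) simp
  qed
  have ft: "sobolev_ft s (dist_of ?G) (fourier ?G)" by (rule sobolev_ft_dist_of[OF iG iw2])
  show ?thesis
  proof (rule that[of "dist_of ?G"])
    show "dist_of ?G \<in> sobolev s" by (rule sobolevI[OF tempered_dist_of[OF iG] ft])
    have "(LINT \<xi>|lborel. wt s \<xi> * (cmod (fourier ?G \<xi>))^2) \<le> 1" by (rule order_trans[OF integral_mono[OF iw2 iH le] H1])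
    then show "sobolev_norm s (dist_of ?G) \<le> 1" unfolding sobolev_norm_eq[OF ft] by simp
    fix C :: real
    obtain n where n: "C < real n" using reals_Archimedean2 by blast
    obtain K where K: "\<And>x. cmod (complex_of_real (\<phi> n x)) \<le> K" using schwartz_bounded[OF profileD(4)[OF \<phi>(1)]] by blast
    note [measurable] = borel_measurable_integrable[OF ig]
    have [measurable]: "\<phi> n \<in> borel_measurable borel" by (intro borel_measurable_continuous_onI profileD \<phi>)
    have i\<phi>: "integrable lborel (\<lambda>x. g x * \<phi> n x)"
    proof (rule integrable_bound[OF integrable_mult_left[OF ig, of K]])
      show "AE x in lborel. norm (g x * \<phi> n x) \<le> norm (g x * K)"
        using K order_trans[OF K abs_ge_self] by (intro AE_I2) (simp add: abs_mult mult_left_mono)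
    qed measurable
    have "real n \<le> c n * (LINT x|lborel. b n x * \<phi> n x)" using M[of n] c(1)[of n] by (simp add: pos_divide_le_eq mult.commute)
    also have "... = (LINT x|lborel. c n * b n x * \<phi> n x)" unfolding mult.assoc by (rule integral_mult_right_zero[symmetric])
    also have "... \<le> (LINT x|lborel. g x * \<phi> n x)"
    proof (rule integral_mono_AE[OF _ i\<phi>])
      show "integrable lborel (\<lambda>x. c n * b n x * \<phi> n x)" unfolding mult.assoc by (intro integrable_mult_right profile_mult b \<phi>)
      show "AE x in lborel. c n * b n x * \<phi> n x \<le> g x * \<phi> n x"
        using sm
      proof eventually_elim
        case (elim x)
        \<comment> \<open>All summands are nonnegative, so \<open>g\<close> dominates each single
          one.\<close>
        have "(\<Sum>k\<in>{n}. c k * b k x) \<le> g x" unfolding g_def by (intro sum_le_suminf elim) (use nn in auto)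
        then show ?case using profileD(2)[OF \<phi>(1)] by (intro mult_right_mono) auto
      qed
    qed
    also have "... \<le> cmod (dist_of ?G (cplx (\<phi> n)))"
    proof -
      have "dist_of ?G (cplx (\<phi> n)) = (LINT x|lborel. complex_of_real (g x * \<phi> n x))"
        using profileD(4)[OF \<phi>(1)] by (simp add: dist_of_def)
      also have "... = complex_of_real (LINT x|lborel. g x * \<phi> n x)" by (rule integral_complex_of_real)
      finally show ?thesis by simp
    qed
    finally show "\<exists>\<phi>. profile \<phi> \<and> (LINT x|lborel. \<phi> x powr (p / (p - 1))) \<le> 1 \<and> C < cmod (dist_of ?G (cplx \<phi>))"
      using n \<phi> by (intro exI[of _ "\<phi> n"]) auto
  qed
qed

text \<open>Well-posedness on the unit ball of data would provide a solution starting from the datum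
  of \<open>unbounded_datum\<close>, contrary to \<open>solution_initial_bound\<close>.\<close>

lemma ill_posed_below_sobolev:
  assumes \<omega>: "\<bar>\<omega>\<bar> = 1" and p: "1 < p" and s: "s < s_sob p"
  shows "ill_posed \<omega> p s"
  unfolding ill_posed_def
proof
  assume "locally_well_posed \<omega> p s"
  then obtain T u v where T: "0 < T" and lwp: "\<And>u0 u1. u0 \<in> sobolev s \<Longrightarrow> u1 \<in> sobolev (s - 1) \<Longrightarrow> data_norm s u0 u1 \<le> 1 \<Longrightarrow>
      gNLW_solution \<omega> p s {- T..T} (u u0 u1) (v u0 u1) \<and> u u0 u1 0 = u0"
    unfolding locally_well_posed_def by (metis zero_less_one)
  obtain u0 where u0: "u0 \<in> sobolev s" "sobolev_norm s u0 \<le> 1"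
    "\<And>C. \<exists>\<phi>. profile \<phi> \<and> (LINT x|lborel. \<phi> x powr (p / (p - 1))) \<le> 1 \<and> C < cmod (u0 (cplx \<phi>))"
    using unbounded_datum[OF p s] by blast
  have "zero_dist \<in> sobolev (s - 1)"
    by (rule sobolevI[OF _ sobolev_ft_zero]) (simp add: zero_dist_eq tempered_dist_of)
  with lwp[of u0 zero_dist] u0 have sol: "gNLW_solution \<omega> p s {- T..T} (u u0 zero_dist) (v u0 zero_dist)" "u u0 zero_dist 0 = u0"
    by (simp_all add: data_norm_def)
  obtain C where "\<And>\<phi>. profile \<phi> \<Longrightarrow> (LINT x|lborel. \<phi> x powr (p / (p - 1))) \<le> 1 \<Longrightarrow> cmod (u0 (cplx \<phi>)) \<le> C"
    using solution_initial_bound[OF \<omega> p T sol(1)] unfolding sol(2) by blast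
  with u0(3)[of C] show False by force
qed

text \<open>Continuity is refuted at the threshold one. The norm of \<open>v t\<close> can only
  increase the data norm, so a lower bound for \<open>u t\<close> decides both cases.\<close>

lemma not_solution_map_continuous:
  assumes t: "0 < t"
    and inflation: "\<And>\<epsilon>. 0 < \<epsilon> \<Longrightarrow> \<exists>u v. gNLW_solution \<omega> p s {0..t} u v \<and> (\<forall>\<tau>\<in>{0..t}. real_valued (u \<tau>)) \<and>
      u 0 \<in> dist_of ` schwartz \<and> sobolev_norm s (u 0) < \<epsilon> \<and> v 0 = zero_dist \<and> 1 \<le> sobolev_norm s (u t)"
  shows "\<not> solution_map_continuous_at_zero \<omega> p s t" "\<not> solution_operator_continuous_at_zero \<omega> p s t"
proof -
  have "(\<lambda>_. 0) \<in> schwartz" by (rule schwartz_compact_support[of _ 0 0]) auto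
  then have z: "zero_dist \<in> dist_of ` schwartz" unfolding zero_dist_eq by blast
  have tI: "t \<in> {0..t}" using t by simp
  show "\<not> solution_map_continuous_at_zero \<omega> p s t"
  proof
    assume "solution_map_continuous_at_zero \<omega> p s t"
    then obtain \<delta> where \<delta>: "0 < \<delta>" "\<And>I u v. gNLW_solution \<omega> p s I u v \<Longrightarrow> t \<in> I \<Longrightarrow> u 0 \<in> dist_of ` schwartz \<Longrightarrow> v 0 \<in> dist_of ` schwartz \<Longrightarrow>
        data_norm s (u 0) (v 0) < \<delta> \<Longrightarrow> data_norm s (u t) (v t) < 1"
      unfolding solution_map_continuous_at_zero_def by (metis zero_less_one)
    from inflation[OF \<delta>(1)] obtain u v where uv: "gNLW_solution \<omega> p s {0..t} u v" "u 0 \<in> dist_of ` schwartz" "sobolev_norm s (u 0) < \<delta>"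
      "v 0 = zero_dist" "1 \<le> sobolev_norm s (u t)" by blast
    have "data_norm s (u t) (v t) < 1" by (rule \<delta>(2)[OF uv(1) tI uv(2)]) (use uv z in \<open>simp_all add: data_norm_def\<close>)
    then show False using uv(5) sobolev_norm_nonneg[of "s - 1" "v t"] by (simp add: data_norm_def)
  qed
  show "\<not> solution_operator_continuous_at_zero \<omega> p s t"
  proof
    assume "solution_operator_continuous_at_zero \<omega> p s t"
    then obtain \<delta> where \<delta>: "0 < \<delta>" "\<And>I u v. gNLW_solution \<omega> p s I u v \<Longrightarrow> t \<in> I \<Longrightarrow> u 0 \<in> dist_of ` schwartz \<Longrightarrow> v 0 = zero_dist \<Longrightarrow>
        sobolev_norm s (u 0) < \<delta> \<Longrightarrow> sobolev_norm s (u t) < 1"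
      unfolding solution_operator_continuous_at_zero_def by (metis zero_less_one)
    from inflation[OF \<delta>(1)] obtain u v where uv: "gNLW_solution \<omega> p s {0..t} u v" "u 0 \<in> dist_of ` schwartz" "sobolev_norm s (u 0) < \<delta>"
      "v 0 = zero_dist" "1 \<le> sobolev_norm s (u t)" by blast
    from \<delta>(2)[OF uv(1) tI uv(2,4,3)] uv(5) show False by simp
  qed
qed

text \<open>Inflation is available at every positive time and with every target norm; the parts of
  the statement differ in the time and the target at which it is invoked.\<close>

theorem theorem6:
  fixes \<omega> p s :: real
  assumes "\<omega> \<in> {1, -1}"
    and "p > 1"
    and "s < s_sob p"
    and "(\<exists>n::nat. odd n \<and> p = real n) \<or> p > real_of_int \<lfloor>s\<rfloor> + 1"
  shows "ill_posed \<omega> p s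
    \<and> (s_crit p < s \<longrightarrow>
        (\<forall>\<epsilon>>0. \<exists>I u v t.
           gNLW_solution \<omega> p s I u v \<and> t \<in> I \<and> (\<forall>\<tau>\<in>I. real_valued (u \<tau>)) \<and>
           u 0 \<in> dist_of ` schwartz \<and> sobolev_norm s (u 0) < \<epsilon> \<and> v 0 = zero_dist \<and>
           0 < t \<and> t < \<epsilon> \<and> sobolev_norm s (u t) > 1 / \<epsilon>)
      \<and> (\<forall>t>0. \<not> solution_map_continuous_at_zero \<omega> p s t))
    \<and> (s < s_crit p \<longrightarrow>
        (\<exists>c :: real \<Rightarrow> real. (\<forall>t>0. c t > 0) \<and>
          (\<forall>\<epsilon>>0. \<forall>t>0. \<exists>I u v.
             gNLW_solution \<omega> p s I u v \<and> t \<in> I \<and> (\<forall>\<tau>\<in>I. real_valued (u \<tau>)) \<and>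
             u 0 \<in> dist_of ` schwartz \<and> sobolev_norm s (u 0) < \<epsilon> \<and> v 0 = zero_dist \<and>
             sobolev_norm s (u t) \<ge> c t))
      \<and> (\<forall>t>0. \<not> solution_map_continuous_at_zero \<omega> p s t))
    \<and> (s = s_crit p \<longrightarrow>
        (\<exists>c :: real. c > 0 \<and>
          (\<forall>\<epsilon>>0. \<forall>t>0. \<exists>I u v.
             gNLW_solution \<omega> p s I u v \<and> t \<in> I \<and> (\<forall>\<tau>\<in>I. real_valued (u \<tau>)) \<and>
             u 0 \<in> dist_of ` schwartz \<and> sobolev_norm s (u 0) < \<epsilon> \<and> v 0 = zero_dist \<and>
             sobolev_norm s (u t) \<ge> c))
      \<and> (\<forall>t>0. \<not> solution_map_continuous_at_zero \<omega> p s t))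
    \<and> (s \<le> s_crit p \<longrightarrow> (\<forall>t>0. \<not> solution_operator_continuous_at_zero \<omega> p s t))"
proof -
  have \<omega>: "\<bar>\<omega>\<bar> = 1" using assms(1) by auto
  note p = assms(2) and s = assms(3)
  have "s_sob p < 1 / 2" using p by (auto simp: s_sob_def max_def)
  with s have s2: "s < 1 / 2" by simp
  have inflation: "\<exists>u v. gNLW_solution \<omega> p s {0..T} u v \<and> (\<forall>\<tau>\<in>{0..T}. real_valued (u \<tau>)) \<and>
      u 0 \<in> dist_of ` schwartz \<and> sobolev_norm s (u 0) < \<epsilon> \<and> v 0 = zero_dist \<and> M \<le> sobolev_norm s (u T)"
    if "0 < T" "0 < \<epsilon>" for T \<epsilon> M
    by (rule norm_inflation[OF \<omega> p s2 base_profile_exists[OF p s] that])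
  have map: "\<not> solution_map_continuous_at_zero \<omega> p s t" and operator: "\<not> solution_operator_continuous_at_zero \<omega> p s t" if "0 < t" for t
    by (rule not_solution_map_continuous[OF that inflation[OF that]]; assumption)+
  have a: "\<exists>I u v t. gNLW_solution \<omega> p s I u v \<and> t \<in> I \<and> (\<forall>\<tau>\<in>I. real_valued (u \<tau>)) \<and>
      u 0 \<in> dist_of ` schwartz \<and> sobolev_norm s (u 0) < \<epsilon> \<and> v 0 = zero_dist \<and>
      0 < t \<and> t < \<epsilon> \<and> sobolev_norm s (u t) > 1 / \<epsilon>" if \<epsilon>: "0 < \<epsilon>" for \<epsilon>
  proof -
    \<comment> \<open>The time \<open>\<epsilon> / 2\<close> and the target
      \<open>1 / \<epsilon> + 1\<close> turn weak bounds into the strict ones required.\<close>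
    have "0 < \<epsilon> / 2" using \<epsilon> by simp
    from inflation[OF this \<epsilon>, of "1 / \<epsilon> + 1"] obtain u v where
      "gNLW_solution \<omega> p s {0..\<epsilon> / 2} u v" "\<forall>\<tau>\<in>{0..\<epsilon> / 2}. real_valued (u \<tau>)" "u 0 \<in> dist_of ` schwartz"
      "sobolev_norm s (u 0) < \<epsilon>" "v 0 = zero_dist" "1 / \<epsilon> + 1 \<le> sobolev_norm s (u (\<epsilon> / 2))" by blast
    with \<epsilon> show ?thesis by (intro exI[of _ "{0..\<epsilon> / 2}"] exI[of _ u] exI[of _ v] exI[of _ "\<epsilon> / 2"]) auto
  qed
  have b: "\<exists>I u v. gNLW_solution \<omega> p s I u v \<and> t \<in> I \<and> (\<forall>\<tau>\<in>I. real_valued (u \<tau>)) \<and>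
      u 0 \<in> dist_of ` schwartz \<and> sobolev_norm s (u 0) < \<epsilon> \<and> v 0 = zero_dist \<and> sobolev_norm s (u t) \<ge> 1"
    if "0 < \<epsilon>" "0 < t" for \<epsilon> t
  proof -
    from inflation[OF that(2,1), of 1] obtain u v where
      "gNLW_solution \<omega> p s {0..t} u v" "\<forall>\<tau>\<in>{0..t}. real_valued (u \<tau>)" "u 0 \<in> dist_of ` schwartz"
      "sobolev_norm s (u 0) < \<epsilon>" "v 0 = zero_dist" "1 \<le> sobolev_norm s (u t)" by blast
    with that show ?thesis by (intro exI[of _ "{0..t}"] exI[of _ u] exI[of _ v]) auto
  qed
  show ?thesis
  proof (intro conjI impI allI ill_posed_below_sobolev[OF \<omega> p s] a map operator; assumption?)
    \<comment> \<open>The target 1 can be met at every time, so the constant function 1 is a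
      witness.\<close>
    show "\<exists>c :: real \<Rightarrow> real. (\<forall>t>0. c t > 0) \<and>
          (\<forall>\<epsilon>>0. \<forall>t>0. \<exists>I u v.
             gNLW_solution \<omega> p s I u v \<and> t \<in> I \<and> (\<forall>\<tau>\<in>I. real_valued (u \<tau>)) \<and>
             u 0 \<in> dist_of ` schwartz \<and> sobolev_norm s (u 0) < \<epsilon> \<and> v 0 = zero_dist \<and>
             sobolev_norm s (u t) \<ge> c t)"
      by (intro exI[of _ "\<lambda>_. 1"] conjI allI impI b) simp_all
    show "\<exists>c :: real. c > 0 \<and>
          (\<forall>\<epsilon>>0. \<forall>t>0. \<exists>I u v.
             gNLW_solution \<omega> p s I u v \<and> t \<in> I \<and> (\<forall>\<tau>\<in>I. real_valued (u \<tau>)) \<and>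
             u 0 \<in> dist_of ` schwartz \<and> sobolev_norm s (u 0) < \<epsilon> \<and> v 0 = zero_dist \<and>
             sobolev_norm s (u t) \<ge> c)"
      by (intro exI[of _ "1::real"] conjI allI impI b) simp_all
  qed
qed

end
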